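(* Let $m>0$, and let $a,b$ be real-valued, twice differentiable functions on $(0,\infty)$ such that, for some constants $C>0$, $\alpha$, $\gamma$ with $\tfrac34<\alpha<1$ and $1-\alpha<\gamma<\alpha-\tfrac12$, $$|a^{(\nu)}(r)|+|b^{(\nu)}(r)|\le C(1+r)^{-\alpha-\nu}\quad(r>0,\ \nu=0,1,2),\qquad |a(r)|<C(1+r)^{-1-\alpha+\gamma}\quad (r>0).$$ Extend $a$ and $b$ to $(-\infty,0)$ as even functions: $a(-r)=a(r)$, $b(-r)=b(r)$. In $L^2(\mathbb{R};\mathbb{C}^2)$ consider the self-adjoint operators $$\mathcal{L}=J\frac{d}{dr}+\begin{bmatrix} m+b(r) & a(r) \\ a(r) & -m+b(r) \end{bmatrix},\qquad \mathcal{L}_0=J\frac{d}{dr}+\begin{bmatrix} m & 0 \\ 0 & -m \end{bmatrix},\qquad J=\begin{bmatrix} 0 & -1 \\ 1 & 0 \end{bmatrix}.$$ Then the generalized wave operators $W_\pm(\mathcal{L},\mathcal{L}_0)$ exist, and the corresponding deviation factor $W_0(t)$ is, in the momentum representation, the operator of multiplication by $$\widetilde W_0(t,p)=\exp\Big(\mathrm{i}\,\mathrm{sgn}(t)\int_1^{|t|}b(rs)\,dr\Big)I_2,\qquad s=\frac{p}{\sqrt{p^2+m^2}} .$$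
   Context: Momentum representation: $\widetilde\Psi(p)=\frac{1}{\sqrt{2\pi}}\int_{-\infty}^{\infty}\mathrm{e}^{-\mathrm{i}pr}\Psi(r)\,dr$; thus $W_0(t)=\mathcal{F}^{-1}\widetilde W_0(t,\cdot)\mathcal{F}$ with $\mathcal{F}$ the unitary Fourier transform. Both operators are considered on the natural domain (the Sobolev space $H^1(\mathbb{R};\mathbb{C}^2)$). $I_2$ is the $2\times2$ identity matrix. Generalized wave operators: let $A_0$ be a self-adjoint operator in a Hilbert space, $G_0$ its absolutely continuous subspace, $P_0$ the orthogonal projector onto $G_0$. An operator function $W_0(t)$, $|t|>R$ (for some $R\ge 0$), with values acting in $G_0$ is called a deviation factor, and $W_\pm(A,A_0)$ are called generalized wave operators, if: (1) $W_0(t)$ and $W_0(t)^{-1}$ are bounded operators in $G_0$ for all $|t|>R$, and $\lim_{t\to\pm\infty}W_0(t+\tau)W_0(t)^{-1}P_0=P_0$ (strongly) for every real $\tau$; (2) $W_0(t)A_0P_0=A_0W_0(t)P_0$ and $W_0(t)W_0(t+\tau)P_0=W_0(t+\tau)W_0(t)P_0$ for all admissible $t$ and $\tau$; (3) the limits $W_\pm(A,A_0)=\lim_{t\to\pm\infty}\big[\mathrm{e}^{\mathrm{i}At}\mathrm{e}^{-\mathrm{i}A_0t}W_0(t)^{-1}\big]P_0$ exist in the sense of strong convergence. Here $A=\mathcal{L}$, $A_0=\mathcal{L}_0$, and $G_0$ is the whole space. *)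

theory Defs
  imports "HOL-Analysis.Analysis"
begin

section \<open>Complex Hilbert spaces\<close>

text \<open>The underlying real inner product is the real part of the complex one, which is linear in its
  first argument; norm and topology are those of the class \<^class>\<open>real_inner\<close>.\<close>

class complex_hilbert_space = real_inner + complete_space +
  fixes scaleC :: "complex \<Rightarrow> 'a \<Rightarrow> 'a"  (infixr "*\<^sub>C" 75)
    and cinner :: "'a \<Rightarrow> 'a \<Rightarrow> complex"
  assumes scaleC_add_right: "c *\<^sub>C (x + y) = c *\<^sub>C x + c *\<^sub>C y"
    and scaleC_add_left: "(c + d) *\<^sub>C x = c *\<^sub>C x + d *\<^sub>C x"
    and scaleC_scaleC: "c *\<^sub>C d *\<^sub>C x = (c * d) *\<^sub>C x"
    and scaleC_of_real: "complex_of_real r *\<^sub>C x = r *\<^sub>R x"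
    and cinner_commute: "cinner x y = cnj (cinner y x)"
    and cinner_add_left: "cinner (x + y) z = cinner x z + cinner y z"
    and cinner_scaleC_left: "cinner (c *\<^sub>C x) y = c * cinner x y"
    and Re_cinner: "Re (cinner x y) = x \<bullet> y"

section \<open>Unbounded operators and one-parameter unitary groups\<close>

definition csubspace :: "'a::complex_hilbert_space set \<Rightarrow> bool" where
  "csubspace S \<longleftrightarrow> 0 \<in> S \<and> (\<forall>x\<in>S. \<forall>y\<in>S. x + y \<in> S) \<and> (\<forall>c. \<forall>x\<in>S. c *\<^sub>C x \<in> S)"

definition clinear_on :: "'a::complex_hilbert_space set \<Rightarrow> ('a \<Rightarrow> 'a) \<Rightarrow> bool" where
  "clinear_on S T \<longleftrightarrow> (\<forall>x\<in>S. \<forall>y\<in>S. T (x + y) = T x + T y) \<and> (\<forall>c. \<forall>x\<in>S. T (c *\<^sub>C x) = c *\<^sub>C T x)"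

definition bounded_operator_in :: "'a::complex_hilbert_space set \<Rightarrow> ('a \<Rightarrow> 'a) \<Rightarrow> bool" where
  "bounded_operator_in S T \<longleftrightarrow>
     T ` S \<subseteq> S \<and> clinear_on S T \<and> (\<exists>K. \<forall>x\<in>S. norm (T x) \<le> K * norm x)"

text \<open>An unbounded operator is a partial function whose \<^const>\<open>dom\<close> is the operator domain. In the
  last conjunct the right-hand side is the graph of the adjoint, so it says that \<open>A\<close> equals its
  adjoint, including domains.\<close>

definition self_adjoint :: "('a::complex_hilbert_space \<rightharpoonup> 'a) \<Rightarrow> bool" where
  "self_adjoint A \<longleftrightarrow>
     csubspace (dom A) \<and> clinear_on (dom A) (\<lambda>x. the (A x)) \<and> closure (dom A) = UNIV \<and>
     (\<forall>y z. A y = Some z \<longleftrightarrow> (\<forall>x w. A x = Some w \<longrightarrow> cinner w y = cinner x z))"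

definition unitary_operator :: "('a::complex_hilbert_space \<Rightarrow> 'a) \<Rightarrow> bool" where
  "unitary_operator U \<longleftrightarrow> clinear_on UNIV U \<and> surj U \<and> (\<forall>x y. cinner (U x) (U y) = cinner x y)"

definition unitary_group :: "(real \<Rightarrow> 'a::complex_hilbert_space \<Rightarrow> 'a) \<Rightarrow> bool" where
  "unitary_group U \<longleftrightarrow>
     (\<forall>t. unitary_operator (U t)) \<and> (\<forall>s t. U (s + t) = U s \<circ> U t) \<and>
     (\<forall>x. continuous_on UNIV (\<lambda>t. U t x))"

text \<open>\<open>exp_i A t\<close> is \<open>e\<^sup>i\<^sup>A\<^sup>t\<close>: by Stone's theorem, for self-adjoint \<open>A\<close> these operators form the unique
  strongly continuous unitary group with infinitesimal generator \<open>iA\<close> (the domain of the generator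
  being exactly the domain of \<open>A\<close>).\<close>

definition exp_i :: "('a::complex_hilbert_space \<rightharpoonup> 'a) \<Rightarrow> real \<Rightarrow> 'a \<Rightarrow> 'a" where
  "exp_i A = (THE U. unitary_group U \<and>
     (\<forall>x y. A x = Some y \<longleftrightarrow> ((\<lambda>h. (1 / h) *\<^sub>R (U h x - x)) \<longlongrightarrow> \<i> *\<^sub>C y) (at 0)))"

text \<open>The spectral measure \<open>\<langle>E(\<cdot>)x, x\<rangle>\<close> of \<open>A\<close> at \<open>x\<close> is the finite Borel measure on the line determined
  by \<open>\<langle>e\<^sup>i\<^sup>A\<^sup>t x, x\<rangle> = \<integral> e\<^sup>i\<^sup>\<lambda>\<^sup>t d\<langle>E(\<lambda>)x, x\<rangle>\<close> for all real \<open>t\<close>.\<close>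

definition is_spectral_measure ::
    "('a::complex_hilbert_space \<rightharpoonup> 'a) \<Rightarrow> 'a \<Rightarrow> real measure \<Rightarrow> bool" where
  "is_spectral_measure A x \<mu> \<longleftrightarrow>
     sets \<mu> = sets borel \<and> finite_measure \<mu> \<and>
     (\<forall>t. cinner (exp_i A t x) x = (\<integral>l. exp (\<i> * of_real (l * t)) \<partial>\<mu>))"

definition ac_subspace :: "('a::complex_hilbert_space \<rightharpoonup> 'a) \<Rightarrow> 'a set" where
  "ac_subspace A = {x. \<exists>\<mu>. is_spectral_measure A x \<mu> \<and> absolutely_continuous lborel \<mu>}"

definition orth_projector :: "'a::complex_hilbert_space set \<Rightarrow> 'a \<Rightarrow> 'a" where
  "orth_projector S x = (THE y. y \<in> S \<and> (\<forall>z\<in>S. cinner (x - y) z = 0))"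

section \<open>Generalized wave operators\<close>

text \<open>\<open>W0 t\<close> is an operator in the absolutely continuous subspace \<open>G0\<close> of \<open>A0\<close>; its values off \<open>G0\<close> are
  irrelevant, and its inverse is taken within \<open>G0\<close>. The commutation of \<open>W0 t\<close> with
  \<open>A0\<close> is an equality of partial functions, i.e. the domains of both products coincide as well.\<close>

definition generalized_wave_operators ::
    "('a::complex_hilbert_space \<rightharpoonup> 'a) \<Rightarrow> ('a \<rightharpoonup> 'a) \<Rightarrow> (real \<Rightarrow> 'a \<Rightarrow> 'a) \<Rightarrow> ('a \<Rightarrow> 'a) \<Rightarrow> ('a \<Rightarrow> 'a) \<Rightarrow> bool"
  where
  "generalized_wave_operators A A0 W0 Wplus Wminus \<longleftrightarrow>
    (let G0 = ac_subspace A0; P0 = orth_projector G0; W0inv = (\<lambda>t. inv_into G0 (W0 t)) in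
     \<exists>R\<ge>0.
       (\<forall>t. \<bar>t\<bar> > R \<longrightarrow> bij_betw (W0 t) G0 G0 \<and> bounded_operator_in G0 (W0 t) \<and>
                        bounded_operator_in G0 (W0inv t)) \<and>
       (\<forall>\<tau> x. ((\<lambda>t. W0 (t + \<tau>) (W0inv t (P0 x))) \<longlongrightarrow> P0 x) at_top \<and>
              ((\<lambda>t. W0 (t + \<tau>) (W0inv t (P0 x))) \<longlongrightarrow> P0 x) at_bot) \<and>
       (\<forall>t. \<bar>t\<bar> > R \<longrightarrow> (\<lambda>x. map_option (W0 t) (A0 (P0 x))) = (\<lambda>x. A0 (W0 t (P0 x)))) \<and>
       (\<forall>t \<tau> x. \<bar>t\<bar> > R \<longrightarrow> \<bar>t + \<tau>\<bar> > R \<longrightarrow>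
          W0 t (W0 (t + \<tau>) (P0 x)) = W0 (t + \<tau>) (W0 t (P0 x))) \<and>
       (\<forall>x. ((\<lambda>t. exp_i A t (exp_i A0 (- t) (W0inv t (P0 x)))) \<longlongrightarrow> Wplus x) at_top) \<and>
       (\<forall>x. ((\<lambda>t. exp_i A t (exp_i A0 (- t) (W0inv t (P0 x)))) \<longlongrightarrow> Wminus x) at_bot))"

section \<open>The Hilbert space of square-integrable functions from the line to \<open>\<complex>\<^sup>2\<close>\<close>

definition square_integrable :: "(real \<Rightarrow> complex^2) \<Rightarrow> bool" where
  "square_integrable f \<longleftrightarrow> f \<in> borel_measurable borel \<and> integrable lborel (\<lambda>x. (norm (f x))\<^sup>2)"

definition vdot :: "complex^2 \<Rightarrow> complex^2 \<Rightarrow> complex" where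
  "vdot u v = (\<Sum>i\<in>UNIV. u $ i * cnj (v $ i))"

lemma norm_vscale: "norm (c *s (v :: complex^2)) = cmod c * norm v"
  by (simp add: norm_vec_def L2_set_def norm_mult power_mult_distrib
      flip: sum_distrib_left distrib_left) (simp add: real_sqrt_mult flip: distrib_left)

lemma Re_vdot: "Re (vdot u v) = u \<bullet> v"
  by (simp add: vdot_def inner_vec_def inner_complex_def)

lemma norm_vdot_le: "cmod (vdot u v) \<le> (norm u)\<^sup>2 + (norm v)\<^sup>2"
proof -
  have "cmod (vdot u v) \<le> (\<Sum>i\<in>UNIV. cmod (u $ i * cnj (v $ i)))"
    unfolding vdot_def by (rule norm_sum)
  also have "\<dots> \<le> (\<Sum>i\<in>(UNIV::2 set). norm u * norm v)"
    by (rule sum_mono) (simp add: norm_mult mult_mono Finite_Cartesian_Product.norm_nth_le)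
  also have "\<dots> = 2 * norm u * norm v" by simp
  also have "\<dots> \<le> (norm u)\<^sup>2 + (norm v)\<^sup>2" by (rule sum_squares_bound)
  finally show ?thesis .
qed

lemma borel_measurable_vscale [measurable]:
  fixes f :: "real \<Rightarrow> complex^2"
  assumes [measurable]: "f \<in> borel_measurable borel"
  shows "(\<lambda>x. c *s f x) \<in> borel_measurable borel"
proof -
  have "continuous_on UNIV (\<lambda>v::complex^2. c *s v)"
    unfolding vector_scalar_mult_def by (intro continuous_intros)
  then have "(\<lambda>v::complex^2. c *s v) \<in> borel_measurable borel"
    by (rule borel_measurable_continuous_onI)
  from measurable_compose[OF assms this] show ?thesis .
qed

lemma borel_measurable_vdot [measurable]:
  fixes f g :: "real \<Rightarrow> complex^2"
  assumes [measurable]: "f \<in> borel_measurable borel" "g \<in> borel_measurable borel"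
  shows "(\<lambda>x. vdot (f x) (g x)) \<in> borel_measurable borel"
proof -
  have "continuous_on UNIV (\<lambda>p::(complex^2) \<times> (complex^2). vdot (fst p) (snd p))"
    unfolding vdot_def by (intro continuous_intros)
  then have m: "(\<lambda>p::(complex^2) \<times> (complex^2). vdot (fst p) (snd p)) \<in> borel_measurable borel"
    by (rule borel_measurable_continuous_onI)
  have "(\<lambda>x. (f x, g x)) \<in> borel_measurable borel"
    by (intro borel_measurable_Pair assms)
  from measurable_compose[OF this m] show ?thesis by simp
qed

lemma square_integrable_0: "square_integrable (\<lambda>x. 0)"
  by (simp add: square_integrable_def)

lemma square_integrable_add:
  assumes "square_integrable f" "square_integrable g"
  shows "square_integrable (\<lambda>x. f x + g x)"
proof -
  have [measurable]: "f \<in> borel_measurable borel" "g \<in> borel_measurable borel"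
    using assms by (auto simp: square_integrable_def)
  have "integrable lborel (\<lambda>x. 2 * (norm (f x))\<^sup>2 + 2 * (norm (g x))\<^sup>2)"
    using assms by (auto simp: square_integrable_def)
  then have "integrable lborel (\<lambda>x. (norm (f x + g x))\<^sup>2)"
  proof (rule Bochner_Integration.integrable_bound)
    show "AE x in lborel. norm ((norm (f x + g x))\<^sup>2) \<le> norm (2 * (norm (f x))\<^sup>2 + 2 * (norm (g x))\<^sup>2)"
    proof (rule AE_I2)
      fix x
      have "(norm (f x + g x))\<^sup>2 \<le> (norm (f x) + norm (g x))\<^sup>2"
        by (intro power_mono norm_triangle_ineq) auto
      also have "\<dots> \<le> 2 * (norm (f x))\<^sup>2 + 2 * (norm (g x))\<^sup>2"
        using sum_squares_bound[of "norm (f x)" "norm (g x)"] by (simp add: power2_sum)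
      finally show "norm ((norm (f x + g x))\<^sup>2) \<le> norm (2 * (norm (f x))\<^sup>2 + 2 * (norm (g x))\<^sup>2)"
        by simp
    qed
  qed measurable
  then show ?thesis by (simp add: square_integrable_def)
qed

lemma square_integrable_vscale:
  assumes "square_integrable f"
  shows "square_integrable (\<lambda>x. c *s f x)"
  using assms by (auto simp: square_integrable_def norm_vscale power_mult_distrib)

lemma square_integrable_uminus: "square_integrable f \<Longrightarrow> square_integrable (\<lambda>x. - f x)"
  by (simp add: square_integrable_def)

lemma square_integrable_diff:
  "square_integrable f \<Longrightarrow> square_integrable g \<Longrightarrow> square_integrable (\<lambda>x. f x - g x)"
  using square_integrable_add[OF _ square_integrable_uminus, of f g] by simp

lemma square_integrable_scaleR: "square_integrable f \<Longrightarrow> square_integrable (\<lambda>x. c *\<^sub>R f x)"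
  by (auto simp: square_integrable_def power_mult_distrib)

lemma integrable_vdot:
  assumes "square_integrable f" "square_integrable g"
  shows "integrable lborel (\<lambda>x. vdot (f x) (g x))"
proof -
  have [measurable]: "f \<in> borel_measurable borel" "g \<in> borel_measurable borel"
    using assms by (auto simp: square_integrable_def)
  have "integrable lborel (\<lambda>x. (norm (f x))\<^sup>2 + (norm (g x))\<^sup>2)"
    using assms by (auto simp: square_integrable_def)
  then show ?thesis
    by (rule Bochner_Integration.integrable_bound) (auto intro!: AE_I2 order_trans[OF norm_vdot_le])
qed

quotient_type L2 = "real \<Rightarrow> complex^2" / partial:
  "\<lambda>f g. square_integrable f \<and> square_integrable g \<and> (AE x in lborel. f x = g x)"
proof (rule part_equivpI)
  show "\<exists>f. square_integrable f \<and> square_integrable f \<and> (AE x in lborel. f x = f x)"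
    using square_integrable_0 by auto
  show "symp (\<lambda>f g. square_integrable f \<and> square_integrable g \<and> (AE x in lborel. f x = g x))"
    by (auto intro!: sympI)
  show "transp (\<lambda>f g. square_integrable f \<and> square_integrable g \<and> (AE x in lborel. f x = g x))"
    by (rule transpI) auto
qed

text \<open>From here on, \<open>rep_L2\<close> picks a representative of a class and \<open>abs_L2\<close> forms the class of a
  square-integrable function.\<close>

instantiation L2 :: real_inner
begin

lift_definition zero_L2 :: L2 is "\<lambda>x. 0" by (simp add: square_integrable_0)
lift_definition plus_L2 :: "L2 \<Rightarrow> L2 \<Rightarrow> L2" is "\<lambda>f g x. f x + g x"
  by (auto simp: square_integrable_add)
lift_definition minus_L2 :: "L2 \<Rightarrow> L2 \<Rightarrow> L2" is "\<lambda>f g x. f x - g x"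
  by (auto simp: square_integrable_diff)
lift_definition uminus_L2 :: "L2 \<Rightarrow> L2" is "\<lambda>f x. - f x"
  by (auto simp: square_integrable_uminus)
lift_definition scaleR_L2 :: "real \<Rightarrow> L2 \<Rightarrow> L2" is "\<lambda>c f x. c *\<^sub>R f x"
  by (auto simp: square_integrable_scaleR)
lift_definition inner_L2 :: "L2 \<Rightarrow> L2 \<Rightarrow> real" is "\<lambda>f g. \<integral>x. f x \<bullet> g x \<partial>lborel"
  by (rule integral_cong_AE) (auto simp: square_integrable_def)
definition norm_L2 :: "L2 \<Rightarrow> real" where "norm_L2 f = sqrt (f \<bullet> f)"
definition dist_L2 :: "L2 \<Rightarrow> L2 \<Rightarrow> real" where "dist_L2 f g = norm (f - g)"
definition sgn_L2 :: "L2 \<Rightarrow> L2" where "sgn_L2 f = inverse (norm f) *\<^sub>R f"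
definition uniformity_L2 :: "(L2 \<times> L2) filter" where
  "uniformity_L2 = (INF e\<in>{0 <..}. principal {(x, y). dist x y < e})"
definition open_L2 :: "L2 set \<Rightarrow> bool" where
  "open_L2 U = (\<forall>x\<in>U. eventually (\<lambda>(x', y). x' = x \<longrightarrow> y \<in> U) uniformity)"

lemma integrable_inner:
  assumes "square_integrable f" "square_integrable g"
  shows "integrable lborel (\<lambda>x. f x \<bullet> g x)"
  using integrable_Re[OF integrable_vdot[OF assms]] by (simp add: Re_vdot)

instance
proof
  fix f g h :: L2 and r s :: real
  show "dist f g = norm (f - g)" "sgn f = inverse (norm f) *\<^sub>R f" "norm f = sqrt (f \<bullet> f)"
    by (simp_all add: dist_L2_def sgn_L2_def norm_L2_def)
  show "uniformity = (INF e\<in>{0 <..}. principal {(x::L2, y). dist x y < e})"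
    by (rule uniformity_L2_def)
  show "open U = (\<forall>x\<in>U. eventually (\<lambda>(x', y). x' = x \<longrightarrow> y \<in> U) uniformity)" for U :: "L2 set"
    by (rule open_L2_def)
  show "f + g + h = f + (g + h)" "f + g = g + f" "0 + f = f" "- f + f = 0" "f - g = f + - g"
    by (transfer, simp add: square_integrable_add square_integrable_uminus square_integrable_diff
        square_integrable_0 add_ac)+
  show "r *\<^sub>R (f + g) = r *\<^sub>R f + r *\<^sub>R g" "(r + s) *\<^sub>R f = r *\<^sub>R f + s *\<^sub>R f"
    "r *\<^sub>R s *\<^sub>R f = (r * s) *\<^sub>R f" "1 *\<^sub>R f = f"
    by (transfer, simp add: square_integrable_add square_integrable_scaleR algebra_simps)+
  show "f \<bullet> g = g \<bullet> f"
    by transfer (simp add: inner_commute)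
  show "(f + g) \<bullet> h = f \<bullet> h + g \<bullet> h"
    by transfer (simp add: inner_add_left integrable_inner)
  show "(r *\<^sub>R f) \<bullet> g = r * (f \<bullet> g)"
    by transfer simp
  show "0 \<le> f \<bullet> f"
    by transfer simp
  show "f \<bullet> f = 0 \<longleftrightarrow> f = 0"
  proof transfer
    fix f :: "real \<Rightarrow> complex^2"
    assume f: "square_integrable f \<and> square_integrable f \<and> (AE x in lborel. f x = f x)"
    then have "(\<integral>x. f x \<bullet> f x \<partial>lborel) = 0 \<longleftrightarrow> (AE x in lborel. f x \<bullet> f x = 0)"
      by (intro integral_nonneg_eq_0_iff_AE integrable_inner) auto
    with f show "(\<integral>x. f x \<bullet> f x \<partial>lborel) = 0 \<longleftrightarrow>
      square_integrable f \<and> square_integrable (\<lambda>x. 0) \<and> (AE x in lborel. f x = 0)"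
      by (simp add: square_integrable_0)
  qed
qed

end

lemma square_integrable_rep: "square_integrable (rep_L2 f)"
  using Quotient3_rep_reflp[OF Quotient3_L2, of f] by simp

lemma abs_rep_L2 [simp]: "abs_L2 (rep_L2 f) = f"
  by (rule Quotient3_abs_rep[OF Quotient3_L2])

lemma norm_abs_L2: "square_integrable f \<Longrightarrow> (norm (abs_L2 f))\<^sup>2 = (\<integral>x. (norm (f x))\<^sup>2 \<partial>lborel)"
  by (simp add: norm_L2_def inner_L2.abs_eq power2_norm_eq_inner)

lemma nn_integral_norm_L2:
  assumes "square_integrable f"
  shows "(\<integral>\<^sup>+x. ennreal ((norm (f x))\<^sup>2) \<partial>lborel) = ennreal ((norm (abs_L2 f))\<^sup>2)"
  unfolding norm_abs_L2[OF assms] using assms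
  by (intro nn_integral_eq_integral) (auto simp: square_integrable_def)

lemma abs_L2_minus:
  "square_integrable f \<Longrightarrow> square_integrable g \<Longrightarrow> abs_L2 f - abs_L2 g = abs_L2 (\<lambda>x. f x - g x)"
  by (simp add: minus_L2.abs_eq)

lemma nn_integral_diff_L2:
  "(\<integral>\<^sup>+x. ennreal ((norm (rep_L2 f x - rep_L2 g x))\<^sup>2) \<partial>lborel) = ennreal ((norm (f - g))\<^sup>2)"
proof -
  have "f - g = abs_L2 (\<lambda>x. rep_L2 f x - rep_L2 g x)"
    using abs_L2_minus[OF square_integrable_rep[of f] square_integrable_rep[of g]] by simp
  then show ?thesis
    by (simp add: nn_integral_norm_L2 square_integrable_diff square_integrable_rep)
qed

instance L2 :: complete_space
proof
  fix X :: "nat \<Rightarrow> L2"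
  assume X: "Cauchy X"
  have "\<exists>N. \<forall>m\<ge>N. \<forall>n\<ge>N. norm (X m - X n) < (1/2) ^ k" for k
    using CauchyD[OF X, of "(1/2)^k"] by simp
  then obtain N where N: "\<And>k m n. m \<ge> N k \<Longrightarrow> n \<ge> N k \<Longrightarrow> norm (X m - X n) < (1/2) ^ k"
    by metis
  define s where "s k = (\<Sum>j\<le>k. N j)" for k
  have s: "s k \<ge> N j" if "k \<ge> j" for j k
    unfolding s_def using that by (intro member_le_sum) auto
  define F where "F n = rep_L2 (X n)" for n
  have sF: "square_integrable (F n)" for n
    by (simp add: F_def square_integrable_rep)
  have [measurable]: "F n \<in> borel_measurable borel" for n
    using sF[of n] by (simp add: square_integrable_def)
  have nnF: "(\<integral>\<^sup>+x. ennreal ((norm (F m x - F n x))\<^sup>2) \<partial>lborel) = ennreal ((norm (X m - X n))\<^sup>2)" for m n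
    unfolding F_def by (rule nn_integral_diff_L2)
  define d where "d k x = norm (F (s (Suc k)) x - F (s k) x)" for k x
  have [measurable]: "d k \<in> borel_measurable borel" for k
    unfolding d_def by measurable
  have dk: "(\<integral>\<^sup>+x. ennreal (2^k * (d k x)\<^sup>2) \<partial>lborel) \<le> ennreal ((1/2)^k)" for k
  proof -
    have "(\<integral>\<^sup>+x. ennreal (2^k * (d k x)\<^sup>2) \<partial>lborel) = ennreal (2^k) * (\<integral>\<^sup>+x. ennreal ((d k x)\<^sup>2) \<partial>lborel)"
      by (simp add: ennreal_mult nn_integral_cmult)
    also have "\<dots> = ennreal (2^k * (norm (X (s (Suc k)) - X (s k)))\<^sup>2)"
      by (simp add: d_def nnF ennreal_mult)
    also have "\<dots> \<le> ennreal (2^k * ((1/2)^k)\<^sup>2)"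
      using N[of k "s (Suc k)" "s k"] s[of k "Suc k"] s[of k k]
      by (intro ennreal_leI mult_left_mono power_mono) auto
    also have "2^k * ((1/2)^k)\<^sup>2 = ((1/2)^k :: real)"
      by (simp add: power2_eq_square power_divide)
    finally show ?thesis .
  qed
  have "(\<integral>\<^sup>+x. (\<Sum>k. ennreal (2^k * (d k x)\<^sup>2)) \<partial>lborel) = (\<Sum>k. \<integral>\<^sup>+x. ennreal (2^k * (d k x)\<^sup>2) \<partial>lborel)"
    by (rule nn_integral_suminf) measurable
  also have "\<dots> \<le> (\<Sum>k. ennreal ((1/2)^k))"
    by (intro suminf_le dk) auto
  also have "\<dots> = ennreal (\<Sum>k. (1/2)^k)"
    by (intro suminf_ennreal2) (auto intro: summable_geometric)
  also have "\<dots> < \<infinity>" by simp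
  finally have "(\<integral>\<^sup>+x. (\<Sum>k. ennreal (2^k * (d k x)\<^sup>2)) \<partial>lborel) \<noteq> \<infinity>" by simp
  then have "AE x in lborel. (\<Sum>k. ennreal (2^k * (d k x)\<^sup>2)) \<noteq> \<infinity>"
    by (intro nn_integral_noteq_infinite) auto
  then have conv: "AE x in lborel. convergent (\<lambda>k. F (s k) x)"
  proof eventually_elim
    fix x
    assume "(\<Sum>k. ennreal (2^k * (d k x)\<^sup>2)) \<noteq> \<infinity>"
    then have "summable (\<lambda>k. 2^k * (d k x)\<^sup>2)"
      by (intro summable_suminf_not_top) auto
    then have "summable (\<lambda>k. (1/2)^k + 2^k * (d k x)\<^sup>2)"
      by (intro summable_add summable_geometric) auto
    then have "summable (\<lambda>k. F (s (Suc k)) x - F (s k) x)"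
    proof (rule summable_comparison_test')
      fix k :: nat
      let ?q = "(2::real)^k"
      have "0 \<le> (1 - ?q * d k x)\<^sup>2 / ?q" by simp
      also have "\<dots> = (1/2)^k - 2 * d k x + ?q * (d k x)\<^sup>2"
        by (simp add: power2_eq_square field_simps power_divide)
      finally have "2 * d k x \<le> (1/2)^k + ?q * (d k x)\<^sup>2" by simp
      moreover have "0 \<le> d k x" by (simp add: d_def)
      ultimately show "norm (F (s (Suc k)) x - F (s k) x) \<le> (1/2)^k + ?q * (d k x)\<^sup>2"
        unfolding d_def[symmetric] by linarith
    qed
    then have "convergent (\<lambda>n. (\<Sum>k<n. F (s (Suc k)) x - F (s k) x) + F (s 0) x)"
      by (intro convergent_add convergent_const) (simp add: summable_iff_convergent)
    then show "convergent (\<lambda>k. F (s k) x)"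
      by (simp add: sum_lessThan_telescope[of "\<lambda>k. F (s k) x"])
  qed
  define g where "g x = lim (\<lambda>k. F (s k) x)" for x
  have [measurable]: "g \<in> borel_measurable borel"
    unfolding g_def by measurable
  have Fg: "(\<integral>\<^sup>+x. ennreal ((norm (F n x - g x))\<^sup>2) \<partial>lborel) \<le> ennreal (((1/2)^j)\<^sup>2)"
    if n: "n \<ge> N j" for n j
  proof -
    have "(\<integral>\<^sup>+x. ennreal ((norm (F n x - g x))\<^sup>2) \<partial>lborel)
        = (\<integral>\<^sup>+x. liminf (\<lambda>k. ennreal ((norm (F n x - F (s k) x))\<^sup>2)) \<partial>lborel)"
    proof (rule nn_integral_cong_AE, use conv in eventually_elim)
      fix x
      assume "convergent (\<lambda>k. F (s k) x)"
      then have "(\<lambda>k. F (s k) x) \<longlonglongrightarrow> g x"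
        by (simp add: g_def convergent_LIMSEQ_iff)
      then have "(\<lambda>k. ennreal ((norm (F n x - F (s k) x))\<^sup>2)) \<longlonglongrightarrow> ennreal ((norm (F n x - g x))\<^sup>2)"
        by (intro tendsto_intros)
      then show "ennreal ((norm (F n x - g x))\<^sup>2) = liminf (\<lambda>k. ennreal ((norm (F n x - F (s k) x))\<^sup>2))"
        by (intro lim_imp_Liminf[symmetric]) auto
    qed
    also have "\<dots> \<le> liminf (\<lambda>k. \<integral>\<^sup>+x. ennreal ((norm (F n x - F (s k) x))\<^sup>2) \<partial>lborel)"
      by (rule nn_integral_liminf) measurable
    also have "\<dots> \<le> liminf (\<lambda>k. ennreal (((1/2)^j)\<^sup>2))"
    proof (rule Liminf_mono, unfold eventually_sequentially, intro exI[of _ j] allI impI)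
      fix k assume "j \<le> k"
      then show "(\<integral>\<^sup>+x. ennreal ((norm (F n x - F (s k) x))\<^sup>2) \<partial>lborel) \<le> ennreal (((1/2)^j)\<^sup>2)"
        unfolding nnF using N[OF n s[of j k]] by (intro ennreal_leI power_mono) auto
    qed
    also have "\<dots> = ennreal (((1/2)^j)\<^sup>2)" by (simp add: Liminf_const)
    finally show ?thesis .
  qed
  have sFg: "square_integrable (\<lambda>x. F n x - g x)" if "n \<ge> N j" for n j
    using le_less_trans[OF Fg[OF that]] by (simp add: square_integrable_def integrable_iff_bounded)
  have "square_integrable (\<lambda>x. F (N 0) x - (F (N 0) x - g x))"
    by (intro square_integrable_diff sF sFg[of 0]) simp
  then have sg: "square_integrable g" by simp
  have "X \<longlonglongrightarrow> abs_L2 g"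
  proof (rule LIMSEQ_I)
    fix e :: real assume "e > 0"
    then obtain j where j: "(1/2)^j < e"
      using real_arch_pow_inv[of e "1/2"] by auto
    have "norm (X n - abs_L2 g) < e" if n: "n \<ge> N j" for n
    proof -
      have "X n - abs_L2 g = abs_L2 (\<lambda>x. F n x - g x)"
        using abs_L2_minus[OF sF[of n] sg] by (simp add: F_def)
      then have "ennreal ((norm (X n - abs_L2 g))\<^sup>2) \<le> ennreal (((1/2)^j)\<^sup>2)"
        using Fg[OF n] nn_integral_norm_L2[OF sFg[OF n]] by simp
      then have "(norm (X n - abs_L2 g))\<^sup>2 \<le> ((1/2)^j)\<^sup>2"
        by (simp add: ennreal_le_iff)
      then have "norm (X n - abs_L2 g) \<le> (1/2)^j"
        by (rule power2_le_imp_le) simp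
      with j show ?thesis by simp
    qed
    then show "\<exists>no. \<forall>n\<ge>no. norm (X n - abs_L2 g) < e" by blast
  qed
  then show "convergent X" by (auto simp: convergent_def)
qed

instantiation L2 :: complex_hilbert_space
begin

lift_definition scaleC_L2 :: "complex \<Rightarrow> L2 \<Rightarrow> L2" is "\<lambda>c f x. c *s f x"
  by (auto simp: square_integrable_vscale)
lift_definition cinner_L2 :: "L2 \<Rightarrow> L2 \<Rightarrow> complex" is "\<lambda>f g. \<integral>x. vdot (f x) (g x) \<partial>lborel"
  by (rule integral_cong_AE) (auto simp: square_integrable_def)

instance
proof
  fix f g h :: L2 and c d :: complex and r :: real
  show "c *\<^sub>C (f + g) = c *\<^sub>C f + c *\<^sub>C g" "(c + d) *\<^sub>C f = c *\<^sub>C f + d *\<^sub>C f"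
    "c *\<^sub>C d *\<^sub>C f = (c * d) *\<^sub>C f"
    by (transfer, simp add: square_integrable_add square_integrable_vscale vector_add_ldistrib
        vector_sadd_rdistrib vector_smult_assoc)+
  have "complex_of_real r *s v = r *\<^sub>R v" for v :: "complex^2"
    by (simp add: vec_eq_iff complex_eq_iff)
  then show "complex_of_real r *\<^sub>C f = r *\<^sub>R f"
    by transfer (simp add: square_integrable_scaleR)
  have *: "vdot v u = cnj (vdot u v)" for u v
    by (simp add: vdot_def mult.commute)
  show "cinner f g = cnj (cinner g f)"
  proof transfer
    fix f g :: "real \<Rightarrow> complex^2"
    show "(\<integral>x. vdot (f x) (g x) \<partial>lborel) = cnj (\<integral>x. vdot (g x) (f x) \<partial>lborel)"
      unfolding *[of "f _"] by (rule Bochner_Integration.integral_cnj)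
  qed
  have "vdot (u + v) w = vdot u w + vdot v w" for u v w
    by (simp add: vdot_def distrib_right sum.distrib)
  then show "cinner (f + g) h = cinner f h + cinner g h"
    by transfer (simp add: integrable_vdot)
  have "vdot (c *s u) v = c * vdot u v" for u v
    by (simp add: vdot_def sum_distrib_left mult.assoc flip: distrib_left)
  then show "cinner (c *\<^sub>C f) g = c * cinner f g"
    by transfer simp
  show "Re (cinner f g) = f \<bullet> g"
    by transfer (simp add: integrable_vdot Re_vdot flip: integral_Re)
qed

end

section \<open>Fourier transform, Sobolev space, Dirac operators\<close>

text \<open>The unitary Fourier transform is the limit in quadratic mean of the truncated Fourier
  integrals.\<close>

definition fourier :: "L2 \<Rightarrow> L2" where
  "fourier f = (THE g. ((\<lambda>R. \<integral>\<^sup>+p. ennreal ((norm (rep_L2 g p -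
      complex_of_real (1 / sqrt (2 * pi)) *s
        (\<integral>r\<in>{-R..R}. exp (- (\<i> * of_real (p * r))) *s rep_L2 f r \<partial>lborel)))\<^sup>2) \<partial>lborel) \<longlongrightarrow> 0) at_top)"

text \<open>Multiplication by a matrix function; used only for functions preserving square-integrability.\<close>

definition mult_op :: "(real \<Rightarrow> complex^2^2) \<Rightarrow> L2 \<Rightarrow> L2" where
  "mult_op M f = abs_L2 (\<lambda>x. M x *v rep_L2 f x)"

definition test_function :: "(real \<Rightarrow> real) \<Rightarrow> bool" where
  "test_function \<phi> \<longleftrightarrow>
     (\<forall>n x. (deriv ^^ n) \<phi> differentiable (at x)) \<and> (\<exists>R. \<forall>x. \<bar>x\<bar> > R \<longrightarrow> \<phi> x = 0)"

definition has_weak_derivative :: "L2 \<Rightarrow> L2 \<Rightarrow> bool" where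
  "has_weak_derivative f g \<longleftrightarrow>
     (\<forall>\<phi>. test_function \<phi> \<longrightarrow>
        (\<integral>x. deriv \<phi> x *\<^sub>R rep_L2 f x \<partial>lborel) = - (\<integral>x. \<phi> x *\<^sub>R rep_L2 g x \<partial>lborel))"

definition sobolev_H1 :: "L2 set" where
  "sobolev_H1 = {f. \<exists>g. has_weak_derivative f g}"

definition weak_derivative :: "L2 \<Rightarrow> L2" where
  "weak_derivative f = (THE g. has_weak_derivative f g)"

definition J :: "complex^2^2" where
  "J = vector [vector [0, -1], vector [1, 0]]"

definition dirac_operator :: "(real \<Rightarrow> complex^2^2) \<Rightarrow> L2 \<rightharpoonup> L2" where
  "dirac_operator V f =
     (if f \<in> sobolev_H1 then Some (mult_op (\<lambda>_. J) (weak_derivative f) + mult_op V f) else None)"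

text \<open>The coefficients on the half-line enter through their even extensions \<open>r \<mapsto> a \<bar>r\<bar>\<close>, \<open>r \<mapsto> b \<bar>r\<bar>\<close>; the
  arbitrary values at 0 only matter on a null set.\<close>

definition op_L :: "real \<Rightarrow> (real \<Rightarrow> real) \<Rightarrow> (real \<Rightarrow> real) \<Rightarrow> L2 \<rightharpoonup> L2" where
  "op_L m a b = dirac_operator (\<lambda>r. vector
     [vector [of_real (m + b \<bar>r\<bar>), of_real (a \<bar>r\<bar>)],
      vector [of_real (a \<bar>r\<bar>), of_real (- m + b \<bar>r\<bar>)]])"

definition op_L0 :: "real \<Rightarrow> L2 \<rightharpoonup> L2" where
  "op_L0 m = dirac_operator (\<lambda>_. vector
     [vector [of_real m, 0],
      vector [0, of_real (- m)]])"

text \<open>Note that \<open>mat c\<close> is \<open>c\<close> times the identity matrix, and that the interval integral is oriented.\<close>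

definition W0_tilde :: "real \<Rightarrow> (real \<Rightarrow> real) \<Rightarrow> real \<Rightarrow> real \<Rightarrow> complex^2^2" where
  "W0_tilde m b t p =
     (let s = p / sqrt (p\<^sup>2 + m\<^sup>2)
      in mat (exp (\<i> * of_real (sgn t * (LBINT r=1..\<bar>t\<bar>. b \<bar>r * s\<bar>)))))"

definition deviation_factor :: "real \<Rightarrow> (real \<Rightarrow> real) \<Rightarrow> real \<Rightarrow> L2 \<Rightarrow> L2" where
  "deviation_factor m b t = inv fourier \<circ> mult_op (W0_tilde m b t) \<circ> fourier"

end

theory Submission
  imports Defs "HOL-Probability.Probability"
begin

text \<open>The Fourier transform diagonalises the free group into the two branches \<open>exp (\<plusminus> \<i> t E)\<close>,
  \<open>E = sqrt (p\<^sup>2 + m\<^sup>2)\<close>, travelling with the group velocity \<open>s = p / E\<close>. By Cook's method it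
  suffices that the norm of \<open>(V - b (\<bar>t\<bar> \<bar>s\<bar>)) exp (- \<i> t L0) W0(t)\<inverse> x\<close> is integrable in \<open>t\<close> for \<open>x\<close> in a
  total set, here the wave packets whose Fourier transforms are smooth with compact support off the
  origin: the deviation factor subtracts exactly the value of \<open>b\<close> on the classical ray \<open>r = t s\<close>. In
  position space this is an oscillatory integral over \<open>p\<close> whose symbol \<open>b r - b (t s)\<close> vanishes at the
  stationary point. The symbol is the derivative \<open>r - t s\<close> of the free phase times a divided
  difference of \<open>b\<close>, so a single integration by parts gives \<open>O(t powr (- 2 * \<alpha>))\<close> near the ray, without
  any stationary phase expansion. Away from the rays two integrations by parts give
  \<open>O(t powr (2 - 2 * \<alpha>) / (t + \<bar>r\<bar>)\<^sup>2)\<close>, and near them the entry \<open>a\<close> is estimated by its size. Integrating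
  the squares over \<open>r\<close> yields \<open>O(t powr - \<kappa>)\<close> with \<open>\<kappa> = min (2 \<alpha> - 1/2) (1/2 + \<alpha> - \<gamma>) > 1\<close>.\<close>

section \<open>Complex Hilbert spaces\<close>

text \<open>\<open>exp_i\<close> and \<open>fourier\<close> are definite descriptions, so the groups
  and the transform have to be exhibited before they can be evaluated: the free group as a Fourier
  multiplier, the full group as a bounded perturbation of it in the interaction picture.
  Self-adjointness then follows from the generator property instead of preceding it. The obstacle in
  the estimates is that only two derivatives of \<open>b\<close> are controlled while the deviation
  phase, of size \<open>t powr (1 - \<alpha>)\<close>, sits in the exponent. Near the ray its
  derivative, times a divided difference of size \<open>t powr (- \<alpha> - 1)\<close>, is what
  produces \<open>t powr (- 2 * \<alpha>)\<close>; away from the ray it costs a factor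
  \<open>t powr (1 - \<alpha>)\<close> in each of the two integrations by parts. The square root of
  the length \<open>O(t)\<close> of the region near the rays shifts the exponents by 1/2. Hence
  \<open>\<kappa> > 1\<close> amounts to \<alpha> > 3/4 and \<gamma> < \<alpha> - 1/2. Momenta near
  0 are excluded because a ray must leave the origin at a definite speed for decay in
  \<open>r\<close> to become decay in \<open>t\<close>.\<close>

instance complex_hilbert_space \<subseteq> banach ..

lemma cinner_add_right: "cinner x (y + z) = cinner x y + cinner x z"
  by (metis cinner_commute cinner_add_left complex_cnj_add)

lemma cinner_scaleC_right: "cinner x (c *\<^sub>C y) = cnj c * cinner x y"
  by (metis cinner_commute cinner_scaleC_left complex_cnj_mult)

lemma cinner_scaleR_left: "cinner (r *\<^sub>R x) y = r *\<^sub>R cinner x y"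
  by (metis cinner_scaleC_left scaleC_of_real scaleR_conv_of_real)

lemma cinner_scaleR_right: "cinner x (r *\<^sub>R y) = r *\<^sub>R cinner x y"
  by (metis cinner_scaleC_right scaleC_of_real scaleR_conv_of_real complex_cnj_complex_of_real)

lemma cinner_self: "cinner x x = complex_of_real ((norm x)\<^sup>2)"
proof -
  have "Im (cinner x x) = 0"
    using cinner_commute[of x x] by (metis Im_complex_of_real Reals_cnj_iff complex_is_Real_iff)
  then show ?thesis
    by (simp add: complex_eq_iff Re_cinner power2_norm_eq_inner)
qed

lemma norm_scaleC: "norm (c *\<^sub>C x) = cmod c * norm x"
proof -
  have "complex_of_real ((norm (c *\<^sub>C x))\<^sup>2) = c * cnj c * complex_of_real ((norm x)\<^sup>2)"
    unfolding cinner_self[symmetric] by (simp add: cinner_scaleC_left cinner_scaleC_right)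
  also have "\<dots> = complex_of_real ((cmod c * norm x)\<^sup>2)"
    by (simp only: power_mult_distrib of_real_mult of_real_power complex_norm_square[of c] flip: complex_norm_square)
  finally have "(norm (c *\<^sub>C x))\<^sup>2 = (cmod c * norm x)\<^sup>2"
    by (simp only: of_real_eq_iff)
  then show ?thesis by (simp add: power2_eq_iff_nonneg)
qed

text \<open>Multiplying \<open>x\<close> by a unimodular \<open>c\<close> makes the product real and
  nonnegative, which reduces the claim to the real Cauchy-Schwarz inequality.\<close>

lemma cmod_cinner_le: "cmod (cinner x y) \<le> norm x * norm y"
proof (cases "cinner x y = 0")
  case False
  define c where "c = cnj (cinner x y) / cmod (cinner x y)"
  have "cmod c = 1" using False by (simp add: c_def norm_divide)
  have "cmod (cinner x y) = Re (c * cinner x y)"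
    using False by (simp add: c_def complex_norm_square[symmetric] mult.commute power2_eq_square)
  also have "\<dots> = (c *\<^sub>C x) \<bullet> y"
    by (simp add: Re_cinner flip: cinner_scaleC_left)
  also have "\<dots> \<le> norm x * norm y"
    using norm_cauchy_schwarz[of "c *\<^sub>C x" y] \<open>cmod c = 1\<close> by (simp add: norm_scaleC)
  finally show ?thesis .
qed auto

lemma bounded_bilinear_cinner: "bounded_bilinear (cinner :: 'a \<Rightarrow> 'a::complex_hilbert_space \<Rightarrow> complex)"
proof
  show "\<exists>K. \<forall>a b :: 'a. norm (cinner a b) \<le> norm a * norm b * K"
    by (rule exI[of _ 1]) (simp add: cmod_cinner_le)
qed (simp_all add: cinner_add_left cinner_add_right cinner_scaleR_left cinner_scaleR_right)

interpretation cinner: bounded_bilinear "cinner :: 'a \<Rightarrow> 'a::complex_hilbert_space \<Rightarrow> complex"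
  by (rule bounded_bilinear_cinner)

lemma bounded_linear_scaleC: "bounded_linear (\<lambda>x::'a::complex_hilbert_space. c *\<^sub>C x)"
proof
  fix r :: real and x :: 'a
  show "c *\<^sub>C r *\<^sub>R x = r *\<^sub>R c *\<^sub>C x"
    by (metis scaleC_of_real scaleC_scaleC mult.commute)
  show "\<exists>K. \<forall>x::'a. norm (c *\<^sub>C x) \<le> norm x * K"
    by (rule exI[of _ "cmod c"]) (simp add: norm_scaleC mult.commute)
qed (simp add: scaleC_add_right)

lemmas scaleC_diff_right = linear_diff[OF bounded_linear.linear[OF bounded_linear_scaleC]]
lemmas scaleC_scaleR = linear_scale[OF bounded_linear.linear[OF bounded_linear_scaleC]]
lemmas scaleC_zero_right [simp] = linear_0[OF bounded_linear.linear[OF bounded_linear_scaleC]]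
lemmas tendsto_scaleC = bounded_linear.tendsto[OF bounded_linear_scaleC]

lemma scaleC_one [simp]: "1 *\<^sub>C x = x"
  using scaleC_of_real[of 1 x] by simp

lemma scaleC_uminus_left: "(- c) *\<^sub>C x = - (c *\<^sub>C x)"
  using scaleC_scaleC[of "of_real (-1)" c x] by (simp only: scaleC_of_real) simp

lemma csubspace_scaleR: "csubspace S \<Longrightarrow> x \<in> S \<Longrightarrow> r *\<^sub>R x \<in> S"
  by (metis csubspace_def scaleC_of_real)

text \<open>The nearest point of a closed subspace exists by the parallelogram law, and the
  remainder is orthogonal to the subspace.\<close>

theorem csubspace_dense:
  fixes M :: "'a::complex_hilbert_space set"
  assumes M: "csubspace M" "closed M" and orth: "\<And>x. (\<And>y. y \<in> M \<Longrightarrow> cinner x y = 0) \<Longrightarrow> x = 0"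
  shows "M = UNIV"
proof -
  have "x \<in> M" for x
  proof -
    define d where "d = (INF y\<in>M. norm (x - y))"
    have bdd: "bdd_below ((\<lambda>y. norm (x - y)) ` M)" by (rule bdd_belowI[of _ 0]) auto
    have ne: "M \<noteq> {}" using M by (auto simp: csubspace_def)
    have d: "d \<le> norm (x - y)" if "y \<in> M" for y
      unfolding d_def using bdd that by (rule cINF_lower)
    have d0: "0 \<le> d" unfolding d_def using ne by (intro cINF_greatest) auto
    have "\<exists>y\<in>M. norm (x - y) < d + 1 / real (Suc n)" for n
      using cInf_lessD[of "(\<lambda>y. norm (x - y)) ` M" "d + 1 / real (Suc n)"] ne
      unfolding d_def by auto
    then obtain y where yM: "\<And>n. y n \<in> M" and y: "\<And>n. norm (x - y n) < d + 1 / real (Suc n)"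
      by metis
    have para: "(norm (u - v))\<^sup>2 \<le> 2 * (norm (x - u))\<^sup>2 + 2 * (norm (x - v))\<^sup>2 - 4 * d\<^sup>2"
      if "u \<in> M" "v \<in> M" for u v
    proof -
      have "(1/2) *\<^sub>R (u + v) \<in> M" using M that by (intro csubspace_scaleR) (auto simp: csubspace_def)
      from d[OF this] have "d\<^sup>2 \<le> (norm (x - (1/2) *\<^sub>R (u + v)))\<^sup>2" using d0 by (intro power_mono) auto
      moreover have "(norm (u - v))\<^sup>2 + 4 * (norm (x - (1/2) *\<^sub>R (u + v)))\<^sup>2
          = 2 * (norm (x - u))\<^sup>2 + 2 * (norm (x - v))\<^sup>2"
        by (simp add: power2_norm_eq_inner inner_simps inner_commute algebra_simps)
      ultimately show ?thesis by linarith
    qed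
    have lim0: "(\<lambda>n. norm (x - y n)) \<longlonglongrightarrow> d"
    proof (rule tendsto_sandwich[OF _ _ tendsto_const])
      show "(\<lambda>n. d + 1 / real (Suc n)) \<longlonglongrightarrow> d"
        using tendsto_add[OF tendsto_const LIMSEQ_inverse_real_of_nat, of d]
        by (simp add: inverse_eq_divide)
    qed (use d yM y in \<open>auto intro!: always_eventually less_imp_le\<close>)
    have "Cauchy y"
    proof (rule CauchyI)
      fix e :: real assume e: "e > 0"
      have "(\<lambda>n. (norm (x - y n))\<^sup>2) \<longlonglongrightarrow> d\<^sup>2" by (intro tendsto_intros lim0)
      then have "\<forall>\<^sub>F n in sequentially. dist ((norm (x - y n))\<^sup>2) (d\<^sup>2) < e\<^sup>2 / 4"
        using e by (intro tendstoD) auto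
      then obtain N where N: "\<And>n. n \<ge> N \<Longrightarrow> \<bar>(norm (x - y n))\<^sup>2 - d\<^sup>2\<bar> < e\<^sup>2 / 4"
        by (auto simp: eventually_sequentially dist_real_def)
      have "norm (y m - y n) < e" if "m \<ge> N" "n \<ge> N" for m n
      proof -
        have "(norm (y m - y n))\<^sup>2 < e\<^sup>2"
          using para[OF yM[of m] yM[of n]] N[OF that(1)] N[OF that(2)] by linarith
        then show ?thesis using e by (simp add: power2_less_imp_less)
      qed
      then show "\<exists>N. \<forall>m\<ge>N. \<forall>n\<ge>N. norm (y m - y n) < e" by blast
    qed
    then obtain z where z: "y \<longlonglongrightarrow> z" using Cauchy_convergent convergent_def by blast
    have zM: "z \<in> M" using M(2) yM z by (meson closed_sequentially)
    have "(\<lambda>n. norm (x - y n)) \<longlonglongrightarrow> norm (x - z)" by (intro tendsto_intros z)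
    with lim0 have dz: "norm (x - z) = d" by (rule LIMSEQ_unique[symmetric])
    have re: "(x - z) \<bullet> w = 0" if w: "w \<in> M" for w
    proof (cases "w = 0")
      case False
      \<comment> \<open>This \<open>t\<close> minimises the distance from \<open>x\<close> to the
        line through \<open>z\<close> in direction \<open>w\<close>; the minimum is smaller than the
        distance to \<open>z\<close> unless the inner product is 0.\<close>
      define t where "t = ((x - z) \<bullet> w) / (w \<bullet> w)"
      have "z + t *\<^sub>R w \<in> M" using M w zM csubspace_scaleR[of M w t] by (auto simp: csubspace_def)
      from d[OF this] have "(norm (x - z))\<^sup>2 \<le> (norm (x - (z + t *\<^sub>R w)))\<^sup>2"
        unfolding dz using d0 by (intro power_mono) auto
      also have "\<dots> = (norm (x - z))\<^sup>2 - 2 * t * ((x - z) \<bullet> w) + t\<^sup>2 * (w \<bullet> w)"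
        by (simp only: power2_norm_eq_inner) (simp add: inner_simps inner_commute algebra_simps power2_eq_square)
      also have "\<dots> = (norm (x - z))\<^sup>2 - ((x - z) \<bullet> w)\<^sup>2 / (w \<bullet> w)"
        using False by (simp add: t_def power2_eq_square field_simps)
      finally have "((x - z) \<bullet> w)\<^sup>2 / (w \<bullet> w) \<le> 0" by simp
      then show ?thesis using False
        by (smt (verit) divide_nonneg_pos inner_gt_zero_iff mult_eq_0_iff divide_eq_0_iff zero_le_power2 power_eq_0_iff)
    qed auto
    \<comment> \<open>Real orthogonality tested with \<open>w\<close> and with \<i> times
      \<open>w\<close> yields the real and the imaginary part.\<close>
    have "cinner (x - z) w = 0" if w: "w \<in> M" for w
    proof -
      have "\<i> *\<^sub>C w \<in> M" using M w by (auto simp: csubspace_def)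
      from re[OF this] have "Re (cinner (x - z) (\<i> *\<^sub>C w)) = 0" by (simp add: Re_cinner)
      then have "Im (cinner (x - z) w) = 0" by (simp add: cinner_scaleC_right)
      moreover have "Re (cinner (x - z) w) = 0" using re[OF w] by (simp add: Re_cinner)
      ultimately show ?thesis by (simp add: complex_eq_iff)
    qed
    then have "x - z = 0" by (rule orth)
    with zM show ?thesis by simp
  qed
  then show ?thesis by auto
qed

section \<open>Unitary groups and their generators\<close>

text \<open>Generators are specified by difference quotients at 0; this equivalence makes the
  calculus of \<open>has_vector_derivative\<close> available for them.\<close>

lemma has_vector_derivative_iff_quotient:
  "(f has_vector_derivative D) (at t) \<longleftrightarrow> ((\<lambda>h. (1 / h) *\<^sub>R (f (t + h) - f t)) \<longlongrightarrow> D) (at 0)"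
proof -
  have *: "norm (f (t + h) - f t - h *\<^sub>R D) / norm h = norm ((1 / h) *\<^sub>R (f (t + h) - f t) - D)" if "h \<noteq> 0" for h
  proof -
    have "(1 / h) *\<^sub>R (f (t + h) - f t) - D = (1 / h) *\<^sub>R (f (t + h) - f t - h *\<^sub>R D)"
      using that by (simp add: algebra_simps)
    then show ?thesis by simp
  qed
  have "(f has_vector_derivative D) (at t) \<longleftrightarrow> (\<lambda>h. norm (f (t + h) - f t - h *\<^sub>R D) / norm h) \<midarrow>0\<rightarrow> 0"
    unfolding has_vector_derivative_def has_derivative_at by (simp add: bounded_linear_scaleR_left)
  also have "\<dots> \<longleftrightarrow> (\<lambda>h. norm ((1 / h) *\<^sub>R (f (t + h) - f t) - D)) \<midarrow>0\<rightarrow> 0"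
    by (rule filterlim_cong[OF refl refl]) (simp add: eventually_at_filter *[unfolded real_norm_def])
  also have "\<dots> \<longleftrightarrow> ((\<lambda>h. (1 / h) *\<^sub>R (f (t + h) - f t)) \<longlongrightarrow> D) (at 0)"
    by (simp only: tendsto_norm_zero_iff LIM_zero_iff)
  finally show ?thesis .
qed

lemma continuous_on_vderiv:
  "(\<And>t. t \<in> S \<Longrightarrow> (f has_vector_derivative f' t) (at t)) \<Longrightarrow> continuous_on S f"
  by (intro continuous_at_imp_continuous_on ballI has_vector_derivative_continuous)

lemma has_vector_derivative_compose_minus:
  assumes "(f has_vector_derivative D) (at (- t))"
  shows "((\<lambda>s. f (- s)) has_vector_derivative - D) (at (t::real))"
proof -
  have "((\<lambda>s::real. - s) has_vector_derivative - 1) (at t)" by (auto intro!: derivative_eq_intros)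
  from vector_diff_chain_at[OF this assms] show ?thesis by (simp add: o_def)
qed

lemma has_vector_derivative_zero_const:
  fixes f :: "real \<Rightarrow> 'a::real_normed_vector"
  assumes "\<And>t. (f has_vector_derivative 0) (at t)"
  shows "f t = f 0"
  using has_derivative_zero_unique[of UNIV f t 0] assms
  by (auto simp: has_vector_derivative_def)

text \<open>On a window with \<open>t\<close> in its interior, \<open>G\<close> differs from the
  integral starting at \<open>-R\<close> by a constant. This removes the case distinction at 0,
  where the two branches of \<open>G\<close> meet.\<close>

lemma antiderivative_exists:
  fixes f :: "real \<Rightarrow> 'a::banach"
  assumes f: "continuous_on UNIV f"
  shows "\<exists>G. G 0 = 0 \<and> (\<forall>t. (G has_vector_derivative f t) (at t))"
proof -
  define G where "G t = (if t \<ge> 0 then integral {0..t} f else - integral {t..0} f)" for t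
  have int: "f integrable_on {a..b}" for a b
    by (rule integrable_continuous_real) (rule continuous_on_subset[OF f], simp)
  have eq: "G t = integral {-R..t} f - integral {-R..0} f" if t: "-R \<le> t" and "R > 0" for t R
  proof (cases "t \<ge> 0")
    case True
    then show ?thesis
      using Henstock_Kurzweil_Integration.integral_combine[of "-R" 0 t f] that int by (simp add: G_def algebra_simps)
  next
    case False
    then show ?thesis
      using Henstock_Kurzweil_Integration.integral_combine[of "-R" t 0 f] that int by (simp add: G_def algebra_simps)
  qed
  have "(G has_vector_derivative f t) (at t)" for t
  proof -
    define R where "R = \<bar>t\<bar> + 1"
    have "((\<lambda>u. integral {-R..u} f) has_vector_derivative f t) (at t within {-R..R})"
      by (rule integral_has_vector_derivative) (auto intro: continuous_on_subset[OF f] simp: R_def)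
    then have "((\<lambda>u. integral {-R..u} f) has_vector_derivative f t) (at t)"
      by (subst (asm) at_within_interior) (auto simp: R_def)
    then have "((\<lambda>u. integral {-R..u} f - integral {-R..0} f) has_vector_derivative f t) (at t)"
      by (auto intro!: derivative_eq_intros)
    moreover have "\<forall>\<^sub>F u in nhds t. integral {-R..u} f - integral {-R..0} f = G u"
      by (rule eventually_mono[OF eventually_nhds_in_open[of "{-R<..<R}"]], use R_def in force, use R_def in force)
        (subst eq[of R], auto simp: R_def)
    moreover have "integral {-R..t} f - integral {-R..0} f = G t"
      by (subst eq[of R]) (auto simp: R_def)
    ultimately show ?thesis
      unfolding has_vector_derivative_def
      using has_derivative_transform_eventually[of "\<lambda>u. integral {-R..u} f - integral {-R..0} f" _ t UNIV G]
      by (simp add: eventually_nhds_conv_at)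
  qed
  moreover have "G 0 = 0" by (simp add: G_def)
  ultimately show ?thesis by blast
qed

abbreviation generator_quotient :: "(real \<Rightarrow> 'a \<Rightarrow> 'a) \<Rightarrow> 'a \<Rightarrow> real \<Rightarrow> 'a::real_vector" where
  "generator_quotient U x \<equiv> (\<lambda>h. (1 / h) *\<^sub>R (U h x - x))"

text \<open>The condition inside the definite description of \<open>exp_i\<close>: a group with this
  property is \<open>exp_i A\<close> as soon as uniqueness is known.\<close>

definition generates :: "(real \<Rightarrow> 'a \<Rightarrow> 'a) \<Rightarrow> ('a::complex_hilbert_space \<rightharpoonup> 'a) \<Rightarrow> bool" where
  "generates U A \<longleftrightarrow> unitary_group U \<and>
     (\<forall>x y. A x = Some y \<longleftrightarrow> (generator_quotient U x \<longlongrightarrow> \<i> *\<^sub>C y) (at 0))"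

lemma unitary_operator_bounded_linear:
  assumes "unitary_operator U"
  shows "bounded_linear U" "norm (U x) = norm x" "U (c *\<^sub>C x) = c *\<^sub>C U x" "bij U"
    "cinner (U x) (U y) = cinner x y"
proof -
  have ip: "cinner (U x) (U y) = cinner x y" for x y using assms by (auto simp: unitary_operator_def)
  then show "cinner (U x) (U y) = cinner x y" .
  have n: "norm (U x) = norm x" for x
    using ip[of x x] unfolding cinner_self of_real_eq_iff by (simp add: power2_eq_iff_nonneg)
  then show "norm (U x) = norm x" .
  have c: "U (c *\<^sub>C x) = c *\<^sub>C U x" for c x using assms by (auto simp: unitary_operator_def clinear_on_def)
  then show "U (c *\<^sub>C x) = c *\<^sub>C U x" .
  have add: "U (x + y) = U x + U y" for x y using assms by (auto simp: unitary_operator_def clinear_on_def)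
  show bl: "bounded_linear U"
    by (rule bounded_linear_intro[of _ 1]) (auto simp: add n c simp flip: scaleC_of_real)
  have "inj U"
  proof (rule injI)
    fix x y assume "U x = U y"
    then have "U (x - y) = 0" using linear_diff[OF bounded_linear.linear[OF bl]] by simp
    then show "x = y" using n[of "x - y"] by simp
  qed
  then show "bij U" using assms by (auto simp: unitary_operator_def bij_def)
qed

context
  fixes U :: "real \<Rightarrow> 'a::complex_hilbert_space \<Rightarrow> 'a"
  assumes U: "unitary_group U"
begin

lemma ug_unitary: "unitary_operator (U t)" using U by (simp add: unitary_group_def)
lemma ug_add: "U (s + t) x = U s (U t x)" using U by (simp add: unitary_group_def)
lemma ug_cont: "continuous_on UNIV (\<lambda>t. U t x)" using U by (simp add: unitary_group_def)
lemmas ug_bl = unitary_operator_bounded_linear(1)[OF ug_unitary]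
lemmas ug_norm = unitary_operator_bounded_linear(2)[OF ug_unitary]
lemmas ug_scaleC = unitary_operator_bounded_linear(3)[OF ug_unitary]
lemmas ug_cinner = unitary_operator_bounded_linear(5)[OF ug_unitary]
lemmas ug_diff = linear_diff[OF bounded_linear.linear[OF ug_bl]]
lemmas ug_plus = linear_add[OF bounded_linear.linear[OF ug_bl]]
lemmas ug_scaleR = linear_scale[OF bounded_linear.linear[OF ug_bl]]

text \<open>By the group law \<open>U 0\<close> is idempotent, and an idempotent linear isometry is
  the identity.\<close>

lemma ug_0: "U 0 x = x"
proof -
  have "U 0 (U 0 x - x) = 0" using ug_add[of 0 0 x] by (simp add: ug_diff)
  then show ?thesis using ug_norm[of 0 "U 0 x - x"] by simp
qed

lemma ug_minus: "U (- t) (U t x) = x" "U t (U (- t) x) = x"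
  unfolding ug_add[symmetric] by (simp_all add: ug_0)

lemma ug_adj: "cinner (U t x) y = cinner x (U (- t) y)"
  using ug_cinner[of t x "U (-t) y"] by (simp add: ug_minus)

text \<open>Since every \<open>U t\<close> is an isometry, strong continuity is automatically joint
  continuity in time and vector: the moving part \<open>f t - l\<close> keeps its norm.\<close>

lemma ug_tendsto_path:
  assumes "(f \<longlongrightarrow> l) F" "(g \<longlongrightarrow> s) F"
  shows "((\<lambda>t. U (g t) (f t)) \<longlongrightarrow> U s l) F"
proof -
  have "((\<lambda>t. U (g t) l) \<longlongrightarrow> U s l) F"
    by (rule continuous_on_tendsto_compose[OF ug_cont[of l] assms(2)]) auto
  moreover have "((\<lambda>t. U (g t) (f t - l)) \<longlongrightarrow> 0) F"
    by (rule tendsto_norm_zero_cancel)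
      (use tendsto_norm_zero[OF LIM_zero[OF assms(1)]] in \<open>simp add: ug_norm\<close>)
  ultimately have "((\<lambda>t. U (g t) (f t - l) + U (g t) l) \<longlongrightarrow> 0 + U s l) F" by (intro tendsto_add)
  then show ?thesis by (simp flip: ug_plus)
qed

lemma ug_continuous_path:
  "continuous_on S f \<Longrightarrow> continuous_on S g \<Longrightarrow> continuous_on S (\<lambda>t. U (g t) (f t))"
  unfolding continuous_on_def by (intro ballI ug_tendsto_path) simp_all

lemma ug_uminus: "unitary_group (\<lambda>t. U (- t))"
  unfolding unitary_group_def
proof (intro conjI allI)
  fix s t and x :: 'a
  show "unitary_operator (U (- t))" by (rule ug_unitary)
  show "U (- (s + t)) = U (- s) \<circ> U (- t)" using ug_add[of "-s" "-t"] by (auto simp: fun_eq_iff)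
  show "continuous_on UNIV (\<lambda>t. U (- t) x)" by (intro ug_continuous_path continuous_intros)
qed

text \<open>Product rule in which only the single vector \<open>y t\<close> has to lie in the domain
  of the generator; the increment of \<open>y\<close> is controlled by joint continuity.\<close>

lemma ug_has_vector_derivative_path:
  assumes g: "((\<lambda>h. (1 / h) *\<^sub>R (U h (y t) - y t)) \<longlongrightarrow> w) (at 0)"
    and y: "(y has_vector_derivative y') (at t)"
  shows "((\<lambda>t. U t (y t)) has_vector_derivative U t (w + y')) (at t)"
  unfolding has_vector_derivative_iff_quotient
proof -
  have "((\<lambda>h. U h ((1/h) *\<^sub>R (y (t + h) - y t))) \<longlongrightarrow> U 0 y') (at 0)"
    using y unfolding has_vector_derivative_iff_quotient by (intro ug_tendsto_path tendsto_ident_at)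
  then have "((\<lambda>h. U t ((1 / h) *\<^sub>R (U h (y t) - y t) + U h ((1/h) *\<^sub>R (y (t + h) - y t)))) \<longlongrightarrow> U t (w + y')) (at 0)"
    by (intro ug_tendsto_path tendsto_intros g) (simp add: ug_0)
  moreover have "U t ((1 / h) *\<^sub>R (U h (y t) - y t) + U h ((1/h) *\<^sub>R (y (t + h) - y t)))
      = (1 / h) *\<^sub>R (U (t + h) (y (t + h)) - U t (y t))" for h
    using ug_add[of t h "y (t + h)"]
    by (simp add: ug_plus ug_diff ug_scaleR scaleR_add_right scaleR_diff_right)
  ultimately show "((\<lambda>h. (1 / h) *\<^sub>R (U (t + h) (y (t + h)) - U t (y t))) \<longlongrightarrow> U t (w + y')) (at 0)"
    by simp
qed

lemma ug_orbit_quotient: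
  assumes "(generator_quotient U x \<longlongrightarrow> w) (at 0)"
  shows "((\<lambda>h. (1 / h) *\<^sub>R (U h (U t x) - U t x)) \<longlongrightarrow> U t w) (at 0)"
proof -
  have "((\<lambda>h. U t ((1 / h) *\<^sub>R (U h x - x))) \<longlongrightarrow> U t w) (at 0)"
    by (intro ug_tendsto_path assms tendsto_const)
  then show ?thesis by (simp add: ug_scaleR ug_diff add.commute flip: ug_add)
qed

lemma ug_has_vector_derivative_orbit:
  assumes "(generator_quotient U x \<longlongrightarrow> w) (at 0)"
  shows "((\<lambda>t. U t x) has_vector_derivative U t w) (at t)"
  using ug_has_vector_derivative_path[of "\<lambda>_. x" t w 0] assms by (simp add: has_vector_derivative_const)

lemma ug_reverse_quotient:
  assumes "(generator_quotient U x \<longlongrightarrow> w) (at 0)"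
  shows "((\<lambda>h. (1 / h) *\<^sub>R (U (- h) x - x)) \<longlongrightarrow> - w) (at 0)"
proof -
  have "((\<lambda>t. U t x) has_vector_derivative w) (at (- 0))"
    using ug_has_vector_derivative_orbit[OF assms, of 0] by (simp add: ug_0)
  from has_vector_derivative_compose_minus[OF this] show ?thesis
    by (simp add: has_vector_derivative_iff_quotient ug_0)
qed

end

text \<open>On the common domain \<open>V (- t) (U t x)\<close> has derivative 0: the orbit of
  \<open>U\<close> stays in the domain of \<open>A\<close>, where both generators agree. Density and
  continuity do the rest.\<close>

lemma generates_unique:
  fixes A :: "'a::complex_hilbert_space \<rightharpoonup> 'a"
  assumes U: "generates U A" and V: "generates V A" and dense: "closure (dom A) = UNIV"
  shows "U = V"
proof -
  have UG: "unitary_group U" and VG: "unitary_group V" using U V by (auto simp: generates_def)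
  note VG' = ug_uminus[OF VG]
  have eq: "U t x = V t x" if x: "x \<in> dom A" for t x
  proof -
    from x obtain y where "A x = Some y" by auto
    then have gU: "(generator_quotient U x \<longlongrightarrow> \<i> *\<^sub>C y) (at 0)" using U by (auto simp: generates_def)
    have "((\<lambda>t. V (- t) (U t x)) has_vector_derivative 0) (at t)" for t
    proof -
      have gU': "((\<lambda>h. (1 / h) *\<^sub>R (U h (U t x) - U t x)) \<longlongrightarrow> \<i> *\<^sub>C U t y) (at 0)"
        using ug_orbit_quotient[OF UG gU, of t] by (simp add: ug_scaleC[OF UG])
      then have "A (U t x) = Some (U t y)" using U by (auto simp: generates_def)
      then have "((\<lambda>h. (1 / h) *\<^sub>R (V h (U t x) - U t x)) \<longlongrightarrow> \<i> *\<^sub>C U t y) (at 0)"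
        using V by (auto simp: generates_def)
      from ug_has_vector_derivative_path[OF VG' ug_reverse_quotient[OF VG this]
          ug_has_vector_derivative_orbit[OF UG gU]]
      show ?thesis by (simp add: ug_scaleC[OF UG] linear_0[OF bounded_linear.linear[OF ug_bl[OF VG]]])
    qed
    from has_vector_derivative_zero_const[OF this, of t]
    have "V (- t) (U t x) = x" by (simp add: ug_0[OF UG] ug_0[OF VG])
    then show ?thesis by (metis ug_minus(2)[OF VG])
  qed
  have "U t x = V t x" for t x
  proof -
    have "closed {x. U t x = V t x}"
      by (intro closed_Collect_eq linear_continuous_on ug_bl UG VG)
    then have "closure (dom A) \<subseteq> {x. U t x = V t x}" using eq by (intro closure_minimal) auto
    then show ?thesis using dense by auto
  qed
  then show ?thesis by (intro ext)
qed

lemma exp_i_eq: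
  assumes "generates U A" "closure (dom A) = UNIV"
  shows "exp_i A = U"
proof -
  have "exp_i A = (THE U. generates U A)" by (simp add: exp_i_def generates_def)
  also have "\<dots> = U" using assms generates_unique by (intro the_equality) blast+
  finally show ?thesis .
qed

text \<open>The easy half of Stone's theorem. Symmetry comes from differentiating
  \<open>ug_adj\<close>. For maximality, a pair in the graph of the adjoint satisfies the integrated
  evolution equation when tested against the domain; density removes the test vector, and
  differentiation at 0 puts the pair into the graph of \<open>A\<close>.\<close>

lemma generates_self_adjoint:
  fixes A :: "'a::complex_hilbert_space \<rightharpoonup> 'a"
  assumes U: "generates U A" and dense: "closure (dom A) = UNIV"
  shows "self_adjoint A"
proof -
  have UG: "unitary_group U" using U by (auto simp: generates_def)
  have gA: "A x = Some y \<longleftrightarrow> (generator_quotient U x \<longlongrightarrow> \<i> *\<^sub>C y) (at 0)" for x y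
    using U by (auto simp: generates_def)
  have A0: "A 0 = Some 0" unfolding gA by (simp add: linear_0[OF bounded_linear.linear[OF ug_bl[OF UG]]])
  have Aadd: "A (x + y) = Some (v + w)" if "A x = Some v" "A y = Some w" for x y v w
  proof -
    have "(1 / h) *\<^sub>R (U h x - x) + (1 / h) *\<^sub>R (U h y - y) = (1 / h) *\<^sub>R (U h (x + y) - (x + y))" for h
      by (simp add: ug_plus[OF UG] algebra_simps)
    with tendsto_add[OF that[unfolded gA]] show ?thesis unfolding gA by (simp add: scaleC_add_right)
  qed
  have Asc: "A (c *\<^sub>C x) = Some (c *\<^sub>C v)" if "A x = Some v" for x v c
  proof -
    have "((\<lambda>h. c *\<^sub>C (1 / h) *\<^sub>R (U h x - x)) \<longlongrightarrow> c *\<^sub>C \<i> *\<^sub>C v) (at 0)"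
      using that[unfolded gA] by (rule tendsto_scaleC)
    then show ?thesis unfolding gA
      by (simp add: ug_scaleC[OF UG] scaleC_scaleR scaleC_diff_right scaleC_scaleC mult.commute)
  qed
  have sym: "cinner w y = cinner x z" if "A y = Some z" "A x = Some w" for x y z w
  proof -
    have "((\<lambda>h. cinner ((1 / h) *\<^sub>R (U h x - x)) y) \<longlongrightarrow> cinner (\<i> *\<^sub>C w) y) (at 0)"
      using that(2)[unfolded gA] by (intro cinner.tendsto tendsto_const)
    moreover have "((\<lambda>h. cinner x ((1 / h) *\<^sub>R (U (-h) y - y))) \<longlongrightarrow> cinner x (- (\<i> *\<^sub>C z))) (at 0)"
      using ug_reverse_quotient[OF UG] that(1)[unfolded gA] by (intro cinner.tendsto tendsto_const)
    moreover have "cinner ((1 / h) *\<^sub>R (U h x - x)) y = cinner x ((1 / h) *\<^sub>R (U (-h) y - y))" for h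
      by (simp add: cinner_scaleR_left cinner_scaleR_right cinner.diff_left cinner.diff_right ug_adj[OF UG])
    ultimately have "cinner (\<i> *\<^sub>C w) y = cinner x (- (\<i> *\<^sub>C z))"
      by (simp add: tendsto_unique[OF at_neq_bot])
    then show ?thesis by (simp add: cinner_scaleC_left cinner_scaleC_right cinner.minus_right)
  qed
  have adj: "A y = Some z" if yz: "\<And>x w. A x = Some w \<Longrightarrow> cinner w y = cinner x z" for y z
  proof -
    obtain G where G0: "G 0 = 0" and G: "\<And>t. (G has_vector_derivative U t z) (at t)"
      using antiderivative_exists[OF ug_cont[OF UG, of z]] by blast
    \<comment> \<open>Defect of the integrated evolution equation for the pair
      \<open>(y, z)\<close>. No differentiability of the orbit of \<open>y\<close> is known yet,
      which is why the equation is used in integrated form.\<close>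
    define k where "k t = U t y - y - \<i> *\<^sub>C G t" for t
    have k0: "cinner x (k t) = 0" if x: "x \<in> dom A" for x t
    proof -
      from x obtain w where w: "A x = Some w" by auto
      have "((\<lambda>t. cinner x (k t)) has_vector_derivative 0) (at t)" for t
      proof -
        have "A (U (- t) x) = Some (U (- t) w)"
          using ug_orbit_quotient[OF UG w[unfolded gA], of "-t"] unfolding gA by (simp add: ug_scaleC[OF UG])
        from yz[OF this] have *: "cinner (U (-t) w) y = cinner (U (- t) x) z" .
        have "((\<lambda>t. U t x) has_vector_derivative U (-t) (\<i> *\<^sub>C w)) (at (- t))"
          by (rule ug_has_vector_derivative_orbit[OF UG w[unfolded gA]])
        from has_vector_derivative_compose_minus[OF this]
        have "((\<lambda>t. cinner (U (-t) x) y) has_vector_derivative cinner (- U (-t) (\<i> *\<^sub>C w)) y) (at t)"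
          by (rule bounded_linear.has_vector_derivative[OF cinner.bounded_linear_left])
        moreover have "((\<lambda>t. cinner x y + cinner x (\<i> *\<^sub>C G t)) has_vector_derivative cinner x (\<i> *\<^sub>C U t z)) (at t)"
          using bounded_linear.has_vector_derivative[OF cinner.bounded_linear_right
              bounded_linear.has_vector_derivative[OF bounded_linear_scaleC G]]
          by (auto intro!: derivative_eq_intros)
        moreover have "cinner x (k t) = cinner (U (-t) x) y - (cinner x y + cinner x (\<i> *\<^sub>C G t))" for t
          by (simp add: k_def cinner.diff_right ug_adj[OF UG])
        moreover have "cinner (- U (-t) (\<i> *\<^sub>C w)) y = cinner x (\<i> *\<^sub>C U t z)"
          using * by (simp add: cinner.minus_left cinner_scaleC_right ug_scaleC[OF UG] cinner_scaleC_left ug_adj[OF UG])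
        ultimately show ?thesis using has_vector_derivative_diff by fastforce
      qed
      from has_vector_derivative_zero_const[OF this, of t]
      show ?thesis by (simp add: k_def G0 ug_0[OF UG] cinner.zero_right)
    qed
    have "k t = 0" for t
    proof -
      have "closed {x. cinner x (k t) = 0}"
        by (intro closed_Collect_eq linear_continuous_on cinner.bounded_linear_left continuous_on_const)
      then have "closure (dom A) \<subseteq> {x. cinner x (k t) = 0}" using k0 by (intro closure_minimal) auto
      then have "cinner (k t) (k t) = 0" using dense by auto
      then show ?thesis by (simp add: cinner_self)
    qed
    then have k: "U t y = y + \<i> *\<^sub>C G t" for t
      unfolding k_def by (metis (no_types) add.commute diff_diff_eq eq_iff_diff_eq_0)
    have "((\<lambda>t. y + \<i> *\<^sub>C G t) has_vector_derivative \<i> *\<^sub>C U 0 z) (at 0)"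
      using bounded_linear.has_vector_derivative[OF bounded_linear_scaleC G]
      by (auto intro!: derivative_eq_intros)
    then show ?thesis unfolding gA
      by (simp add: has_vector_derivative_iff_quotient G0 ug_0[OF UG] k)
  qed
  show ?thesis
    unfolding self_adjoint_def csubspace_def clinear_on_def
  proof (intro conjI ballI allI)
    show "0 \<in> dom A" using A0 by (simp add: domI)
    fix x assume "x \<in> dom A"
    then obtain v where v: "A x = Some v" by auto
    show "c *\<^sub>C x \<in> dom A" "the (A (c *\<^sub>C x)) = c *\<^sub>C the (A x)" for c
      using Asc[OF v, of c] v by (simp_all add: domI)
    fix y assume "y \<in> dom A"
    then obtain w where w: "A y = Some w" by auto
    show "x + y \<in> dom A" "the (A (x + y)) = the (A x) + the (A y)"
      using Aadd[OF v w] v w by (simp_all add: domI)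
  next
    fix y z
    show "A y = Some z \<longleftrightarrow> (\<forall>x w. A x = Some w \<longrightarrow> cinner w y = cinner x z)"
      using sym[of y z] adj[of y z] by blast
  qed (rule dense)
qed

section \<open>Bounded perturbations of generators\<close>

text \<open>One step of the Picard iteration: integrating a bound of order \<open>n\<close> gains
  the factor \<open>1 / (n + 1)\<close> that makes the series converge for all times.\<close>

lemma antiderivative_power_bound:
  fixes G :: "real \<Rightarrow> 'a::real_normed_vector"
  assumes G0: "G 0 = 0" and G: "\<And>t. (G has_vector_derivative g t) (at t)"
    and g: "\<And>t. norm (g t) \<le> M * K * (K * \<bar>t\<bar>) ^ n / fact n"
  shows "norm (G t) \<le> M * (K * \<bar>t\<bar>) ^ Suc n / fact (Suc n)"
proof -
  have phi: "((\<lambda>s. M * (K * s) ^ Suc n / fact (Suc n)) has_vector_derivative M * K * (K * s) ^ n / fact n) (at s)" for s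
    unfolding has_real_derivative_iff_has_vector_derivative[symmetric]
    by (rule derivative_eq_intros refl | simp)+
  \<comment> \<open>Stated for an arbitrary pair \<open>H\<close>, \<open>h\<close> at nonnegative
    times so that negative times follow by applying it to the reflected function.\<close>
  have *: "norm (H t) \<le> M * (K * \<bar>t\<bar>) ^ Suc n / fact (Suc n)"
    if t: "t \<ge> 0" and H0: "H 0 = 0" and H: "\<And>t. (H has_vector_derivative h t) (at t)"
      and h: "\<And>t. norm (h t) \<le> M * K * (K * \<bar>t\<bar>) ^ n / fact n" for t and H h :: "real \<Rightarrow> 'a"
  proof (cases "t = 0")
    case False
    have "norm (H t - H 0) \<le> M * (K * t) ^ Suc n / fact (Suc n) - M * (K * 0) ^ Suc n / fact (Suc n)"
    proof (rule differentiable_bound_general)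
      show "continuous_on {0..t} H"
        by (intro continuous_on_vderiv[OF H])
      show "continuous_on {0..t} (\<lambda>s. M * (K * s) ^ Suc n / fact (Suc n))"
        by (intro continuous_on_vderiv[OF phi])
      show "norm (h s) \<le> M * K * (K * s) ^ n / fact n" if "0 < s" for s using h[of s] that by simp
    qed (use H phi t False in auto)
    then show ?thesis using t H0 by simp
  qed (use H0 in simp)
  show ?thesis
  proof (cases "t \<ge> 0")
    case False
    have "norm (G (- (- t))) \<le> M * (K * \<bar>- t\<bar>) ^ Suc n / fact (Suc n)"
      using False G0 g[of "- _"]
      by (intro *[of "-t" "\<lambda>t. G (- t)" "\<lambda>t. - g (- t)"] has_vector_derivative_compose_minus G) auto
    then show ?thesis by simp
  qed (use *[OF _ G0 G g] in auto)
qed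

text \<open>The Picard series, differentiated term by term on bounded windows. The hypothesis
  \<open>cont\<close> asks only that \<open>B\<close> preserve continuity of paths: in the
  application \<open>B\<close> is strongly continuous, not norm continuous.\<close>

lemma linear_ode_solution:
  fixes B :: "real \<Rightarrow> 'a::banach \<Rightarrow> 'a"
  assumes lin: "\<And>t. bounded_linear (B t)" and K: "\<And>t x. norm (B t x) \<le> K * norm x" "0 \<le> K"
    and cont: "\<And>f. continuous_on UNIV f \<Longrightarrow> continuous_on UNIV (\<lambda>t. B t (f t))"
  shows "\<exists>Z. Z 0 = x \<and> (\<forall>t. (Z has_vector_derivative B t (Z t)) (at t))"
proof -
  define P where "P f = (SOME G. G 0 = 0 \<and> (\<forall>t. (G has_vector_derivative f t) (at t)))" for f :: "real \<Rightarrow> 'a"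
  have P: "P f 0 = 0" "(P f has_vector_derivative f t) (at t)" if "continuous_on UNIV f" for f t
    using someI_ex[OF antiderivative_exists[OF that]] unfolding P_def by blast+
  define Z where "Z = rec_nat (\<lambda>_. x) (\<lambda>_ z. P (\<lambda>t. B t (z t)))"
  have Z0: "Z 0 = (\<lambda>_. x)" and ZS: "Z (Suc n) = P (\<lambda>t. B t (Z n t))" for n by (simp_all add: Z_def)
  have contZ: "continuous_on UNIV (Z n)" for n
  proof (induction n)
    case (Suc n)
    then show ?case
      unfolding ZS using P(2)[OF cont[OF Suc]] has_vector_derivative_continuous
      by (intro continuous_at_imp_continuous_on) blast
  qed (simp add: Z0)
  have ZS0: "Z (Suc n) 0 = 0" and dZ: "(Z (Suc n) has_vector_derivative B t (Z n t)) (at t)" for n t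
    unfolding ZS using P[OF cont[OF contZ]] by blast+
  have bd: "norm (Z n t) \<le> norm x * (K * \<bar>t\<bar>) ^ n / fact n" for n t
  proof (induction n arbitrary: t)
    case (Suc n)
    show ?case
    proof (rule antiderivative_power_bound[where G = "Z (Suc n)", OF ZS0 dZ])
      fix t
      have "norm (B t (Z n t)) \<le> K * (norm x * (K * \<bar>t\<bar>) ^ n / fact n)"
        using K(1)[of t "Z n t"] mult_left_mono[OF Suc[of t] K(2)] by linarith
      then show "norm (B t (Z n t)) \<le> norm x * K * (K * \<bar>t\<bar>) ^ n / fact n"
        by (simp add: mult_ac)
    qed
  qed (simp add: Z0)
  \<comment> \<open>Index shift: the zeroth iterate is constant and has derivative 0, the iterate
    \<open>Suc n\<close> has derivative \<open>B t (Z n t)\<close>.\<close>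
  define g where "g n t = (case n of 0 \<Rightarrow> 0 | Suc n \<Rightarrow> B t (Z n t))" for n t
  have dg: "(Z n has_vector_derivative g n t) (at t)" for n t
    by (cases n) (auto simp: g_def dZ Z0)
  have exp_sum: "summable (\<lambda>n. c * y ^ n / fact n)" for c y :: real
    using summable_mult[OF summable_exp[of y], of c] by (simp add: field_simps)
  have sumZ: "summable (\<lambda>n. Z n t)" for t
    by (rule summable_comparison_test'[OF exp_sum[of "norm x" "K * \<bar>t\<bar>"], of 0]) (use bd in auto)
  define S where "S t = (\<Sum>n. Z n t)" for t
  have sumg: "(\<lambda>n. g n t) sums B t (S t)" for t
  proof -
    have "(\<lambda>n. B t (Z n t)) sums B t (S t)"
      unfolding S_def by (intro bounded_linear.sums[OF lin] summable_sums sumZ)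
    then show ?thesis using sums_Suc_iff[of "\<lambda>n. g n t" "B t (S t)"] by (simp add: g_def)
  qed
  have "(S has_vector_derivative B t (S t)) (at t)" for t
  proof -
    define R where "R = \<bar>t\<bar> + 1"
    define M where "M n = (case n of 0 \<Rightarrow> 0 | Suc n \<Rightarrow> K * norm x * (K * R) ^ n / fact n)" for n
    have "summable (\<lambda>n. M (Suc n))" unfolding M_def using exp_sum[of "K * norm x" "K * R"] by simp
    then have "summable M" by (simp add: summable_Suc_iff)
    have gM: "norm (g n s) \<le> M n" if s: "s \<in> {-R<..<R}" for n s
    proof (cases n)
      case (Suc k)
      have "norm (B s (Z k s)) \<le> K * (norm x * (K * \<bar>s\<bar>) ^ k / fact k)"
        using K(1)[of s "Z k s"] mult_left_mono[OF bd[of k s] K(2)] by linarith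
      also have "\<dots> \<le> K * (norm x * (K * R) ^ k / fact k)"
        using s K(2) by (intro mult_left_mono divide_right_mono power_mono) auto
      finally show ?thesis using Suc by (simp add: g_def M_def mult_ac)
    qed (simp add: g_def M_def)
    have "uniform_limit {-R<..<R} (\<lambda>n s. \<Sum>i<n. g i s) (\<lambda>s. \<Sum>i. g i s) sequentially"
      by (rule Weierstrass_m_test[OF gM \<open>summable M\<close>])
    moreover have "(\<Sum>i. g i s) = B s (S s)" for s using sumg[of s] by (rule sums_unique[symmetric])
    ultimately have ul: "uniform_limit {-R<..<R} (\<lambda>n s. \<Sum>i<n. g i s) (\<lambda>s. B s (S s)) sequentially"
      by simp
    have "\<exists>g'. \<forall>s\<in>{-R<..<R}. (\<lambda>n. Z n s) sums (g' s) \<and>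
        (g' has_derivative (\<lambda>h. h *\<^sub>R B s (S s))) (at s within {-R<..<R})"
    proof (rule has_derivative_series[where f' = "\<lambda>n s h. h *\<^sub>R g n s"])
      show "(Z n has_derivative (\<lambda>h. h *\<^sub>R g n s)) (at s within {-R<..<R})" for n s
        using dg[of n s] unfolding has_vector_derivative_def by (rule has_derivative_at_withinI)
      show "\<forall>\<^sub>F n in sequentially. \<forall>s\<in>{-R<..<R}. \<forall>h. norm ((\<Sum>i<n. h *\<^sub>R g i s) - h *\<^sub>R B s (S s)) \<le> e * norm h"
        if "e > 0" for e
        using uniform_limitD[OF ul that]
      proof eventually_elim
        case (elim n)
        show ?case
        proof (intro ballI allI)
          fix s h assume "s \<in> {-R<..<R}"
          then have "norm ((\<Sum>i<n. g i s) - B s (S s)) \<le> e" using elim by (auto simp: dist_norm less_imp_le)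
          then have "\<bar>h\<bar> * norm ((\<Sum>i<n. g i s) - B s (S s)) \<le> \<bar>h\<bar> * e" by (intro mult_left_mono) auto
          then show "norm ((\<Sum>i<n. h *\<^sub>R g i s) - h *\<^sub>R B s (S s)) \<le> e * norm h"
            by (simp add: mult.commute flip: scaleR_sum_right scaleR_diff_right)
        qed
      qed
      have "0 < R" by (simp add: R_def add_nonneg_pos)
      then show "(0::real) \<in> {-R<..<R}" by simp
      show "(\<lambda>n. Z n 0) sums S 0" unfolding S_def by (intro summable_sums sumZ)
    qed simp
    then obtain g' where g': "\<And>s. s \<in> {-R<..<R} \<Longrightarrow> (\<lambda>n. Z n s) sums (g' s)"
      "\<And>s. s \<in> {-R<..<R} \<Longrightarrow> (g' has_derivative (\<lambda>h. h *\<^sub>R B s (S s))) (at s within {-R<..<R})" by metis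
    have eq: "g' s = S s" if "s \<in> {-R<..<R}" for s using g'(1)[OF that] by (simp add: S_def sums_iff)
    have t: "t \<in> {-R<..<R}" by (auto simp: R_def)
    have "(S has_derivative (\<lambda>h. h *\<^sub>R B t (S t))) (at t within {-R<..<R})"
      by (rule has_derivative_transform[OF t _ g'(2)[OF t]]) (simp add: eq)
    then show ?thesis unfolding has_vector_derivative_def
      by (subst (asm) at_within_open[OF t]) auto
  qed
  moreover have "S 0 = x"
  proof -
    have "(\<lambda>n. Z n 0) = (\<lambda>n. if n = 0 then x else 0)"
    proof
      fix n show "Z n 0 = (if n = 0 then x else 0)" by (cases n) (auto simp: Z0 ZS0)
    qed
    then show ?thesis using sums_single[of 0 "\<lambda>_. x"] by (simp add: S_def sums_iff)
  qed
  ultimately show ?thesis by blast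
qed

text \<open>Interaction picture: conjugating \<open>V\<close> by the free group gives a bounded
  time-dependent equation for \<open>Z\<close>, and \<open>U0 t\<close> applied to its solution is
  the perturbed group. The unbounded operator never enters the differential equation.\<close>

theorem bounded_perturbation_generates:
  fixes A0 :: "'a::complex_hilbert_space \<rightharpoonup> 'a" and V :: "'a \<Rightarrow> 'a"
  assumes gen: "generates U0 A0" and V: "bounded_linear V" "\<And>c x. V (c *\<^sub>C x) = c *\<^sub>C V x"
    and sym: "\<And>x y. cinner (V x) y = cinner x (V y)"
  shows "\<exists>U. generates U (\<lambda>x. map_option (\<lambda>y. y + V x) (A0 x))"
proof -
  have U0: "unitary_group U0" using gen by (simp add: generates_def)
  note [simp] = ug_0[OF U0] ug_norm[OF U0] ug_minus[OF U0] ug_scaleC[OF U0]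
  define B where "B t w = \<i> *\<^sub>C U0 (- t) (V (U0 t w))" for t w
  obtain K where K: "0 \<le> K" "\<And>x. norm (V x) \<le> K * norm x"
    using bounded_linear.nonneg_bounded[OF V(1)] by (auto simp: mult.commute)
  have linB: "bounded_linear (B t)" for t
    unfolding B_def
    by (intro bounded_linear_compose[OF bounded_linear_scaleC] bounded_linear_compose[OF ug_bl[OF U0]]
        bounded_linear_compose[OF V(1)] ug_bl[OF U0])
  have normB: "norm (B t x) \<le> K * norm x" for t x
    using K(2)[of "U0 t x"] by (simp add: B_def norm_scaleC)
  have contB: "continuous_on UNIV (\<lambda>t. B t (f t))" if "continuous_on UNIV f" for f
    unfolding B_def
    by (intro bounded_linear.continuous_on[OF bounded_linear_scaleC] bounded_linear.continuous_on[OF V(1)]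
        ug_continuous_path[OF U0] that continuous_intros)
  have skewB: "cinner (B t z) w + cinner z (B t w) = 0" for t z w
    using ug_adj[OF U0, of "-t"] ug_adj[OF U0, of "t" z]
    by (simp add: B_def cinner_scaleC_left cinner_scaleC_right sym)
  have B_scaleC: "B t (c *\<^sub>C x) = c *\<^sub>C B t x" for t c x
    by (simp add: B_def V(2) scaleC_scaleC mult.commute)
  have "\<exists>Z. \<forall>x. Z x 0 = x \<and> (\<forall>t. (Z x has_vector_derivative B t (Z x t)) (at t))"
    using linear_ode_solution[OF linB normB K(1) contB] by (intro choice) blast
  then obtain Z where Z0: "\<And>x. Z x 0 = x" and dZ: "\<And>x t. (Z x has_vector_derivative B t (Z x t)) (at t)"
    by blast
  \<comment> \<open>\<open>B t\<close> is skew-adjoint, so inner products of two solutions are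
    conserved. This gives unitarity as well as uniqueness.\<close>
  have cst: "cinner (Y t) (W t) = cinner (Y 0) (W 0)"
    if "\<And>t. (Y has_vector_derivative B t (Y t)) (at t)" "\<And>t. (W has_vector_derivative B t (W t)) (at t)"
    for Y W t
  proof (rule has_vector_derivative_zero_const)
    fix t
    show "((\<lambda>t. cinner (Y t) (W t)) has_vector_derivative 0) (at t)"
      using bounded_bilinear.has_vector_derivative[OF bounded_bilinear_cinner that(1)[of t] that(2)[of t]]
        skewB[of t "Y t" "W t"] by (simp add: add.commute)
  qed
  \<comment> \<open>The difference of two solutions with equal initial value has conserved norm 0;
    no Gronwall argument enters.\<close>
  have uniq: "Y t = Z (Y 0) t" if Y: "\<And>t. (Y has_vector_derivative B t (Y t)) (at t)" for Y t
  proof -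
    have "((\<lambda>t. Y t - Z (Y 0) t) has_vector_derivative B t (Y t - Z (Y 0) t)) (at t)" for t
      using has_vector_derivative_diff[OF Y[of t] dZ[of "Y 0" t]]
      by (simp add: linear_diff[OF bounded_linear.linear[OF linB]])
    from cst[OF this this, of t] show ?thesis by (simp add: Z0 cinner_self cinner.zero_left)
  qed
  define U where "U t x = U0 t (Z x t)" for t x
  have U_add: "U (t + s) x = U t (U s x)" for s t x
  proof -
    \<comment> \<open>The time-shifted solution, transported by \<open>U0 s\<close>, solves the same
      equation with initial value \<open>U s x\<close>; uniqueness turns this into the group
      law.\<close>
    have "((\<lambda>t. U0 s (Z x (t + s))) has_vector_derivative B t (U0 s (Z x (t + s)))) (at t)" for t
    proof -
      have "((\<lambda>t. Z x (t + s)) has_vector_derivative B (t + s) (Z x (t + s))) (at t)"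
      proof -
        have "((\<lambda>t. t + s) has_vector_derivative 1) (at t)" by (auto intro!: derivative_eq_intros)
        from vector_diff_chain_at[OF this dZ[of x "t + s"]] show ?thesis by (simp add: o_def)
      qed
      from bounded_linear.has_vector_derivative[OF ug_bl[OF U0] this, of s]
      have "((\<lambda>t. U0 s (Z x (t + s))) has_vector_derivative U0 s (B (t + s) (Z x (t + s)))) (at t)" .
      moreover have "U0 s (B (t + s) w) = B t (U0 s w)" for w
        unfolding B_def by (simp flip: ug_add[OF U0] )
      ultimately show ?thesis by simp
    qed
    from uniq[OF this, of t] show ?thesis by (simp add: U_def ug_add[OF U0])
  qed
  have U_0: "U 0 x = x" for x by (simp add: U_def Z0)
  have U_lin: "clinear_on UNIV (U t)" for t
  proof -
    have "Z (x + y) t = Z x t + Z y t" for x y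
    proof -
      have "((\<lambda>t. Z x t + Z y t) has_vector_derivative B t (Z x t + Z y t)) (at t)" for t
        using has_vector_derivative_add[OF dZ[of x t] dZ[of y t]]
        by (simp add: linear_add[OF bounded_linear.linear[OF linB]])
      from uniq[OF this, of t] show ?thesis by (simp add: Z0)
    qed
    moreover have "Z (c *\<^sub>C x) t = c *\<^sub>C Z x t" for c x
    proof -
      have "((\<lambda>t. c *\<^sub>C Z x t) has_vector_derivative B t (c *\<^sub>C Z x t)) (at t)" for t
        using bounded_linear.has_vector_derivative[OF bounded_linear_scaleC dZ[of x t]] by (simp add: B_scaleC)
      from uniq[OF this, of t] show ?thesis by (simp add: Z0)
    qed
    ultimately show ?thesis by (simp add: clinear_on_def U_def ug_plus[OF U0])
  qed
  have U_cinner: "cinner (U t x) (U t y) = cinner x y" for t x y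
    using cst[OF dZ dZ, of x t y] by (simp add: U_def ug_cinner[OF U0] Z0)
  have U_surj: "surj (U t)" for t
    by (rule surjI[of _ "U (- t)"]) (simp add: U_0 flip: U_add)
  have contZ: "continuous_on UNIV (Z x)" for x
    by (intro continuous_on_vderiv[OF dZ])
  have UG: "unitary_group U"
    unfolding unitary_group_def unitary_operator_def
  proof (intro conjI allI ext)
    show "continuous_on UNIV (\<lambda>t. U t x)" for x
      unfolding U_def by (intro ug_continuous_path[OF U0] contZ continuous_intros)
  qed (simp_all add: U_lin U_surj U_cinner U_add)
  \<comment> \<open>An equivalence, not just an implication: the two difference quotients differ by
    a convergent term, so both generators have the same domain.\<close>
  have lim: "(generator_quotient U x \<longlongrightarrow> w + \<i> *\<^sub>C V x) (at 0)
      \<longleftrightarrow> ((\<lambda>h. (1 / h) *\<^sub>R (U0 h x - x)) \<longlongrightarrow> w) (at 0)" for x w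
  proof -
    have "((\<lambda>h. (1 / h) *\<^sub>R (Z x h - x)) \<longlongrightarrow> \<i> *\<^sub>C V x) (at 0)"
      using dZ[of x 0] unfolding has_vector_derivative_iff_quotient by (simp add: Z0 B_def)
    then have 1: "((\<lambda>h. U0 h ((1 / h) *\<^sub>R (Z x h - x))) \<longlongrightarrow> U0 0 (\<i> *\<^sub>C V x)) (at 0)"
      by (rule ug_tendsto_path[OF U0 _ tendsto_ident_at])
    have 2: "(1 / h) *\<^sub>R (U h x - x) = (1 / h) *\<^sub>R (U0 h x - x) + U0 h ((1 / h) *\<^sub>R (Z x h - x))" for h
      by (simp add: U_def ug_scaleR[OF U0] ug_diff[OF U0] algebra_simps)
    show ?thesis
    proof
      assume "(generator_quotient U x \<longlongrightarrow> w + \<i> *\<^sub>C V x) (at 0)"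
      from tendsto_diff[OF this 1] show "((\<lambda>h. (1 / h) *\<^sub>R (U0 h x - x)) \<longlongrightarrow> w) (at 0)"
        unfolding 2 by (simp add: U0)
    next
      assume "((\<lambda>h. (1 / h) *\<^sub>R (U0 h x - x)) \<longlongrightarrow> w) (at 0)"
      from tendsto_add[OF this 1] show "(generator_quotient U x \<longlongrightarrow> w + \<i> *\<^sub>C V x) (at 0)"
        unfolding 2 by (simp add: U0)
    qed
  qed
  have "map_option (\<lambda>y. y + V x) (A0 x) = Some y \<longleftrightarrow> A0 x = Some (y - V x)" for x y
    by (cases "A0 x") (auto simp: algebra_simps)
  also have "A0 x = Some (y - V x) \<longleftrightarrow> (generator_quotient U x \<longlongrightarrow> \<i> *\<^sub>C y) (at 0)" for x y
    using gen lim[of x "\<i> *\<^sub>C (y - V x)"] by (simp add: generates_def scaleC_diff_right)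
  finally show ?thesis using UG by (auto simp: generates_def)
qed

section \<open>Convergence of families of isometries\<close>

text \<open>For isometries the vectors along which \<open>T t x\<close> converges form a closed
  subspace; it contains a total set, hence is everything.\<close>

lemma convergence_on_total_set:
  fixes T :: "real \<Rightarrow> 'a::complex_hilbert_space \<Rightarrow> 'a"
  assumes T: "\<And>t. bounded_linear (T t)" "\<And>t c x. T t (c *\<^sub>C x) = c *\<^sub>C T t x" "\<And>t x. norm (T t x) = norm x"
    and F: "F \<noteq> bot" and conv: "\<And>x. x \<in> D \<Longrightarrow> \<exists>l. ((\<lambda>t. T t x) \<longlongrightarrow> l) F"
    and total: "\<And>x. (\<And>y. y \<in> D \<Longrightarrow> cinner x y = 0) \<Longrightarrow> x = 0"
  shows "\<exists>l. ((\<lambda>t. T t x) \<longlongrightarrow> l) F"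
proof -
  define M where "M = {x. \<exists>l. ((\<lambda>t. T t x) \<longlongrightarrow> l) F}"
  note lin = bounded_linear.linear[OF T(1)]
  have "csubspace M"
    unfolding csubspace_def M_def
  proof (intro conjI ballI allI; clarsimp)
    show "\<exists>l. ((\<lambda>t. T t 0) \<longlongrightarrow> l) F" by (auto simp: linear_0[OF lin])
    fix x y l k assume l: "((\<lambda>t. T t x) \<longlongrightarrow> l) F"
    show "\<exists>l. ((\<lambda>t. T t (c *\<^sub>C x)) \<longlongrightarrow> l) F" for c
      unfolding T(2) using tendsto_scaleC[OF l] by blast
    assume k: "((\<lambda>t. T t y) \<longlongrightarrow> k) F"
    then show "\<exists>l. ((\<lambda>t. T t (x + y)) \<longlongrightarrow> l) F"
      unfolding linear_add[OF lin] using tendsto_add[OF l k] by blast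
  qed
  moreover have "closed M"
    unfolding closed_sequential_limits
  proof (intro allI impI; elim conjE)
    fix X x assume X: "\<forall>n::nat. X n \<in> M" "X \<longlonglongrightarrow> x"
    then obtain l where l: "\<And>n. ((\<lambda>t. T t (X n)) \<longlongrightarrow> l n) F" unfolding M_def by simp metis
    \<comment> \<open>The limits inherit the isometry, so the limits along a convergent sequence of
      vectors again form a Cauchy sequence.\<close>
    have dl: "norm (l n - l m) = norm (X n - X m)" for n m
    proof -
      have "((\<lambda>t. norm (T t (X n) - T t (X m))) \<longlongrightarrow> norm (l n - l m)) F" by (intro tendsto_intros l)
      then have "((\<lambda>t. norm (X n - X m)) \<longlongrightarrow> norm (l n - l m)) F"
        by (simp add: T(3) flip: linear_diff[OF lin])
      then show ?thesis using tendsto_unique[OF F tendsto_const] by metis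
    qed
    have "Cauchy l" using LIMSEQ_imp_Cauchy[OF X(2)] by (simp add: Cauchy_def dist_norm dl)
    then obtain k where k: "l \<longlonglongrightarrow> k" using Cauchy_convergent convergent_def by blast
    have "((\<lambda>t. T t x) \<longlongrightarrow> k) F"
    proof (rule tendstoI)
      fix e :: real assume "e > 0"
      then have "\<forall>\<^sub>F n in sequentially. dist (X n) x < e/3 \<and> dist (l n) k < e/3"
        using tendstoD[OF X(2), of "e/3"] tendstoD[OF k, of "e/3"] by (intro eventually_conj) auto
      then obtain n where n: "norm (X n - x) < e/3" "norm (l n - k) < e/3"
        unfolding eventually_sequentially dist_norm by blast
      have "\<forall>\<^sub>F t in F. dist (T t (X n)) (l n) < e/3" using \<open>e > 0\<close> by (intro tendstoD[OF l]) auto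
      then show "\<forall>\<^sub>F t in F. dist (T t x) k < e"
      proof eventually_elim
        case (elim t)
        have "T t x - k = - T t (X n - x) + (T t (X n) - l n) + (l n - k)" by (simp add: linear_diff[OF lin])
        then have "norm (T t x - k) \<le> norm (X n - x) + norm (T t (X n) - l n) + norm (l n - k)"
          by (metis norm_triangle_mono norm_minus_cancel T(3) order_refl)
        then show ?case using n elim by (simp add: dist_norm)
      qed
    qed
    then show "x \<in> M" by (auto simp: M_def)
  qed
  ultimately have "M = UNIV"
    using total conv by (intro csubspace_dense) (auto simp: M_def)
  then show ?thesis by (auto simp: M_def)
qed

text \<open>Cook's criterion: an integrable bound on the derivative makes the path Cauchy at
  infinity.\<close>

lemma convergent_at_top_if_derivative_bound:
  fixes f :: "real \<Rightarrow> 'a::banach"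
  assumes f: "\<And>t. t \<ge> 1 \<Longrightarrow> (f has_vector_derivative f' t) (at t)"
    and bd: "\<And>t. t \<ge> 1 \<Longrightarrow> norm (f' t) \<le> C * t powr (- k)" and k: "k > 1"
  shows "\<exists>l. (f \<longlongrightarrow> l) at_top"
proof -
  \<comment> \<open>Antiderivative of the majorant normalised to vanish at infinity, so
    \<open>- G t\<close> is the remaining tail integral.\<close>
  define G where "G t = - (C / (k - 1)) * t powr (1 - k)" for t
  have G: "(G has_vector_derivative C * t powr (- k)) (at t)" if "t > 0" for t
  proof -
    have "((\<lambda>t. t powr (1 - k)) has_real_derivative (1 - k) * t powr (1 - k - 1)) (at t)"
      using that by (rule has_real_derivative_powr)
    moreover have "- (C / (k - 1)) * ((1 - k) * t powr (1 - k - 1)) = C * t powr (- k)"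
    proof -
      have "- (C / d) * (- d * y) = C * y" if "d \<noteq> 0" for d y :: real using that by simp
      from this[of "k - 1" "t powr (- k)"] k show ?thesis by simp
    qed
    ultimately show ?thesis
      unfolding G_def has_real_derivative_iff_has_vector_derivative[symmetric]
      by (metis DERIV_cmult)
  qed
  have le: "norm (f t - f s) \<le> G t - G s" if "1 \<le> s" "s \<le> t" for s t
  proof (cases "s = t")
    case False
    show ?thesis
    proof (rule differentiable_bound_general[where f' = f' and \<phi>' = "\<lambda>t. C * t powr (- k)"])
      show "continuous_on {s..t} f"
        using that by (intro continuous_on_vderiv[OF f]) auto
      show "continuous_on {s..t} G"
        using that by (intro continuous_on_vderiv[OF G]) auto
    qed (use that False f G bd in auto)
  qed simp
  have C: "C \<ge> 0" using bd[of 1] norm_ge_zero[of "f' 1"] by (smt (verit) mult_cancel_left1 powr_one_eq_one order_trans)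
  then have G0: "G t \<le> 0" for t using k by (simp add: G_def)
  have limG: "(G \<longlongrightarrow> 0) at_top"
  proof -
    have "((\<lambda>t. t powr (1 - k)) \<longlongrightarrow> 0) at_top"
      using tendsto_neg_powr[of "1 - k" "\<lambda>t. t" at_top] k by (simp add: filterlim_ident)
    from tendsto_mult_right_zero[OF this, of "- (C / (k - 1))"] show ?thesis unfolding G_def .
  qed
  have "Cauchy (\<lambda>n. f (real (Suc n)))"
  proof (rule CauchyI')
    fix e :: real assume "e > 0"
    then have "\<forall>\<^sub>F t in at_top. dist (G t) 0 < e" by (intro tendstoD limG)
    then obtain N where N: "\<And>t. t \<ge> N \<Longrightarrow> \<bar>G t\<bar> < e" by (auto simp: eventually_at_top_linorder)
    have "norm (f (real (Suc m)) - f (real (Suc n))) < e" if "m \<ge> nat \<lceil>N\<rceil>" "n > m" for m n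
    proof -
      have "norm (f (real (Suc n)) - f (real (Suc m))) \<le> G (real (Suc n)) - G (real (Suc m))"
        using that by (intro le) auto
      also have "\<dots> \<le> \<bar>G (real (Suc m))\<bar>" using G0[of "real (Suc n)"] by linarith
      also have "\<dots> < e" using that by (intro N) linarith
      finally show ?thesis by (simp add: norm_minus_commute)
    qed
    then show "\<exists>M. \<forall>m\<ge>M. \<forall>n>m. dist (f (real (Suc m))) (f (real (Suc n))) < e"
      unfolding dist_norm by blast
  qed
  then obtain l where l: "(\<lambda>n. f (real (Suc n))) \<longlonglongrightarrow> l" using Cauchy_convergent convergent_def by blast
  have "norm (f t - l) \<le> - G t" if "t \<ge> 1" for t
  proof (rule tendsto_upperbound)
    show "(\<lambda>n. norm (f t - f (real (Suc n)))) \<longlonglongrightarrow> norm (f t - l)" by (intro tendsto_intros l)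
    have "norm (f t - f (real (Suc n))) \<le> - G t" if "n \<ge> nat \<lceil>t\<rceil>" for n
      using le[of t "real (Suc n)"] that \<open>t \<ge> 1\<close> G0[of "real (Suc n)"] norm_minus_commute[of "f t"] by simp
    then show "\<forall>\<^sub>F n in sequentially. norm (f t - f (real (Suc n))) \<le> - G t"
      unfolding eventually_sequentially by blast
  qed simp
  then have ev: "\<forall>\<^sub>F t in at_top. norm (f t - l) \<le> - G t"
    by (auto simp: eventually_at_top_linorder)
  have "((\<lambda>t. - G t) \<longlongrightarrow> 0) at_top" using tendsto_minus[OF limG] by simp
  from Lim_null_comparison[OF ev this] have "((\<lambda>t. f t - l) \<longlongrightarrow> 0) at_top" .
  then show ?thesis using LIM_zero_cancel by blast
qed

section \<open>The space \<open>L2\<close>\<close>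

lemmas integrable_dominated = Bochner_Integration.integrable_bound

lemma norm_axis_complex: "norm (axis i c :: complex^2) = cmod c"
  using exhaust_2[of i] by (auto simp: norm_vec_def L2_set_def sum_2 axis_def)

lemma borel_measurable_vec_iff:
  fixes f :: "'a \<Rightarrow> complex^2"
  shows "f \<in> borel_measurable M \<longleftrightarrow> (\<forall>i. (\<lambda>x. f x $ i) \<in> borel_measurable M)"
proof
  assume f: "f \<in> borel_measurable M"
  show "\<forall>i. (\<lambda>x. f x $ i) \<in> borel_measurable M"
  proof
    fix i :: 2
    have "(\<lambda>v::complex^2. v $ i) \<in> borel_measurable borel"
      by (intro borel_measurable_continuous_onI continuous_intros)
    from measurable_compose[OF f this] show "(\<lambda>x. f x $ i) \<in> borel_measurable M" .
  qed
next
  assume f: "\<forall>i. (\<lambda>x. f x $ i) \<in> borel_measurable M"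
  have m: "(\<lambda>c::complex. axis i c :: complex^2) \<in> borel_measurable borel" for i
  proof (intro borel_measurable_continuous_onI)
    have "bounded_linear (\<lambda>c::complex. axis i c :: complex^2)"
      by (rule bounded_linear_intro[of _ 1]) (auto simp: norm_axis_complex, auto simp: axis_def vec_eq_iff)
    then show "continuous_on UNIV (\<lambda>c::complex. axis i c :: complex^2)"
      by (rule linear_continuous_on)
  qed
  have "f = (\<lambda>x. \<Sum>i\<in>UNIV. axis i (f x $ i))"
    by (auto simp: fun_eq_iff vec_eq_iff axis_def if_distrib cong: if_cong)
  moreover have "(\<lambda>x. \<Sum>i\<in>UNIV. axis i (f x $ i) :: complex^2) \<in> borel_measurable M"
    using measurable_compose[OF f[rule_format] m] by (intro borel_measurable_sum) simp
  ultimately show "f \<in> borel_measurable M" by simp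
qed

lemma measurable_vec_nth [measurable (raw)]:
  "f \<in> borel_measurable M \<Longrightarrow> (\<lambda>x. (f x :: complex^2) $ i) \<in> borel_measurable M"
  by (simp add: borel_measurable_vec_iff)

lemma norm_vec2_sq: "(norm (v :: complex^2))\<^sup>2 = (\<Sum>i\<in>UNIV. (cmod (v $ i))\<^sup>2)"
  by (simp add: norm_vec_def L2_set_def sum_nonneg)

lemma square_integrable_measurable: "square_integrable f \<Longrightarrow> f \<in> borel_measurable borel"
  by (simp add: square_integrable_def)

lemma square_integrable_bound:
  assumes "square_integrable g" "f \<in> borel_measurable borel" "AE x in lborel. norm (f x) \<le> K * norm (g x)"
  shows "square_integrable f"
proof -
  have [measurable]: "f \<in> borel_measurable borel" by fact
  have "integrable lborel (\<lambda>x. (norm (f x))\<^sup>2)"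
  proof (rule integrable_dominated)
    show "integrable lborel (\<lambda>x. K\<^sup>2 * (norm (g x))\<^sup>2)" using assms(1) by (simp add: square_integrable_def)
    show "AE x in lborel. norm ((norm (f x))\<^sup>2) \<le> norm (K\<^sup>2 * (norm (g x))\<^sup>2)"
      using assms(3)
    proof eventually_elim
      case (elim x)
      then have "(norm (f x))\<^sup>2 \<le> (K * norm (g x))\<^sup>2" by (intro power_mono) auto
      then show ?case by (simp add: power_mult_distrib)
    qed
  qed simp
  then show ?thesis using assms by (simp add: square_integrable_def)
qed

lemma square_integrable_cong_AE:
  assumes "square_integrable g" "f \<in> borel_measurable borel" "AE x in lborel. f x = g x"
  shows "square_integrable f"
  by (rule square_integrable_bound[OF assms(1,2), of 1]) (use assms(3) in auto)

lemma rep_abs_L2: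
  assumes "square_integrable f"
  shows "AE x in lborel. rep_L2 (abs_L2 f) x = f x"
  using rep_abs_rsp_left[OF Quotient3_L2, of f f] assms by simp

lemma abs_L2_eqI:
  "square_integrable f \<Longrightarrow> square_integrable g \<Longrightarrow> AE x in lborel. f x = g x \<Longrightarrow> abs_L2 f = abs_L2 g"
  by (rule Quotient3_rel_abs[OF Quotient3_L2]) simp

lemma abs_L2_eq_iff:
  "square_integrable f \<Longrightarrow> square_integrable g \<Longrightarrow> abs_L2 f = abs_L2 g \<longleftrightarrow> (AE x in lborel. f x = g x)"
  using rep_abs_L2[of f] rep_abs_L2[of g] abs_L2_eqI[of f g] by auto

lemma L2_eq_iff: "f = g \<longleftrightarrow> (AE x in lborel. rep_L2 f x = rep_L2 g x)"
  using abs_L2_eq_iff[OF square_integrable_rep square_integrable_rep, of f g] by simp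

lemma L2_cases [cases type: L2]:
  obtains f where "square_integrable f" "F = abs_L2 f"
  using square_integrable_rep[of F] abs_rep_L2[of F] by metis

lemma rep_L2_measurable [measurable]: "rep_L2 f \<in> borel_measurable borel"
  by (rule square_integrable_measurable[OF square_integrable_rep])

lemma abs_L2_add:
  "square_integrable f \<Longrightarrow> square_integrable g \<Longrightarrow> abs_L2 f + abs_L2 g = abs_L2 (\<lambda>x. f x + g x)"
  by (simp add: plus_L2.abs_eq)

lemma abs_L2_scaleC: "square_integrable f \<Longrightarrow> c *\<^sub>C abs_L2 f = abs_L2 (\<lambda>x. c *s f x)"
  by (simp add: scaleC_L2.abs_eq)

lemma abs_L2_scaleR: "square_integrable f \<Longrightarrow> c *\<^sub>R abs_L2 f = abs_L2 (\<lambda>x. c *\<^sub>R f x)"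
  by (simp add: scaleR_L2.abs_eq)

lemma cinner_abs_L2:
  "square_integrable f \<Longrightarrow> square_integrable g \<Longrightarrow> cinner (abs_L2 f) (abs_L2 g) = (LBINT x. vdot (f x) (g x))"
  by (simp add: cinner_L2.abs_eq)

lemma cinner_rep_L2: "cinner f g = (LBINT x. vdot (rep_L2 f x) (rep_L2 g x))"
  using cinner_abs_L2[OF square_integrable_rep square_integrable_rep, of f g] by simp

lemma cinner_abs_L2_right:
  "square_integrable g \<Longrightarrow> cinner f (abs_L2 g) = (LBINT x. vdot (rep_L2 f x) (g x))"
  using cinner_abs_L2[OF square_integrable_rep, of g f] by simp

lemma vdot_scale_left: "vdot (c *s u) v = c * vdot u v"
  by (simp add: vdot_def sum_distrib_left mult.assoc flip: distrib_left)

lemma vdot_scale_right: "vdot u (c *s v) = cnj c * vdot u v"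
  by (simp add: vdot_def sum_distrib_left mult_ac flip: distrib_left)

lemma L2_tendsto_dominated_seq:
  fixes g :: "nat \<Rightarrow> real \<Rightarrow> complex^2"
  assumes g: "\<And>n. square_integrable (g n)" "square_integrable g0"
    and lim: "AE x in lborel. (\<lambda>n. g n x) \<longlonglongrightarrow> g0 x"
    and w: "integrable lborel (\<lambda>x. (w x)\<^sup>2)" "\<And>n. AE x in lborel. norm (g n x) \<le> w x"
  shows "(\<lambda>n. abs_L2 (g n)) \<longlonglongrightarrow> abs_L2 g0"
proof -
  have [measurable]: "g n \<in> borel_measurable borel" "g0 \<in> borel_measurable borel" for n
    using g by (auto simp: square_integrable_def)
  have sd: "square_integrable (\<lambda>x. g n x - g0 x)" for n by (intro square_integrable_diff g)
  have w': "AE x in lborel. \<forall>n. norm (g n x) \<le> w x" using w(2) by (simp add: AE_all_countable)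
  have "(\<lambda>n. \<integral>x. (norm (g n x - g0 x))\<^sup>2 \<partial>lborel) \<longlonglongrightarrow> (\<integral>x. 0 \<partial>(lborel::real measure))"
  \<comment> \<open>The limit inherits the bound \<open>w\<close>, so the difference is at most
    \<open>2 * w\<close> and its square at most four times the square of \<open>w\<close>.\<close>
  proof (rule integral_dominated_convergence[where w = "\<lambda>x. 4 * (w x)\<^sup>2"])
    show "AE x in lborel. (\<lambda>n. (norm (g n x - g0 x))\<^sup>2) \<longlonglongrightarrow> 0"
      using lim by eventually_elim (auto intro!: tendsto_eq_intros)
    show "AE x in lborel. norm ((norm (g n x - g0 x))\<^sup>2) \<le> 4 * (w x)\<^sup>2" for n
      using w' lim
    proof eventually_elim
      case (elim x)
      have "norm (g0 x) \<le> w x"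
        by (rule tendsto_upperbound[OF tendsto_norm[OF elim(2)]]) (use elim(1) in auto)
      then have "norm (g n x - g0 x) \<le> 2 * w x"
        using elim(1)[rule_format, of n] norm_triangle_ineq4[of "g n x" "g0 x"] by linarith
      then have "(norm (g n x - g0 x))\<^sup>2 \<le> (2 * w x)\<^sup>2" by (intro power_mono) auto
      then show ?case by (simp add: power_mult_distrib)
    qed
  qed (use w(1) in simp_all)
  then have "(\<lambda>n. (norm (abs_L2 (g n) - abs_L2 g0))\<^sup>2) \<longlonglongrightarrow> 0"
    by (simp add: abs_L2_minus g norm_abs_L2[OF sd])
  then have "(\<lambda>n. sqrt ((norm (abs_L2 (g n) - abs_L2 g0))\<^sup>2)) \<longlonglongrightarrow> sqrt 0" by (rule tendsto_real_sqrt)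
  then show ?thesis by (simp add: tendsto_norm_zero_iff LIM_zero_iff)
qed

lemma L2_tendsto_dominated_at:
  fixes g :: "real \<Rightarrow> real \<Rightarrow> complex^2"
  assumes g: "\<And>t. square_integrable (g t)" "square_integrable g0"
    and lim: "AE x in lborel. ((\<lambda>t. g t x) \<longlongrightarrow> g0 x) (at a)"
    and w: "integrable lborel (\<lambda>x. (w x)\<^sup>2)" "\<And>t. t \<noteq> a \<Longrightarrow> \<bar>t - a\<bar> < d \<Longrightarrow> AE x in lborel. norm (g t x) \<le> w x"
    and d: "d > 0"
  shows "((\<lambda>t. abs_L2 (g t)) \<longlongrightarrow> abs_L2 g0) (at a)"
  unfolding tendsto_at_iff_sequentially
proof (intro allI impI)
  fix X assume X: "\<forall>i. X i \<in> UNIV - {a}" "X \<longlonglongrightarrow> a"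
  obtain N where N: "\<And>n. n \<ge> N \<Longrightarrow> \<bar>X n - a\<bar> < d"
    using tendstoD[OF X(2) d] by (auto simp: eventually_sequentially dist_real_def)
  have "(\<lambda>n. abs_L2 (g (X (n + N)))) \<longlonglongrightarrow> abs_L2 g0"
  proof (rule L2_tendsto_dominated_seq[OF g(1) g(2) _ w(1)])
    show "AE x in lborel. (\<lambda>n. g (X (n + N)) x) \<longlonglongrightarrow> g0 x"
      using lim
    proof eventually_elim
      case (elim x)
      then have "(\<lambda>n. g (X n) x) \<longlonglongrightarrow> g0 x"
        unfolding tendsto_at_iff_sequentially using X by (auto simp: comp_def)
      then show ?case by (rule LIMSEQ_ignore_initial_segment)
    qed
    show "AE x in lborel. norm (g (X (n + N)) x) \<le> w x" for n
      using X(1) N by (intro w(2)) auto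
  qed
  then have "(\<lambda>n. abs_L2 (g (X n))) \<longlonglongrightarrow> abs_L2 g0" by (rule LIMSEQ_offset)
  then show "((\<lambda>t. abs_L2 (g t)) \<circ> X) \<longlonglongrightarrow> abs_L2 g0" by (simp add: comp_def)
qed

lemma L2_tendsto_dominated_at_top:
  fixes g :: "real \<Rightarrow> real \<Rightarrow> complex^2"
  assumes g: "\<And>t. square_integrable (g t)" "square_integrable g0"
    and lim: "AE x in lborel. ((\<lambda>t. g t x) \<longlongrightarrow> g0 x) at_top"
    and w: "integrable lborel (\<lambda>x. (w x)\<^sup>2)" "\<And>t. AE x in lborel. norm (g t x) \<le> w x"
  shows "((\<lambda>t. abs_L2 (g t)) \<longlongrightarrow> abs_L2 g0) at_top"
proof (rule tendsto_at_topI_sequentially)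
  fix X :: "nat \<Rightarrow> real" assume X: "filterlim X at_top sequentially"
  show "(\<lambda>n. abs_L2 (g (X n))) \<longlonglongrightarrow> abs_L2 g0"
  proof (rule L2_tendsto_dominated_seq[OF g(1) g(2) _ w(1) w(2)])
    show "AE x in lborel. (\<lambda>n. g (X n) x) \<longlonglongrightarrow> g0 x"
      using lim by eventually_elim (rule filterlim_compose[OF _ X])
  qed
qed

section \<open>Multiplication operators\<close>

text \<open>The bound is required at every point rather than almost everywhere, so sums and products
  of symbols need no bookkeeping of null sets.\<close>

definition bounded_symbol :: "(real \<Rightarrow> complex^2^2) \<Rightarrow> real \<Rightarrow> bool" where
  "bounded_symbol M K \<longleftrightarrow> (\<forall>i j. (\<lambda>x. M x $ i $ j) \<in> borel_measurable borel) \<and> (\<forall>x v. norm (M x *v v) \<le> K * norm v)"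

lemma measurable_matrix_vector:
  assumes "\<And>i j. (\<lambda>x. (M x :: complex^2^2) $ i $ j) \<in> borel_measurable borel" "f \<in> borel_measurable borel"
  shows "(\<lambda>x. M x *v f x) \<in> borel_measurable borel"
  unfolding borel_measurable_vec_iff matrix_vector_mult_def using assms by simp

lemma square_integrable_mult:
  assumes M: "bounded_symbol M K" and f: "square_integrable f"
  shows "square_integrable (\<lambda>x. M x *v f x)"
  using M f unfolding bounded_symbol_def
  by (intro square_integrable_bound[OF f, of _ K] measurable_matrix_vector)
    (auto simp: square_integrable_def)

lemma mult_op_abs:
  assumes M: "bounded_symbol M K" and f: "square_integrable f"
  shows "mult_op M (abs_L2 f) = abs_L2 (\<lambda>x. M x *v f x)"
  unfolding mult_op_def
  by (intro abs_L2_eqI square_integrable_mult[OF M] f square_integrable_rep) (use rep_abs_L2[OF f] in auto)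

lemma rep_mult_op:
  assumes M: "bounded_symbol M K"
  shows "AE x in lborel. rep_L2 (mult_op M f) x = M x *v rep_L2 f x"
  unfolding mult_op_def by (intro rep_abs_L2 square_integrable_mult[OF M] square_integrable_rep)

lemma mult_op_linear:
  assumes M: "bounded_symbol M K"
  shows "mult_op M (f + g) = mult_op M f + mult_op M g" "mult_op M (c *\<^sub>C f) = c *\<^sub>C mult_op M f"
    "norm (mult_op M f) \<le> K * norm f" "bounded_linear (mult_op M)"
proof -
  have add: "mult_op M (f + g) = mult_op M f + mult_op M g" for f g
    by (cases f; cases g) (simp add: abs_L2_add square_integrable_add mult_op_abs[OF M]
        square_integrable_mult[OF M] matrix_vector_right_distrib)
  then show "mult_op M (f + g) = mult_op M f + mult_op M g" .
  have sc: "mult_op M (c *\<^sub>C f) = c *\<^sub>C mult_op M f" for f c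
    by (cases f) (simp add: abs_L2_scaleC square_integrable_vscale mult_op_abs[OF M]
        square_integrable_mult[OF M] vector_scalar_commute)
  then show "mult_op M (c *\<^sub>C f) = c *\<^sub>C mult_op M f" .
  have bd: "norm (mult_op M f) \<le> K * norm f" for f
  proof (cases f)
    case (1 h)
    have "K \<ge> 0"
    proof -
      have "0 \<le> K * norm (axis 1 1 :: complex^2)"
        using M norm_ge_zero order_trans unfolding bounded_symbol_def by blast
      then show ?thesis by (simp add: norm_axis_complex)
    qed
    have "(norm (mult_op M f))\<^sup>2 = (LBINT x. (norm (M x *v h x))\<^sup>2)"
      using 1 by (simp add: mult_op_abs[OF M] norm_abs_L2 square_integrable_mult[OF M])
    also have "\<dots> \<le> (LBINT x. K\<^sup>2 * (norm (h x))\<^sup>2)"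
    proof (rule integral_mono)
      show "integrable lborel (\<lambda>x. (norm (M x *v h x))\<^sup>2)"
        using square_integrable_mult[OF M 1(1)] by (simp add: square_integrable_def)
      show "integrable lborel (\<lambda>x. K\<^sup>2 * (norm (h x))\<^sup>2)" using 1(1) by (simp add: square_integrable_def)
      show "(norm (M x *v h x))\<^sup>2 \<le> K\<^sup>2 * (norm (h x))\<^sup>2" for x
        unfolding power_mult_distrib[symmetric] using M
        by (intro power_mono) (auto simp: bounded_symbol_def)
    qed
    also have "\<dots> = (K * norm f)\<^sup>2" using 1 by (simp add: norm_abs_L2 power_mult_distrib)
    finally show ?thesis by (rule power2_le_imp_le) (use \<open>K \<ge> 0\<close> in simp)
  qed
  then show "norm (mult_op M f) \<le> K * norm f" .
  show "bounded_linear (mult_op M)"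
    by (rule bounded_linear_intro[of _ K]) (use add sc bd in \<open>auto simp: mult.commute simp flip: scaleC_of_real\<close>)
qed

lemma mult_op_mult_op:
  assumes M: "bounded_symbol M K" and N: "bounded_symbol N L"
  shows "mult_op M (mult_op N f) = mult_op (\<lambda>x. M x ** N x) f"
proof (cases f)
  case (1 h)
  have "mult_op M (mult_op N f) = abs_L2 (\<lambda>x. M x *v (N x *v h x))"
    using 1 by (simp add: mult_op_abs[OF M] mult_op_abs[OF N] square_integrable_mult[OF N])
  also have "\<dots> = mult_op (\<lambda>x. M x ** N x) f"
    unfolding mult_op_def
  proof (rule abs_L2_eqI)
    show sh: "square_integrable (\<lambda>x. M x *v (N x *v h x))"
      by (intro square_integrable_mult[OF M] square_integrable_mult[OF N] 1)
    show "AE x in lborel. M x *v (N x *v h x) = (M x ** N x) *v rep_L2 f x"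
      using rep_abs_L2[OF 1(1)] by eventually_elim (simp add: 1(2) matrix_vector_mul_assoc)
    then show "square_integrable (\<lambda>x. (M x ** N x) *v rep_L2 f x)"
    proof (intro square_integrable_cong_AE[OF sh] measurable_matrix_vector)
      show "(\<lambda>x. (M x ** N x) $ i $ j) \<in> borel_measurable borel" for i j
        using assms by (auto simp: matrix_matrix_mult_def bounded_symbol_def intro!: borel_measurable_sum borel_measurable_times)
    qed auto
  qed
  finally show ?thesis .
qed

lemma mult_op_one: "mult_op (\<lambda>x. mat 1) f = f"
  by (simp add: mult_op_def)

lemma mult_op_sum:
  assumes M: "bounded_symbol M K" and N: "bounded_symbol N L"
  shows "mult_op (\<lambda>x. M x + N x) f = mult_op M f + mult_op N f"
  by (cases f) (simp add: mult_op_def abs_L2_add square_integrable_mult[OF M] square_integrable_mult[OF N]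
      square_integrable_rep matrix_vector_mult_add_rdistrib)

lemma cinner_mult_op:
  assumes M: "bounded_symbol M K" and N: "bounded_symbol N L"
    and adj: "\<And>x u v. vdot (M x *v u) v = vdot u (N x *v v)"
  shows "cinner (mult_op M f) g = cinner f (mult_op N g)"
  by (cases f; cases g) (simp add: mult_op_abs[OF M] mult_op_abs[OF N] cinner_abs_L2
      square_integrable_mult[OF M] square_integrable_mult[OF N] adj)

lemma mat2_expand:
  "(A :: complex^2^2) *v v = vector [A$1$1 * v$1 + A$1$2 * v$2, A$2$1 * v$1 + A$2$2 * v$2]"
  by (simp add: vec_eq_iff forall_2 matrix_vector_mult_def sum_2)

lemma vdot_expand: "vdot u v = u$1 * cnj (v$1) + u$2 * cnj (v$2)"
  by (simp add: vdot_def sum_2)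

lemma norm_mat2_le:
  assumes "\<And>i j. cmod (A $ i $ j) \<le> B"
  shows "norm ((A :: complex^2^2) *v v) \<le> 4 * B * norm v"
proof -
  have B: "0 \<le> B" using assms norm_ge_zero order_trans by blast
  have "norm (A *v v) \<le> (\<Sum>i\<in>UNIV. cmod ((A *v v) $ i))" unfolding norm_vec_def by (rule L2_set_le_sum) simp
  also have "\<dots> \<le> (\<Sum>i\<in>(UNIV::2 set). 2 * B * norm v)"
  proof (rule sum_mono)
    fix i :: 2
    have "cmod (A $ i $ j * v $ j) \<le> B * norm v" for j
      unfolding norm_mult by (intro mult_mono assms B Finite_Cartesian_Product.norm_nth_le) simp
    from this[of 1] this[of 2] norm_triangle_ineq[of "A $ i $ 1 * v $ 1" "A $ i $ 2 * v $ 2"]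
    show "cmod ((A *v v) $ i) \<le> 2 * B * norm v" by (simp add: matrix_vector_mult_def sum_2)
  qed
  finally show ?thesis by simp
qed

section \<open>Test functions\<close>

text \<open>For \<open>i = j = 0\<close> this is the standard smooth function supported on
  \<open>[a, b]\<close>, with steepness \<open>c\<close>. The powers of the two reciprocals are
  exactly what differentiation produces, so the family is closed under derivatives up to linear
  combinations.\<close>

definition bump :: "real \<Rightarrow> nat \<Rightarrow> nat \<Rightarrow> real \<Rightarrow> real \<Rightarrow> real \<Rightarrow> real" where
  "bump c i j a b x = (if a < x \<and> x < b
     then (1 / (x - a)) ^ i * (1 / (b - x)) ^ j * exp (- c * (1 / (x - a) + 1 / (b - x))) else 0)"

text \<open>Being closed under differentiation, the span turns smoothness of all orders into a
  single induction; it also absorbs the translated differences used for weak derivatives.\<close>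

inductive_set bump_span :: "(real \<Rightarrow> real) set" where
  bump: "a < b \<Longrightarrow> c > 0 \<Longrightarrow> bump c i j a b \<in> bump_span"
| add: "f \<in> bump_span \<Longrightarrow> g \<in> bump_span \<Longrightarrow> (\<lambda>x. f x + g x) \<in> bump_span"
| scale: "f \<in> bump_span \<Longrightarrow> (\<lambda>x. k * f x) \<in> bump_span"

text \<open>A single term of the exponential series is bounded by its sum.\<close>

lemma power_mult_exp_le:
  fixes t c :: real
  assumes "t \<ge> 0" "c > 0"
  shows "t ^ n * exp (- c * t) \<le> fact n / c ^ n"
proof -
  have "sum (\<lambda>k. (c * t) ^ k /\<^sub>R fact k) {n} \<le> exp (c * t)"
    unfolding exp_def
    using sum_le_suminf[of "\<lambda>k. (c * t) ^ k /\<^sub>R fact k" "{n}"] summable_exp_generic[of "c * t"] assms by auto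
  then have "(c * t) ^ n \<le> fact n * exp (c * t)" by (simp add: field_simps)
  then show ?thesis using assms by (simp add: exp_minus power_mult_distrib field_simps)
qed

text \<open>Serves the two endpoints of the support of a bump, where the defining formula
  changes.\<close>

lemma has_derivative_zero_if_quadratic_bound:
  fixes f :: "real \<Rightarrow> real"
  assumes "\<And>x. \<bar>f x\<bar> \<le> K * (x - a)\<^sup>2"
  shows "(f has_real_derivative 0) (at a)"
proof -
  have f0: "f a = 0" using assms[of a] by simp
  have "((\<lambda>h. (f (a + h) - f a) / h) \<longlongrightarrow> 0) (at 0)"
  proof (rule Lim_null_comparison)
    show "\<forall>\<^sub>F h in at 0. norm ((f (a + h) - f a) / h) \<le> K * \<bar>h\<bar>"
      unfolding eventually_at_filter
    proof (intro always_eventually allI impI)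
      fix h :: real assume "h \<noteq> 0"
      then have "\<bar>f (a + h)\<bar> / \<bar>h\<bar> \<le> (K * h\<^sup>2) / \<bar>h\<bar>" using assms[of "a + h"] by (intro divide_right_mono) auto
      then show "norm ((f (a + h) - f a) / h) \<le> K * \<bar>h\<bar>"
        using \<open>h \<noteq> 0\<close> by (simp add: f0 power2_eq_square abs_mult_self_eq[of h, symmetric] del: abs_mult_self_eq)
    qed
    show "((\<lambda>h. K * \<bar>h\<bar>) \<longlongrightarrow> 0) (at 0)" by (auto intro!: tendsto_eq_intros)
  qed
  then show ?thesis by (simp add: DERIV_def)
qed

text \<open>Writing the square of \<open>x - a\<close> as the inverse square of its reciprocal
  raises the exponent \<open>i\<close> by 2, and the exponential dominates every power; likewise at
  \<open>b\<close>.\<close>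

lemma bump_quadratic_bound:
  assumes c: "c > 0"
  shows "\<exists>K\<ge>0. \<forall>x. \<bar>bump c i j a b x\<bar> \<le> K * (x - a)\<^sup>2 \<and> \<bar>bump c i j a b x\<bar> \<le> K * (x - b)\<^sup>2"
proof -
  let ?B = "\<lambda>n. fact n / c ^ n"
  \<comment> \<open>One summand per endpoint: exponents \<open>i + 2\<close>, \<open>j\<close> for
    the factor at \<open>a\<close> and \<open>i\<close>, \<open>j + 2\<close> for the factor at
    \<open>b\<close>.\<close>
  define K where "K = ?B (i + 2) * ?B j + ?B i * ?B (j + 2)"
  have B0: "0 \<le> ?B n" for n using c by simp
  have "\<bar>bump c i j a b x\<bar> \<le> K * (x - a)\<^sup>2 \<and> \<bar>bump c i j a b x\<bar> \<le> K * (x - b)\<^sup>2" for x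
  proof (cases "a < x \<and> x < b")
    case True
    define u v where "u = 1 / (x - a)" and "v = 1 / (b - x)"
    have uv: "u > 0" "v > 0" "u * (x - a) = 1" "v * (b - x) = 1" using True by (auto simp: u_def v_def)
    have bump: "bump c i j a b x = (u ^ i * exp (- c * u)) * (v ^ j * exp (- c * v))"
      using True by (simp add: bump_def u_def v_def exp_add[symmetric] algebra_simps)
    have "(u ^ (i + 2) * exp (- c * u)) * (v ^ j * exp (- c * v)) \<le> ?B (i + 2) * ?B j"
      using c uv by (intro mult_mono power_mult_exp_le B0) auto
    then have "(u ^ (i + 2) * exp (- c * u)) * (v ^ j * exp (- c * v)) \<le> K"
      unfolding K_def using mult_nonneg_nonneg[OF B0[of i] B0[of "j + 2"]] by linarith
    then have "(u ^ (i + 2) * exp (- c * u)) * (v ^ j * exp (- c * v)) * (x - a)\<^sup>2 \<le> K * (x - a)\<^sup>2"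
      by (rule mult_right_mono) simp
    moreover have "(u ^ (i + 2) * exp (- c * u)) * (v ^ j * exp (- c * v)) * (x - a)\<^sup>2
        = (u * (x - a))\<^sup>2 * bump c i j a b x"
      unfolding bump by (simp add: power_add power_mult_distrib mult_ac power2_eq_square)
    moreover have "(u ^ i * exp (- c * u)) * (v ^ (j + 2) * exp (- c * v)) \<le> ?B i * ?B (j + 2)"
      using c uv by (intro mult_mono power_mult_exp_le B0) auto
    then have "(u ^ i * exp (- c * u)) * (v ^ (j + 2) * exp (- c * v)) \<le> K"
      unfolding K_def using mult_nonneg_nonneg[OF B0[of "i + 2"] B0[of j]] by linarith
    then have "(u ^ i * exp (- c * u)) * (v ^ (j + 2) * exp (- c * v)) * (b - x)\<^sup>2 \<le> K * (b - x)\<^sup>2"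
      by (rule mult_right_mono) simp
    moreover have "(u ^ i * exp (- c * u)) * (v ^ (j + 2) * exp (- c * v)) * (b - x)\<^sup>2
        = (v * (b - x))\<^sup>2 * bump c i j a b x"
      unfolding bump by (simp add: power_add power_mult_distrib mult_ac power2_eq_square)
    moreover have "bump c i j a b x \<ge> 0" unfolding bump using uv by simp
    ultimately show ?thesis using uv by (simp add: power2_commute)
  next
    case False
    have "K \<ge> 0" unfolding K_def by (intro add_nonneg_nonneg mult_nonneg_nonneg B0)
    then show ?thesis using False by (auto simp: bump_def)
  qed
  moreover have "K \<ge> 0" unfolding K_def by (intro add_nonneg_nonneg mult_nonneg_nonneg B0)
  ultimately show ?thesis by blast
qed

text \<open>The first pair of terms comes from the powers, the second from the exponential. The
  result is written as binary sums of scalar multiples so that the closure rules of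
  \<open>bump_span\<close> apply literally.\<close>

lemma DERIV_bump:
  assumes ab: "a < b" and c: "c > 0"
  shows "(bump c i j a b has_real_derivative
    (- real i * bump c (i + 1) j a b x + real j * bump c i (j + 1) a b x)
    + (c * bump c (i + 2) j a b x + - c * bump c i (j + 2) a b x)) (at x)"
proof -
  have bz: "bump c i j a b x = 0" if "\<not> (a < x \<and> x < b)" for i j x using that by (auto simp: bump_def)
  consider "x = a" | "x = b" | "a < x \<and> x < b" | "x < a" | "b < x" by linarith
  then show ?thesis
  proof cases
    case 1
    obtain K where K: "\<And>x. \<bar>bump c i j a b x\<bar> \<le> K * (x - a)\<^sup>2" using bump_quadratic_bound[OF c] by blast
    have "(bump c i j a b has_real_derivative 0) (at a)" by (rule has_derivative_zero_if_quadratic_bound[OF K])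
    then show ?thesis using 1 by (simp add: bz)
  next
    case 2
    obtain K where K: "\<And>x. \<bar>bump c i j a b x\<bar> \<le> K * (x - b)\<^sup>2" using bump_quadratic_bound[OF c] by blast
    have "(bump c i j a b has_real_derivative 0) (at b)" by (rule has_derivative_zero_if_quadratic_bound[OF K])
    then show ?thesis using 2 by (simp add: bz)
  next
    case 3
    define u v where "u x = 1 / (x - a)" and "v x = 1 / (b - x)" for x
    have du: "(u has_real_derivative - ((u x)\<^sup>2)) (at x)"
      unfolding u_def using 3 by (auto intro!: derivative_eq_intros simp: power2_eq_square)
    have dv: "(v has_real_derivative (v x)\<^sup>2) (at x)"
      unfolding v_def using 3 by (auto intro!: derivative_eq_intros simp: power2_eq_square)
    have dui: "((\<lambda>x. u x ^ i) has_real_derivative - real i * u x ^ (i + 1)) (at x)" for i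
    proof (induction i)
      case (Suc i)
      from DERIV_mult[OF du Suc] show ?case by (simp add: power2_eq_square algebra_simps)
    qed auto
    have dvj: "((\<lambda>x. v x ^ j) has_real_derivative real j * v x ^ (j + 1)) (at x)" for j
    proof (induction j)
      case (Suc j)
      from DERIV_mult[OF dv Suc] show ?case by (simp add: power2_eq_square algebra_simps)
    qed auto
    have dE: "((\<lambda>x. exp (- c * (u x + v x))) has_real_derivative
        exp (- c * (u x + v x)) * (- c * (- ((u x)\<^sup>2) + (v x)\<^sup>2))) (at x)"
      by (intro DERIV_fun_exp DERIV_cmult DERIV_add du dv)
    let ?F = "\<lambda>x. u x ^ i * v x ^ j * exp (- c * (u x + v x))"
    have "(?F has_real_derivative (- real i * bump c (i + 1) j a b x + real j * bump c i (j + 1) a b x)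
      + (c * bump c (i + 2) j a b x + - c * bump c i (j + 2) a b x)) (at x)"
      using DERIV_mult[OF DERIV_mult[OF dui[of i] dvj[of j]] dE] 3
      by (simp add: bump_def flip: u_def v_def) (simp add: algebra_simps power2_eq_square)
    then show ?thesis
      by (rule DERIV_cong_ev[THEN iffD1, rotated -1])
        (use 3 eventually_nhds_in_open[of "{a<..<b}" x] in \<open>auto elim!: eventually_mono simp: bump_def u_def v_def\<close>)
  next
    case 4
    have "((\<lambda>x. 0) has_real_derivative 0) (at x)" by simp
    then have "(bump c i j a b has_real_derivative 0) (at x)"
      by (rule DERIV_cong_ev[THEN iffD1, rotated -1])
        (use 4 eventually_nhds_in_open[of "{..<a}" x] in \<open>auto elim!: eventually_mono simp: bump_def\<close>)
    then show ?thesis using 4 by (simp add: bz)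
  next
    case 5
    have "((\<lambda>x. 0) has_real_derivative 0) (at x)" by simp
    then have "(bump c i j a b has_real_derivative 0) (at x)"
      by (rule DERIV_cong_ev[THEN iffD1, rotated -1])
        (use 5 eventually_nhds_in_open[of "{b<..}" x] in \<open>auto elim!: eventually_mono simp: bump_def\<close>)
    then show ?thesis using 5 ab by (simp add: bz)
  qed
qed

lemma bump_span_DERIV:
  "f \<in> bump_span \<Longrightarrow> \<exists>g\<in>bump_span. \<forall>x. (f has_real_derivative g x) (at x)"
proof (induction rule: bump_span.induct)
  case (bump a b c i j)
  show ?case
    using DERIV_bump[OF bump, of i j]
    by (intro bexI[of _ "\<lambda>x. (- real i * bump c (i + 1) j a b x + real j * bump c i (j + 1) a b x)
      + (c * bump c (i + 2) j a b x + - c * bump c i (j + 2) a b x)"] allI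
        bump_span.add bump_span.scale bump_span.bump bump)
next
  case (add f g)
  then obtain f' g' where "f' \<in> bump_span" "g' \<in> bump_span"
    "\<And>x. (f has_real_derivative f' x) (at x)" "\<And>x. (g has_real_derivative g' x) (at x)" by blast
  then show ?case
    by (intro bexI[of _ "\<lambda>x. f' x + g' x"] allI DERIV_add bump_span.add)
next
  case (scale f k)
  then obtain f' where "f' \<in> bump_span" "\<And>x. (f has_real_derivative f' x) (at x)" by blast
  then show ?case
    by (intro bexI[of _ "\<lambda>x. k * f' x"] allI DERIV_cmult bump_span.scale)
qed

lemma bump_span_support:
  "f \<in> bump_span \<Longrightarrow> \<exists>R. \<forall>x. \<bar>x\<bar> > R \<longrightarrow> f x = 0"
proof (induction rule: bump_span.induct)
  case (bump a b c i j)
  show ?case by (rule exI[of _ "\<bar>a\<bar> + \<bar>b\<bar>"]) (auto simp: bump_def)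
next
  case (add f g)
  then obtain R S where "\<forall>x. \<bar>x\<bar> > R \<longrightarrow> f x = 0" "\<forall>x. \<bar>x\<bar> > S \<longrightarrow> g x = 0" by blast
  then show ?case by (intro exI[of _ "max R S"]) auto
next
  case (scale f k)
  then show ?case by auto
qed

lemma bump_span_translate: "f \<in> bump_span \<Longrightarrow> (\<lambda>x. f (x - h)) \<in> bump_span"
proof (induction rule: bump_span.induct)
  case (bump a b c i j)
  have "(\<lambda>x. bump c i j a b (x - h)) = bump c i j (a + h) (b + h)"
    by (auto simp: bump_def fun_eq_iff algebra_simps)
  then show ?case using bump by (auto intro: bump_span.bump)
qed (auto intro: bump_span.add bump_span.scale)

lemma bump_span_funpow_deriv: "f \<in> bump_span \<Longrightarrow> (deriv ^^ n) f \<in> bump_span"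
proof (induction n)
  case (Suc n)
  then obtain g where g: "g \<in> bump_span" "\<And>x. ((deriv ^^ n) f has_real_derivative g x) (at x)"
    using bump_span_DERIV by blast
  then have "deriv ((deriv ^^ n) f) = g" by (intro ext DERIV_imp_deriv)
  then show ?case using g by simp
qed simp

lemma bump_span_test_function: "f \<in> bump_span \<Longrightarrow> test_function f"
  unfolding test_function_def
  using bump_span_funpow_deriv[THEN bump_span_DERIV] bump_span_support real_differentiable_def by blast

text \<open>Weaker than \<open>test_function\<close>: continuity is enough for integrability, and
  the notion covers a test function and its derivative alike.\<close>

definition compactly_supported :: "(real \<Rightarrow> real) \<Rightarrow> bool" where
  "compactly_supported f \<longleftrightarrow> continuous_on UNIV f \<and> (\<exists>R. \<forall>x. \<bar>x\<bar> > R \<longrightarrow> f x = 0)"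

lemma test_function_facts:
  assumes f: "test_function f"
  shows "(f has_real_derivative deriv f x) (at x)" "compactly_supported f" "compactly_supported (deriv f)"
proof -
  have d: "(deriv ^^ n) f differentiable (at x)" for n x using f by (simp add: test_function_def)
  have df: "(f has_real_derivative deriv f x) (at x)" for x
    using d[of 0 x] by (simp add: DERIV_deriv_iff_real_differentiable)
  then show "(f has_real_derivative deriv f x) (at x)" .
  obtain R where R: "\<And>x. \<bar>x\<bar> > R \<Longrightarrow> f x = 0" using f by (auto simp: test_function_def)
  have R': "deriv f x = 0" if "\<bar>x\<bar> > R" for x
  proof -
    have "open {x::real. \<bar>x\<bar> > R}" by (intro open_Collect_less continuous_intros)
    from eventually_nhds_in_open[OF this] that
    have "\<forall>\<^sub>F y in nhds x. R < \<bar>y\<bar>" by auto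
    then have "\<forall>\<^sub>F y in nhds x. f y = 0" by (rule eventually_mono) (rule R)
    then have "(f has_real_derivative 0) (at x)"
      by (subst DERIV_cong_ev[OF refl _ refl, of f "\<lambda>_. 0"]) auto
    then show ?thesis by (rule DERIV_imp_deriv)
  qed
  show "compactly_supported f"
    unfolding compactly_supported_def using R
    by (auto intro!: exI[of _ R] continuous_at_imp_continuous_on DERIV_isCont[OF df])
  show "compactly_supported (deriv f)"
    unfolding compactly_supported_def using R' d[of 1]
    by (auto intro!: exI[of _ R] continuous_at_imp_continuous_on dest: differentiable_imp_continuous_within)
qed

lemma compactly_supported_bounded:
  assumes "compactly_supported f"
  shows "\<exists>B\<ge>0. \<exists>R\<ge>0. \<forall>x. \<bar>f x\<bar> \<le> B * indicator {-R..R} x"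
proof -
  obtain R0 where R0: "\<And>x. \<bar>x\<bar> > R0 \<Longrightarrow> f x = 0" using assms by (auto simp: compactly_supported_def)
  define R where "R = max R0 0"
  have "compact (f ` {-R..R})"
    using assms by (intro compact_continuous_image) (auto simp: compactly_supported_def intro: continuous_on_subset)
  then obtain B where B: "\<And>x. x \<in> {-R..R} \<Longrightarrow> \<bar>f x\<bar> \<le> B"
    using compact_imp_bounded bounded_iff by (metis imageI real_norm_def)
  have "B \<ge> 0" using B[of 0] by (auto simp: R_def intro: order_trans[OF abs_ge_zero])
  have "\<bar>f x\<bar> \<le> B * indicator {-R..R} x" for x
  proof (cases "x \<in> {-R..R}")
    case False
    then have "\<bar>x\<bar> > R0" by (auto simp: R_def)
    then show ?thesis using R0[of x] \<open>B \<ge> 0\<close> by simp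
  qed (use B[of x] in simp)
  then show ?thesis using \<open>B \<ge> 0\<close> by (intro exI[of _ B] conjI exI[of _ R]) (auto simp: R_def)
qed

lemma compactly_supported_measurable: "compactly_supported f \<Longrightarrow> f \<in> borel_measurable borel"
  by (auto simp: compactly_supported_def intro: borel_measurable_continuous_onI)

lemma compactly_supported_integrable:
  assumes "compactly_supported f"
  shows "integrable lborel f" "integrable lborel (\<lambda>x. (f x)\<^sup>2)"
proof -
  note [measurable] = compactly_supported_measurable[OF assms]
  obtain B R where BR: "B \<ge> 0" "R \<ge> 0" "\<And>x. \<bar>f x\<bar> \<le> B * indicator {-R..R} x"
    using compactly_supported_bounded[OF assms] by blast
  have i: "integrable lborel (\<lambda>x. k * indicator {-R..R} x :: real)" for k
    by (intro integrable_mult_right) (simp add: BR)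
  show "integrable lborel f"
    by (rule integrable_dominated[OF i[of B]]) (use BR in auto)
  show "integrable lborel (\<lambda>x. (f x)\<^sup>2)"
  proof (rule integrable_dominated[OF i[of "B\<^sup>2"]])
    show "AE x in lborel. norm ((f x)\<^sup>2) \<le> norm (B\<^sup>2 * indicator {-R..R} x :: real)"
    proof (rule AE_I2)
      fix x
      show "norm ((f x)\<^sup>2) \<le> norm (B\<^sup>2 * indicator {-R..R} x :: real)"
        using power_mono[OF BR(3)[of x], of 2] by (cases "x \<in> {-R..R}") (auto simp: indicator_def)
    qed
  qed simp
qed

section \<open>Totality of the vector-valued test functions\<close>

definition vtest :: "(real \<Rightarrow> real) \<Rightarrow> 2 \<Rightarrow> L2" where
  "vtest \<phi> j = abs_L2 (\<lambda>x. \<phi> x *\<^sub>R axis j 1)"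

lemma square_integrable_vtest:
  assumes "compactly_supported \<phi>"
  shows "square_integrable (\<lambda>x. \<phi> x *\<^sub>R axis j (1::complex))"
proof -
  note [measurable] = compactly_supported_measurable[OF assms]
  show ?thesis
    using compactly_supported_integrable(2)[OF assms]
    by (auto simp: square_integrable_def norm_axis_complex power_mult_distrib)
qed

lemma vdot_axis: "vdot u (r *\<^sub>R axis j 1) = r *\<^sub>R (u $ j)"
  using exhaust_2[of j] unfolding vdot_expand vector_scaleR_component
  by (auto simp: axis_def)

lemma cinner_vtest:
  assumes "compactly_supported \<phi>"
  shows "cinner f (vtest \<phi> j) = (LBINT x. \<phi> x *\<^sub>R (rep_L2 f x $ j))"
  unfolding vtest_def by (simp add: cinner_abs_L2_right square_integrable_vtest[OF assms] vdot_axis)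

lemma integrable_vec_iff:
  fixes F :: "'a \<Rightarrow> complex^2"
  shows "integrable M F \<longleftrightarrow> (\<forall>i. integrable M (\<lambda>x. F x $ i))"
proof
  assume F: "\<forall>i. integrable M (\<lambda>x. F x $ i)"
  have bl: "bounded_linear (\<lambda>c::complex. axis i c :: complex^2)" for i
    by (rule bounded_linear_intro[of _ 1]) (auto simp: norm_axis_complex, auto simp: axis_def vec_eq_iff)
  have "F = (\<lambda>x. \<Sum>i\<in>UNIV. axis i (F x $ i))"
    by (auto simp: fun_eq_iff vec_eq_iff axis_def if_distrib cong: if_cong)
  moreover have "integrable M (\<lambda>x. \<Sum>i\<in>UNIV. axis i (F x $ i) :: complex^2)"
    by (intro Bochner_Integration.integrable_sum integrable_bounded_linear[OF bl]) (use F in auto)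
  ultimately show "integrable M F" by simp
qed (auto intro: integrable_bounded_linear[OF bounded_linear_vec_nth])

lemma integral_vec_nth:
  fixes F :: "'a \<Rightarrow> complex^2"
  assumes "integrable M F"
  shows "integral\<^sup>L M F $ i = (\<integral>x. F x $ i \<partial>M)"
  by (rule integral_bounded_linear[OF bounded_linear_vec_nth assms, symmetric])

lemma integrable_compactly_supported_mult:
  assumes "compactly_supported \<phi>" "square_integrable f"
  shows "integrable lborel (\<lambda>x. \<phi> x *\<^sub>R f x)"
  unfolding integrable_vec_iff
  using integrable_vdot[OF assms(2) square_integrable_vtest[OF assms(1)]] by (simp add: vdot_axis)

text \<open>Only intervals off the origin are tested, because wave packets have such momentum
  support. Inside one interval the half-lines form an intersection-stable generator, so vanishing
  integrals spread to all Borel sets.\<close>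

lemma AE_zero_if_interval_integrals_zero:
  fixes g :: "real \<Rightarrow> complex"
  assumes [measurable]: "g \<in> borel_measurable borel"
    and int: "\<And>a b. a < b \<Longrightarrow> 0 < a \<or> b < 0 \<Longrightarrow> set_integrable lborel {a<..<b} g"
    and zero: "\<And>a b. a < b \<Longrightarrow> 0 < a \<or> b < 0 \<Longrightarrow> (LINT x:{a<..<b}|lborel. g x) = 0"
  shows "AE x in lborel. g x = 0"
proof -
  have loc: "AE x in lborel. x \<in> {c<..<d} \<longrightarrow> g x = 0" if cd: "c < d" "0 < c \<or> d < 0" for c d
  proof -
    define h where "h x = indicat_real {c<..<d} x *\<^sub>R g x" for x
    have h: "integrable lborel h" using int[OF cd] unfolding set_integrable_def h_def[abs_def] .
    have hs: "set_integrable lborel A h" if "A \<in> sets borel" for A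
      unfolding set_integrable_def using that h by (intro integrable_mult_indicator) auto
    have "set_lebesgue_integral lborel A h = 0" if A: "A \<in> sets lborel" for A
    proof -
      have sb: "sets borel = sigma_sets UNIV (range lessThan :: real set set)"
        by (subst borel_Iio) (simp add: sets_measure_of)
      have "A \<in> sigma_sets UNIV (range lessThan)" using A sb by simp
      note A' = this
      have I: "Int_stable (range (lessThan :: real \<Rightarrow> _))"
      proof (rule Int_stableI)
        fix a b assume "a \<in> range (lessThan :: real \<Rightarrow> _)" "b \<in> range (lessThan :: real \<Rightarrow> _)"
        then obtain x y where "a = {..<x}" "b = {..<y}" by auto
        then have "a \<inter> b = {..<min x y}" by auto
        then show "a \<inter> b \<in> range lessThan" by blast
      qed
      have "range (lessThan :: real \<Rightarrow> _) \<subseteq> Pow UNIV" by simp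
      from I this A' show ?thesis
      proof (induction rule: sigma_sets_induct_disjoint)
        case (basic A)
        then obtain y where A: "A = {..<y}" by auto
        have "(LINT x:A|lborel. h x) = (LINT x:{c<..<min y d}|lborel. g x)"
          unfolding set_lebesgue_integral_def A h_def
          by (intro Bochner_Integration.integral_cong) (auto simp: indicator_def)
        also have "\<dots> = 0"
        proof (cases "c < min y d")
          case True
          then show ?thesis using cd by (intro zero) auto
        next
          case False
          then have e: "{c<..<min y d} = {}" by auto
          show ?thesis unfolding e by (simp add: set_lebesgue_integral_def)
        qed
        finally show ?case .
      next
        case empty show ?case by (simp add: set_lebesgue_integral_def)
      next
        case (compl A)
        have A: "A \<in> sets borel" using compl(1) sb by simp
        have "(LINT x|lborel. h x) = (LINT x:{c<..<d}|lborel. g x)"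
          by (simp add: set_lebesgue_integral_def h_def)
        then have "(LINT x|lborel. h x) = 0" using zero[OF cd] by simp
        moreover have "(LINT x:UNIV - A|lborel. h x) = (LINT x|lborel. h x - indicat_real A x *\<^sub>R h x)"
          unfolding set_lebesgue_integral_def
          by (rule Bochner_Integration.integral_cong) (auto simp: indicator_def)
        moreover have "\<dots> = (LINT x|lborel. h x) - (LINT x:A|lborel. h x)"
          unfolding set_lebesgue_integral_def
          by (rule Bochner_Integration.integral_diff[OF h hs[OF A, unfolded set_integrable_def]])
        ultimately show ?case using compl by simp
      next
        case (union A)
        have A: "A i \<in> sets borel" for i
          using union(2) sb by auto
        have "(LINT x:(\<Union>i. A i)|lborel. h x) = (\<Sum>i. (LINT x:(A i)|lborel. h x))"
          using union(1) A by (intro lebesgue_integral_countable_add hs) (auto simp: disjoint_family_on_def)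
        then show ?case using union by simp
      qed
    qed
    then have "AE x in lborel. h x = 0" by (rule sigma_finite_measure.density_zero[OF sigma_finite_lborel h])
    then show ?thesis by eventually_elim (auto simp: h_def indicator_def)
  qed
  \<comment> \<open>Countably many intervals exhaust the two open half-lines; the origin itself is a
    null set.\<close>
  have "AE x in lborel. \<forall>n::nat. (x \<in> {1 / (n + 1)<..<n + 2} \<longrightarrow> g x = 0) \<and> (x \<in> {- real (n + 2)<..<- (1 / (n + 1))} \<longrightarrow> g x = 0)"
    unfolding AE_all_countable
  proof
    fix n :: nat
    have "1 / (real n + 1) \<le> 1" by simp
    then have "1 / (real n + 1) < real n + 2" by linarith
    then show "AE x in lborel. (x \<in> {1 / (n + 1)<..<n + 2} \<longrightarrow> g x = 0) \<and> (x \<in> {- real (n + 2)<..<- (1 / (n + 1))} \<longrightarrow> g x = 0)"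
      by (intro AE_conjI loc) (auto simp: add.commute)
  qed
  moreover have "AE x in lborel. x \<noteq> (0::real)" by (rule AE_lborel_singleton)
  ultimately show ?thesis
  proof eventually_elim
    case (elim x)
    obtain n1 :: nat where n1: "\<bar>x\<bar> < n1" using reals_Archimedean2 by blast
    obtain n2 :: nat where n2: "1 / (real n2 + 1) < \<bar>x\<bar>"
      using reals_Archimedean[of "\<bar>x\<bar>"] elim(2) by (auto simp: inverse_eq_divide add.commute)
    define n where "n = max n1 n2"
    have "1 / (real n + 1) \<le> 1 / (real n2 + 1)" by (intro divide_left_mono) (auto simp: n_def)
    then have "1 / (real n + 1) < \<bar>x\<bar>" "\<bar>x\<bar> < real n + 2" using n1 n2 by (auto simp: n_def)
    then show "g x = 0" using elim(1)[rule_format, of n] by (cases "x > 0") (auto simp: add.commute)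
  qed
qed

text \<open>As the steepness \<open>c\<close> tends to 0 the bumps converge to the indicator of the
  interval, so orthogonality to bumps gives vanishing interval integrals of each component. This is
  why \<open>c\<close> is a parameter.\<close>

theorem L2_total:
  assumes "\<And>a b c j. a < b \<Longrightarrow> 0 < a \<or> b < 0 \<Longrightarrow> c > 0 \<Longrightarrow> cinner f (vtest (bump c 0 0 a b) j) = 0"
  shows "f = 0"
proof -
  have "AE x in lborel. rep_L2 f x $ j = 0" for j
  proof (rule AE_zero_if_interval_integrals_zero)
    show "(\<lambda>x. rep_L2 f x $ j) \<in> borel_measurable borel" by measurable
    fix a b :: real assume ab: "a < b" "0 < a \<or> b < 0"
    have "integrable lborel (\<lambda>x. (norm (rep_L2 f x))\<^sup>2 + indicator {a<..<b} x)"
      using square_integrable_rep[of f] ab by (auto simp: square_integrable_def)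
    then show int: "set_integrable lborel {a<..<b} (\<lambda>x. rep_L2 f x $ j)"
      unfolding set_integrable_def
    proof (rule integrable_dominated)
      have "cmod (v $ j) \<le> (norm v)\<^sup>2 + 1" for v :: "complex^2"
      proof -
        have "cmod (v $ j) \<le> norm v" by (rule Finite_Cartesian_Product.norm_nth_le)
        moreover have "2 * norm v \<le> (norm v)\<^sup>2 + 1" using sum_squares_bound[of "norm v" 1] by simp
        moreover have "0 \<le> norm v" by simp
        ultimately show ?thesis by linarith
      qed
      then show "AE x in lborel. norm (indicat_real {a<..<b} x *\<^sub>R rep_L2 f x $ j)
          \<le> norm ((norm (rep_L2 f x))\<^sup>2 + indicat_real {a<..<b} x)"
        by (auto simp: indicator_def)
    qed measurable
    have "(\<lambda>n. \<integral>x. bump (1 / (real n + 1)) 0 0 a b x *\<^sub>R (rep_L2 f x $ j) \<partial>lborel)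
        \<longlonglongrightarrow> (LBINT x. indicat_real {a<..<b} x *\<^sub>R (rep_L2 f x $ j))"
    proof (rule integral_dominated_convergence[where w = "\<lambda>x. norm (indicat_real {a<..<b} x *\<^sub>R (rep_L2 f x $ j))"])
      show "integrable lborel (\<lambda>x. norm (indicat_real {a<..<b} x *\<^sub>R (rep_L2 f x $ j)))"
        using int by (simp only: set_integrable_def) (rule integrable_norm)
      have "(\<lambda>n. bump (1 / (real n + 1)) 0 0 a b x) \<longlonglongrightarrow> indicat_real {a<..<b} x" for x
      proof (cases "a < x \<and> x < b")
        case True
        define k where "k = 1 / (x - a) + 1 / (b - x)"
        have "(\<lambda>n. exp (- (1 / (real n + 1)) * k)) \<longlonglongrightarrow> exp (- 0 * k)"
          using LIMSEQ_inverse_real_of_nat by (intro tendsto_intros) (simp add: inverse_eq_divide add.commute)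
        then show ?thesis using True by (simp add: bump_def k_def)
      qed (auto simp: bump_def)
      then show "AE x in lborel. (\<lambda>n. bump (1 / (real n + 1)) 0 0 a b x *\<^sub>R (rep_L2 f x $ j))
          \<longlonglongrightarrow> indicat_real {a<..<b} x *\<^sub>R (rep_L2 f x $ j)"
        by (intro AE_I2 tendsto_intros)
      have "\<bar>bump c 0 0 a b x\<bar> \<le> indicat_real {a<..<b} x" if "c > 0" for c x
        using that by (auto simp: bump_def add_nonneg_nonneg)
      then show "AE x in lborel. norm (bump (1 / (real n + 1)) 0 0 a b x *\<^sub>R (rep_L2 f x $ j))
          \<le> norm (indicat_real {a<..<b} x *\<^sub>R (rep_L2 f x $ j))" for n
        by (intro AE_I2) (auto intro!: mult_right_mono)
      show "(\<lambda>x. bump (1 / (real n + 1)) 0 0 a b x *\<^sub>R (rep_L2 f x $ j)) \<in> borel_measurable lborel" for n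
        unfolding bump_def by measurable
    qed measurable
    moreover have "(LBINT x. bump c 0 0 a b x *\<^sub>R (rep_L2 f x $ j)) = 0" if "c > 0" for c
    proof -
      have "compactly_supported (bump c 0 0 a b)"
        using ab that by (intro test_function_facts(2) bump_span_test_function bump_span.bump)
      from cinner_vtest[OF this, of f j] assms[OF ab that] show ?thesis by simp
    qed
    ultimately have "(\<lambda>n::nat. 0::complex) \<longlonglongrightarrow> (LBINT x. indicat_real {a<..<b} x *\<^sub>R (rep_L2 f x $ j))"
      by simp
    then show "(LINT x:{a<..<b}|lborel. rep_L2 f x $ j) = 0"
      unfolding set_lebesgue_integral_def using LIMSEQ_unique tendsto_const by metis
  qed
  from this[of 1] this[of 2] have "AE x in lborel. rep_L2 f x = 0"
    by eventually_elim (simp add: vec_eq_iff forall_2)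
  then have "abs_L2 (rep_L2 f) = abs_L2 (\<lambda>x. 0)"
    by (intro abs_L2_eqI square_integrable_rep square_integrable_0)
  then show ?thesis by (simp add: zero_L2.abs_eq)
qed

section \<open>Translations\<close>

definition trans :: "real \<Rightarrow> L2 \<Rightarrow> L2" where
  "trans y f = abs_L2 (\<lambda>x. rep_L2 f (x - y))"

lemma square_integrable_translate:
  assumes "square_integrable f"
  shows "square_integrable (\<lambda>x. f (x - y))"
proof -
  have [measurable]: "f \<in> borel_measurable borel" using assms by (simp add: square_integrable_def)
  have "integrable lborel (\<lambda>x. (norm (f (- y + 1 * x)))\<^sup>2)"
    using assms by (intro lborel_integrable_real_affine) (auto simp: square_integrable_def)
  then show ?thesis by (simp add: square_integrable_def)
qed

lemma trans_abs:
  assumes f: "square_integrable f"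
  shows "trans y (abs_L2 f) = abs_L2 (\<lambda>x. f (x - y))"
proof -
  have [measurable]: "f \<in> borel_measurable borel" using f by (simp add: square_integrable_def)
  have "AE x in lborel. rep_L2 (abs_L2 f) (- y + 1 * x) = f (- y + 1 * x)"
    by (rule AE_borel_affine[where P = "\<lambda>x. rep_L2 (abs_L2 f) x = f x"]) (use rep_abs_L2[OF f] in auto)
  then show ?thesis unfolding trans_def
    by (intro abs_L2_eqI square_integrable_translate f square_integrable_rep) simp
qed

lemma trans_linear:
  shows "trans y (c *\<^sub>C f) = c *\<^sub>C trans y f" "norm (trans y f) = norm f" "bounded_linear (trans y)"
    "cinner (trans y f) g = cinner f (trans (- y) g)"
proof -
  have sc: "trans y (c *\<^sub>C f) = c *\<^sub>C trans y f" for c f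
    by (cases f) (simp add: abs_L2_scaleC square_integrable_vscale square_integrable_translate trans_abs)
  then show "trans y (c *\<^sub>C f) = c *\<^sub>C trans y f" .
  have add: "trans y (f + g) = trans y f + trans y g" for f g
    by (cases f; cases g) (simp add: abs_L2_add square_integrable_add square_integrable_translate trans_abs)
  show adj: "cinner (trans y f) g = cinner f (trans (- y) g)" for y f g
  proof (cases f; cases g)
    fix u v assume u: "square_integrable u" "f = abs_L2 u" and v: "square_integrable v" "g = abs_L2 v"
    have "cinner (trans y f) g = (LBINT x. vdot (u (x - y)) (v x))"
      using u v by (simp add: trans_abs cinner_abs_L2 square_integrable_translate)
    also have "\<dots> = (LBINT x. vdot (u x) (v (x - (- y))))"
      by (subst lborel_integral_real_affine[where c = 1 and t = y]) (auto simp: add.commute)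
    also have "\<dots> = cinner f (trans (- y) g)"
      unfolding u(2) v(2) trans_abs[OF v(1)] by (simp only: cinner_abs_L2 u v square_integrable_translate[OF v(1)])
    finally show ?thesis .
  qed
  have inv: "trans (- y) (trans y f) = f" for f
    by (cases f) (simp add: trans_abs square_integrable_translate)
  have "complex_of_real ((norm (trans y f))\<^sup>2) = complex_of_real ((norm f)\<^sup>2)" for f
    by (simp only: cinner_self[symmetric] adj inv)
  then have n: "norm (trans y f) = norm f" for f by (simp only: of_real_eq_iff power2_eq_iff_nonneg norm_ge_zero)
  then show "norm (trans y f) = norm f" .
  show "bounded_linear (trans y)"
    by (rule bounded_linear_intro[of _ 1]) (use add sc n in \<open>auto simp flip: scaleC_of_real\<close>)
qed

lemma trans_vtest_tendsto:
  assumes \<phi>: "compactly_supported \<phi>"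
  shows "((\<lambda>y. trans y (vtest \<phi> j)) \<longlongrightarrow> vtest \<phi> j) (at 0)"
proof -
  obtain B R where BR: "B \<ge> 0" "R \<ge> 0" "\<And>x. \<bar>\<phi> x\<bar> \<le> B * indicator {-R..R} x"
    using compactly_supported_bounded[OF \<phi>] by blast
  have "((\<lambda>y. abs_L2 (\<lambda>x. \<phi> (x - y) *\<^sub>R axis j 1)) \<longlongrightarrow> abs_L2 (\<lambda>x. \<phi> x *\<^sub>R axis j 1)) (at 0)"
  proof (rule L2_tendsto_dominated_at[where d = 1 and w = "\<lambda>x. B * indicator {-R-1..R+1} x"])
    show "square_integrable (\<lambda>x. \<phi> (x - y) *\<^sub>R axis j (1::complex))" for y
      by (rule square_integrable_translate[OF square_integrable_vtest[OF \<phi>]])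
    have "((\<lambda>y. \<phi> (x - y)) \<longlongrightarrow> \<phi> x) (at 0)" for x
    proof -
      have "((\<lambda>y. \<phi> (x - y)) \<longlongrightarrow> \<phi> (x - 0)) (at 0)"
        using \<phi> by (intro continuous_on_tendsto_compose[of UNIV \<phi>] tendsto_intros) (auto simp: compactly_supported_def)
      then show ?thesis by simp
    qed
    then show "AE x in lborel. ((\<lambda>y. \<phi> (x - y) *\<^sub>R axis j 1) \<longlongrightarrow> \<phi> x *\<^sub>R axis j (1::complex)) (at 0)"
      by (intro AE_I2 tendsto_intros)
    have "integrable lborel (\<lambda>x. B\<^sup>2 * indicat_real {-R-1..R+1} x)"
      using BR by (intro integrable_mult_right) simp
    moreover have "(B * indicat_real {-R-1..R+1} x)\<^sup>2 = B\<^sup>2 * indicat_real {-R-1..R+1} x" for x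
      by (simp add: power_mult_distrib indicator_def)
    ultimately show "integrable lborel (\<lambda>x. (B * indicat_real {-R-1..R+1} x)\<^sup>2)" by simp
    show "AE x in lborel. norm (\<phi> (x - y) *\<^sub>R axis j (1::complex)) \<le> B * indicat_real {-R-1..R+1} x"
      if "\<bar>y - 0\<bar> < 1" for y
    proof (rule AE_I2)
      fix x
      have "\<bar>\<phi> (x - y)\<bar> \<le> B * indicat_real {-R..R} (x - y)" by (rule BR)
      also have "\<dots> \<le> B * indicat_real {-R-1..R+1} x"
        using that BR(1) by (intro mult_left_mono) (auto simp: indicator_def)
      finally show "norm (\<phi> (x - y) *\<^sub>R axis j (1::complex)) \<le> B * indicat_real {-R-1..R+1} x"
        by (simp add: norm_axis_complex)
    qed
  qed (use square_integrable_vtest[OF \<phi>] in auto)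
  then show ?thesis by (simp add: vtest_def trans_abs square_integrable_vtest[OF \<phi>])
qed

lemma compactly_supported_bump: "a < b \<Longrightarrow> c > 0 \<Longrightarrow> compactly_supported (bump c i j a b)"
  by (intro test_function_facts(2) bump_span_test_function bump_span.bump)

text \<open>Isometry and totality give existence of the limit from the case of test functions, where
  translation is dominated convergence. The value of the limit is found separately.\<close>

lemma trans_tendsto: "((\<lambda>y. trans y f) \<longlongrightarrow> f) (at 0)"
proof -
  define D where "D = {vtest (bump c 0 0 a b) j |a b c j. a < b \<and> c > 0}"
  have "\<exists>l. ((\<lambda>y. trans y f) \<longlongrightarrow> l) (at 0)"
  proof (rule convergence_on_total_set[where D = D])
    show "\<exists>l. ((\<lambda>y. trans y x) \<longlongrightarrow> l) (at 0)" if "x \<in> D" for x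
      using that trans_vtest_tendsto compactly_supported_bump unfolding D_def by blast
    show "x = 0" if "\<And>y. y \<in> D \<Longrightarrow> cinner x y = 0" for x
    proof (rule L2_total)
      fix a b c :: real and j assume "a < b" "c > 0"
      then show "cinner x (vtest (bump c 0 0 a b) j) = 0" by (intro that) (auto simp: D_def)
    qed
  qed (use trans_linear in auto)
  then obtain l where l: "((\<lambda>y. trans y f) \<longlongrightarrow> l) (at 0)" by blast
  \<comment> \<open>Weak identification: the translation is moved onto the test function, where its
    limit is already known.\<close>
  have "l - f = 0"
  proof (rule L2_total)
    fix a b c :: real and j assume "a < b" "c > 0"
    then have v: "((\<lambda>y. trans y (vtest (bump c 0 0 a b) j)) \<longlongrightarrow> vtest (bump c 0 0 a b) j) (at 0)" (is "(_ \<longlongrightarrow> ?v) _")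
      by (intro trans_vtest_tendsto compactly_supported_bump)
    have "filterlim uminus (at 0) (at (0::real))"
      by (rule filterlim_atI) (auto intro!: tendsto_eq_intros simp: eventually_at_filter)
    from filterlim_compose[OF v this] have "((\<lambda>y. trans (- y) ?v) \<longlongrightarrow> ?v) (at 0)" .
    then have "((\<lambda>y. cinner f (trans (- y) ?v)) \<longlongrightarrow> cinner f ?v) (at 0)"
      by (intro cinner.tendsto tendsto_const)
    moreover have "((\<lambda>y. cinner (trans y f) ?v) \<longlongrightarrow> cinner l ?v) (at 0)"
      by (intro cinner.tendsto tendsto_const l)
    ultimately have "cinner l ?v = cinner f ?v"
      by (simp add: trans_linear(4) tendsto_unique[OF at_neq_bot])
    then show "cinner (l - f) ?v = 0" by (simp add: cinner.diff_left)
  qed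
  then show ?thesis using l by simp
qed

section \<open>Fourier integrals\<close>

lemma mult_le_sum_squares: "a * b \<le> a\<^sup>2 + (b::real)\<^sup>2"
proof -
  have "2 * (a * b) \<le> a\<^sup>2 + b\<^sup>2" using sum_squares_bound[of a b] by simp
  moreover have "0 \<le> a\<^sup>2 + b\<^sup>2" by simp
  ultimately show ?thesis by linarith
qed

text \<open>Scalar and unnormalised; the factor \<open>1 / sqrt (2 * pi)\<close> enters only in
  \<open>FT\<close>.\<close>

definition ft :: "(real \<Rightarrow> complex) \<Rightarrow> real \<Rightarrow> complex" where
  "ft f p = (LBINT x. exp (- (\<i> * of_real (p * x))) * f x)"

lemma cmod_exp_minus_i [simp]: "cmod (exp (- (\<i> * complex_of_real x))) = 1"
  by (simp add: norm_exp_eq_Re)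

lemma cmod_exp_i [simp]: "cmod (exp (\<i> * complex_of_real x)) = 1"
  by (simp add: norm_exp_eq_Re)

lemma measurable_exp_minus_i [measurable]:
  assumes [measurable]: "f \<in> borel_measurable M"
  shows "(\<lambda>x. exp (- (\<i> * complex_of_real (f x)))) \<in> borel_measurable M"
proof -
  have "(\<lambda>y. exp (- (\<i> * complex_of_real y))) \<in> borel_measurable borel"
    by (intro borel_measurable_continuous_onI continuous_intros)
  from measurable_compose[OF assms this] show ?thesis .
qed

lemma measurable_cnj [measurable]:
  assumes [measurable]: "f \<in> borel_measurable M"
  shows "(\<lambda>x. cnj (f x)) \<in> borel_measurable M"
proof -
  have "cnj \<in> borel_measurable borel" by (intro borel_measurable_continuous_onI continuous_intros)
  from measurable_compose[OF assms this] show ?thesis .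
qed

lemma integrable_unimodular_mult:
  fixes f g :: "real \<Rightarrow> complex"
  assumes "integrable lborel f" "g \<in> borel_measurable borel" "\<And>x. cmod (g x) \<le> K"
  shows "integrable lborel (\<lambda>x. g x * f x)"
proof -
  have [measurable]: "f \<in> borel_measurable borel" "g \<in> borel_measurable borel" using assms by auto
  show ?thesis
  proof (rule integrable_dominated)
    show "integrable lborel (\<lambda>x. K * cmod (f x))" using assms(1) by (intro integrable_mult_right integrable_norm)
    show "AE x in lborel. cmod (g x * f x) \<le> norm (K * cmod (f x))"
    proof (rule AE_I2)
      fix x
      have "cmod (g x) * cmod (f x) \<le> K * cmod (f x)" using assms(3) by (intro mult_right_mono) auto
      then show "cmod (g x * f x) \<le> norm (K * cmod (f x))" by (simp add: norm_mult)
    qed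
  qed simp
qed

lemma ft_measurable [measurable]:
  assumes [measurable]: "f \<in> borel_measurable borel"
  shows "ft f \<in> borel_measurable borel"
  unfolding ft_def by measurable

lemma cmod_ft_le: "integrable lborel f \<Longrightarrow> cmod (ft f p) \<le> (LBINT x. cmod (f x))"
  unfolding ft_def
  by (rule order_trans[OF integral_norm_bound]) (simp add: norm_mult)

text \<open>Fubini for a unimodular kernel that is symmetric in \<open>p\<close> and
  \<open>x\<close>.\<close>

lemma ft_multiplication_formula:
  assumes f: "integrable lborel f" and h: "integrable lborel h"
  shows "(LBINT p. ft f p * h p) = (LBINT x. f x * ft h x)"
proof -
  have [measurable]: "f \<in> borel_measurable borel" "h \<in> borel_measurable borel" using f h by auto
  define F where "F = (\<lambda>(x, p). exp (- (\<i> * of_real (p * x))) * f x * h p)"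
  have "integrable (lborel \<Otimes>\<^sub>M lborel) F"
  proof (rule lborel_pair.Fubini_integrable)
    show "F \<in> borel_measurable (lborel \<Otimes>\<^sub>M lborel)" unfolding F_def by measurable
    show "integrable lborel (\<lambda>x. \<integral>p. norm (F (x, p)) \<partial>lborel)"
      using f h by (simp add: F_def norm_mult)
    show "AE x in lborel. integrable lborel (\<lambda>p. F (x, p))"
    proof (rule AE_I2)
      fix x
      have "integrable lborel (\<lambda>p. f x * (exp (- (\<i> * of_real (p * x))) * h p))"
        by (intro integrable_mult_right integrable_unimodular_mult[where K = 1] h) auto
      then show "integrable lborel (\<lambda>p. F (x, p))" by (simp add: F_def mult_ac)
    qed
  qed
  then have F: "integrable (lborel \<Otimes>\<^sub>M lborel) (case_prod (\<lambda>x p. F (x, p)))" by simp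
  have "(LBINT p. ft f p * h p) = (LBINT p. (LBINT x. F (x, p)))"
    unfolding ft_def F_def by simp
  also have "\<dots> = (LBINT x. (LBINT p. F (x, p)))" by (rule lborel_pair.Fubini_integral[OF F])
  also have "\<dots> = (LBINT x. f x * ft h x)"
  proof (rule Bochner_Integration.integral_cong[OF refl])
    fix x
    have "(LBINT p. F (x, p)) = (LBINT p. f x * (exp (- (\<i> * of_real (x * p))) * h p))"
      by (simp add: F_def mult_ac)
    then show "(LBINT p. F (x, p)) = f x * ft h x" unfolding ft_def by simp
  qed
  finally show ?thesis .
qed

lemma cnj_ft: "cnj (ft f p) = ft (\<lambda>x. cnj (f (- x))) p"
proof -
  have "cnj (ft f p) = (LBINT x. exp (\<i> * of_real (p * x)) * cnj (f x))"
    unfolding ft_def by (subst Bochner_Integration.integral_cnj[symmetric]) (simp add: exp_cnj)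
  also have "\<dots> = ft (\<lambda>x. cnj (f (- x))) p"
    unfolding ft_def
    by (subst lborel_integral_real_affine[where c = "-1" and t = 0]) auto
  finally show ?thesis .
qed

lemma gaussian_integrable: "e > 0 \<Longrightarrow> integrable lborel (\<lambda>p::real. exp (- e * p\<^sup>2 / 2))"
proof -
  assume e: "e > 0"
  have "integrable lborel (\<lambda>x. std_normal_density (0 + sqrt e * x))"
    using e by (intro lborel_integrable_real_affine) auto
  then have "integrable lborel (\<lambda>x. sqrt (2 * pi) * std_normal_density (0 + sqrt e * x))"
    by (rule integrable_mult_right)
  then show ?thesis using e
    by (simp add: std_normal_density_def power_mult_distrib)
qed

text \<open>Rescaling of the characteristic function of the standard normal distribution, which
  supplies the one Fourier integral that must be computed.\<close>

lemma ft_gaussian: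
  assumes e: "e > 0"
  shows "ft (\<lambda>p. of_real (exp (- e * p\<^sup>2 / 2))) y = of_real (sqrt (2 * pi / e) * exp (- y\<^sup>2 / (2 * e)))"
proof -
  define t where "t = - y / sqrt e"
  have "char std_normal_distribution t = (LBINT x. std_normal_density x *\<^sub>R iexp (t * x))"
    unfolding char_def by (rule integral_density) auto
  then have "of_real (exp (- t\<^sup>2 / 2)) = (LBINT x. std_normal_density x *\<^sub>R iexp (t * x))"
    by (simp add: char_std_normal_distribution)
  also have "\<dots> = sqrt e *\<^sub>R (LBINT p. std_normal_density (0 + sqrt e * p) *\<^sub>R iexp (t * (0 + sqrt e * p)))"
    using e by (subst lborel_integral_real_affine[where c = "sqrt e" and t = 0]) auto
  also have "(\<lambda>p. std_normal_density (0 + sqrt e * p) *\<^sub>R iexp (t * (0 + sqrt e * p)))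
      = (\<lambda>p. of_real (1 / sqrt (2 * pi)) * (exp (- (\<i> * of_real (y * p))) * of_real (exp (- e * p\<^sup>2 / 2))))"
    using e by (simp add: fun_eq_iff std_normal_density_def t_def power_mult_distrib scaleR_conv_of_real mult_ac)
  also have "sqrt e *\<^sub>R (LBINT p. of_real (1 / sqrt (2 * pi)) * (exp (- (\<i> * of_real (y * p))) * of_real (exp (- e * p\<^sup>2 / 2))))
      = of_real (sqrt e / sqrt (2 * pi)) * ft (\<lambda>p. of_real (exp (- e * p\<^sup>2 / 2))) y"
    unfolding ft_def by (simp add: scaleR_conv_of_real)
  finally have "of_real (exp (- t\<^sup>2 / 2)) = of_real (sqrt e / sqrt (2 * pi)) * ft (\<lambda>p. of_real (exp (- e * p\<^sup>2 / 2))) y" .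
  then have "of_real (sqrt (2 * pi) / sqrt e) * of_real (exp (- t\<^sup>2 / 2)) = (of_real (sqrt (2 * pi) / sqrt e) * of_real (sqrt e / sqrt (2 * pi))) * ft (\<lambda>p. of_real (exp (- e * p\<^sup>2 / 2))) y"
    by (simp only: mult.assoc)
  moreover have "of_real (sqrt (2 * pi) / sqrt e) * of_real (sqrt e / sqrt (2 * pi)) = (1 :: complex)"
    using e by (simp flip: of_real_mult)
  moreover have "t\<^sup>2 = y\<^sup>2 / e" using e by (simp add: t_def power_divide)
  ultimately show ?thesis using e by (simp add: real_sqrt_divide mult.commute)
qed

abbreviation gauss :: "real \<Rightarrow> complex" where
  "gauss z \<equiv> of_real (std_normal_density z)"

abbreviation damp :: "real \<Rightarrow> real \<Rightarrow> real" where
  "damp e p \<equiv> exp (- e * p\<^sup>2 / 2)"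

text \<open>Damping makes the momentum integral absolutely convergent. In position space the damping
  factor becomes an average over translations by \<open>sqrt e * z\<close> with normally distributed
  \<open>z\<close>, which concentrates at 0 as \<open>e\<close> tends to 0.\<close>

lemma ft_gaussian_parseval:
  fixes f g :: "real \<Rightarrow> complex"
  assumes f: "integrable lborel f" "integrable lborel (\<lambda>x. (cmod (f x))\<^sup>2)"
    and g: "integrable lborel g" "integrable lborel (\<lambda>x. (cmod (g x))\<^sup>2)" and e: "e > 0"
  shows "(LBINT p. of_real (damp e p) * (ft f p * cnj (ft g p)))
    = 2 * pi * (LBINT z. gauss z * (LBINT x. f x * cnj (g (x - sqrt e * z))))"
proof -
  have [measurable]: "f \<in> borel_measurable borel" "g \<in> borel_measurable borel" using f g by auto
  define k where "k p = complex_of_real (damp e p)" for p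
  have k: "integrable lborel k" unfolding k_def by (intro integrable_of_real gaussian_integrable e)
  have km [measurable]: "k \<in> borel_measurable borel" unfolding k_def by measurable
  define g' where "g' x = cnj (g (- x))" for x
  have g': "integrable lborel g'"
    unfolding g'_def using lborel_integrable_real_affine[OF g(1), of "-1" 0] by (simp add: integrable_cnj)
  have gm [measurable]: "g' \<in> borel_measurable borel" unfolding g'_def by measurable
  have kx: "integrable lborel (\<lambda>p. exp (- (\<i> * of_real (x * p))) * k p)" for x
    by (intro integrable_unimodular_mult[where K = 1] k) auto
  \<comment> \<open>The multiplication formula shifts the transform from \<open>g\<close> to the
    Gaussian, where it is explicit; the substitution \<open>y = - x + sqrt e * z\<close> then
    produces the normal density.\<close>
  have inner: "ft (\<lambda>p. k p * cnj (ft g p)) x = 2 * pi * (LBINT z. gauss z * cnj (g (x - sqrt e * z)))" for x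
  proof -
    have "ft (\<lambda>p. k p * cnj (ft g p)) x = (LBINT p. ft g' p * (exp (- (\<i> * of_real (x * p))) * k p))"
      unfolding ft_def[of "\<lambda>p. k p * cnj (ft g p)" x] by (simp add: cnj_ft g'_def[abs_def] mult_ac)
    also have "\<dots> = (LBINT y. g' y * ft (\<lambda>p. exp (- (\<i> * of_real (x * p))) * k p) y)"
      by (rule ft_multiplication_formula[OF g' kx])
    also have "(\<lambda>y. ft (\<lambda>p. exp (- (\<i> * of_real (x * p))) * k p) y) = (\<lambda>y. ft k (x + y))"
    proof -
      have "exp (- (\<i> * of_real (y * p))) * (exp (- (\<i> * of_real (x * p))) * w) = exp (- (\<i> * of_real ((x + y) * p))) * w"
        for y p w
        unfolding mult.assoc[symmetric] exp_add[symmetric] by (simp add: algebra_simps)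
      then show ?thesis unfolding ft_def by (simp only:)
    qed
    also have "(LBINT y. g' y * ft k (x + y)) = sqrt e *\<^sub>R (LBINT z. g' (- x + sqrt e * z) * ft k (x + (- x + sqrt e * z)))"
      using e by (subst lborel_integral_real_affine[where c = "sqrt e" and t = "- x"]) auto
    also have "\<dots> = (LBINT z. sqrt e *\<^sub>R (g' (- x + sqrt e * z) * ft k (x + (- x + sqrt e * z))))" by simp
    also have "(\<lambda>z. sqrt e *\<^sub>R (g' (- x + sqrt e * z) * ft k (x + (- x + sqrt e * z))))
        = (\<lambda>z. 2 * pi * (gauss z * cnj (g (x - sqrt e * z))))"
    proof
      fix z
      have "ft k (sqrt e * z) = of_real (sqrt (2 * pi / e) * exp (- (sqrt e * z)\<^sup>2 / (2 * e)))"
        unfolding k_def by (rule ft_gaussian[OF e])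
      also have "sqrt (2 * pi / e) * exp (- (sqrt e * z)\<^sup>2 / (2 * e)) = (2 * pi / sqrt e) * std_normal_density z"
      proof -
        define S where "S = sqrt (2 * pi)"
        have S: "S > 0" "2 * pi = S * S" by (simp_all add: S_def)
        have "sqrt (2 * pi / e) * exp (- (sqrt e * z)\<^sup>2 / (2 * e)) = S * exp (- z\<^sup>2 / 2) / sqrt e"
          using e by (simp add: power_mult_distrib real_sqrt_divide S_def)
        also have "\<dots> = (S * S / sqrt e) * (1 / S * exp (- z\<^sup>2 / 2))" using S(1) by simp
        also have "\<dots> = (2 * pi / sqrt e) * std_normal_density z"
          unfolding S(2)[symmetric] by (simp add: std_normal_density_def S_def)
        finally show ?thesis .
      qed
      finally show "sqrt e *\<^sub>R (g' (- x + sqrt e * z) * ft k (x + (- x + sqrt e * z))) = 2 * pi * (gauss z * cnj (g (x - sqrt e * z)))"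
        using e by (simp add: g'_def scaleR_conv_of_real mult_ac)
    qed
    also have "(LBINT z. 2 * pi * (gauss z * cnj (g (x - sqrt e * z))))
      = 2 * pi * (LBINT z. gauss z * cnj (g (x - sqrt e * z)))" by simp
    finally show ?thesis .
  qed
  define F where "F = (\<lambda>(z, x). gauss z * (f x * cnj (g (x - sqrt e * z))))"
  \<comment> \<open>Bound for the translated products that is uniform in the translation, as needed
    to integrate over \<open>z\<close> in Fubini's theorem.\<close>
  define M where "M = (LBINT x. (cmod (f x))\<^sup>2) + (LBINT x. (cmod (g x))\<^sup>2)"
  have gs: "integrable lborel (\<lambda>x. (cmod (g (x - s)))\<^sup>2)" "(LBINT x. (cmod (g (x - s)))\<^sup>2) = (LBINT x. (cmod (g x))\<^sup>2)" for s
    using lborel_integrable_real_affine[OF g(2), of 1 "-s"]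
      lborel_integral_real_affine[of 1 "\<lambda>x. (cmod (g x))\<^sup>2" "-s"] by simp_all
  have fg: "cmod (f x) * cmod (g (x - s)) \<le> (cmod (f x))\<^sup>2 + (cmod (g (x - s)))\<^sup>2" for x s
    by (rule mult_le_sum_squares)
  have fgi: "integrable lborel (\<lambda>x. f x * cnj (g (x - s)))" for s
    by (rule integrable_dominated[OF Bochner_Integration.integrable_add[OF f(2) gs(1)[of s]]])
      (use fg in \<open>auto simp: norm_mult\<close>)
  have fgM: "(LBINT x. cmod (f x) * cmod (g (x - s))) \<le> M" for s
  proof -
    have "(LBINT x. cmod (f x) * cmod (g (x - s))) \<le> (LBINT x. (cmod (f x))\<^sup>2 + (cmod (g (x - s)))\<^sup>2)"
      using integrable_norm[OF fgi[of s]] f(2) gs(1)[of s] fg by (intro integral_mono) (auto simp: norm_mult)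
    also have "\<dots> = M" unfolding M_def using f(2) gs[of s] by simp
    finally show ?thesis .
  qed
  have "integrable (lborel \<Otimes>\<^sub>M lborel) F"
  proof (rule lborel_pair.Fubini_integrable)
    show "F \<in> borel_measurable (lborel \<Otimes>\<^sub>M lborel)" unfolding F_def by measurable
    have "norm (F (z, x)) = std_normal_density z * (cmod (f x) * cmod (g (x - sqrt e * z)))" for z x
      by (simp add: F_def norm_mult)
    then have eq: "(LBINT x. norm (F (z, x))) = std_normal_density z * (LBINT x. cmod (f x) * cmod (g (x - sqrt e * z)))" for z
      by simp
    show "integrable lborel (\<lambda>z. \<integral>x. norm (F (z, x)) \<partial>lborel)"
    proof (rule integrable_dominated)
      show "integrable lborel (\<lambda>z. M * std_normal_density z)" by (intro integrable_mult_right) simp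
      show "AE z in lborel. norm (LBINT x. norm (F (z, x))) \<le> norm (M * std_normal_density z)"
      proof (rule AE_I2)
        fix z
        have "0 \<le> (LBINT x. cmod (f x) * cmod (g (x - sqrt e * z)))" by (intro integral_nonneg_AE) simp
        then show "norm (LBINT x. norm (F (z, x))) \<le> norm (M * std_normal_density z)"
          unfolding eq using fgM[of "sqrt e * z"]
          by (simp add: abs_mult mult.commute[of M] mult_left_mono order_trans[OF _ abs_ge_self])
      qed
      show "(\<lambda>z. \<integral>x. norm (F (z, x)) \<partial>lborel) \<in> borel_measurable lborel" unfolding F_def by measurable
    qed
    show "AE z in lborel. integrable lborel (\<lambda>x. F (z, x))"
      unfolding F_def using fgi by simp
  qed
  then have F: "integrable (lborel \<Otimes>\<^sub>M lborel) (case_prod (\<lambda>z x. F (z, x)))" by simp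
  have "(LBINT p. of_real (damp e p) * (ft f p * cnj (ft g p))) = (LBINT p. ft f p * (k p * cnj (ft g p)))"
    by (simp add: k_def mult_ac)
  also have "\<dots> = (LBINT x. f x * ft (\<lambda>p. k p * cnj (ft g p)) x)"
  proof (rule ft_multiplication_formula[OF f(1)])
    have "integrable lborel (\<lambda>p. cnj (ft g p) * k p)"
      by (rule integrable_unimodular_mult[OF k, of _ "\<integral>x. cmod (g x) \<partial>lborel"]) (use cmod_ft_le[OF g(1)] in auto)
    then show "integrable lborel (\<lambda>p. k p * cnj (ft g p))" by (simp add: mult.commute)
  qed
  also have "\<dots> = (LBINT x. 2 * pi * (f x * (LBINT z. gauss z * cnj (g (x - sqrt e * z)))))"
    unfolding inner by (simp add: mult_ac)
  also have "\<dots> = 2 * pi * (LBINT x. (LBINT z. F (z, x)))"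
    unfolding F_def by (simp add: mult_ac flip: integral_mult_right_zero)
  also have "(LBINT x. (LBINT z. F (z, x))) = (LBINT z. (LBINT x. F (z, x)))"
    by (rule lborel_pair.Fubini_integral[OF F])
  also have "\<dots> = (LBINT z. gauss z * (LBINT x. f x * cnj (g (x - sqrt e * z))))"
    unfolding F_def by simp
  finally show ?thesis .
qed

section \<open>The Plancherel theorem\<close>

definition FT :: "(real \<Rightarrow> complex^2) \<Rightarrow> real \<Rightarrow> complex^2" where
  "FT f p = complex_of_real (1 / sqrt (2 * pi)) *s (LBINT x. exp (- (\<i> * of_real (p * x))) *s f x)"

lemma integrable_exp_vscale:
  fixes f :: "real \<Rightarrow> complex^2"
  assumes "integrable lborel f"
  shows "integrable lborel (\<lambda>x. exp (- (\<i> * of_real (p * x))) *s f x)"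
  using assms unfolding integrable_vec_iff
  by (auto intro!: integrable_unimodular_mult[where K = 1])

lemma FT_nth:
  assumes "integrable lborel f"
  shows "FT f p $ j = complex_of_real (1 / sqrt (2 * pi)) * ft (\<lambda>x. f x $ j) p"
  unfolding FT_def ft_def vector_smult_component integral_vec_nth[OF integrable_exp_vscale[OF assms]]
  by (rule refl)

lemma FT_add:
  "integrable lborel f \<Longrightarrow> integrable lborel g \<Longrightarrow> FT (\<lambda>x. f x + g x) = (\<lambda>p. FT f p + FT g p)"
  unfolding FT_def
  by (rule ext) (simp only: vector_add_ldistrib integrable_exp_vscale Bochner_Integration.integral_add)

lemma FT_diff:
  "integrable lborel f \<Longrightarrow> integrable lborel g \<Longrightarrow> FT (\<lambda>x. f x - g x) = (\<lambda>p. FT f p - FT g p)"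
  unfolding FT_def
  by (rule ext) (simp only: vector_ssub_ldistrib integrable_exp_vscale Bochner_Integration.integral_diff)

lemma FT_vscale:
  assumes "integrable lborel f"
  shows "FT (\<lambda>x. c *s f x) = (\<lambda>p. c *s FT f p)"
proof -
  have "integrable lborel (\<lambda>x. c *s f x)" using assms by (simp add: integrable_vec_iff)
  then show ?thesis using assms by (simp add: fun_eq_iff vec_eq_iff FT_nth ft_def mult_ac)
qed

lemma FT_measurable [measurable]:
  assumes "integrable lborel f"
  shows "FT f \<in> borel_measurable borel"
proof -
  have [measurable]: "f \<in> borel_measurable borel" using assms by auto
  show ?thesis unfolding borel_measurable_vec_iff FT_nth[OF assms] by measurable
qed

lemma square_integrable_nth:
  assumes "square_integrable f"
  shows "integrable lborel (\<lambda>x. (cmod (f x $ j))\<^sup>2)"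
proof -
  have [measurable]: "f \<in> borel_measurable borel" using assms by (simp add: square_integrable_def)
  show ?thesis
    by (rule integrable_dominated[of lborel "\<lambda>x. (norm (f x))\<^sup>2"])
      (use assms in \<open>auto simp: square_integrable_def intro!: power_mono Finite_Cartesian_Product.norm_nth_le\<close>)
qed

text \<open>Let the damping tend to 0 in the Gaussian Parseval identity. The position side converges
  by continuity of translations; the momentum side increases monotonically, so square integrability
  of the transform is obtained together with the value of its norm.\<close>

theorem FT_plancherel:
  assumes f: "integrable lborel f" "square_integrable f"
  shows "square_integrable (FT f)" "norm (abs_L2 (FT f)) = norm (abs_L2 f)"
proof -
  have [measurable]: "f \<in> borel_measurable borel" using f by auto
  note [measurable] = FT_measurable[OF f(1)]
  let ?F = "abs_L2 f" and ?h = "\<lambda>j. ft (\<lambda>x. f x $ j)"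
  have fj: "integrable lborel (\<lambda>x. f x $ j)" for j using f(1) by (simp add: integrable_vec_iff)
  have fjm [measurable]: "(\<lambda>x. f x $ j) \<in> borel_measurable borel" for j by measurable
  have fj2: "integrable lborel (\<lambda>x. (cmod (f x $ j))\<^sup>2)" for j by (rule square_integrable_nth[OF f(2)])
  \<comment> \<open>Autocorrelation of a component; summed over both components it is the inner
    product of the class of \<open>f\<close> with its translate.\<close>
  define a where "a j s = (LBINT x. f x $ j * cnj (f (x - s) $ j))" for j s
  have am [measurable]: "a j \<in> borel_measurable borel" for j unfolding a_def by measurable
  have vi: "integrable lborel (\<lambda>x. f x $ j * cnj (f (x - s) $ j))" for j s
  proof (rule integrable_dominated[OF integrable_norm[OF Bochner_Integration.integrable_add]])
    show "integrable lborel (\<lambda>x. (cmod (f x $ j))\<^sup>2)" by (rule fj2)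
    show "integrable lborel (\<lambda>x. (cmod (f (x - s) $ j))\<^sup>2)"
      by (rule square_integrable_nth[OF square_integrable_translate[OF f(2)]])
    show "AE x in lborel. norm (f x $ j * cnj (f (x - s) $ j)) \<le> norm (norm ((cmod (f x $ j))\<^sup>2 + (cmod (f (x - s) $ j))\<^sup>2))"
    proof (rule AE_I2)
      fix x
      have "cmod (f x $ j) * cmod (f (x - s) $ j) \<le> (cmod (f x $ j))\<^sup>2 + (cmod (f (x - s) $ j))\<^sup>2"
        by (rule mult_le_sum_squares)
      then show "norm (f x $ j * cnj (f (x - s) $ j)) \<le> norm (norm ((cmod (f x $ j))\<^sup>2 + (cmod (f (x - s) $ j))\<^sup>2))"
        by (simp add: norm_mult)
    qed
  qed measurable
  have A: "a 1 s + a 2 s = cinner ?F (trans s ?F)" for s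
  proof -
    have "cinner ?F (trans s ?F) = (LBINT x. vdot (f x) (f (x - s)))"
      using f(2) by (simp add: trans_abs cinner_abs_L2 square_integrable_translate)
    then show ?thesis unfolding a_def vdot_expand by (simp add: vi)
  qed
  have A_le: "cmod (a 1 s + a 2 s) \<le> (norm ?F)\<^sup>2" for s
    unfolding A using cmod_cinner_le[of ?F "trans s ?F"] by (simp add: trans_linear(2) power2_eq_square)
  \<comment> \<open>Damped version of the squared norm of the transform, finite for every positive
    \<open>e\<close> because the transform is bounded.\<close>
  define L where "L e = (LBINT p. damp e p * (norm (FT f p))\<^sup>2)" for e
  have ftb: "cmod (?h j p) \<le> (LBINT x. cmod (f x $ j))" for j p by (rule cmod_ft_le[OF fj])
  have gi: "integrable lborel (\<lambda>p. of_real (damp e p) * (?h j p * cnj (?h j p)))"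
    if "e > 0" for e j
  proof -
    define B where "B = (LBINT x. cmod (f x $ j))"
    have "integrable lborel (\<lambda>p. (?h j p * cnj (?h j p)) * complex_of_real (damp e p))"
    proof (rule integrable_unimodular_mult[where K = "B * B"])
      show "integrable lborel (\<lambda>p. complex_of_real (damp e p))"
        by (intro integrable_of_real gaussian_integrable that)
      show "cmod (?h j p * cnj (?h j p)) \<le> B * B" for p
        unfolding norm_mult complex_mod_cnj using ftb by (intro mult_mono) (auto simp: B_def intro: order_trans[OF norm_ge_zero])
    qed measurable
    then show ?thesis by (simp add: mult.commute)
  qed
  have norm_eq: "complex_of_real ((norm (FT f p))\<^sup>2) = of_real (1 / (2 * pi)) *
      (?h 1 p * cnj (?h 1 p) + ?h 2 p * cnj (?h 2 p))" for p
    unfolding norm_vec2_sq sum_2 FT_nth[OF f(1)] of_real_add norm_mult power_mult_distrib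
    by (simp add: complex_norm_square[symmetric] norm_divide power_divide distrib_left flip: complex_norm_square)
  have L: "complex_of_real (L e) = (LBINT z. gauss z * (a 1 (sqrt e * z) + a 2 (sqrt e * z)))"
    and Li: "integrable lborel (\<lambda>p. damp e p * (norm (FT f p))\<^sup>2)" if e: "e > 0" for e
  proof -
    let ?G = "\<lambda>j p. of_real (damp e p) * (?h j p * cnj (?h j p))"
    have eq: "complex_of_real (damp e p * (norm (FT f p))\<^sup>2) = of_real (1 / (2 * pi)) * (?G 1 p + ?G 2 p)" for p
      unfolding of_real_mult[of "exp _"] norm_eq by (simp add: algebra_simps)
    have "integrable lborel (\<lambda>p. complex_of_real (damp e p * (norm (FT f p))\<^sup>2))"
      unfolding eq by (intro integrable_mult_right Bochner_Integration.integrable_add gi e)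
    then show "integrable lborel (\<lambda>p. damp e p * (norm (FT f p))\<^sup>2)"
      by (simp only: complex_of_real_integrable_eq)
    have ki: "integrable lborel (\<lambda>z. gauss z * a j (sqrt e * z))" for j
    proof -
      define B where "B = 2 * (LBINT x. (cmod (f x $ j))\<^sup>2)"
      have "cmod (a j s) \<le> B" for s
      proof -
        have "cmod (a j s) \<le> (LBINT x. cmod (f x $ j * cnj (f (x - s) $ j)))"
          unfolding a_def by (rule integral_norm_bound)
        also have "\<dots> \<le> (LBINT x. (cmod (f x $ j))\<^sup>2 + (cmod (f (x - s) $ j))\<^sup>2)"
        proof (rule integral_mono)
          show "integrable lborel (\<lambda>x. (cmod (f x $ j))\<^sup>2 + (cmod (f (x - s) $ j))\<^sup>2)"
            by (intro Bochner_Integration.integrable_add fj2 square_integrable_nth[OF square_integrable_translate[OF f(2)]])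
          show "cmod (f x $ j * cnj (f (x - s) $ j)) \<le> (cmod (f x $ j))\<^sup>2 + (cmod (f (x - s) $ j))\<^sup>2" for x
            unfolding norm_mult complex_mod_cnj by (rule mult_le_sum_squares)
        qed (use integrable_norm[OF vi] in auto)
        also have "\<dots> = B"
          using square_integrable_nth[OF square_integrable_translate[OF f(2)], of s j] fj2[of j]
            lborel_integral_real_affine[of 1 "\<lambda>x. (cmod (f x $ j))\<^sup>2" "-s"] by (simp add: B_def)
        finally show ?thesis .
      qed
      then have "integrable lborel (\<lambda>z. a j (sqrt e * z) * gauss z)"
        by (intro integrable_unimodular_mult[where K = B]) auto
      then show ?thesis by (simp add: mult.commute)
    qed
    have "complex_of_real (L e) = (LBINT p. of_real (1 / (2 * pi)) * (?G 1 p + ?G 2 p))"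
      unfolding L_def eq[symmetric] by (rule integral_complex_of_real[symmetric])
    also have "\<dots> = of_real (1 / (2 * pi)) * ((LBINT p. ?G 1 p) + (LBINT p. ?G 2 p))"
      using gi[OF e] by simp
    also have "\<dots> = of_real (1 / (2 * pi)) * (2 * pi * (LBINT z. gauss z * a 1 (sqrt e * z))
        + 2 * pi * (LBINT z. gauss z * a 2 (sqrt e * z)))"
      unfolding a_def ft_gaussian_parseval[OF fj fj2 fj fj2 e] by (rule refl)
    also have "of_real (1 / (2 * pi)) * (2 * pi * (LBINT z. gauss z * a 1 (sqrt e * z))
        + 2 * pi * (LBINT z. gauss z * a 2 (sqrt e * z)))
      = (LBINT z. gauss z * a 1 (sqrt e * z)) + (LBINT z. gauss z * a 2 (sqrt e * z))"
      by (simp add: field_simps)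
    also have "\<dots> = (LBINT z. gauss z * (a 1 (sqrt e * z) + a 2 (sqrt e * z)))"
      by (simp add: distrib_left ki)
    finally show "complex_of_real (L e) = (LBINT z. gauss z * (a 1 (sqrt e * z) + a 2 (sqrt e * z)))" .
  qed
  define e where "e n = 1 / real (Suc n)" for n
  have e0: "e n > 0" for n by (simp add: e_def)
  have elim: "e \<longlonglongrightarrow> 0" unfolding e_def using LIMSEQ_inverse_real_of_nat by (simp add: inverse_eq_divide)
  have "(\<lambda>n. \<integral>z. gauss z * (a 1 (sqrt (e n) * z) + a 2 (sqrt (e n) * z)) \<partial>lborel)
      \<longlonglongrightarrow> (LBINT z. gauss z * of_real ((norm ?F)\<^sup>2))"
  proof (rule integral_dominated_convergence[where w = "\<lambda>z. std_normal_density z * (norm ?F)\<^sup>2"])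
    show "integrable lborel (\<lambda>z. std_normal_density z * (norm ?F)\<^sup>2)" by (intro integrable_mult_left) simp
    show "AE z in lborel. (\<lambda>n. gauss z * (a 1 (sqrt (e n) * z) + a 2 (sqrt (e n) * z)))
        \<longlonglongrightarrow> gauss z * of_real ((norm ?F)\<^sup>2)"
    proof (rule AE_I2)
      fix z
      have t0: "trans 0 ?F = ?F" by (simp add: trans_abs f(2))
      have "isCont (\<lambda>s. cinner ?F (trans s ?F)) 0"
        unfolding isCont_def using trans_tendsto[of ?F] by (auto simp: t0 intro!: cinner.tendsto)
      moreover have "(\<lambda>n. sqrt (e n) * z) \<longlonglongrightarrow> 0"
        using tendsto_mult_left_zero[OF tendsto_real_sqrt[OF elim, simplified], of z] by simp
      ultimately have "(\<lambda>n. cinner ?F (trans (sqrt (e n) * z) ?F)) \<longlonglongrightarrow> cinner ?F (trans 0 ?F)"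
        by (rule isCont_tendsto_compose)
      then show "(\<lambda>n. gauss z * (a 1 (sqrt (e n) * z) + a 2 (sqrt (e n) * z)))
        \<longlonglongrightarrow> gauss z * of_real ((norm ?F)\<^sup>2)"
        unfolding A t0 cinner_self by (intro tendsto_mult tendsto_const)
    qed
    show "AE z in lborel. norm (gauss z * (a 1 (sqrt (e n) * z) + a 2 (sqrt (e n) * z)))
        \<le> std_normal_density z * (norm ?F)\<^sup>2" for n
      unfolding norm_mult by (intro AE_I2 mult_mono A_le) auto
  qed measurable
  then have "(\<lambda>n. complex_of_real (L (e n))) \<longlonglongrightarrow> of_real ((norm ?F)\<^sup>2)"
    by (simp add: L[OF e0] flip: integral_complex_of_real of_real_mult)
  then have Llim: "(\<lambda>n. L (e n)) \<longlonglongrightarrow> (norm ?F)\<^sup>2" by (simp only: tendsto_of_real_iff)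
  \<comment> \<open>Monotone convergence in the extended reals does not presuppose that the limit is
    finite.\<close>
  have "(\<lambda>n. \<integral>\<^sup>+p. ennreal (damp (e n) p * (norm (FT f p))\<^sup>2) \<partial>lborel)
      \<longlonglongrightarrow> (\<integral>\<^sup>+p. ennreal ((norm (FT f p))\<^sup>2) \<partial>lborel)"
  proof (rule nn_integral_LIMSEQ)
    show "incseq (\<lambda>n p. ennreal (damp (e n) p * (norm (FT f p))\<^sup>2))"
    proof (intro incseq_SucI le_funI ennreal_leI mult_right_mono)
      fix n and p :: real
      have "e (Suc n) \<le> e n" unfolding e_def by (intro divide_left_mono) auto
      then have "e (Suc n) * p\<^sup>2 \<le> e n * p\<^sup>2" by (intro mult_right_mono) auto
      then show "damp (e n) p \<le> exp (- e (Suc n) * p\<^sup>2 / 2)" by simp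
    qed simp
    show "(\<lambda>n. ennreal (damp (e n) p * (norm (FT f p))\<^sup>2)) \<longlonglongrightarrow> ennreal ((norm (FT f p))\<^sup>2)" for p
    proof (rule tendsto_ennrealI)
      have "(\<lambda>n. damp (e n) p * (norm (FT f p))\<^sup>2) \<longlonglongrightarrow> exp (- 0 * p\<^sup>2 / 2) * (norm (FT f p))\<^sup>2"
        by (intro tendsto_intros elim) simp
      then show "(\<lambda>n. damp (e n) p * (norm (FT f p))\<^sup>2) \<longlonglongrightarrow> (norm (FT f p))\<^sup>2" by simp
    qed
  qed measurable
  moreover have "(\<integral>\<^sup>+p. ennreal (damp (e n) p * (norm (FT f p))\<^sup>2) \<partial>lborel) = ennreal (L (e n))" for n
    unfolding L_def by (intro nn_integral_eq_integral Li e0) auto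
  moreover have "(\<lambda>n. ennreal (L (e n))) \<longlonglongrightarrow> ennreal ((norm ?F)\<^sup>2)" by (intro tendsto_ennrealI Llim)
  ultimately have eq: "(\<integral>\<^sup>+p. ennreal ((norm (FT f p))\<^sup>2) \<partial>lborel) = ennreal ((norm ?F)\<^sup>2)"
    using LIMSEQ_unique by simp
  then have "integrable lborel (\<lambda>p. (norm (FT f p))\<^sup>2)"
    by (subst integrable_iff_bounded) (simp add: ennreal_less_top)
  then show si: "square_integrable (FT f)" by (simp add: square_integrable_def)
  from nn_integral_norm_L2[OF this] eq have "(norm (abs_L2 (FT f)))\<^sup>2 = (norm ?F)\<^sup>2" by simp
  then show "norm (abs_L2 (FT f)) = norm ?F" by (simp add: power2_eq_iff_nonneg)
qed

text \<open>Componentwise multiplication formula; conjugating the kernel is what reflects the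
  argument of the transform of \<open>h\<close>.\<close>

lemma FT_adjoint:
  assumes f: "integrable lborel f" and h: "integrable lborel h"
  shows "(LBINT p. vdot (FT f p) (h p)) = (LBINT x. vdot (f x) (FT h (- x)))"
proof -
  let ?c = "complex_of_real (1 / sqrt (2 * pi))"
  have fj: "integrable lborel (\<lambda>x. f x $ j)" and hj: "integrable lborel (\<lambda>x. h x $ j)"
    and chj: "integrable lborel (\<lambda>x. cnj (h x $ j))" for j
    using f h by (simp_all add: integrable_vec_iff integrable_cnj)
  have fm [measurable]: "(\<lambda>x. f x $ j) \<in> borel_measurable borel"
    and hm [measurable]: "(\<lambda>x. cnj (h x $ j)) \<in> borel_measurable borel" for j
    using fj[of j] chj[of j] by auto
  have i1: "integrable lborel (\<lambda>p. ft (\<lambda>x. f x $ j) p * cnj (h p $ j))" for j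
    by (intro integrable_unimodular_mult[OF chj _ cmod_ft_le[OF fj]]) measurable
  have i2: "integrable lborel (\<lambda>x. f x $ j * ft (\<lambda>p. cnj (h p $ j)) x)" for j
    using integrable_unimodular_mult[OF fj[of j] _ cmod_ft_le[OF chj[of j]]] by (simp add: mult.commute)
  have c: "cnj (ft (\<lambda>x. h x $ j) (- x)) = ft (\<lambda>p. cnj (h p $ j)) x" for j x
    unfolding ft_def by (subst Bochner_Integration.integral_cnj[symmetric]) (simp add: exp_cnj)
  have "(LBINT p. vdot (FT f p) (h p))
      = (LBINT p. ?c * (ft (\<lambda>x. f x $ 1) p * cnj (h p $ 1) + ft (\<lambda>x. f x $ 2) p * cnj (h p $ 2)))"
    by (simp add: vdot_expand FT_nth[OF f] distrib_left mult.assoc)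
  also have "\<dots> = ?c * ((LBINT p. ft (\<lambda>x. f x $ 1) p * cnj (h p $ 1)) + (LBINT p. ft (\<lambda>x. f x $ 2) p * cnj (h p $ 2)))"
    using i1 by simp
  also have "\<dots> = ?c * ((LBINT x. f x $ 1 * ft (\<lambda>p. cnj (h p $ 1)) x) + (LBINT x. f x $ 2 * ft (\<lambda>p. cnj (h p $ 2)) x))"
    unfolding ft_multiplication_formula[OF fj chj] by (rule refl)
  also have "?c * ((LBINT x. f x $ 1 * ft (\<lambda>p. cnj (h p $ 1)) x) + (LBINT x. f x $ 2 * ft (\<lambda>p. cnj (h p $ 2)) x))
     = (LBINT x. ?c * (f x $ 1 * ft (\<lambda>p. cnj (h p $ 1)) x + f x $ 2 * ft (\<lambda>p. cnj (h p $ 2)) x))"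
    using i2 by simp
  also have "\<dots> = (LBINT x. vdot (f x) (FT h (- x)))"
    by (simp add: vdot_expand FT_nth[OF h] c distrib_left mult_ac)
  finally show ?thesis .
qed

section \<open>The Fourier transform on \<open>L2\<close>\<close>

definition trunc :: "real \<Rightarrow> L2 \<Rightarrow> real \<Rightarrow> complex^2" where
  "trunc R f x = indicat_real {-R..R} x *\<^sub>R rep_L2 f x"

lemma trunc_measurable [measurable]: "trunc R f \<in> borel_measurable borel"
  unfolding trunc_def by measurable

lemma square_integrable_trunc: "square_integrable (trunc R f)"
  by (rule square_integrable_bound[OF square_integrable_rep[of f] trunc_measurable, where K = 1])
    (auto simp: trunc_def indicator_def)

lemma integrable_trunc: "integrable lborel (trunc R f)"
proof (rule integrable_dominated)
  show "integrable lborel (\<lambda>x. indicator {-R..R} x + (norm (rep_L2 f x))\<^sup>2)"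
  proof (rule Bochner_Integration.integrable_add)
    show "integrable lborel (indicat_real {-R..R})"
      by (rule integrable_real_indicator) (auto simp: emeasure_lborel_Icc_eq)
  qed (use square_integrable_rep[of f] in \<open>simp add: square_integrable_def\<close>)
  show "AE x in lborel. norm (trunc R f x) \<le> norm (indicat_real {-R..R} x + (norm (rep_L2 f x))\<^sup>2)"
  proof (rule AE_I2)
    fix x
    have "norm (rep_L2 f x) \<le> 1 + (norm (rep_L2 f x))\<^sup>2"
      using sum_squares_bound[of "norm (rep_L2 f x)" 1] norm_ge_zero[of "rep_L2 f x"]
      unfolding mult_1_right power_one by linarith
    then show "norm (trunc R f x) \<le> norm (indicat_real {-R..R} x + (norm (rep_L2 f x))\<^sup>2)"
      by (cases "x \<in> {-R..R}") (auto simp: trunc_def)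
  qed
qed simp

lemma abs_trunc_tendsto: "((\<lambda>R. abs_L2 (trunc R f)) \<longlongrightarrow> f) at_top"
proof -
  have "((\<lambda>R. abs_L2 (trunc R f)) \<longlongrightarrow> abs_L2 (rep_L2 f)) at_top"
  proof (rule L2_tendsto_dominated_at_top[where w = "\<lambda>x. norm (rep_L2 f x)"])
    have "\<forall>\<^sub>F R in at_top. trunc R f x = rep_L2 f x" for x
      by (rule eventually_mono[OF eventually_ge_at_top[of "\<bar>x\<bar>"]]) (auto simp: trunc_def indicator_def)
    then show "AE x in lborel. ((\<lambda>R. trunc R f x) \<longlongrightarrow> rep_L2 f x) at_top"
      by (intro AE_I2 tendsto_eventually)
    show "integrable lborel (\<lambda>x. (norm (rep_L2 f x))\<^sup>2)"
      using square_integrable_rep[of f] by (simp add: square_integrable_def)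
  qed (auto simp: square_integrable_trunc square_integrable_rep trunc_def indicator_def)
  then show ?thesis by simp
qed

definition FR :: "real \<Rightarrow> L2 \<Rightarrow> L2" where
  "FR R f = abs_L2 (FT (trunc R f))"

lemma FT_diff_norm:
  assumes "integrable lborel f" "square_integrable f" "integrable lborel g" "square_integrable g"
  shows "norm (abs_L2 (FT f) - abs_L2 (FT g)) = norm (abs_L2 f - abs_L2 g)"
proof -
  have "abs_L2 (FT f) - abs_L2 (FT g) = abs_L2 (FT (\<lambda>x. f x - g x))"
    using assms by (simp add: abs_L2_minus FT_plancherel FT_diff)
  then show ?thesis using assms
    by (simp add: FT_plancherel(2) square_integrable_diff abs_L2_minus)
qed

text \<open>The condition under the definite description of \<open>fourier\<close> is convergence in
  norm of the truncated transforms, and such limits are unique.\<close>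

lemma fourier_eqI:
  assumes lim: "((\<lambda>R. FR R f) \<longlongrightarrow> g) at_top"
  shows "fourier f = g"
proof -
  have *: "((\<lambda>R. \<integral>\<^sup>+p. ennreal ((norm (rep_L2 h p - complex_of_real (1 / sqrt (2 * pi)) *s
        (\<integral>r\<in>{-R..R}. exp (- (\<i> * of_real (p * r))) *s rep_L2 f r \<partial>lborel)))\<^sup>2) \<partial>lborel) \<longlongrightarrow> 0) at_top
     \<longleftrightarrow> ((\<lambda>R. FR R f) \<longlongrightarrow> h) at_top" for h
  proof -
    have FT: "complex_of_real (1 / sqrt (2 * pi)) *s
        (\<integral>r\<in>{-R..R}. exp (- (\<i> * of_real (p * r))) *s rep_L2 f r \<partial>lborel) = FT (trunc R f) p" for R p
    proof -
      have "indicat_real {-R..R} r *\<^sub>R (c *s v) = c *s (indicat_real {-R..R} r *\<^sub>R v)" for r c and v :: "complex^2"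
        by (simp add: indicator_def)
      then show ?thesis unfolding FT_def trunc_def set_lebesgue_integral_def by simp
    qed
    have nn: "(\<integral>\<^sup>+p. ennreal ((norm (rep_L2 h p - FT (trunc R f) p))\<^sup>2) \<partial>lborel) = ennreal ((norm (FR R f - h))\<^sup>2)" for R
    proof -
      have s: "square_integrable (FT (trunc R f))" by (intro FT_plancherel integrable_trunc square_integrable_trunc)
      from nn_integral_norm_L2[OF square_integrable_diff[OF square_integrable_rep[of h] s]]
      show ?thesis
        by (simp add: FR_def norm_minus_commute[of "abs_L2 (FT _)"] flip: abs_L2_minus[OF square_integrable_rep s])
    qed
    have "((\<lambda>R. \<integral>\<^sup>+p. ennreal ((norm (rep_L2 h p - FT (trunc R f) p))\<^sup>2) \<partial>lborel) \<longlongrightarrow> 0) at_top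
        \<longleftrightarrow> ((\<lambda>R. (norm (FR R f - h))\<^sup>2) \<longlongrightarrow> 0) at_top"
      unfolding nn ennreal_0[symmetric] by (rule tendsto_ennreal_iff) auto
    also have "\<dots> \<longleftrightarrow> ((\<lambda>R. norm (FR R f - h)) \<longlongrightarrow> 0) at_top"
    proof
      assume "((\<lambda>R. (norm (FR R f - h))\<^sup>2) \<longlongrightarrow> 0) at_top"
      from tendsto_real_sqrt[OF this] show "((\<lambda>R. norm (FR R f - h)) \<longlongrightarrow> 0) at_top" by simp
    next
      assume "((\<lambda>R. norm (FR R f - h)) \<longlongrightarrow> 0) at_top"
      from tendsto_power[OF this, of 2] show "((\<lambda>R. (norm (FR R f - h))\<^sup>2) \<longlongrightarrow> 0) at_top" by simp
    qed
    also have "\<dots> \<longleftrightarrow> ((\<lambda>R. FR R f) \<longlongrightarrow> h) at_top" by (simp add: tendsto_norm_zero_iff LIM_zero_iff)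
    finally show ?thesis unfolding FT .
  qed
  show ?thesis
    unfolding fourier_def *
  proof (rule the_equality)
    show "h = g" if "((\<lambda>R. FR R f) \<longlongrightarrow> h) at_top" for h
      by (rule tendsto_unique[OF _ that lim]) simp
  qed (rule lim)
qed

text \<open>By Plancherel the truncated transforms have the same mutual distances as the
  truncations, so they form a Cauchy family.\<close>

lemma fourier_tendsto: "((\<lambda>R. FR R f) \<longlongrightarrow> fourier f) at_top"
proof -
  have FRd: "norm (FR R f - FR S f) = norm (abs_L2 (trunc R f) - abs_L2 (trunc S f))" for R S
    unfolding FR_def by (intro FT_diff_norm integrable_trunc square_integrable_trunc)
  have cn: "(\<lambda>n. abs_L2 (trunc (real n) f)) \<longlonglongrightarrow> f"
    by (rule filterlim_compose[OF abs_trunc_tendsto filterlim_real_sequentially])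
  have "Cauchy (\<lambda>n. FR (real n) f)"
    using LIMSEQ_imp_Cauchy[OF cn] by (simp add: Cauchy_def dist_norm FRd)
  then obtain g where g: "(\<lambda>n. FR (real n) f) \<longlonglongrightarrow> g" using Cauchy_convergent convergent_def by blast
  \<comment> \<open>Exact distance to the limit along integers, which carries the convergence over
    to real truncation radii.\<close>
  have "norm (FR R f - g) = norm (abs_L2 (trunc R f) - f)" for R
  proof (rule LIMSEQ_unique)
    show "(\<lambda>n. norm (FR R f - FR (real n) f)) \<longlonglongrightarrow> norm (FR R f - g)" by (intro tendsto_intros g)
    show "(\<lambda>n. norm (FR R f - FR (real n) f)) \<longlonglongrightarrow> norm (abs_L2 (trunc R f) - f)"
      unfolding FRd by (intro tendsto_intros cn)
  qed
  moreover have "((\<lambda>R. norm (abs_L2 (trunc R f) - f)) \<longlongrightarrow> 0) at_top"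
    using abs_trunc_tendsto[of f] by (simp add: tendsto_norm_zero_iff LIM_zero_iff)
  ultimately have "((\<lambda>R. norm (FR R f - g)) \<longlongrightarrow> 0) at_top" by simp
  then have lim: "((\<lambda>R. FR R f) \<longlongrightarrow> g) at_top" by (simp add: tendsto_norm_zero_iff LIM_zero_iff)
  then show ?thesis using fourier_eqI[OF lim] by simp
qed

theorem fourier_abs:
  assumes f: "integrable lborel f" "square_integrable f"
  shows "fourier (abs_L2 f) = abs_L2 (FT f)"
proof (rule fourier_eqI)
  have "norm (FR R (abs_L2 f) - abs_L2 (FT f)) = norm (abs_L2 (trunc R (abs_L2 f)) - abs_L2 f)" for R
    unfolding FR_def by (intro FT_diff_norm integrable_trunc square_integrable_trunc f)
  moreover have "((\<lambda>R. norm (abs_L2 (trunc R (abs_L2 f)) - abs_L2 f)) \<longlongrightarrow> 0) at_top"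
    using abs_trunc_tendsto[of "abs_L2 f"] by (simp add: tendsto_norm_zero_iff LIM_zero_iff)
  ultimately have "((\<lambda>R. norm (FR R (abs_L2 f) - abs_L2 (FT f))) \<longlongrightarrow> 0) at_top" by simp
  then show "((\<lambda>R. FR R (abs_L2 f)) \<longlongrightarrow> abs_L2 (FT f)) at_top" by (simp add: tendsto_norm_zero_iff LIM_zero_iff)
qed

lemma FT_cong_AE:
  assumes "f \<in> borel_measurable borel" "g \<in> borel_measurable borel" "AE x in lborel. f x = g x"
  shows "FT f = FT g"
proof
  fix p
  have e: "(\<lambda>x. exp (- (\<i> * of_real (p * x))) *s h x) \<in> borel_measurable lborel"
    if [measurable]: "h \<in> borel_measurable borel" for h :: "real \<Rightarrow> complex^2"
    unfolding borel_measurable_vec_iff vector_smult_component by measurable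
  have "(LBINT x. exp (- (\<i> * of_real (p * x))) *s f x) = (LBINT x. exp (- (\<i> * of_real (p * x))) *s g x)"
    by (rule integral_cong_AE[OF e e]) (use assms in auto)
  then show "FT f p = FT g p" unfolding FT_def by simp
qed

lemma fourier_add: "fourier (f + g) = fourier f + fourier g"
proof (rule fourier_eqI)
  have "FR R (f + g) = FR R f + FR R g" for R
  proof -
    have "f + g = abs_L2 (\<lambda>x. rep_L2 f x + rep_L2 g x)"
      using abs_L2_add[OF square_integrable_rep square_integrable_rep, of f g] by simp
    then have "AE x in lborel. rep_L2 (f + g) x = rep_L2 f x + rep_L2 g x"
      using rep_abs_L2[OF square_integrable_add[OF square_integrable_rep square_integrable_rep, of f g]] by simp
    then have "AE x in lborel. trunc R (f + g) x = trunc R f x + trunc R g x"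
      by eventually_elim (simp add: trunc_def scaleR_add_right)
    then have "FT (trunc R (f + g)) = FT (\<lambda>x. trunc R f x + trunc R g x)" by (intro FT_cong_AE) auto
    then show ?thesis unfolding FR_def
      by (simp add: FT_add integrable_trunc abs_L2_add FT_plancherel square_integrable_trunc)
  qed
  then show "((\<lambda>R. FR R (f + g)) \<longlongrightarrow> fourier f + fourier g) at_top"
    by (simp add: tendsto_add fourier_tendsto)
qed

lemma fourier_scaleC: "fourier (c *\<^sub>C f) = c *\<^sub>C fourier f"
proof (rule fourier_eqI)
  have "FR R (c *\<^sub>C f) = c *\<^sub>C FR R f" for R
  proof -
    have "c *\<^sub>C f = abs_L2 (\<lambda>x. c *s rep_L2 f x)"
      using abs_L2_scaleC[OF square_integrable_rep, of c f] by simp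
    then have "AE x in lborel. rep_L2 (c *\<^sub>C f) x = c *s rep_L2 f x"
      using rep_abs_L2[OF square_integrable_vscale[OF square_integrable_rep, of c f]] by simp
    then have "AE x in lborel. trunc R (c *\<^sub>C f) x = c *s trunc R f x"
      by eventually_elim (simp add: trunc_def vec_eq_iff)
    then have "FT (trunc R (c *\<^sub>C f)) = FT (\<lambda>x. c *s trunc R f x)"
      by (intro FT_cong_AE borel_measurable_vscale) auto
    then show ?thesis unfolding FR_def
      by (simp add: FT_vscale integrable_trunc abs_L2_scaleC FT_plancherel square_integrable_trunc)
  qed
  then show "((\<lambda>R. FR R (c *\<^sub>C f)) \<longlongrightarrow> c *\<^sub>C fourier f) at_top"
    by (simp add: tendsto_scaleC fourier_tendsto)
qed

lemma fourier_norm: "norm (fourier f) = norm f"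
proof -
  have "((\<lambda>R. norm (FR R f)) \<longlongrightarrow> norm (fourier f)) at_top" by (intro tendsto_intros fourier_tendsto)
  moreover have "((\<lambda>R. norm (abs_L2 (trunc R f))) \<longlongrightarrow> norm f) at_top" by (intro tendsto_intros abs_trunc_tendsto)
  moreover have "norm (FR R f) = norm (abs_L2 (trunc R f))" for R
    unfolding FR_def by (intro FT_plancherel integrable_trunc square_integrable_trunc)
  ultimately show ?thesis using tendsto_unique[OF trivial_limit_at_top_linorder] by simp
qed

definition reflect :: "L2 \<Rightarrow> L2" where
  "reflect f = abs_L2 (\<lambda>x. rep_L2 f (- x))"

lemma square_integrable_reflect:
  assumes "square_integrable f"
  shows "square_integrable (\<lambda>x. f (- x))"
proof -
  have [measurable]: "f \<in> borel_measurable borel" using assms by (simp add: square_integrable_def)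
  have "integrable lborel (\<lambda>x. (norm (f (0 + (-1) * x)))\<^sup>2)"
    using assms by (intro lborel_integrable_real_affine) (auto simp: square_integrable_def)
  then show ?thesis by (simp add: square_integrable_def)
qed

lemma reflect_abs:
  assumes f: "square_integrable f"
  shows "reflect (abs_L2 f) = abs_L2 (\<lambda>x. f (- x))"
proof -
  have [measurable]: "f \<in> borel_measurable borel" using f by (simp add: square_integrable_def)
  have "AE x in lborel. rep_L2 (abs_L2 f) (0 + (-1) * x) = f (0 + (-1) * x)"
    by (rule AE_borel_affine[where P = "\<lambda>x. rep_L2 (abs_L2 f) x = f x"]) (use rep_abs_L2[OF f] in auto)
  then show ?thesis unfolding reflect_def
    by (intro abs_L2_eqI square_integrable_reflect f square_integrable_rep) simp
qed

lemma reflect_norm: "norm (reflect f) = norm f"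
proof (cases f)
  case (1 h)
  have "(norm (reflect f))\<^sup>2 = (LBINT x. (norm (h (- x)))\<^sup>2)"
    using 1 by (simp add: reflect_abs norm_abs_L2 square_integrable_reflect)
  also have "\<dots> = (norm f)\<^sup>2"
    using 1 lborel_integral_real_affine[of "-1" "\<lambda>x. (norm (h x))\<^sup>2" 0] by (simp add: norm_abs_L2)
  finally show ?thesis by (simp add: power2_eq_iff_nonneg)
qed

lemma reflect_diff: "reflect (f - g) = reflect f - reflect g"
  by (cases f; cases g) (simp add: reflect_abs abs_L2_minus square_integrable_diff square_integrable_reflect)

lemma reflect_tendsto: "(f \<longlongrightarrow> l) F \<Longrightarrow> ((\<lambda>t. reflect (f t)) \<longlongrightarrow> reflect l) F"
  by (subst LIM_zero_iff[symmetric], subst tendsto_norm_zero_iff[symmetric], subst reflect_diff[symmetric],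
      subst reflect_norm) (simp add: tendsto_norm_zero_iff LIM_zero_iff)

lemma fourier_adjoint: "cinner (fourier f) h = cinner f (reflect (fourier h))"
proof -
  have "cinner (FR R f) (abs_L2 (trunc R h)) = cinner (abs_L2 (trunc R f)) (reflect (FR R h))" for R
    unfolding FR_def
    by (simp add: reflect_abs cinner_abs_L2 FT_plancherel integrable_trunc square_integrable_trunc
        square_integrable_reflect FT_adjoint)
  moreover have "((\<lambda>R. cinner (FR R f) (abs_L2 (trunc R h))) \<longlongrightarrow> cinner (fourier f) h) at_top"
    by (intro cinner.tendsto fourier_tendsto abs_trunc_tendsto)
  moreover have "((\<lambda>R. cinner (abs_L2 (trunc R f)) (reflect (FR R h))) \<longlongrightarrow> cinner f (reflect (fourier h))) at_top"
    by (intro cinner.tendsto fourier_tendsto abs_trunc_tendsto reflect_tendsto)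
  ultimately show ?thesis using tendsto_unique[OF trivial_limit_at_top_linorder] by simp
qed

text \<open>An isometry whose adjoint is also an isometry is unitary: expand the square of the norm.\<close>

lemma isometry_adjoint_inverse:
  fixes S T :: "'a::complex_hilbert_space \<Rightarrow> 'a"
  assumes "\<And>x. norm (S x) = norm x" "\<And>x. norm (T x) = norm x" "\<And>x y. cinner (S x) y = cinner x (T y)"
  shows "S (T x) = x"
proof -
  have "cinner (S (T x)) x = complex_of_real ((norm x)\<^sup>2)" by (simp add: assms flip: cinner_self) (simp add: cinner_self assms)
  then have "S (T x) \<bullet> x = (norm x)\<^sup>2" by (metis Re_cinner Re_complex_of_real)
  moreover have "(norm (S (T x) - x))\<^sup>2 = (norm (S (T x)))\<^sup>2 - 2 * (S (T x) \<bullet> x) + (norm x)\<^sup>2"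
    by (simp only: power2_norm_eq_inner) (simp add: inner_simps inner_commute)
  ultimately have "(norm (S (T x) - x))\<^sup>2 = 0" by (simp add: assms)
  then show ?thesis by simp
qed

text \<open>\<open>fourier\<close> and its reflection are mutually adjoint isometries, so each
  inverts the other; no pointwise inversion formula is involved.\<close>

lemma fourier_inverse:
  "fourier (reflect (fourier h)) = h" "reflect (fourier (fourier f)) = f"
proof -
  have adj: "cinner (reflect (fourier x)) y = cinner x (fourier y)" for x y
    using fourier_adjoint[of y x] cinner_commute[of "reflect (fourier x)" y] cinner_commute[of x "fourier y"] by simp
  show "fourier (reflect (fourier h)) = h"
    by (rule isometry_adjoint_inverse[where S = fourier and T = "\<lambda>h. reflect (fourier h)"])
      (auto simp: fourier_norm reflect_norm fourier_adjoint)
  show "reflect (fourier (fourier f)) = f"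
    by (rule isometry_adjoint_inverse[where S = "\<lambda>h. reflect (fourier h)" and T = fourier])
      (auto simp: fourier_norm reflect_norm intro: adj)
qed

theorem fourier_unitary: "unitary_operator fourier"
proof -
  have "surj fourier" using fourier_inverse(1) by (rule surjI)
  then show ?thesis
    unfolding unitary_operator_def clinear_on_def
    by (simp add: fourier_add fourier_scaleC fourier_adjoint fourier_inverse)
qed

lemma inv_fourier: "inv fourier = (\<lambda>h. reflect (fourier h))"
proof
  fix h
  show "inv fourier h = reflect (fourier h)"
    by (rule inv_f_eq[OF bij_is_inj[OF unitary_operator_bounded_linear(4)[OF fourier_unitary]] fourier_inverse(1)])
qed

section \<open>Fourier multipliers\<close>

lemma fourier_facts:
  "fourier (inv fourier f) = f" "inv fourier (fourier f) = f" "norm (inv fourier f) = norm f"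
  "inv fourier (c *\<^sub>C f) = c *\<^sub>C inv fourier f" "inv fourier (f + g) = inv fourier f + inv fourier g"
  "cinner (inv fourier f) g = cinner f (fourier g)" "cinner (fourier f) (fourier g) = cinner f g"
proof -
  note U = unitary_operator_bounded_linear[OF fourier_unitary]
  show 1: "fourier (inv fourier f) = f" for f using bij_is_surj[OF U(4)] by (simp add: surj_f_inv_f)
  show 2: "inv fourier (fourier f) = f" for f using bij_is_inj[OF U(4)] by simp
  show "norm (inv fourier f) = norm f" using fourier_norm[of "inv fourier f"] by (simp add: 1)
  show "inv fourier (c *\<^sub>C f) = c *\<^sub>C inv fourier f"
    using 2[of "c *\<^sub>C inv fourier f"] by (simp add: fourier_scaleC 1)
  show "inv fourier (f + g) = inv fourier f + inv fourier g"
    using 2[of "inv fourier f + inv fourier g"] by (simp add: fourier_add 1)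
  show 7: "cinner (fourier f) (fourier g) = cinner f g" for f g by (rule U(5))
  show "cinner (inv fourier f) g = cinner f (fourier g)"
    using 7[of "inv fourier f" g] by (simp add: 1)
qed

lemma inv_fourier_bounded_linear: "bounded_linear (inv fourier)"
  by (rule bounded_linear_intro[of _ 1]) (auto simp: fourier_facts simp flip: scaleC_of_real)

lemma fourier_bounded_linear: "bounded_linear fourier"
  by (rule unitary_operator_bounded_linear(1)[OF fourier_unitary])

lemmas fourier_diff = linear_diff[OF bounded_linear.linear[OF fourier_bounded_linear]]
lemmas fourier_scaleR = linear_scale[OF bounded_linear.linear[OF fourier_bounded_linear]]

lemma fourier_tendsto_iff: "((\<lambda>t. fourier (f t)) \<longlongrightarrow> fourier l) F \<longleftrightarrow> (f \<longlongrightarrow> l) F"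
  using bounded_linear.tendsto[OF inv_fourier_bounded_linear, of "\<lambda>t. fourier (f t)" "fourier l" F]
    bounded_linear.tendsto[OF fourier_bounded_linear, of f l F]
  by (auto simp: fourier_facts)

lemma fourier_eq_iff: "fourier f = fourier g \<longleftrightarrow> f = g"
  by (metis fourier_facts(2))

definition fmult :: "(real \<Rightarrow> complex^2^2) \<Rightarrow> L2 \<Rightarrow> L2" where
  "fmult N f = inv fourier (mult_op N (fourier f))"

lemma fmult_linear:
  assumes "bounded_symbol N K"
  shows "fmult N (f + g) = fmult N f + fmult N g" "fmult N (c *\<^sub>C f) = c *\<^sub>C fmult N f"
    "bounded_linear (fmult N)"
proof -
  show 1: "fmult N (f + g) = fmult N f + fmult N g" for f g
    by (simp add: fmult_def fourier_add mult_op_linear[OF assms] fourier_facts)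
  show 2: "fmult N (c *\<^sub>C f) = c *\<^sub>C fmult N f" for c f
    by (simp add: fmult_def fourier_scaleC mult_op_linear[OF assms] fourier_facts)
  show "bounded_linear (fmult N)"
    unfolding fmult_def
    by (intro bounded_linear_compose[OF inv_fourier_bounded_linear]
        bounded_linear_compose[OF mult_op_linear(4)[OF assms]] fourier_bounded_linear)
qed

lemma fmult_fmult:
  assumes "bounded_symbol M K" "bounded_symbol N L"
  shows "fmult M (fmult N f) = fmult (\<lambda>p. M p ** N p) f"
  by (simp add: fmult_def fourier_facts mult_op_mult_op[OF assms])

lemma fourier_fmult: "fourier (fmult N f) = mult_op N (fourier f)"
  by (simp add: fmult_def fourier_facts)

text \<open>The pointwise adjoint, which is also the inverse, is carried as an explicit argument: in
  the applications it is again a symbol of the same family with time or phase reversed.\<close>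

definition unitary_symbol :: "(real \<Rightarrow> complex^2^2) \<Rightarrow> (real \<Rightarrow> complex^2^2) \<Rightarrow> bool" where
  "unitary_symbol N N' \<longleftrightarrow> (\<forall>i j. (\<lambda>x. N x $ i $ j) \<in> borel_measurable borel) \<and>
     (\<forall>i j. (\<lambda>x. N' x $ i $ j) \<in> borel_measurable borel) \<and>
     (\<forall>x u v. vdot (N x *v u) v = vdot u (N' x *v v)) \<and> (\<forall>x. N x ** N' x = mat 1) \<and> (\<forall>x. N' x ** N x = mat 1)"

lemma norm_vdot: "complex_of_real ((norm v)\<^sup>2) = vdot v v"
  unfolding norm_vec2_sq vdot_def by (simp add: complex_norm_square[symmetric])

lemma unitary_symbol_sym:
  assumes "unitary_symbol N N'" shows "unitary_symbol N' N"
proof -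
  have "vdot (N' x *v u) v = vdot u (N x *v v)" for x u v
  proof -
    have c: "vdot a b = cnj (vdot b a)" for a b by (simp add: vdot_def mult.commute)
    show ?thesis using assms c[of "N' x *v u" v] c[of "N x *v v" u] by (simp add: unitary_symbol_def)
  qed
  then show ?thesis using assms by (simp add: unitary_symbol_def)
qed

lemma unitary_symbol_norm:
  assumes "unitary_symbol N N'" shows "norm (N x *v v) = norm v" "bounded_symbol N 1"
proof -
  have "vdot (N x *v v) (N x *v v) = vdot v v" for x v
    using assms by (simp add: unitary_symbol_def matrix_vector_mul_assoc)
  then have "(norm (N x *v v))\<^sup>2 = (norm v)\<^sup>2" for x v
    unfolding norm_vdot[symmetric] by (simp only: of_real_eq_iff)
  then show n: "norm (N x *v v) = norm v" for x v by (simp add: power2_eq_iff_nonneg)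
  show "bounded_symbol N 1" using assms n by (simp add: bounded_symbol_def unitary_symbol_def)
qed

lemma fmult_unitary:
  assumes N: "unitary_symbol N N'"
  shows "unitary_operator (fmult N)" "fmult N' (fmult N f) = f" "fmult N (fmult N' f) = f"
proof -
  note b = unitary_symbol_norm(2)[OF N] and b' = unitary_symbol_norm(2)[OF unitary_symbol_sym[OF N]]
  show 1: "fmult N' (fmult N f) = f" for f
    using N by (simp add: fmult_fmult[OF b' b] unitary_symbol_def) (simp add: fmult_def mult_op_one fourier_facts)
  show 2: "fmult N (fmult N' f) = f" for f
    using N by (simp add: fmult_fmult[OF b b'] unitary_symbol_def) (simp add: fmult_def mult_op_one fourier_facts)
  have "cinner (fmult N f) (fmult N g) = cinner f g" for f g
  proof -
    have "cinner (fmult N f) (fmult N g) = cinner (mult_op N (fourier f)) (mult_op N (fourier g))"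
      by (simp add: fourier_facts fourier_fmult fmult_def[of N f])
    also have "\<dots> = cinner (fourier f) (mult_op N' (mult_op N (fourier g)))"
      using N by (intro cinner_mult_op[OF b b']) (auto simp: unitary_symbol_def)
    also have "mult_op N' (mult_op N (fourier g)) = fourier g"
      using N by (simp add: mult_op_mult_op[OF b' b] unitary_symbol_def mult_op_one)
    finally show ?thesis by (simp add: fourier_facts)
  qed
  moreover have "surj (fmult N)" using 2 by (rule surjI)
  ultimately show "unitary_operator (fmult N)"
    unfolding unitary_operator_def clinear_on_def by (simp add: fmult_linear[OF b])
qed

section \<open>The weak derivative in the momentum representation\<close>

lemma ft_deriv:
  assumes d: "\<And>x. (\<phi> has_real_derivative \<phi>' x) (at x)"
    and c: "compactly_supported \<phi>" "compactly_supported \<phi>'"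
  shows "ft (\<lambda>x. of_real (\<phi>' x)) p = \<i> * of_real p * ft (\<lambda>x. of_real (\<phi> x)) p"
proof -
  obtain R1 where R1: "\<And>x. \<bar>x\<bar> > R1 \<Longrightarrow> \<phi> x = 0" using c(1) by (auto simp: compactly_supported_def)
  obtain R2 where R2: "\<And>x. \<bar>x\<bar> > R2 \<Longrightarrow> \<phi>' x = 0" using c(2) by (auto simp: compactly_supported_def)
  define R where "R = max (max R1 R2) 0 + 1"
  define e where "e x = exp (- (\<i> * of_real (p * x)))" for x :: real
  have de: "(e has_vector_derivative - (\<i> * of_real p) * e x) (at x)" for x
  proof -
    have "((\<lambda>z. exp (- (\<i> * of_real p) * z)) has_field_derivative - (\<i> * of_real p) * e x) (at (of_real x))"
      by (auto intro!: derivative_eq_intros simp: e_def mult_ac)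
    from has_vector_derivative_real_field[OF this] show ?thesis
      by (simp add: e_def[abs_def] mult_ac)
  qed
  let ?f = "\<lambda>x. e x * of_real (\<phi>' x) + (- (\<i> * of_real p) * e x) * of_real (\<phi> x)"
  have ec: "continuous_on UNIV e" unfolding e_def by (intro continuous_intros)
  have "has_bochner_integral lborel (\<lambda>x. indicator {-R..R} x *\<^sub>R ?f x) (e R * of_real (\<phi> R) - e (- R) * of_real (\<phi> (- R)))"
  proof (rule has_bochner_integral_FTC_Icc)
    show "-R \<le> R" by (simp add: R_def)
    fix x
    have "((\<lambda>x. complex_of_real (\<phi> x)) has_vector_derivative of_real (\<phi>' x)) (at x)"
      using d[of x] by (intro has_vector_derivative_of_real) (simp add: has_real_derivative_iff_has_vector_derivative)
    from has_vector_derivative_mult[OF de this]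
    have "((\<lambda>x. e x * of_real (\<phi> x)) has_vector_derivative ?f x) (at x)" .
    then show "((\<lambda>x. e x * of_real (\<phi> x)) has_vector_derivative ?f x) (at x within {-R..R})"
      by (rule has_vector_derivative_at_within)
  next
    show "continuous_on {-R..R} ?f"
      using c ec unfolding compactly_supported_def
      by (intro continuous_intros) (auto intro: continuous_on_subset)
  qed
  moreover have "indicator {-R..R} x *\<^sub>R ?f x = ?f x" for x
  proof (cases "x \<in> {-R..R}")
    case False
    then have "\<bar>x\<bar> > R1" "\<bar>x\<bar> > R2" by (auto simp: R_def abs_if)
    then show ?thesis using R1[of x] R2[of x] by simp
  qed simp
  moreover have "\<phi> R = 0" "\<phi> (- R) = 0" using R1[of R] R1[of "-R"] by (auto simp: R_def)
  ultimately have 0: "has_bochner_integral lborel ?f 0" by simp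
  have i: "integrable lborel (\<lambda>x. e x * of_real (f x))" if "compactly_supported f" for f
    unfolding e_def
    by (intro integrable_unimodular_mult[where K = 1] integrable_of_real compactly_supported_integrable that) auto
  have "(LBINT x. ?f x) = (LBINT x. e x * of_real (\<phi>' x)) + - (\<i> * of_real p) * (LBINT x. e x * of_real (\<phi> x))"
    unfolding mult.assoc[of "- (\<i> * complex_of_real p)"]
    by (simp only: i c integrable_mult_right Bochner_Integration.integral_add integral_mult_right_zero)
  with 0 show ?thesis by (simp add: has_bochner_integral_iff ft_def e_def)
qed

lemma FT_vtest:
  assumes "compactly_supported \<phi>"
  shows "fourier (vtest \<phi> j) = abs_L2 (FT (\<lambda>x. \<phi> x *\<^sub>R axis j 1))"
    "square_integrable (FT (\<lambda>x. \<phi> x *\<^sub>R axis j 1))"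
    "FT (\<lambda>x. \<phi> x *\<^sub>R axis j 1) p = (complex_of_real (1 / sqrt (2 * pi)) * ft (\<lambda>x. of_real (\<phi> x)) p) *s axis j 1"
proof -
  have i: "integrable lborel (\<lambda>x. \<phi> x *\<^sub>R axis j (1::complex))"
    using compactly_supported_integrable(1)[OF assms] by simp
  note s = square_integrable_vtest[OF assms, of j]
  show "fourier (vtest \<phi> j) = abs_L2 (FT (\<lambda>x. \<phi> x *\<^sub>R axis j 1))"
    unfolding vtest_def by (rule fourier_abs[OF i s])
  show "square_integrable (FT (\<lambda>x. \<phi> x *\<^sub>R axis j 1))" by (rule FT_plancherel(1)[OF i s])
  have "(\<lambda>x. (\<phi> x *\<^sub>R axis j (1::complex)) $ k) = (if k = j then (\<lambda>x. of_real (\<phi> x)) else (\<lambda>x. 0))" for k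
    by (auto simp: fun_eq_iff axis_def of_real_def)
  then show "FT (\<lambda>x. \<phi> x *\<^sub>R axis j 1) p = (complex_of_real (1 / sqrt (2 * pi)) * ft (\<lambda>x. of_real (\<phi> x)) p) *s axis j 1"
    unfolding vec_eq_iff FT_nth[OF i] by (auto simp: axis_def ft_def)
qed

text \<open>Turns the vector-valued integrals into inner products with \<open>vtest\<close>, to
  which unitarity of \<open>fourier\<close> applies.\<close>

lemma weak_derivative_iff_components:
  "has_weak_derivative f g \<longleftrightarrow>
     (\<forall>\<phi> j. test_function \<phi> \<longrightarrow> cinner f (vtest (deriv \<phi>) j) = - cinner g (vtest \<phi> j))"
proof -
  have "(LBINT x. deriv \<phi> x *\<^sub>R rep_L2 f x) = - (LBINT x. \<phi> x *\<^sub>R rep_L2 g x) \<longleftrightarrow>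
      (\<forall>j. cinner f (vtest (deriv \<phi>) j) = - cinner g (vtest \<phi> j))" if "test_function \<phi>" for \<phi>
    using test_function_facts[OF that]
    by (simp add: vec_eq_iff cinner_vtest integral_vec_nth integrable_compactly_supported_mult square_integrable_rep)
  then show ?thesis unfolding has_weak_derivative_def by blast
qed

text \<open>A bump has nonzero mean and hence no primitive of compact support, but its difference
  with a translate has mean 0 and does.\<close>

lemma bump_span_difference_primitive:
  assumes \<phi>: "\<phi> \<in> bump_span"
  obtains \<psi> where "test_function \<psi>" "deriv \<psi> = (\<lambda>x. \<phi> x - \<phi> (x - 1))"
proof -
  have cs: "compactly_supported \<phi>" by (intro test_function_facts(2) bump_span_test_function \<phi>)
  then obtain \<Phi> where "\<And>t. (\<Phi> has_vector_derivative \<phi> t) (at t)"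
    using antiderivative_exists[of \<phi>] by (auto simp: compactly_supported_def)
  then have \<Phi>: "(\<Phi> has_real_derivative \<phi> t) (at t)" for t
    by (simp add: has_real_derivative_iff_has_vector_derivative)
  define \<psi> where "\<psi> x = \<Phi> x - \<Phi> (x - 1)" for x
  define \<eta> where "\<eta> x = \<phi> x + (-1) * \<phi> (x - 1)" for x
  have \<eta>: "\<eta> \<in> bump_span" unfolding \<eta>_def by (intro bump_span.add bump_span.scale \<phi> bump_span_translate)
  have d: "(\<psi> has_real_derivative \<eta> x) (at x)" for x
  proof -
    have "((\<lambda>x. \<Phi> (x - 1)) has_real_derivative \<phi> (x - 1) * 1) (at x)"
      by (rule DERIV_chain2[OF \<Phi>]) (auto intro!: derivative_eq_intros)
    from DERIV_diff[OF \<Phi>[of x] this] show ?thesis by (simp add: \<psi>_def[abs_def] \<eta>_def)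
  qed
  then have dd: "deriv \<psi> = \<eta>" by (intro ext DERIV_imp_deriv)
  obtain R where R: "\<And>x. \<bar>x\<bar> > R \<Longrightarrow> \<phi> x = 0" using cs by (auto simp: compactly_supported_def)
  have "\<psi> x = 0" if x: "\<bar>x\<bar> > \<bar>R\<bar> + 1" for x
  proof -
    \<comment> \<open>The primitive over an interval of length 1 is a value of \<phi> inside that
      interval, so it vanishes once the interval leaves the support.\<close>
    obtain z where z: "x - 1 < z" "z < x" "\<Phi> x - \<Phi> (x - 1) = (x - (x - 1)) * \<phi> z"
      using MVT2[of "x - 1" x \<Phi> \<phi>] \<Phi> by auto
    then have "\<bar>z\<bar> > R" using x by (auto simp: abs_if split: if_splits)
    then show ?thesis using z R by (simp add: \<psi>_def)
  qed
  then have sup: "\<exists>R. \<forall>x. \<bar>x\<bar> > R \<longrightarrow> \<psi> x = 0" by blast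
  have "(deriv ^^ n) \<psi> differentiable (at x)" for n x
  proof (cases n)
    case 0
    then show ?thesis using d real_differentiable_def by auto
  next
    case (Suc k)
    then have "(deriv ^^ n) \<psi> = (deriv ^^ k) \<eta>" by (simp only: funpow_Suc_right o_apply dd)
    then show ?thesis using bump_span_test_function[OF \<eta>] by (simp add: test_function_def)
  qed
  with sup have "test_function \<psi>" by (simp add: test_function_def)
  moreover have "deriv \<psi> = (\<lambda>x. \<phi> x - \<phi> (x - 1))" unfolding dd \<eta>_def by simp
  ultimately show thesis by (rule that)
qed

lemma ft_translate:
  assumes "integrable lborel f"
  shows "ft (\<lambda>x. f (x - y)) p = exp (- (\<i> * of_real (p * y))) * ft f p"
proof -
  have "ft (\<lambda>x. f (x - y)) p = (LBINT x. exp (- (\<i> * of_real (p * (y + x)))) * f x)"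
    unfolding ft_def by (subst lborel_integral_real_affine[where c = 1 and t = y]) auto
  also have "(\<lambda>x. exp (- (\<i> * of_real (p * (y + x)))) * f x) = (\<lambda>x. exp (- (\<i> * of_real (p * y))) * (exp (- (\<i> * of_real (p * x))) * f x))"
    unfolding mult.assoc[symmetric] exp_add[symmetric] by (simp add: algebra_simps)
  finally show ?thesis by (simp add: ft_def)
qed

lemma cmod_one_minus_exp_le: "cmod (1 - exp (- (\<i> * complex_of_real p))) \<le> \<bar>p\<bar>"
  using iexp_approx1[of "- p" 0] by (simp add: norm_minus_commute)

text \<open>For the direction from the weak derivative, \<open>p\<close> times the transform of
  \<open>f\<close> is not yet known to be square integrable. Testing with primitives of differences
  replaces the factor \<open>p\<close> by bounded factors; these are divided out pointwise at the
  end.\<close>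

theorem weak_derivative_fourier:
  "has_weak_derivative f g \<longleftrightarrow> (AE p in lborel. rep_L2 (fourier g) p = (\<i> * of_real p) *s rep_L2 (fourier f) p)"
proof
  assume g: "AE p in lborel. rep_L2 (fourier g) p = (\<i> * of_real p) *s rep_L2 (fourier f) p"
  show "has_weak_derivative f g"
    unfolding weak_derivative_iff_components
  proof (intro allI impI)
    fix \<phi> and j :: 2 assume \<phi>: "test_function \<phi>"
    note c = test_function_facts(2,3)[OF \<phi>]
    let ?F = "\<lambda>\<phi>. FT (\<lambda>x. \<phi> x *\<^sub>R axis j 1)"
    have F: "?F (deriv \<phi>) p = (\<i> * of_real p) *s ?F \<phi> p" for p
      by (simp add: FT_vtest(3) c ft_deriv[OF test_function_facts(1)[OF \<phi>] c] vector_smult_assoc mult_ac)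
    have m: "(\<lambda>x. vdot (rep_L2 h x) (?F \<phi> x)) \<in> borel_measurable lborel" if "compactly_supported \<phi>" for h \<phi>
      unfolding measurable_lborel1 measurable_lborel2
      by (intro borel_measurable_vdot rep_L2_measurable square_integrable_measurable FT_vtest(2) that)
    have "cinner f (vtest (deriv \<phi>) j) = cinner (fourier f) (abs_L2 (?F (deriv \<phi>)))"
      by (simp add: fourier_facts(7) flip: FT_vtest(1)[OF c(2)])
    also have "\<dots> = (LBINT p. vdot (rep_L2 (fourier f) p) (?F (deriv \<phi>) p))"
      by (rule cinner_abs_L2_right[OF FT_vtest(2)[OF c(2)]])
    also have "\<dots> = (LBINT p. - vdot (rep_L2 (fourier g) p) (?F \<phi> p))"
    proof (rule integral_cong_AE[OF m[OF c(2)]])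
      show "(\<lambda>p. - vdot (rep_L2 (fourier g) p) (?F \<phi> p)) \<in> borel_measurable lborel"
        using m[OF c(1)] by simp
      show "AE p in lborel. vdot (rep_L2 (fourier f) p) (?F (deriv \<phi>) p) = - vdot (rep_L2 (fourier g) p) (?F \<phi> p)"
        using g by eventually_elim (simp add: F vdot_scale_left vdot_scale_right)
    qed
    also have "\<dots> = - cinner (fourier g) (abs_L2 (?F \<phi>))"
      by (simp add: cinner_abs_L2_right[OF FT_vtest(2)[OF c(1)]])
    also have "\<dots> = - cinner g (vtest \<phi> j)"
      by (simp add: fourier_facts(7) flip: FT_vtest(1)[OF c(1)])
    finally show "cinner f (vtest (deriv \<phi>) j) = - cinner g (vtest \<phi> j)" .
  qed
next
  assume wd: "has_weak_derivative f g"
  define z where "z p = cnj (1 - exp (- (\<i> * complex_of_real p)))" for p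
  \<comment> \<open>\<open>z\<close> is the bounded factor produced by a unit difference,
    \<open>w\<close> the one produced by its primitive. Both are bounded, so the combination
    \<open>K\<close> lies in L2 and totality of the bumps applies to it.\<close>
  define w where "w p = z p / cnj (\<i> * of_real p)" for p
  have zm [measurable]: "z \<in> borel_measurable borel" unfolding z_def by measurable
  have wm [measurable]: "w \<in> borel_measurable borel" unfolding w_def by measurable
  have z2: "cmod (z p) \<le> 2" for p
    unfolding z_def complex_mod_cnj by (rule order_trans[OF norm_triangle_ineq4]) simp
  have w1: "cmod (w p) \<le> 1" for p
    using cmod_one_minus_exp_le[of p] unfolding w_def z_def norm_divide complex_mod_cnj
    by (cases "p = 0") (auto simp: norm_mult divide_simps)
  let ?f = "rep_L2 (fourier f)" and ?g = "rep_L2 (fourier g)"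
  have ms: "(\<lambda>p. s p *s h p) \<in> borel_measurable borel"
    if [measurable]: "s \<in> borel_measurable borel" "h \<in> borel_measurable borel" for s and h :: "real \<Rightarrow> complex^2"
    unfolding borel_measurable_vec_iff vector_smult_component by measurable
  have szf: "square_integrable (\<lambda>p. z p *s ?f p)"
    by (rule square_integrable_bound[OF square_integrable_rep[of "fourier f"], where K = 2])
      (auto intro!: ms mult_right_mono z2 simp: norm_vscale)
  have swg: "square_integrable (\<lambda>p. w p *s ?g p)"
    by (rule square_integrable_bound[OF square_integrable_rep[of "fourier g"], where K = 1])
      (auto intro!: ms mult_left_le_one_le w1 simp: norm_vscale)
  note sK = square_integrable_add[OF szf swg]
  define K where "K = abs_L2 (\<lambda>p. z p *s ?f p + w p *s ?g p)"
  have "inv fourier K = 0"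
  proof (rule L2_total)
    fix a b c :: real and j assume "a < b" "c > 0"
    then have \<phi>: "bump c 0 0 a b \<in> bump_span" (is "?\<phi> \<in> _") by (rule bump_span.bump)
    note c\<phi> = test_function_facts(2)[OF bump_span_test_function[OF \<phi>]]
    obtain \<psi> where \<psi>: "test_function \<psi>" "deriv \<psi> = (\<lambda>x. ?\<phi> x - ?\<phi> (x - 1))"
      using bump_span_difference_primitive[OF \<phi>] .
    note c = test_function_facts(2,3)[OF \<psi>(1)]
    let ?F = "\<lambda>\<phi>. FT (\<lambda>x. \<phi> x *\<^sub>R axis j 1)"
    have i\<phi>: "integrable lborel (\<lambda>x. complex_of_real (?\<phi> x))"
      by (intro integrable_of_real compactly_supported_integrable c\<phi>)
    have ti: "integrable lborel (\<lambda>x. complex_of_real (?\<phi> (x - 1)))"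
      using lborel_integrable_real_affine[OF i\<phi>, of 1 "-1"] by simp
    have f\<psi>: "ft (\<lambda>x. of_real (deriv \<psi> x)) p = (1 - exp (- (\<i> * of_real p))) * ft (\<lambda>x. of_real (?\<phi> x)) p" for p
    proof -
      have "ft (\<lambda>x. of_real (deriv \<psi> x)) p = ft (\<lambda>x. of_real (?\<phi> x)) p - ft (\<lambda>x. of_real (?\<phi> (x - 1))) p"
        unfolding \<psi>(2) ft_def of_real_diff right_diff_distrib
        by (intro Bochner_Integration.integral_diff integrable_unimodular_mult[where K = 1] i\<phi> ti) auto
      then show ?thesis using ft_translate[OF i\<phi>, of 1 p] by (simp add: algebra_simps)
    qed
    have F\<psi>: "?F (deriv \<psi>) p = (1 - exp (- (\<i> * of_real p))) *s ?F ?\<phi> p" for p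
      by (simp add: FT_vtest(3) c c\<phi> f\<psi> vector_smult_assoc mult_ac)
    have F\<psi>': "?F \<psi> p = ((1 - exp (- (\<i> * of_real p))) / (\<i> * of_real p)) *s ?F ?\<phi> p" if "p \<noteq> 0" for p
    proof -
      have "ft (\<lambda>x. of_real (\<psi> x)) p = (1 - exp (- (\<i> * of_real p))) / (\<i> * of_real p) * ft (\<lambda>x. of_real (?\<phi> x)) p"
        using ft_deriv[OF test_function_facts(1)[OF \<psi>(1)] c, of p] f\<psi>[of p] that by (simp add: field_simps)
      then show ?thesis by (simp add: FT_vtest(3) c c\<phi> vector_smult_assoc mult_ac)
    qed
    have m: "(\<lambda>x. vdot (h x) (?F \<phi> x)) \<in> borel_measurable lborel"
      if "compactly_supported \<phi>" "h \<in> borel_measurable borel" for h \<phi>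
      unfolding measurable_lborel1 measurable_lborel2
      by (intro borel_measurable_vdot that square_integrable_measurable FT_vtest(2))
    have 1: "cinner f (vtest (deriv \<psi>) j) = (LBINT p. vdot (z p *s ?f p) (?F ?\<phi> p))"
    proof -
      have "cinner f (vtest (deriv \<psi>) j) = (LBINT p. vdot (?f p) (?F (deriv \<psi>) p))"
        unfolding fourier_facts(7)[of f "vtest (deriv \<psi>) j", symmetric] FT_vtest(1)[OF c(2)]
        by (rule cinner_abs_L2_right[OF FT_vtest(2)[OF c(2)]])
      then show ?thesis by (simp only: F\<psi> vdot_scale_left vdot_scale_right z_def)
    qed
    have 2: "cinner g (vtest \<psi> j) = (LBINT p. vdot (w p *s ?g p) (?F ?\<phi> p))"
    proof -
      have "cinner g (vtest \<psi> j) = (LBINT p. vdot (?g p) (?F \<psi> p))"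
        unfolding fourier_facts(7)[of g "vtest \<psi> j", symmetric] FT_vtest(1)[OF c(1)]
        by (rule cinner_abs_L2_right[OF FT_vtest(2)[OF c(1)]])
      also have "\<dots> = (LBINT p. vdot (w p *s ?g p) (?F ?\<phi> p))"
      proof (rule integral_cong_AE)
        have "AE p in lborel. p \<noteq> (0::real)" by (rule AE_lborel_singleton)
        then show "AE p in lborel. vdot (?g p) (?F \<psi> p) = vdot (w p *s ?g p) (?F ?\<phi> p)"
        proof eventually_elim
          case (elim p)
          show ?case
            unfolding F\<psi>'[OF elim] vdot_scale_left vdot_scale_right w_def z_def complex_cnj_divide by (rule refl)
        qed
      qed (intro m c c\<phi> ms wm rep_L2_measurable)+
      finally show ?thesis .
    qed
    have "cinner K (fourier (vtest ?\<phi> j)) = (LBINT p. vdot (z p *s ?f p + w p *s ?g p) (?F ?\<phi> p))"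
      unfolding K_def FT_vtest(1)[OF c\<phi>] by (rule cinner_abs_L2[OF sK FT_vtest(2)[OF c\<phi>]])
    also have "\<dots> = (LBINT p. vdot (z p *s ?f p) (?F ?\<phi> p) + vdot (w p *s ?g p) (?F ?\<phi> p))"
      by (simp add: vdot_expand algebra_simps)
    also have "\<dots> = cinner f (vtest (deriv \<psi>) j) + cinner g (vtest \<psi> j)"
      unfolding 1 2 by (intro Bochner_Integration.integral_add integrable_vdot szf swg FT_vtest(2) c\<phi>)
    also have "\<dots> = 0" using wd \<psi>(1) by (simp add: weak_derivative_iff_components)
    finally show "cinner (inv fourier K) (vtest ?\<phi> j) = 0" by (simp add: fourier_facts)
  qed
  then have "K = 0" by (metis fourier_facts(1,3) norm_eq_zero)
  then have "abs_L2 (\<lambda>p. z p *s ?f p + w p *s ?g p) = abs_L2 (\<lambda>p. 0)" by (simp add: K_def zero_L2.abs_eq)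
  then have AE0: "AE p in lborel. z p *s ?f p + w p *s ?g p = 0"
    by (simp add: abs_L2_eq_iff[OF sK square_integrable_0])
  \<comment> \<open>\<open>z\<close> vanishes only at multiples of \<open>2 * pi\<close>, a
    countable set, so it can be cancelled almost everywhere.\<close>
  have "{p. z p = 0} \<subseteq> range (\<lambda>n::int. of_int (2 * n) * pi)"
  proof
    fix p assume "p \<in> {p. z p = 0}"
    then have "exp (- (\<i> * complex_of_real p)) = 1" by (simp add: z_def)
    then obtain n :: int where "- p = of_int (2 * n) * pi" by (auto simp: exp_eq_1)
    then have "p = of_int (2 * (- n)) * pi" by simp
    then show "p \<in> range (\<lambda>n::int. of_int (2 * n) * pi)" by blast
  qed
  then have "countable {p. z p = 0}" by (rule countable_subset) simp
  then have "AE p in lborel. p \<notin> {p. z p = 0}" by (intro AE_not_in countable_imp_null_set_lborel)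
  moreover have "AE p in lborel. p \<noteq> (0::real)" by (rule AE_lborel_singleton)
  ultimately show "AE p in lborel. ?g p = (\<i> * of_real p) *s ?f p"
    using AE0
  proof eventually_elim
    case (elim p)
    have "?g p $ k = \<i> * of_real p * (?f p $ k)" for k
    proof -
      have "z p * (?f p $ k) + w p * (?g p $ k) = 0"
        using elim(3) by (metis vector_add_component vector_smult_component zero_index)
      then have "z p * (?f p $ k - ?g p $ k / (\<i> * of_real p)) = 0"
        using elim(2) by (simp add: w_def field_simps)
      then have "?f p $ k = ?g p $ k / (\<i> * of_real p)" using elim(1) by simp
      then show ?thesis using elim(2) by simp
    qed
    then show ?case by (simp add: vec_eq_iff)
  qed
qed

lemma weak_derivative_eq:
  assumes "has_weak_derivative f g"
  shows "f \<in> sobolev_H1" "weak_derivative f = g"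
proof -
  show "f \<in> sobolev_H1" using assms by (auto simp: sobolev_H1_def)
  have "h = g" if "has_weak_derivative f h" for h
  proof -
    have "AE p in lborel. rep_L2 (fourier h) p = rep_L2 (fourier g) p"
      using assms[unfolded weak_derivative_fourier] that[unfolded weak_derivative_fourier]
      by eventually_elim simp
    then have "fourier h = fourier g" by (simp add: L2_eq_iff)
    then show ?thesis by (simp add: fourier_eq_iff)
  qed
  then show "weak_derivative f = g"
    unfolding weak_derivative_def using assms by (intro the_equality)
qed

section \<open>The free Dirac operator\<close>

definition energy :: "real \<Rightarrow> real \<Rightarrow> real" where
  "energy m p = sqrt (p\<^sup>2 + m\<^sup>2)"

definition dirac_symbol :: "real \<Rightarrow> real \<Rightarrow> complex^2^2" where
  "dirac_symbol m p = vector [vector [of_real m, - (\<i> * of_real p)], vector [\<i> * of_real p, - of_real m]]"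

text \<open>\<open>e\<^sup>i\<^sup>t\<^sup>H = cos (t E) + \<i> (sin (t E) / E) H\<close>, since the square of the symbol \<open>H\<close> is \<open>E\<^sup>2\<close>.\<close>

definition dirac_group_matrix :: "real \<Rightarrow> real \<Rightarrow> real \<Rightarrow> real \<Rightarrow> complex^2^2" where
  "dirac_group_matrix m p C K = vector [vector [Complex C (m * K), of_real (p * K)], vector [- of_real (p * K), Complex C (- m * K)]]"

definition dirac_group_symbol :: "real \<Rightarrow> real \<Rightarrow> real \<Rightarrow> complex^2^2" where
  "dirac_group_symbol m t p = dirac_group_matrix m p (cos (t * energy m p)) (sin (t * energy m p) / energy m p)"

definition free_group :: "real \<Rightarrow> real \<Rightarrow> L2 \<Rightarrow> L2" where
  "free_group m t = fmult (dirac_group_symbol m t)"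

lemma energy_facts:
  assumes "m > 0" shows "energy m p > 0" "energy m p \<noteq> 0" "(energy m p)\<^sup>2 = p\<^sup>2 + m\<^sup>2"
proof -
  have "0 < p\<^sup>2 + m\<^sup>2" using assms by (intro add_nonneg_pos) auto
  then show "energy m p > 0" "(energy m p)\<^sup>2 = p\<^sup>2 + m\<^sup>2" by (auto simp: energy_def)
  then show "energy m p \<noteq> 0" by simp
qed

lemma energy_measurable [measurable]: "energy m \<in> borel_measurable borel"
  unfolding energy_def by measurable

text \<open>Here \<open>C\<close> and \<open>K\<close> are free: the product formula uses only that
  the square of the symbol is \<open>p\<^sup>2 + m\<^sup>2\<close>. The addition theorems for sine
  and cosine enter afterwards.\<close>

lemma dirac_group_matrix_mult:
  "dirac_group_matrix m p C K ** dirac_group_matrix m p C' K' =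
     dirac_group_matrix m p (C * C' - (p\<^sup>2 + m\<^sup>2) * (K * K')) (K * C' + C * K')"
  by (simp add: vec_eq_iff forall_2 matrix_matrix_mult_def sum_2 dirac_group_matrix_def)
    (auto simp: complex_eq_iff algebra_simps power2_eq_square)

lemma dirac_group_symbol_add:
  assumes "m > 0"
  shows "dirac_group_symbol m s p ** dirac_group_symbol m t p = dirac_group_symbol m (s + t) p"
proof -
  have "(p\<^sup>2 + m\<^sup>2) * (sin (s * energy m p) / energy m p * (sin (t * energy m p) / energy m p)) = sin (s * energy m p) * sin (t * energy m p)"
    unfolding energy_facts(3)[OF assms, symmetric] using energy_facts(2)[OF assms, of p] by (simp add: power2_eq_square)
  then show ?thesis
    unfolding dirac_group_symbol_def dirac_group_matrix_mult
    by (simp add: distrib_right cos_add sin_add add_divide_distrib)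
qed

lemma dirac_group_symbol_0: "dirac_group_symbol m 0 p = mat 1"
  by (simp add: dirac_group_symbol_def dirac_group_matrix_def mat_def vec_eq_iff forall_2 complex_eq_iff)

lemma dirac_group_symbol_measurable: "(\<lambda>p. dirac_group_symbol m t p $ i $ j) \<in> borel_measurable borel"
proof -
  have c: "Complex x y = of_real x + \<i> * of_real y" for x y by (simp add: complex_eq_iff)
  show ?thesis
    using exhaust_2[of i] exhaust_2[of j]
    by (auto simp: dirac_group_symbol_def dirac_group_matrix_def c)
qed

lemma dirac_group_unitary_symbol:
  assumes "m > 0"
  shows "unitary_symbol (dirac_group_symbol m t) (dirac_group_symbol m (- t))"
proof -
  have "vdot (dirac_group_symbol m t p *v u) v = vdot u (dirac_group_symbol m (- t) p *v v)" for p u v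
    by (simp add: dirac_group_symbol_def dirac_group_matrix_def mat2_expand vdot_expand complex_cnj algebra_simps)
  then show ?thesis
    by (simp add: unitary_symbol_def dirac_group_symbol_measurable dirac_group_symbol_add[OF assms] dirac_group_symbol_0)
qed

lemma dirac_group_symbol_expand:
  "dirac_group_symbol m t p *v v = of_real (cos (t * energy m p)) *s v
     + (\<i> * of_real (sin (t * energy m p) / energy m p)) *s (dirac_symbol m p *v v)"
proof -
  have c: "Complex x y = of_real x + \<i> * of_real y" for x y by (simp add: complex_eq_iff)
  have "dirac_group_matrix m p C K *v v = of_real C *s v + (\<i> * of_real K) *s (dirac_symbol m p *v v)" for C K
    by (simp add: dirac_group_matrix_def dirac_symbol_def mat2_expand vec_eq_iff forall_2 c algebra_simps)
  then show ?thesis unfolding dirac_group_symbol_def .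
qed

lemma scaleR_vscale: "r *\<^sub>R (w :: complex^2) = complex_of_real r *s w"
  unfolding vec_eq_iff vector_scaleR_component vector_smult_component by (simp add: scaleR_conv_of_real)

text \<open>The symbol is Hermitian and its square is the scalar \<open>energy m p\<close>
  squared.\<close>

lemma norm_dirac_symbol:
  assumes "m > 0"
  shows "norm (dirac_symbol m p *v v) = energy m p * norm v"
proof -
  have "complex_of_real ((norm (dirac_symbol m p *v v))\<^sup>2) = of_real (p\<^sup>2 + m\<^sup>2) * of_real ((norm v)\<^sup>2)"
    unfolding norm_vdot
    by (simp add: dirac_symbol_def mat2_expand vdot_expand algebra_simps power2_eq_square)
  then have "(norm (dirac_symbol m p *v v))\<^sup>2 = (p\<^sup>2 + m\<^sup>2) * (norm v)\<^sup>2"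
    by (simp only: of_real_eq_iff flip: of_real_mult)
  also have "\<dots> = (energy m p * norm v)\<^sup>2" by (simp add: energy_facts[OF assms] power_mult_distrib)
  finally show ?thesis using energy_facts(1)[OF assms, of p] by (simp add: power2_eq_iff_nonneg)
qed

lemma dirac_symbol_measurable: "(\<lambda>p. dirac_symbol m p $ i $ j) \<in> borel_measurable borel"
  using exhaust_2[of i] exhaust_2[of j] by (auto simp: dirac_symbol_def)

lemma const_symbol: "\<exists>L. bounded_symbol (\<lambda>_. K) L"
proof -
  have "cmod (K $ i $ j) \<le> (\<Sum>i\<in>UNIV. \<Sum>j\<in>UNIV. cmod (K $ i $ j))" for i j
  proof -
    have "cmod (K $ i $ j) \<le> (\<Sum>j\<in>UNIV. cmod (K $ i $ j))" by (rule member_le_sum) auto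
    also have "\<dots> \<le> (\<Sum>i\<in>UNIV. \<Sum>j\<in>UNIV. cmod (K $ i $ j))"
      by (rule member_le_sum[of i UNIV "\<lambda>i. \<Sum>j\<in>UNIV. cmod (K $ i $ j)"]) (auto intro: sum_nonneg)
    finally show ?thesis .
  qed
  from norm_mat2_le[of K, OF this] show ?thesis by (auto simp: bounded_symbol_def)
qed

lemma fourier_mult_const: "fourier (mult_op (\<lambda>_. K) f) = mult_op (\<lambda>_. K) (fourier f)"
proof (rule fourier_eqI)
  obtain L where L: "bounded_symbol (\<lambda>_. K) L" using const_symbol by blast
  have i: "integrable lborel (\<lambda>x. K *v h x)" if "integrable lborel h" for h :: "real \<Rightarrow> complex^2"
    using that unfolding integrable_vec_iff matrix_vector_mult_def by simp
  have FK: "FT (\<lambda>x. K *v h x) = (\<lambda>p. K *v FT h p)" if h: "integrable lborel h" for h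
  proof
    fix p
    have hj: "integrable lborel (\<lambda>x. exp (- (\<i> * of_real (p * x))) * (h x $ j))" for j
      using h by (intro integrable_unimodular_mult[where K = 1]) (auto simp: integrable_vec_iff)
    have "ft (\<lambda>x. (K *v h x) $ k) p = (\<Sum>j\<in>UNIV. K $ k $ j * ft (\<lambda>x. h x $ j) p)" for k
    proof -
      have "ft (\<lambda>x. (K *v h x) $ k) p = (LBINT x. (\<Sum>j\<in>UNIV. K $ k $ j * (exp (- (\<i> * of_real (p * x))) * (h x $ j))))"
        unfolding ft_def matrix_vector_mult_def by (simp add: sum_distrib_left mult_ac)
      also have "\<dots> = (\<Sum>j\<in>UNIV. K $ k $ j * ft (\<lambda>x. h x $ j) p)"
        unfolding ft_def by (subst Bochner_Integration.integral_sum) (use hj in auto)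
      finally show ?thesis .
    qed
    then show "FT (\<lambda>x. K *v h x) p = K *v FT h p"
      unfolding vec_eq_iff FT_nth[OF i[OF h]]
      by (simp add: matrix_vector_mult_def FT_nth[OF h] sum_distrib_left mult_ac)
  qed
  have "FR R (mult_op (\<lambda>_. K) f) = mult_op (\<lambda>_. K) (FR R f)" for R
  proof -
    have "AE x in lborel. trunc R (mult_op (\<lambda>_. K) f) x = K *v trunc R f x"
      using rep_mult_op[OF L, of f] by eventually_elim (simp add: trunc_def indicator_def)
    then have "FT (trunc R (mult_op (\<lambda>_. K) f)) = FT (\<lambda>x. K *v trunc R f x)"
      by (intro FT_cong_AE square_integrable_measurable[OF square_integrable_mult[OF L square_integrable_trunc]]) auto
    then show ?thesis unfolding FR_def FK[OF integrable_trunc]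
      by (simp add: mult_op_abs[OF L] FT_plancherel integrable_trunc square_integrable_trunc)
  qed
  then show "((\<lambda>R. FR R (mult_op (\<lambda>_. K) f)) \<longlongrightarrow> mult_op (\<lambda>_. K) (fourier f)) at_top"
    by (simp add: bounded_linear.tendsto[OF mult_op_linear(4)[OF L] fourier_tendsto])
qed

text \<open>The Sobolev domain is exactly the set where the symbol maps the transform into L2,
  because the symbol stretches every vector by the energy, which dominates
  \<open>\<bar>p\<bar>\<close>.\<close>

theorem op_L0_fourier:
  assumes m: "m > 0"
  shows "op_L0 m f = Some g \<longleftrightarrow> (AE p in lborel. rep_L2 (fourier g) p = dirac_symbol m p *v rep_L2 (fourier f) p)"
proof -
  define D :: "complex^2^2" where "D = vector [vector [of_real m, 0], vector [0, of_real (- m)]]"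
  obtain L where L: "bounded_symbol (\<lambda>_. D) L" using const_symbol by blast
  obtain L' where L': "bounded_symbol (\<lambda>_. J) L'" using const_symbol by blast
  have sym: "J *v ((\<i> * of_real p) *s v) + D *v v = dirac_symbol m p *v v" for p v
    by (simp add: J_def D_def dirac_symbol_def mat2_expand vec_eq_iff forall_2 algebra_simps)
  have op: "AE p in lborel. rep_L2 (fourier (mult_op (\<lambda>_. J) f' + mult_op (\<lambda>_. D) f)) p = dirac_symbol m p *v rep_L2 (fourier f) p"
    if wd: "has_weak_derivative f f'" for f f'
  proof -
    have eq: "fourier (mult_op (\<lambda>_. J) f' + mult_op (\<lambda>_. D) f) = abs_L2 (\<lambda>p. J *v rep_L2 (fourier f') p + D *v rep_L2 (fourier f) p)"
      unfolding fourier_add fourier_mult_const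
      unfolding mult_op_def
      by (simp only: abs_L2_add square_integrable_mult[OF L] square_integrable_mult[OF L'] square_integrable_rep)
    have "AE p in lborel. rep_L2 (fourier (mult_op (\<lambda>_. J) f' + mult_op (\<lambda>_. D) f)) p = J *v rep_L2 (fourier f') p + D *v rep_L2 (fourier f) p"
      unfolding eq by (intro rep_abs_L2 square_integrable_add square_integrable_mult[OF L]
          square_integrable_mult[OF L'] square_integrable_rep)
    with wd[unfolded weak_derivative_fourier] show ?thesis
      by eventually_elim (simp add: sym)
  qed
  have opL0: "op_L0 m f = (if f \<in> sobolev_H1 then Some (mult_op (\<lambda>_. J) (weak_derivative f) + mult_op (\<lambda>_. D) f) else None)"
    unfolding op_L0_def dirac_operator_def D_def ..
  show ?thesis
  proof
    assume "op_L0 m f = Some g"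
    then obtain f' where f': "has_weak_derivative f f'" and "g = mult_op (\<lambda>_. J) (weak_derivative f) + mult_op (\<lambda>_. D) f"
      unfolding opL0 by (auto simp: sobolev_H1_def split: if_splits)
    then have "g = mult_op (\<lambda>_. J) f' + mult_op (\<lambda>_. D) f" using weak_derivative_eq(2)[OF f'] by simp
    then show "AE p in lborel. rep_L2 (fourier g) p = dirac_symbol m p *v rep_L2 (fourier f) p"
      using op[OF f'] by simp
  next
    assume g: "AE p in lborel. rep_L2 (fourier g) p = dirac_symbol m p *v rep_L2 (fourier f) p"
    \<comment> \<open>This bound recovers the weak derivative from the existence of
      \<open>g\<close>.\<close>
    have s: "square_integrable (\<lambda>p. (\<i> * of_real p) *s rep_L2 (fourier f) p)"
    proof (rule square_integrable_bound[OF square_integrable_rep[of "fourier g"], where K = 1])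
      show "(\<lambda>p. (\<i> * of_real p) *s rep_L2 (fourier f) p) \<in> borel_measurable borel"
        unfolding borel_measurable_vec_iff vector_smult_component by measurable
      show "AE p in lborel. norm ((\<i> * of_real p) *s rep_L2 (fourier f) p) \<le> 1 * norm (rep_L2 (fourier g) p)"
        using g
      proof eventually_elim
        case (elim p)
        have "\<bar>p\<bar> \<le> energy m p" unfolding energy_def by (rule real_le_rsqrt) simp
        then show ?case by (simp add: elim norm_dirac_symbol[OF m] norm_vscale norm_mult mult_right_mono)
      qed
    qed
    define f' where "f' = inv fourier (abs_L2 (\<lambda>p. (\<i> * of_real p) *s rep_L2 (fourier f) p))"
    have f': "has_weak_derivative f f'"
      unfolding weak_derivative_fourier f'_def fourier_facts by (rule rep_abs_L2[OF s])
    have "AE p in lborel. rep_L2 (fourier (mult_op (\<lambda>_. J) f' + mult_op (\<lambda>_. D) f)) p = rep_L2 (fourier g) p"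
      using op[OF f'] g by eventually_elim simp
    then have "mult_op (\<lambda>_. J) f' + mult_op (\<lambda>_. D) f = g" by (simp add: fourier_eq_iff flip: L2_eq_iff)
    then show "op_L0 m f = Some g"
      unfolding opL0 using weak_derivative_eq[OF f'] by simp
  qed
qed

text \<open>Fatou's lemma, so no dominating function has to be supplied; this serves the converse
  direction of the generator characterisation, where none is available.\<close>

lemma L2_limit_AE_unique:
  assumes g: "\<And>n. square_integrable (g n)" and lim: "(\<lambda>n. abs_L2 (g n)) \<longlonglongrightarrow> G"
    and pw: "AE x in lborel. (\<lambda>n. g n x) \<longlonglongrightarrow> g0 x" and m: "g0 \<in> borel_measurable borel"
  shows "AE x in lborel. rep_L2 G x = g0 x"
proof -
  have [measurable]: "g n \<in> borel_measurable borel" "g0 \<in> borel_measurable borel" for n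
    using g m by (auto simp: square_integrable_def)
  have "(\<integral>\<^sup>+x. ennreal ((norm (g0 x - rep_L2 G x))\<^sup>2) \<partial>lborel)
      = (\<integral>\<^sup>+x. liminf (\<lambda>n. ennreal ((norm (g n x - rep_L2 G x))\<^sup>2)) \<partial>lborel)"
  proof (rule nn_integral_cong_AE, use pw in eventually_elim)
    fix x assume "(\<lambda>n. g n x) \<longlonglongrightarrow> g0 x"
    then have "(\<lambda>n. ennreal ((norm (g n x - rep_L2 G x))\<^sup>2)) \<longlonglongrightarrow> ennreal ((norm (g0 x - rep_L2 G x))\<^sup>2)"
      by (intro tendsto_intros)
    then show "ennreal ((norm (g0 x - rep_L2 G x))\<^sup>2) = liminf (\<lambda>n. ennreal ((norm (g n x - rep_L2 G x))\<^sup>2))"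
      by (intro lim_imp_Liminf[symmetric]) auto
  qed
  also have "\<dots> \<le> liminf (\<lambda>n. \<integral>\<^sup>+x. ennreal ((norm (g n x - rep_L2 G x))\<^sup>2) \<partial>lborel)"
    by (rule nn_integral_liminf) measurable
  also have "(\<lambda>n. \<integral>\<^sup>+x. ennreal ((norm (g n x - rep_L2 G x))\<^sup>2) \<partial>lborel) = (\<lambda>n. ennreal ((norm (abs_L2 (g n) - G))\<^sup>2))"
    using nn_integral_norm_L2[OF square_integrable_diff[OF g square_integrable_rep[of G]]]
      abs_L2_minus[OF g square_integrable_rep[of G]] by simp
  also have "liminf (\<lambda>n. ennreal ((norm (abs_L2 (g n) - G))\<^sup>2)) = ennreal 0"
  proof (rule lim_imp_Liminf)
    have "(\<lambda>n. (norm (abs_L2 (g n) - G))\<^sup>2) \<longlonglongrightarrow> (norm (G - G))\<^sup>2" by (intro tendsto_intros lim)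
    then show "(\<lambda>n. ennreal ((norm (abs_L2 (g n) - G))\<^sup>2)) \<longlonglongrightarrow> ennreal 0" by (intro tendsto_ennrealI) simp
  qed simp
  finally have "(\<integral>\<^sup>+x. ennreal ((norm (g0 x - rep_L2 G x))\<^sup>2) \<partial>lborel) = 0" by simp
  then have "AE x in lborel. ennreal ((norm (g0 x - rep_L2 G x))\<^sup>2) = 0"
    by (subst (asm) nn_integral_0_iff_AE) auto
  then show ?thesis by eventually_elim simp
qed

text \<open>The second part is the majorant for dominated convergence. Its constant 2 collects the
  cosine and the sine quotient, each at most the energy times the norm of \<open>v\<close>.\<close>

lemma dirac_group_symbol_deriv_0:
  assumes m: "m > 0"
  shows "((\<lambda>h. (1 / h) *\<^sub>R (dirac_group_symbol m h p *v v - v)) \<longlongrightarrow> \<i> *s (dirac_symbol m p *v v)) (at 0)"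
    and "norm ((1 / h) *\<^sub>R (dirac_group_symbol m h p *v v - v)) \<le> 2 * norm (dirac_symbol m p *v v)"
proof -
  let ?E = "energy m p" and ?H = "dirac_symbol m p *v v"
  have E: "?E \<noteq> 0" using energy_facts[OF m] by simp
  have eq: "(1 / h) *\<^sub>R (dirac_group_symbol m h p *v v - v)
      = of_real ((cos (h * ?E) - 1) / h) *s v + (\<i> * of_real (sin (h * ?E) / h / ?E)) *s ?H" for h
    unfolding dirac_group_symbol_expand
    by (simp add: scaleR_vscale vec_eq_iff algebra_simps diff_divide_distrib add_divide_distrib)
  have "((\<lambda>h. cos (h * ?E)) has_real_derivative - sin (0 * ?E) * ?E) (at 0)"
    by (auto intro!: derivative_eq_intros)
  then have c: "((\<lambda>h. (cos (h * ?E) - 1) / h) \<longlongrightarrow> 0) (at 0)" by (simp add: DERIV_def)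
  have "((\<lambda>h. sin (h * ?E)) has_real_derivative cos (0 * ?E) * ?E) (at 0)"
    by (auto intro!: derivative_eq_intros)
  then have "((\<lambda>h. sin (h * ?E) / h) \<longlongrightarrow> ?E) (at 0)" by (simp add: DERIV_def)
  from tendsto_divide[OF this tendsto_const E] have s: "((\<lambda>h. sin (h * ?E) / h / ?E) \<longlongrightarrow> 1) (at 0)" using E by simp
  have bl: "((\<lambda>h. f h *s w) \<longlongrightarrow> c *s w) F" if "(f \<longlongrightarrow> c) F" for f :: "real \<Rightarrow> complex" and c F and w :: "complex^2"
    using that by (intro vec_tendstoI) (auto intro!: tendsto_intros)
  have "((\<lambda>h. (1 / h) *\<^sub>R (dirac_group_symbol m h p *v v - v)) \<longlongrightarrow> of_real 0 *s v + (\<i> * of_real 1) *s ?H) (at 0)"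
    unfolding eq by (intro tendsto_add bl tendsto_mult tendsto_const tendsto_of_real c s)
  then show "((\<lambda>h. (1 / h) *\<^sub>R (dirac_group_symbol m h p *v v - v)) \<longlongrightarrow> \<i> *s ?H) (at 0)" by simp
  show "norm ((1 / h) *\<^sub>R (dirac_group_symbol m h p *v v - v)) \<le> 2 * norm ?H"
  proof (cases "h = 0")
    case False
    have Ep: "?E > 0" using energy_facts[OF m] by simp
    have "\<bar>cos x - 1\<bar> \<le> \<bar>x\<bar>" for x :: real
    proof -
      have "cmod (iexp x - 1) \<le> \<bar>x\<bar>" using iexp_approx1[of x 0] by simp
      moreover have "\<bar>Re (iexp x - 1)\<bar> \<le> cmod (iexp x - 1)" by (rule abs_Re_le_cmod)
      moreover have "Re (iexp x - 1) = cos x - 1" by (simp add: Re_exp)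
      ultimately show ?thesis by simp
    qed
    from this[of "h * ?E"] have 1: "\<bar>(cos (h * ?E) - 1) / h\<bar> \<le> ?E" using False Ep
      by (simp add: abs_mult abs_divide divide_simps mult.commute)
    have "\<bar>sin (h * ?E)\<bar> \<le> \<bar>h * ?E\<bar>" by (rule abs_sin_x_le_abs_x)
    then have 2: "\<bar>sin (h * ?E) / h / ?E\<bar> \<le> 1" using False Ep
      by (simp add: abs_mult abs_divide divide_simps mult.commute)
    have "norm ((1 / h) *\<^sub>R (dirac_group_symbol m h p *v v - v)) \<le> \<bar>(cos (h * ?E) - 1) / h\<bar> * norm v + \<bar>sin (h * ?E) / h / ?E\<bar> * norm ?H"
      unfolding eq by (rule order_trans[OF norm_triangle_ineq]) (simp only: norm_vscale norm_mult norm_ii mult_1_left norm_of_real order_refl)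
    also have "\<dots> \<le> ?E * norm v + 1 * norm ?H" by (intro add_mono mult_right_mono 1 2) auto
    also have "\<dots> = 2 * norm ?H" by (simp add: norm_dirac_symbol[OF m])
    finally show ?thesis .
  qed simp
qed

text \<open>Both directions are checked in momentum space: on the domain the difference quotients
  are dominated by twice the image, and conversely a norm limit of the quotients must agree with
  their pointwise limit.\<close>

theorem free_group_generates:
  assumes m: "m > 0"
  shows "generates (free_group m) (op_L0 m)"
proof -
  note us = dirac_group_unitary_symbol[OF m]
  note bs = unitary_symbol_norm(2)[OF us]
  have add: "free_group m (s + t) f = free_group m s (free_group m t f)" for s t f
    unfolding free_group_def fmult_fmult[OF bs bs] dirac_group_symbol_add[OF m] ..
  have cont: "continuous_on UNIV (\<lambda>t. free_group m t f)" for f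
    unfolding continuous_on_def
  proof
    fix a
    have "((\<lambda>t. abs_L2 (\<lambda>p. dirac_group_symbol m t p *v rep_L2 (fourier f) p)) \<longlongrightarrow> abs_L2 (\<lambda>p. dirac_group_symbol m a p *v rep_L2 (fourier f) p)) (at a)"
    proof (rule L2_tendsto_dominated_at[where d = 1 and w = "\<lambda>p. norm (rep_L2 (fourier f) p)"])
      have bl: "((\<lambda>h. f h *s w) \<longlongrightarrow> c *s w) F" if "(f \<longlongrightarrow> c) F" for f :: "real \<Rightarrow> complex" and c F and w :: "complex^2"
        using that by (intro vec_tendstoI) (auto intro!: tendsto_intros)
      show "AE p in lborel. ((\<lambda>t. dirac_group_symbol m t p *v rep_L2 (fourier f) p) \<longlongrightarrow> dirac_group_symbol m a p *v rep_L2 (fourier f) p) (at a)"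
        unfolding dirac_group_symbol_expand
        by (intro AE_I2 tendsto_add bl tendsto_mult tendsto_of_real tendsto_divide tendsto_intros) (use energy_facts[OF m] in auto)
      show "integrable lborel (\<lambda>p. (norm (rep_L2 (fourier f) p))\<^sup>2)"
        using square_integrable_rep[of "fourier f"] by (simp add: square_integrable_def)
    qed (auto simp: unitary_symbol_norm(1)[OF us] intro: square_integrable_mult[OF bs] square_integrable_rep)
    then have "((\<lambda>t. inv fourier (mult_op (dirac_group_symbol m t) (fourier f))) \<longlongrightarrow> inv fourier (mult_op (dirac_group_symbol m a) (fourier f))) (at a)"
      unfolding mult_op_def by (rule bounded_linear.tendsto[OF inv_fourier_bounded_linear])
    then show "((\<lambda>t. free_group m t f) \<longlongrightarrow> free_group m a f) (at a within UNIV)"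
      by (simp add: free_group_def fmult_def)
  qed
  have ug: "unitary_group (free_group m)"
    unfolding unitary_group_def
  proof (intro conjI allI)
    show "unitary_operator (free_group m t)" for t unfolding free_group_def by (rule fmult_unitary[OF us])
    show "free_group m (s + t) = free_group m s \<circ> free_group m t" for s t by (simp add: fun_eq_iff add)
  qed (rule cont)
  have gen: "op_L0 m f = Some g \<longleftrightarrow> ((\<lambda>h. (1 / h) *\<^sub>R (free_group m h f - f)) \<longlongrightarrow> \<i> *\<^sub>C g) (at 0)" for f g
  proof -
    let ?v = "rep_L2 (fourier f)"
    define q where "q h p = (1 / h) *\<^sub>R (dirac_group_symbol m h p *v ?v p - ?v p)" for h p
    have sq: "square_integrable (q h)" for h
      unfolding q_def by (intro square_integrable_scaleR square_integrable_diff square_integrable_mult[OF bs] square_integrable_rep)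
    have q: "fourier ((1 / h) *\<^sub>R (free_group m h f - f)) = abs_L2 (q h)" for h
    proof -
      have "fourier ((1 / h) *\<^sub>R (free_group m h f - f)) = (1 / h) *\<^sub>R (mult_op (dirac_group_symbol m h) (fourier f) - fourier f)"
        by (simp add: fourier_scaleR fourier_diff free_group_def fourier_fmult)
      also have "fourier f = abs_L2 ?v" by simp
      also have "(1 / h) *\<^sub>R (mult_op (dirac_group_symbol m h) (abs_L2 ?v) - abs_L2 ?v) = abs_L2 (q h)"
        unfolding mult_op_abs[OF bs square_integrable_rep] q_def
        by (simp only: abs_L2_minus abs_L2_scaleR square_integrable_mult[OF bs] square_integrable_rep square_integrable_diff)
      finally show ?thesis .
    qed
    have iff: "((\<lambda>h. (1 / h) *\<^sub>R (free_group m h f - f)) \<longlongrightarrow> \<i> *\<^sub>C g) (at 0) \<longleftrightarrow> ((\<lambda>h. abs_L2 (q h)) \<longlongrightarrow> \<i> *\<^sub>C fourier g) (at 0)"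
      by (subst fourier_tendsto_iff[symmetric]) (simp only: q fourier_scaleC)
    have ig: "\<i> *\<^sub>C fourier g = abs_L2 (\<lambda>p. \<i> *s rep_L2 (fourier g) p)"
      using abs_L2_scaleC[OF square_integrable_rep[of "fourier g"], of \<i>] by simp
    have sH: "(\<lambda>p. dirac_symbol m p *v ?v p) \<in> borel_measurable borel"
      by (intro measurable_matrix_vector dirac_symbol_measurable rep_L2_measurable)
    show ?thesis
      unfolding iff op_L0_fourier[OF m]
    proof
      assume g: "AE p in lborel. rep_L2 (fourier g) p = dirac_symbol m p *v ?v p"
      show "((\<lambda>h. abs_L2 (q h)) \<longlongrightarrow> \<i> *\<^sub>C fourier g) (at 0)"
        unfolding ig
      proof (rule L2_tendsto_dominated_at[where d = 1 and w = "\<lambda>p. 2 * norm (rep_L2 (fourier g) p)"])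
        show "AE p in lborel. ((\<lambda>h. q h p) \<longlongrightarrow> \<i> *s rep_L2 (fourier g) p) (at 0)"
          using g by eventually_elim (simp add: q_def dirac_group_symbol_deriv_0(1)[OF m])
        show "integrable lborel (\<lambda>p. (2 * norm (rep_L2 (fourier g) p))\<^sup>2)"
          using square_integrable_rep[of "fourier g"] by (simp add: square_integrable_def power_mult_distrib)
        show "AE p in lborel. norm (q h p) \<le> 2 * norm (rep_L2 (fourier g) p)" for h
          using g by eventually_elim (simp only: q_def dirac_group_symbol_deriv_0(2)[OF m])
      qed (auto intro: sq square_integrable_vscale square_integrable_rep)
    next
      assume lim: "((\<lambda>h. abs_L2 (q h)) \<longlongrightarrow> \<i> *\<^sub>C fourier g) (at 0)"
      \<comment> \<open>Along this null sequence the quotients converge in norm and pointwise, which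
        identifies the transform of \<open>g\<close>.\<close>
      define X where "X n = 1 / real (Suc n)" for n
      have X: "filterlim X (at 0) sequentially"
        using LIMSEQ_inverse_real_of_nat by (auto simp: filterlim_at X_def[abs_def] inverse_eq_divide)
      have "AE p in lborel. rep_L2 (\<i> *\<^sub>C fourier g) p = \<i> *s (dirac_symbol m p *v ?v p)"
      proof (rule L2_limit_AE_unique[OF sq])
        show "(\<lambda>n. abs_L2 (q (X n))) \<longlonglongrightarrow> \<i> *\<^sub>C fourier g" by (rule filterlim_compose[OF lim X])
        show "AE p in lborel. (\<lambda>n. q (X n) p) \<longlonglongrightarrow> \<i> *s (dirac_symbol m p *v ?v p)"
          unfolding q_def by (intro AE_I2 filterlim_compose[OF dirac_group_symbol_deriv_0(1)[OF m] X])
      qed (intro borel_measurable_vscale sH)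
      moreover have "AE p in lborel. rep_L2 (\<i> *\<^sub>C fourier g) p = \<i> *s rep_L2 (fourier g) p"
        unfolding ig by (intro rep_abs_L2 square_integrable_vscale square_integrable_rep)
      ultimately show "AE p in lborel. rep_L2 (fourier g) p = dirac_symbol m p *v ?v p"
        by eventually_elim (simp add: vec_eq_iff)
    qed
  qed
  show ?thesis unfolding generates_def using ug gen by blast
qed

lemma csubspace_closure:
  fixes S :: "'a::complex_hilbert_space set"
  assumes S: "csubspace S" shows "csubspace (closure S)"
  unfolding csubspace_def
proof (intro conjI ballI allI)
  show "0 \<in> closure S" using S closure_subset by (auto simp: csubspace_def)
  fix x assume "x \<in> closure S"
  then obtain X where X: "\<And>n. X n \<in> S" "X \<longlonglongrightarrow> x" unfolding closure_sequential by blast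
  show "c *\<^sub>C x \<in> closure S" for c
    unfolding closure_sequential using X S tendsto_scaleC[OF X(2), of c]
    by (intro exI[of _ "\<lambda>n. c *\<^sub>C X n"]) (auto simp: csubspace_def)
  fix y assume "y \<in> closure S"
  then obtain Y where Y: "\<And>n. Y n \<in> S" "Y \<longlonglongrightarrow> y" unfolding closure_sequential by blast
  show "x + y \<in> closure S"
    unfolding closure_sequential using X Y S tendsto_add[OF X(2) Y(2)]
    by (intro exI[of _ "\<lambda>n. X n + Y n"]) (auto simp: csubspace_def)
qed

lemma op_L0_dense:
  assumes m: "m > 0"
  shows "closure (dom (op_L0 m)) = UNIV"
proof (rule csubspace_dense)
  have dom: "dom (op_L0 m) = sobolev_H1" by (auto simp: op_L0_def dirac_operator_def dom_def)
  have "csubspace sobolev_H1"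
    unfolding csubspace_def
  proof (intro conjI ballI allI)
    have "has_weak_derivative 0 0"
      by (simp add: weak_derivative_iff_components cinner.zero_left)
    then show "0 \<in> sobolev_H1" by (auto simp: sobolev_H1_def)
    fix f assume "f \<in> sobolev_H1"
    then obtain f' where f': "has_weak_derivative f f'" by (auto simp: sobolev_H1_def)
    then have "has_weak_derivative (c *\<^sub>C f) (c *\<^sub>C f')" for c
      by (simp add: weak_derivative_iff_components cinner_scaleC_left)
    then show "c *\<^sub>C f \<in> sobolev_H1" for c by (auto simp: sobolev_H1_def)
    fix g assume "g \<in> sobolev_H1"
    then obtain g' where "has_weak_derivative g g'" by (auto simp: sobolev_H1_def)
    with f' have "has_weak_derivative (f + g) (f' + g')"
      by (simp add: weak_derivative_iff_components cinner_add_left)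
    then show "f + g \<in> sobolev_H1" by (auto simp: sobolev_H1_def)
  qed
  then show "csubspace (closure (dom (op_L0 m)))" unfolding dom by (rule csubspace_closure)
  fix x assume orth: "\<And>y. y \<in> closure (dom (op_L0 m)) \<Longrightarrow> cinner x y = 0"
  show "x = 0"
  proof (rule L2_total)
    fix a b c :: real and j assume "a < b" "c > 0"
    then have t: "test_function (bump c 0 0 a b)" by (intro bump_span_test_function bump_span.bump)
    have "has_weak_derivative (vtest (bump c 0 0 a b) j) (vtest (deriv (bump c 0 0 a b)) j)"
    proof -
      note c = test_function_facts(2,3)[OF t]
      have "AE p in lborel. rep_L2 (fourier (vtest (bump c 0 0 a b) j)) p = FT (\<lambda>x. bump c 0 0 a b x *\<^sub>R axis j 1) p"
        unfolding FT_vtest(1)[OF c(1)] by (rule rep_abs_L2[OF FT_vtest(2)[OF c(1)]])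
      moreover have "AE p in lborel. rep_L2 (fourier (vtest (deriv (bump c 0 0 a b)) j)) p = FT (\<lambda>x. deriv (bump c 0 0 a b) x *\<^sub>R axis j 1) p"
        unfolding FT_vtest(1)[OF c(2)] by (rule rep_abs_L2[OF FT_vtest(2)[OF c(2)]])
      ultimately show ?thesis
        unfolding weak_derivative_fourier
        by eventually_elim (simp add: FT_vtest(3) c ft_deriv[OF test_function_facts(1)[OF t] c] vector_smult_assoc mult_ac)
    qed
    then have "vtest (bump c 0 0 a b) j \<in> dom (op_L0 m)" unfolding dom by (auto simp: sobolev_H1_def)
    then show "cinner x (vtest (bump c 0 0 a b) j) = 0" by (intro orth subsetD[OF closure_subset])
  qed
qed simp

lemma exp_i_op_L0: "m > 0 \<Longrightarrow> exp_i (op_L0 m) = free_group m"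
  by (intro exp_i_eq free_group_generates op_L0_dense)

section \<open>The perturbed Dirac operator\<close>

text \<open>The bounded difference of the two operators; the mass term stays in the free
  part.\<close>

definition potential :: "(real \<Rightarrow> real) \<Rightarrow> (real \<Rightarrow> real) \<Rightarrow> real \<Rightarrow> complex^2^2" where
  "potential a b r = vector [vector [of_real (b \<bar>r\<bar>), of_real (a \<bar>r\<bar>)], vector [of_real (a \<bar>r\<bar>), of_real (b \<bar>r\<bar>)]]"

lemma even_extension_measurable:
  fixes f :: "real \<Rightarrow> real"
  assumes "\<forall>r>0. f differentiable (at r)"
  shows "(\<lambda>r. f \<bar>r\<bar>) \<in> borel_measurable borel"
proof -
  have "continuous_on (- {0}) (\<lambda>r. f \<bar>r\<bar>)"
  proof (rule continuous_on_compose2[of "{0<..}" f])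
    show "continuous_on {0<..} f"
      using assms by (intro continuous_at_imp_continuous_on) (auto dest: differentiable_imp_continuous_within)
  qed (auto intro!: continuous_intros)
  then have [measurable]: "(\<lambda>r. indicat_real (- {0}) r *\<^sub>R f \<bar>r\<bar>) \<in> borel_measurable borel"
    by (intro borel_measurable_continuous_on_indicator) auto
  \<comment> \<open>The value at 0 is arbitrary, so it is split off as a separate measurable
    term.\<close>
  have "(\<lambda>r. f \<bar>r\<bar>) = (\<lambda>r. indicat_real (- {0}) r *\<^sub>R f \<bar>r\<bar> + indicat_real {0} r * f 0)"
    by (auto simp: fun_eq_iff indicator_def)
  moreover have "\<dots> \<in> borel_measurable borel" by measurable
  ultimately show ?thesis by simp
qed

lemma potential_bounded_symbol:
  fixes a b :: "real \<Rightarrow> real"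
  assumes "\<forall>r>0. a differentiable (at r)" "\<forall>r>0. b differentiable (at r)"
    and "\<And>r. r > 0 \<Longrightarrow> \<bar>a r\<bar> \<le> C" "\<And>r. r > 0 \<Longrightarrow> \<bar>b r\<bar> \<le> C"
  shows "\<exists>K. bounded_symbol (potential a b) K"
proof -
  define B where "B = \<bar>C\<bar> + \<bar>a 0\<bar> + \<bar>b 0\<bar>"
  have "\<bar>a \<bar>r\<bar>\<bar> \<le> B" "\<bar>b \<bar>r\<bar>\<bar> \<le> B" for r
    using assms(3,4)[of "\<bar>r\<bar>"] by (cases "r = 0"; force simp: B_def)+
  then have "cmod (potential a b r $ i $ j) \<le> B" for r i j
    using exhaust_2[of i] exhaust_2[of j] by (auto simp: potential_def)
  moreover have "(\<lambda>r. potential a b r $ i $ j) \<in> borel_measurable borel" for i j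
    using exhaust_2[of i] exhaust_2[of j] even_extension_measurable[OF assms(1)] even_extension_measurable[OF assms(2)]
    by (auto simp: potential_def)
  ultimately show ?thesis
    using norm_mat2_le by (intro exI[of _ "4 * B"]) (auto simp: bounded_symbol_def)
qed

lemma op_L_eq:
  assumes "bounded_symbol (potential a b) K"
  shows "op_L m a b = (\<lambda>f. map_option (\<lambda>y. y + mult_op (potential a b) f) (op_L0 m f))"
proof
  fix f
  define D :: "complex^2^2" where "D = vector [vector [of_real m, 0], vector [0, of_real (- m)]]"
  obtain L where L: "bounded_symbol (\<lambda>_. D) L" using const_symbol by blast
  have "(\<lambda>r. vector [vector [of_real (m + b \<bar>r\<bar>), of_real (a \<bar>r\<bar>)],
      vector [of_real (a \<bar>r\<bar>), of_real (- m + b \<bar>r\<bar>)]]) = (\<lambda>r. D + potential a b r)"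
    by (simp add: fun_eq_iff D_def potential_def vec_eq_iff forall_2)
  then show "op_L m a b f = map_option (\<lambda>y. y + mult_op (potential a b) f) (op_L0 m f)"
    unfolding op_L_def op_L0_def dirac_operator_def D_def[symmetric]
    by (simp add: mult_op_sum[OF L assms] add.assoc)
qed

theorem op_L_generates:
  assumes m: "m > 0" and V: "bounded_symbol (potential a b) K"
  shows "\<exists>U. generates U (op_L m a b)" "closure (dom (op_L m a b)) = UNIV"
proof -
  show "\<exists>U. generates U (op_L m a b)"
    unfolding op_L_eq[OF V]
  proof (rule bounded_perturbation_generates[OF free_group_generates[OF m]])
    show "cinner (mult_op (potential a b) x) y = cinner x (mult_op (potential a b) y)" for x y
      by (rule cinner_mult_op[OF V V]) (simp add: potential_def mat2_expand vdot_expand algebra_simps)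
  qed (use mult_op_linear[OF V] in auto)
  have "dom (op_L m a b) = dom (op_L0 m)" unfolding op_L_eq[OF V] by (auto simp: dom_def)
  then show "closure (dom (op_L m a b)) = UNIV" by (simp add: op_L0_dense[OF m])
qed

section \<open>Oscillatory integrals\<close>

text \<open>The scale \<open>L\<close> will be the growth rate of the phase, so that each derivative costs a factor \<open>L\<close>.\<close>

definition c2_data ::
    "real set \<Rightarrow> real \<Rightarrow> real \<Rightarrow> (real \<Rightarrow> complex) \<Rightarrow> (real \<Rightarrow> complex) \<Rightarrow> (real \<Rightarrow> complex) \<Rightarrow> bool" where
  "c2_data S L M f f1 f2 \<longleftrightarrow> (\<forall>p\<in>S. (f has_vector_derivative f1 p) (at p) \<and> (f1 has_vector_derivative f2 p) (at p) \<and>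
     cmod (f p) \<le> M \<and> cmod (f1 p) \<le> M * L \<and> cmod (f2 p) \<le> M * L\<^sup>2)"

definition c2_bound :: "real set \<Rightarrow> real \<Rightarrow> real \<Rightarrow> (real \<Rightarrow> complex) \<Rightarrow> bool" where
  "c2_bound S L M f \<longleftrightarrow> (\<exists>f1 f2. c2_data S L M f f1 f2)"

lemma c2_dataD:
  assumes "c2_data S L M f f1 f2" "p \<in> S"
  shows "(f has_vector_derivative f1 p) (at p)" "(f1 has_vector_derivative f2 p) (at p)"
    "cmod (f p) \<le> M" "cmod (f1 p) \<le> M * L" "cmod (f2 p) \<le> M * L\<^sup>2"
  using assms by (auto simp: c2_data_def)

lemma c2_bound_cmod: "c2_bound S L M f \<Longrightarrow> p \<in> S \<Longrightarrow> cmod (f p) \<le> M"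
  unfolding c2_bound_def using c2_dataD(3) by blast

lemma c2_boundI:
  assumes "\<And>p. p \<in> S \<Longrightarrow> (f has_vector_derivative f1 p) (at p)"
    and "\<And>p. p \<in> S \<Longrightarrow> (f1 has_vector_derivative f2 p) (at p)"
    and "\<And>p. p \<in> S \<Longrightarrow> cmod (f p) \<le> M" "\<And>p. p \<in> S \<Longrightarrow> cmod (f1 p) \<le> M * L" "\<And>p. p \<in> S \<Longrightarrow> cmod (f2 p) \<le> M * L\<^sup>2"
  shows "c2_bound S L M f"
  unfolding c2_bound_def c2_data_def by (rule exI[of _ f1], rule exI[of _ f2]) (intro ballI conjI assms)

text \<open>The factor 4 is 1 + 2 + 1, the sum of the coefficients in the second derivative of a
  product.\<close>

lemma c2_bound_mult:
  assumes f: "c2_bound S L M f" and g: "c2_bound S L N g" and L: "L \<ge> 0"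
  shows "c2_bound S L (4 * M * N) (\<lambda>p. f p * g p)"
proof -
  obtain f1 f2 where "c2_data S L M f f1 f2"
    using f unfolding c2_bound_def by blast
  note F = c2_dataD[OF this]
  obtain g1 g2 where "c2_data S L N g g1 g2"
    using g unfolding c2_bound_def by blast
  note G = c2_dataD[OF this]
  have b: "cmod (x * y) \<le> A * B" if "cmod x \<le> A" "cmod y \<le> B" for x y A B
    using that unfolding norm_mult by (intro mult_mono) (auto intro: order_trans[OF norm_ge_zero])
  show ?thesis
  proof (rule c2_boundI[where ?f1.0 = "\<lambda>p. f p * g1 p + f1 p * g p"
        and ?f2.0 = "\<lambda>p. (f p * g2 p + f1 p * g1 p) + (f1 p * g1 p + f2 p * g p)"])
    fix p assume p: "p \<in> S"
    have M: "0 \<le> M" "0 \<le> N" using F(3)[OF p] G(3)[OF p] norm_ge_zero order_trans by blast+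
    show "((\<lambda>p. f p * g p) has_vector_derivative f p * g1 p + f1 p * g p) (at p)"
      by (intro has_vector_derivative_mult F G p)
    show "((\<lambda>p. f p * g1 p + f1 p * g p) has_vector_derivative (f p * g2 p + f1 p * g1 p) + (f1 p * g1 p + f2 p * g p)) (at p)"
      by (intro has_vector_derivative_add has_vector_derivative_mult F G p)
    have MN: "0 \<le> M * N" using M by simp
    show "cmod (f p * g p) \<le> 4 * M * N" using b[OF F(3)[OF p] G(3)[OF p]] MN by linarith
    show "cmod (f p * g1 p + f1 p * g p) \<le> 4 * M * N * L"
      using norm_triangle_ineq[of "f p * g1 p" "f1 p * g p"] b[OF F(3)[OF p] G(4)[OF p]] b[OF F(4)[OF p] G(3)[OF p]]
        mult_nonneg_nonneg[OF MN L] by (simp add: mult_ac)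
    have "cmod ((f p * g2 p + f1 p * g1 p) + (f1 p * g1 p + f2 p * g p))
        \<le> (cmod (f p * g2 p) + cmod (f1 p * g1 p)) + (cmod (f1 p * g1 p) + cmod (f2 p * g p))"
      by (rule order_trans[OF norm_triangle_ineq add_mono[OF norm_triangle_ineq norm_triangle_ineq]])
    also have "\<dots> \<le> (M * (N * L\<^sup>2) + M * L * (N * L)) + (M * L * (N * L) + M * L\<^sup>2 * N)"
      by (intro add_mono b F G p)
    also have "\<dots> = 4 * M * N * L\<^sup>2" by (simp add: power2_eq_square algebra_simps)
    finally show "cmod ((f p * g2 p + f1 p * g1 p) + (f1 p * g1 p + f2 p * g p)) \<le> 4 * M * N * L\<^sup>2" .
  qed
qed

lemma c2_bound_add:
  assumes f: "c2_bound S L M f" and g: "c2_bound S L N g"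
  shows "c2_bound S L (M + N) (\<lambda>p. f p + g p)"
proof -
  obtain f1 f2 where "c2_data S L M f f1 f2"
    using f unfolding c2_bound_def by blast
  note F = c2_dataD[OF this]
  obtain g1 g2 where "c2_data S L N g g1 g2"
    using g unfolding c2_bound_def by blast
  note G = c2_dataD[OF this]
  show ?thesis
    by (rule c2_boundI[where ?f1.0 = "\<lambda>p. f1 p + g1 p" and ?f2.0 = "\<lambda>p. f2 p + g2 p"])
      (auto intro!: has_vector_derivative_add F G order_trans[OF norm_triangle_ineq add_mono] simp: distrib_right)
qed

lemma c2_bound_const: "c2_bound S L (cmod k) (\<lambda>_. k)" if "L \<ge> 0"
  by (rule c2_boundI[where ?f1.0 = "\<lambda>_. 0" and ?f2.0 = "\<lambda>_. 0"]) (use that in auto)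

lemma c2_bound_cmult:
  assumes f: "c2_bound S L M f"
  shows "c2_bound S L (cmod k * M) (\<lambda>p. k * f p)"
proof -
  obtain f1 f2 where "c2_data S L M f f1 f2"
    using f unfolding c2_bound_def by blast
  note F = c2_dataD[OF this]
  show ?thesis
    by (rule c2_boundI[where ?f1.0 = "\<lambda>p. k * f1 p" and ?f2.0 = "\<lambda>p. k * f2 p"])
      (auto intro!: has_vector_derivative_mult_right F mult_left_mono simp: norm_mult mult.assoc)
qed

lemma c2_bound_mono:
  assumes f: "c2_bound S L M f" and L: "0 \<le> L" "L \<le> L'" and M: "M \<le> M'"
  shows "c2_bound S L' M' f"
proof -
  obtain f1 f2 where "c2_data S L M f f1 f2"
    using f unfolding c2_bound_def by blast
  note F = c2_dataD[OF this]
  show ?thesis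
  proof (rule c2_boundI[OF F(1,2)])
    fix p assume p: "p \<in> S"
    have M0: "0 \<le> M" using F(3)[OF p] norm_ge_zero order_trans by blast
    show "cmod (f p) \<le> M'" using F(3)[OF p] M by linarith
    have "M * L \<le> M' * L'" using L M M0 by (intro mult_mono) auto
    then show "cmod (f1 p) \<le> M' * L'" using F(4)[OF p] by linarith
    have "M * L\<^sup>2 \<le> M' * L'\<^sup>2" using L M M0 by (intro mult_mono power_mono) auto
    then show "cmod (f2 p) \<le> M' * L'\<^sup>2" using F(5)[OF p] by linarith
  qed
qed

text \<open>The summands of the constant bound \<open>1 / f\<close>, its first derivative, and the
  extra term of the second derivative that is quadratic in \<open>f1\<close>.\<close>

lemma c2_bound_inverse:
  assumes f: "c2_bound S 1 M f" and k: "k > 0" "\<And>p. p \<in> S \<Longrightarrow> cmod (f p) \<ge> k"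
  shows "c2_bound S 1 (1 / k + M / k\<^sup>2 + 2 * M\<^sup>2 / k ^ 3) (\<lambda>p. 1 / f p)"
proof -
  obtain f1 f2 where "c2_data S 1 M f f1 f2"
    using f unfolding c2_bound_def by blast
  note F = c2_dataD[OF this, unfolded power_one mult_1_right]
  define g where "g p = 1 / f p" for p
  have dg: "(g has_vector_derivative - (f1 p * g p * g p)) (at p)" if p: "p \<in> S" for p
  proof -
    have fp: "f p \<noteq> 0" using k(2)[OF p] k(1) by auto
    have "(inverse has_field_derivative - (inverse (f p) * 1 * inverse (f p))) (at (f p))"
      using fp by (intro DERIV_inverse') (auto intro: DERIV_ident)
    from field_vector_diff_chain_at[OF F(1)[OF p] this]
    show ?thesis by (simp add: o_def g_def[abs_def] inverse_eq_divide mult_ac)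
  qed
  have gk: "cmod (g p) \<le> 1 / k" if p: "p \<in> S" for p
    unfolding g_def norm_divide norm_one using k(1) k(2)[OF p] by (intro frac_le) auto
  have b: "cmod (x * y) \<le> A * B" if "cmod x \<le> A" "cmod y \<le> B" for x y A B
    using that unfolding norm_mult by (intro mult_mono) (auto intro: order_trans[OF norm_ge_zero])
  have "c2_bound S 1 (1 / k + M / k\<^sup>2 + 2 * M\<^sup>2 / k ^ 3) g"
  proof (rule c2_boundI[OF dg, where ?f2.0 = "\<lambda>p. - ((f1 p * g p) * (- (f1 p * g p * g p)) + (f1 p * (- (f1 p * g p * g p)) + f2 p * g p) * g p)"])
    fix p assume p: "p \<in> S"
    show "p \<in> S" by fact
    show "((\<lambda>p. - (f1 p * g p * g p)) has_vector_derivative - ((f1 p * g p) * (- (f1 p * g p * g p)) + (f1 p * (- (f1 p * g p * g p)) + f2 p * g p) * g p)) (at p)"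
      by (intro has_vector_derivative_minus has_vector_derivative_mult F dg p)
    have M0: "0 \<le> M" using F(3)[OF p] norm_ge_zero order_trans by blast
    have pos: "0 \<le> 1 / k" "0 \<le> M / k\<^sup>2" "0 \<le> 2 * M\<^sup>2 / k ^ 3" using k M0 by auto
    show "cmod (g p) \<le> 1 / k + M / k\<^sup>2 + 2 * M\<^sup>2 / k ^ 3" using gk[OF p] pos by linarith
    have 1: "cmod (f1 p * g p * g p) \<le> M * (1 / k) * (1 / k)" by (intro b F gk p)
    have e: "M * (1 / k) * (1 / k) = M / k\<^sup>2" by (simp add: power2_eq_square)
    show "cmod (- (f1 p * g p * g p)) \<le> (1 / k + M / k\<^sup>2 + 2 * M\<^sup>2 / k ^ 3) * 1"
      using 1 pos unfolding e norm_minus_cancel mult_1_right by linarith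
    have "cmod (- ((f1 p * g p) * (- (f1 p * g p * g p)) + (f1 p * (- (f1 p * g p * g p)) + f2 p * g p) * g p))
       \<le> cmod ((f1 p * g p) * (f1 p * g p * g p)) + (cmod (f1 p * (f1 p * g p * g p) * g p) + cmod (f2 p * g p * g p))"
      unfolding distrib_right norm_minus_cancel mult_minus_right mult_minus_left
      by (rule order_trans[OF norm_triangle_ineq]) (intro add_mono order_trans[OF norm_triangle_ineq], auto)
    also have "\<dots> \<le> (M * (1/k)) * (M * (1/k) * (1/k)) + (M * (M * (1/k) * (1/k)) * (1/k) + M * (1/k) * (1/k))"
      by (intro add_mono b F gk p 1)
    also have "\<dots> = M / k\<^sup>2 + 2 * M\<^sup>2 / k ^ 3" using k by (simp add: power2_eq_square power3_eq_cube field_simps)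
    finally have fin: "cmod (- ((f1 p * g p) * (- (f1 p * g p * g p)) + (f1 p * (- (f1 p * g p * g p)) + f2 p * g p) * g p))
       \<le> M / k\<^sup>2 + 2 * M\<^sup>2 / k ^ 3" .
    show "cmod (- ((f1 p * g p) * (- (f1 p * g p * g p)) + (f1 p * (- (f1 p * g p * g p)) + f2 p * g p) * g p))
       \<le> (1 / k + M / k\<^sup>2 + 2 * M\<^sup>2 / k ^ 3) * 1\<^sup>2"
      using fin pos unfolding power_one mult_1_right by linarith
  qed
  then show ?thesis by (simp add: g_def[abs_def])
qed

text \<open>Here the scale \<open>L\<close> arises: each derivative of the exponential brings down a
  derivative of the phase. With \<open>L \<ge> 1\<close> the linear term of the second derivative is
  absorbed into the square of \<open>L\<close>.\<close>

lemma c2_bound_exp: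
  fixes \<Phi> \<Phi>1 \<Phi>2 :: "real \<Rightarrow> real"
  assumes d: "\<And>p. p \<in> S \<Longrightarrow> (\<Phi> has_real_derivative \<Phi>1 p) (at p)" "\<And>p. p \<in> S \<Longrightarrow> (\<Phi>1 has_real_derivative \<Phi>2 p) (at p)"
    and b: "\<And>p. p \<in> S \<Longrightarrow> \<bar>\<Phi>1 p\<bar> \<le> K * L" "\<And>p. p \<in> S \<Longrightarrow> \<bar>\<Phi>2 p\<bar> \<le> K * L" and L: "L \<ge> 1" and K: "K \<ge> 0"
  shows "c2_bound S L (1 + K + K\<^sup>2) (\<lambda>p. exp (\<i> * of_real (\<Phi> p)))"
proof -
  let ?e = "\<lambda>p. exp (\<i> * of_real (\<Phi> p))"
  have de: "(?e has_vector_derivative \<i> * of_real (\<Phi>1 p) * ?e p) (at p)" if p: "p \<in> S" for p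
  proof -
    have "((\<lambda>p. \<i> * of_real (\<Phi> p)) has_vector_derivative \<i> * of_real (\<Phi>1 p)) (at p)"
      using d(1)[OF p] by (intro has_vector_derivative_mult_right has_vector_derivative_of_real)
        (simp add: has_real_derivative_iff_has_vector_derivative)
    from field_vector_diff_chain_at[OF this DERIV_exp] show ?thesis by (simp add: o_def)
  qed
  have d1: "((\<lambda>p. complex_of_real (\<Phi>1 p)) has_vector_derivative of_real (\<Phi>2 p)) (at p)" if p: "p \<in> S" for p
    using d(2)[OF p] by (intro has_vector_derivative_of_real) (simp add: has_real_derivative_iff_has_vector_derivative)
  show ?thesis
  proof (rule c2_boundI[OF de, where ?f2.0 = "\<lambda>p. (\<i> * of_real (\<Phi>1 p)) * (\<i> * of_real (\<Phi>1 p) * ?e p) + (\<i> * of_real (\<Phi>2 p)) * ?e p"])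
    fix p assume p: "p \<in> S"
    show "p \<in> S" by fact
    show "((\<lambda>p. \<i> * of_real (\<Phi>1 p) * ?e p) has_vector_derivative (\<i> * of_real (\<Phi>1 p)) * (\<i> * of_real (\<Phi>1 p) * ?e p) + (\<i> * of_real (\<Phi>2 p)) * ?e p) (at p)"
      by (intro has_vector_derivative_mult has_vector_derivative_mult_right d1 de p)
    show "cmod (?e p) \<le> 1 + K + K\<^sup>2" using K by simp
    have "K * L \<le> (1 + K + K\<^sup>2) * L" using K L by (intro mult_right_mono) auto
    then show "cmod (\<i> * of_real (\<Phi>1 p) * ?e p) \<le> (1 + K + K\<^sup>2) * L" using b(1)[OF p] by (simp add: norm_mult)
    have "cmod ((\<i> * of_real (\<Phi>1 p)) * (\<i> * of_real (\<Phi>1 p) * ?e p) + (\<i> * of_real (\<Phi>2 p)) * ?e p) \<le> \<bar>\<Phi>1 p\<bar> * \<bar>\<Phi>1 p\<bar> + \<bar>\<Phi>2 p\<bar>"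
      by (rule order_trans[OF norm_triangle_ineq]) (simp add: norm_mult)
    also have "\<dots> \<le> (K * L) * (K * L) + K * L" using b[OF p] by (intro add_mono mult_mono) auto
    also have "\<dots> \<le> (K * L) * (K * L) + K * L\<^sup>2 + L\<^sup>2"
    proof -
      have "L * 1 \<le> L * L" using L by (intro mult_left_mono) auto
      then have "K * L \<le> K * L\<^sup>2" using K by (intro mult_left_mono) (auto simp: power2_eq_square)
      then show ?thesis by (simp add: add_increasing2)
    qed
    also have "\<dots> = (1 + K + K\<^sup>2) * L\<^sup>2" by (simp add: power2_eq_square algebra_simps)
    finally show "cmod ((\<i> * of_real (\<Phi>1 p)) * (\<i> * of_real (\<Phi>1 p) * ?e p) + (\<i> * of_real (\<Phi>2 p)) * ?e p) \<le> (1 + K + K\<^sup>2) * L\<^sup>2" .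
  qed
qed

lemma c2_bound_of_real:
  fixes f f1 f2 :: "real \<Rightarrow> real"
  assumes "\<And>p. p \<in> S \<Longrightarrow> (f has_real_derivative f1 p) (at p)" "\<And>p. p \<in> S \<Longrightarrow> (f1 has_real_derivative f2 p) (at p)"
    and "\<And>p. p \<in> S \<Longrightarrow> \<bar>f p\<bar> \<le> M" "\<And>p. p \<in> S \<Longrightarrow> \<bar>f1 p\<bar> \<le> M" "\<And>p. p \<in> S \<Longrightarrow> \<bar>f2 p\<bar> \<le> M"
  shows "c2_bound S 1 M (\<lambda>p. of_real (f p))"
  by (rule c2_boundI[where ?f1.0 = "\<lambda>p. of_real (f1 p)" and ?f2.0 = "\<lambda>p. of_real (f2 p)"])
    (use assms in \<open>auto intro!: has_vector_derivative_of_real simp: has_real_derivative_iff_has_vector_derivative\<close>)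

text \<open>Integration by parts without continuity of the derivatives: the gauge integral of a derivative exists
  unconditionally, even with finitely many exceptional points.\<close>

lemma oscillatory_by_parts:
  fixes e K :: "real \<Rightarrow> complex"
  assumes p12: "p1 \<le> p2" and Z: "finite Z"
    and e: "\<And>p. p \<in> {p1..p2} \<Longrightarrow> (e has_vector_derivative \<i> * of_real (d p - f p) * e p) (at p)" "\<And>p. cmod (e p) \<le> 1"
    and K: "continuous_on {p1..p2} K" "\<And>p. p \<in> {p1..p2} - Z \<Longrightarrow> (K has_vector_derivative K' p) (at p)"
    and d: "continuous_on {p1..p2} d" and K0: "K p1 = 0" "K p2 = 0"
    and b: "\<And>p. p \<in> {p1..p2} - Z \<Longrightarrow> cmod (K' p) + \<bar>f p\<bar> * cmod (K p) \<le> B"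
    and B: "B \<ge> 0"
  shows "cmod (integral {p1..p2} (\<lambda>p. e p * (of_real (d p) * K p))) \<le> B * (p2 - p1)"
proof -
  have ec: "continuous_on {p1..p2} e"
    by (intro continuous_on_vderiv[OF e(1)])
  \<comment> \<open>Total derivative of \<open>e * K\<close>. The factor \<open>d\<close> of the
    integrand is the phase derivative up to \<open>f\<close>; the mismatch \<open>f\<close> survives
    as the term \<open>\<bar>f p\<bar> * cmod (K p)\<close> of the bound.\<close>
  let ?D = "\<lambda>p. e p * K' p + (\<i> * of_real (d p - f p) * e p) * K p"
  have "(?D has_integral e p2 * K p2 - e p1 * K p1) {p1..p2}"
  proof (rule fundamental_theorem_of_calculus_interior_strong[OF Z p12])
    show "((\<lambda>p. e p * K p) has_vector_derivative ?D p) (at p)" if "p \<in> {p1<..<p2} - Z" for p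
      using that by (intro has_vector_derivative_mult e K) auto
    show "continuous_on {p1..p2} (\<lambda>p. e p * K p)" by (intro continuous_intros ec K)
  qed
  then have 1: "(?D has_integral 0) {p1..p2}" by (simp add: K0)
  have "(\<lambda>p. e p * (of_real (d p) * K p)) integrable_on {p1..p2}"
    by (intro integrable_continuous_real continuous_intros ec K d)
  then have "((\<lambda>p. \<i> * (e p * (of_real (d p) * K p))) has_integral \<i> * integral {p1..p2} (\<lambda>p. e p * (of_real (d p) * K p))) {p1..p2}"
    by (intro has_integral_mult_right integrable_integral)
  from has_integral_diff[OF this 1]
  have "((\<lambda>p. \<i> * of_real (f p) * e p * K p - e p * K' p) has_integral \<i> * integral {p1..p2} (\<lambda>p. e p * (of_real (d p) * K p))) {p1..p2}"
    by (simp add: algebra_simps)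
  \<comment> \<open>Changing the integrand on the finite set \<open>Z\<close> leaves the integral
    alone and makes the pointwise bound trivial there.\<close>
  then have 2: "((\<lambda>p. if p \<in> Z then 0 else \<i> * of_real (f p) * e p * K p - e p * K' p) has_integral
      \<i> * integral {p1..p2} (\<lambda>p. e p * (of_real (d p) * K p))) {p1..p2}"
    by (rule has_integral_spike_finite[OF Z, rotated]) auto
  have "norm (\<i> * integral {p1..p2} (\<lambda>p. e p * (of_real (d p) * K p))) \<le> B * measure lborel (cbox p1 p2)"
  proof (rule has_integral_bound[OF B])
    show "((\<lambda>p. if p \<in> Z then 0 else \<i> * of_real (f p) * e p * K p - e p * K' p) has_integral
      \<i> * integral {p1..p2} (\<lambda>p. e p * (of_real (d p) * K p))) (cbox p1 p2)" using 2 by simp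
    show "norm (if p \<in> Z then 0 else \<i> * of_real (f p) * e p * K p - e p * K' p) \<le> B" if p: "p \<in> cbox p1 p2" for p
    proof (cases "p \<in> Z")
      case False
      have "cmod (\<i> * of_real (f p) * e p * K p - e p * K' p) \<le> \<bar>f p\<bar> * (cmod (e p) * cmod (K p)) + cmod (e p) * cmod (K' p)"
        by (rule order_trans[OF norm_triangle_ineq4]) (simp add: norm_mult mult.assoc)
      also have "\<dots> \<le> \<bar>f p\<bar> * (1 * cmod (K p)) + 1 * cmod (K' p)"
        by (intro add_mono mult_left_mono mult_right_mono e(2)) auto
      also have "\<dots> \<le> B" using b[of p] p False by simp
      finally show ?thesis using False by simp
    qed (use B in simp)
  qed
  then show ?thesis using p12 by (simp add: norm_mult)
qed

text \<open>Supplies vanishing boundary terms in a second integration by parts, where the derivative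
  of the amplitude is evaluated at the ends of the interval.\<close>

lemma derivative_zero_outside:
  fixes G :: "real \<Rightarrow> complex"
  assumes "(G has_vector_derivative G') (at p)" "\<And>x. x \<notin> {a<..<b} \<Longrightarrow> G x = 0" "p \<notin> {a..b}"
  shows "G' = 0"
proof -
  have "open (- {a..b})" by (simp add: open_Compl)
  from eventually_nhds_in_open[OF this] assms(3) have "\<forall>\<^sub>F x in nhds p. x \<notin> {a..b}" by simp
  then have ev: "\<forall>\<^sub>F x in nhds p. 0 = G x" by (rule eventually_mono) (use assms(2) in auto)
  have "((\<lambda>x. 0) has_derivative (\<lambda>x. 0)) (at p)" by simp
  then have "(G has_derivative (\<lambda>x. 0)) (at p)"
    by (rule has_derivative_transform_eventually[of _ _ p UNIV G])
      (use ev in \<open>auto simp: eventually_nhds_conv_at\<close>)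
  then have "(G has_vector_derivative 0) (at p)" by (simp add: has_vector_derivative_def)
  then show ?thesis using assms(1) vector_derivative_unique_at by blast
qed

text \<open>\<open>g\<close> is the reciprocal of the phase derivative. Two integrations by parts
  cost two factors \<open>N\<close> and two factors \<open>L\<close>; the margins between
  \<open>p1\<close>, \<open>a\<close> and \<open>b\<close>, \<open>p2\<close> make all boundary
  terms vanish.\<close>

lemma oscillatory_nonstationary:
  fixes e G g :: "real \<Rightarrow> complex"
  assumes p: "p1 < a" "a < b" "b < p2" and L: "L \<ge> 0" "M \<ge> 0" "N \<ge> 0"
    and e: "\<And>p. p \<in> {p1..p2} \<Longrightarrow> (e has_vector_derivative \<i> * of_real (d p) * e p) (at p)" "\<And>p. cmod (e p) \<le> 1"
    and G: "c2_bound {p1..p2} L M G" "\<And>p. p \<notin> {a<..<b} \<Longrightarrow> G p = 0"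
    and g: "c2_bound {p1..p2} L N g" "\<And>p. p \<in> {p1..p2} \<Longrightarrow> of_real (d p) * g p = 1"
    and d: "continuous_on {p1..p2} d"
  shows "cmod (integral {p1..p2} (\<lambda>p. e p * G p)) \<le> 8 * M * N\<^sup>2 * L\<^sup>2 * (p2 - p1)"
proof -
  note m = c2_bound_mult[OF G(1) g(1) L(1)]
  obtain h1 h2 where "c2_data {p1..p2} L (4 * M * N) (\<lambda>p. G p * g p) h1 h2"
    using m unfolding c2_bound_def by blast
  note h = c2_dataD[OF this]
  obtain g1 g2 where "c2_data {p1..p2} L N g g1 g2"
    using g(1) unfolding c2_bound_def by blast
  note g' = c2_dataD[OF this]
  have ec: "continuous_on {p1..p2} e"
    by (intro continuous_on_vderiv[OF e(1)])
  have hc: "continuous_on {p1..p2} h1" "continuous_on {p1..p2} g" "continuous_on {p1..p2} (\<lambda>p. G p * g p)"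
    by (intro continuous_at_imp_continuous_on ballI has_vector_derivative_continuous[OF h(2)] has_vector_derivative_continuous[OF g'(1)] has_vector_derivative_continuous[OF h(1)]; assumption)+
  have z: "h1 p1 = 0" "h1 p2 = 0"
    by (rule derivative_zero_outside[OF h(1), where a = a and b = b]; use p G(2) in simp)+
  \<comment> \<open>The first integration by parts is an identity, since the amplitude
    \<open>G\<close> contains no factor \<open>d\<close> and \<open>G * g\<close> vanishes at both
    ends.\<close>
  have first: "integral {p1..p2} (\<lambda>p. e p * G p) = \<i> * integral {p1..p2} (\<lambda>p. e p * h1 p)"
  proof -
    have "((\<lambda>p. e p * h1 p + (\<i> * of_real (d p) * e p) * (G p * g p)) has_integral (e p2 * (G p2 * g p2) - e p1 * (G p1 * g p1))) {p1..p2}"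
    proof (rule fundamental_theorem_of_calculus)
      show "((\<lambda>p. e p * (G p * g p)) has_vector_derivative e p * h1 p + (\<i> * of_real (d p) * e p) * (G p * g p)) (at p within {p1..p2})"
        if "p \<in> {p1..p2}" for p
        by (rule has_vector_derivative_at_within, rule has_vector_derivative_mult[OF e(1)[OF that] h(1)[OF that]])
    qed (use p in simp)
    then have 0: "((\<lambda>p. e p * h1 p + (\<i> * of_real (d p) * e p) * (G p * g p)) has_integral 0) {p1..p2}"
      using p G(2)[of p1] G(2)[of p2] by simp
    have eq: "e p * h1 p + (\<i> * of_real (d p) * e p) * (G p * g p) = e p * h1 p + \<i> * (e p * G p)" if "p \<in> {p1..p2}" for p
      using g(2)[OF that] by (simp add: mult_ac)
    have 1: "((\<lambda>p. e p * h1 p + \<i> * (e p * G p)) has_integral 0) {p1..p2}"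
      by (rule has_integral_eq[OF eq 0])
    have "(\<lambda>p. e p * h1 p) integrable_on {p1..p2}"
      by (intro integrable_continuous_real continuous_intros ec hc)
    from has_integral_diff[OF 1 integrable_integral[OF this]]
    have "((\<lambda>p. \<i> * (e p * G p)) has_integral - integral {p1..p2} (\<lambda>p. e p * h1 p)) {p1..p2}" by simp
    from has_integral_mult_right[OF this, of "- \<i>"]
    have "((\<lambda>p. e p * G p) has_integral \<i> * integral {p1..p2} (\<lambda>p. e p * h1 p)) {p1..p2}" by simp
    then show ?thesis by (rule integral_unique)
  qed
  \<comment> \<open>The second one is estimated: now \<open>h1 * g\<close> plays the role of
    \<open>K\<close>, with no mismatch between \<open>d\<close> and the phase derivative.\<close>
  have second: "cmod (integral {p1..p2} (\<lambda>p. e p * (of_real (d p) * (h1 p * g p)))) \<le> (8 * M * N\<^sup>2 * L\<^sup>2) * (p2 - p1)"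
  proof (rule oscillatory_by_parts[where Z = "{}" and f = "\<lambda>_. 0" and K' = "\<lambda>p. h1 p * g1 p + h2 p * g p"])
    show "continuous_on {p1..p2} (\<lambda>p. h1 p * g p)" by (intro continuous_intros hc)
    show "((\<lambda>p. h1 p * g p) has_vector_derivative h1 p * g1 p + h2 p * g p) (at p)" if "p \<in> {p1..p2} - {}" for p
      using that by (intro has_vector_derivative_mult h(2) g'(1)) auto
    show "cmod (h1 p * g1 p + h2 p * g p) + \<bar>0\<bar> * cmod (h1 p * g p) \<le> 8 * M * N\<^sup>2 * L\<^sup>2" if "p \<in> {p1..p2} - {}" for p
    proof -
      have "cmod (h1 p * g1 p + h2 p * g p) \<le> cmod (h1 p) * cmod (g1 p) + cmod (h2 p) * cmod (g p)"
        by (rule order_trans[OF norm_triangle_ineq]) (simp add: norm_mult)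
      also have "\<dots> \<le> (4 * M * N * L) * (N * L) + (4 * M * N * L\<^sup>2) * N"
        using that L by (intro add_mono mult_mono h g') auto
      also have "\<dots> = 8 * M * N\<^sup>2 * L\<^sup>2" by (simp add: power2_eq_square)
      finally show ?thesis by simp
    qed
  qed (use p e d z L in auto)
  have "integral {p1..p2} (\<lambda>p. e p * (of_real (d p) * (h1 p * g p))) = integral {p1..p2} (\<lambda>p. e p * h1 p)"
  proof (rule Henstock_Kurzweil_Integration.integral_cong)
    fix p assume "p \<in> {p1..p2}"
    from g(2)[OF this] show "e p * (of_real (d p) * (h1 p * g p)) = e p * h1 p" by (simp add: mult_ac)
  qed
  then show ?thesis using second by (simp add: first norm_mult)
qed

section \<open>Estimates for the Dirac phase\<close>

definition speed :: "real \<Rightarrow> real \<Rightarrow> real" where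
  "speed m p = p / energy m p"

abbreviation speed1 :: "real \<Rightarrow> real \<Rightarrow> real" where
  "speed1 m p \<equiv> m\<^sup>2 / energy m p ^ 3"

abbreviation speed2 :: "real \<Rightarrow> real \<Rightarrow> real" where
  "speed2 m p \<equiv> - 3 * m\<^sup>2 * speed m p / energy m p ^ 4"

lemma energy_DERIV:
  assumes "m > 0" shows "(energy m has_real_derivative speed m p) (at p)"
proof -
  have "0 < p\<^sup>2 + m\<^sup>2" using assms by (intro add_nonneg_pos) auto
  then show ?thesis
    unfolding energy_def[abs_def] speed_def
    by (auto intro!: derivative_eq_intros simp: field_simps)
qed

lemma speed_DERIV:
  assumes m: "m > 0" shows "(speed m has_real_derivative speed1 m p) (at p)"
proof -
  have E: "energy m p \<noteq> 0" using energy_facts[OF m] by simp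
  have "((\<lambda>p. p / energy m p) has_real_derivative (1 * energy m p - p * speed m p) / (energy m p * energy m p)) (at p)"
    by (rule DERIV_divide[OF DERIV_ident energy_DERIV[OF m] E])
  moreover have "(1 * energy m p - p * speed m p) / (energy m p * energy m p) = speed1 m p"
  proof -
    have "1 * energy m p - p * speed m p = m\<^sup>2 / energy m p"
      using E energy_facts(3)[OF m, of p] by (simp add: speed_def field_simps power2_eq_square)
    then show ?thesis using E by (simp add: power3_eq_cube)
  qed
  ultimately show ?thesis by (simp add: speed_def[abs_def])
qed

lemma speed_DERIV2:
  assumes m: "m > 0"
  shows "((\<lambda>p. speed1 m p) has_real_derivative speed2 m p) (at p)"
proof -
  have E: "energy m p \<noteq> 0" using energy_facts[OF m] by simp
  have "((\<lambda>p. speed1 m p) has_real_derivative (0 * energy m p ^ 3 - m\<^sup>2 * (real 3 * (speed m p * energy m p ^ (3 - Suc 0)))) / (energy m p ^ 3 * energy m p ^ 3)) (at p)"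
    by (rule DERIV_divide[OF DERIV_const DERIV_power[OF energy_DERIV[OF m]]]) (use E in simp)
  moreover have "(0 * energy m p ^ 3 - m\<^sup>2 * (real 3 * (speed m p * energy m p ^ (3 - Suc 0)))) / (energy m p ^ 3 * energy m p ^ 3) = speed2 m p"
    using E by (simp add: field_simps power_add[symmetric]) (simp add: power_numeral_reduce)?
  ultimately show ?thesis by simp
qed

lemma energy_ge: "m > 0 \<Longrightarrow> m \<le> energy m p"
  unfolding energy_def by (rule real_le_rsqrt) simp

lemma speed_bounds:
  assumes m: "m > 0"
  shows "\<bar>speed m p\<bar> < 1" "\<bar>speed1 m p\<bar> \<le> 1 / m" "\<bar>speed2 m p\<bar> \<le> 3 / m\<^sup>2"
proof -
  have E: "energy m p > 0" using energy_facts[OF m] by simp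
  have "\<bar>p\<bar> < energy m p" unfolding energy_def using m by (intro real_less_rsqrt) simp
  then show s: "\<bar>speed m p\<bar> < 1" using E by (simp add: speed_def abs_divide)
  have "m ^ 3 \<le> energy m p ^ 3" "m ^ 4 \<le> energy m p ^ 4" using m energy_ge[OF m] by (auto intro: power_mono)
  then have "speed1 m p \<le> m\<^sup>2 / m ^ 3" "m\<^sup>2 / energy m p ^ 4 \<le> m\<^sup>2 / m ^ 4"
    using m E by (auto intro!: divide_left_mono)
  moreover have "m\<^sup>2 / m ^ 3 = 1 / m" "m\<^sup>2 / m ^ 4 = 1 / m\<^sup>2"
    using m by (simp_all add: power2_eq_square power3_eq_cube power4_eq_xxxx)
  ultimately have 1: "speed1 m p \<le> 1 / m" "m\<^sup>2 / energy m p ^ 4 \<le> 1 / m\<^sup>2" by auto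
  then show "\<bar>speed1 m p\<bar> \<le> 1 / m" using E by simp
  have "\<bar>speed2 m p\<bar> = 3 * ((m\<^sup>2 / energy m p ^ 4) * \<bar>speed m p\<bar>)"
    using E by (simp add: abs_mult abs_divide)
  also have "\<dots> \<le> 3 * ((1 / m\<^sup>2) * 1)"
    using s 1(2) E by (intro mult_left_mono mult_mono) auto
  finally show "\<bar>speed2 m p\<bar> \<le> 3 / m\<^sup>2" by simp
qed

lemma speed_strict_mono:
  assumes m: "m > 0" and "p < q" shows "speed m p < speed m q"
  using assms(2)
  by (rule DERIV_pos_imp_increasing) (use speed_DERIV[OF m] energy_facts(1)[OF m] m in \<open>auto intro!: exI divide_pos_pos zero_less_power\<close>)

section \<open>Decay of the coefficients\<close>

locale dirac_coefficients =
  fixes m C \<alpha> \<gamma> :: real and a b :: "real \<Rightarrow> real"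
  assumes m: "m > 0" and C: "C > 0" and al: "3 / 4 < \<alpha>" "\<alpha> < 1" and ga: "1 - \<alpha> < \<gamma>" "\<gamma> < \<alpha> - 1 / 2"
    and a_diff: "\<forall>r>0. a differentiable (at r) \<and> deriv a differentiable (at r)"
    and b_diff: "\<forall>r>0. b differentiable (at r) \<and> deriv b differentiable (at r)"
    and ab_bound: "\<forall>\<nu>\<in>{0, 1, 2::nat}. \<forall>r>0.
           \<bar>(deriv ^^ \<nu>) a r\<bar> + \<bar>(deriv ^^ \<nu>) b r\<bar> \<le> C * (1 + r) powr (- \<alpha> - real \<nu>)"
    and a_bound: "\<forall>r>0. \<bar>a r\<bar> < C * (1 + r) powr (- 1 - \<alpha> + \<gamma>)"
begin

abbreviation "b1 \<equiv> deriv b"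
abbreviation "b2 \<equiv> deriv (deriv b)"

lemma b_DERIV:
  assumes "r > 0"
  shows "(b has_real_derivative b1 r) (at r)" "(b1 has_real_derivative b2 r) (at r)"
  using b_diff assms by (auto simp: DERIV_deriv_iff_real_differentiable)

lemma b_decay:
  assumes r: "r > 0"
  shows "\<bar>b r\<bar> \<le> C * (1 + r) powr - \<alpha>" "\<bar>b1 r\<bar> \<le> C * (1 + r) powr (- \<alpha> - 1)" "\<bar>b2 r\<bar> \<le> C * (1 + r) powr (- \<alpha> - 2)"
proof -
  have ab: "\<bar>(deriv ^^ \<nu>) a r\<bar> + \<bar>(deriv ^^ \<nu>) b r\<bar> \<le> C * (1 + r) powr (- \<alpha> - real \<nu>)" if "\<nu> \<in> {0,1,2}" for \<nu>
    using ab_bound r that by blast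
  show "\<bar>b r\<bar> \<le> C * (1 + r) powr - \<alpha>" using ab[of 0] by simp
  show "\<bar>b1 r\<bar> \<le> C * (1 + r) powr (- \<alpha> - 1)" using ab[of 1] by simp
  show "\<bar>b2 r\<bar> \<le> C * (1 + r) powr (- \<alpha> - 2)" using ab[of 2] by (simp add: numeral_2_eq_2)
qed

lemma powr_decay:
  fixes e t y q :: real
  assumes "e > 0" "t > 0" "e * t \<le> y" "q \<ge> 0"
  shows "(1 + y) powr - q \<le> e powr - q * t powr - q"
proof -
  have "(1 + y) powr - q \<le> (e * t) powr - q"
    using assms by (intro powr_mono2') (auto intro: mult_pos_pos order_trans)
  then show ?thesis using assms by (simp add: powr_mult)
qed

text \<open>Beyond a ray of positive speed \<open>e\<close>, decay in the position becomes decay in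
  time.\<close>

lemma b_decay_far:
  assumes e: "e > 0" "t > 0" "e * t \<le> y"
  shows "\<bar>b y\<bar> \<le> C * e powr - \<alpha> * t powr - \<alpha>" "\<bar>b1 y\<bar> \<le> C * e powr - (\<alpha> + 1) * t powr - (\<alpha> + 1)"
    "\<bar>b2 y\<bar> \<le> C * e powr - (\<alpha> + 2) * t powr - (\<alpha> + 2)"
proof -
  have y: "y > 0" using e by (meson less_le_trans mult_pos_pos)
  have *: "x \<le> C * e powr - q * t powr - q" if "x \<le> C * (1 + y) powr - q" "q \<ge> 0" for x q
  proof -
    have "C * (1 + y) powr - q \<le> C * (e powr - q * t powr - q)"
      using C powr_decay[OF e that(2)] by (intro mult_left_mono) auto
    then show ?thesis using that(1) by simp
  qed
  show "\<bar>b y\<bar> \<le> C * e powr - \<alpha> * t powr - \<alpha>" using b_decay(1)[OF y] al by (intro *) auto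
  show "\<bar>b1 y\<bar> \<le> C * e powr - (\<alpha> + 1) * t powr - (\<alpha> + 1)" using b_decay(2)[OF y] al by (intro *) auto
  show "\<bar>b2 y\<bar> \<le> C * e powr - (\<alpha> + 2) * t powr - (\<alpha> + 2)" using b_decay(3)[OF y] al by (intro *) auto
qed

lemma a_decay_far:
  assumes e: "e > 0" "t > 0" "e * t \<le> y"
  shows "\<bar>a y\<bar> \<le> C * e powr - (1 + \<alpha> - \<gamma>) * t powr - (1 + \<alpha> - \<gamma>)"
proof -
  have y: "y > 0" using e by (meson less_le_trans mult_pos_pos)
  have "\<bar>a y\<bar> \<le> C * (1 + y) powr - (1 + \<alpha> - \<gamma>)" using a_bound y by (auto simp: algebra_simps intro: less_imp_le)
  also have "\<dots> \<le> C * (e powr - (1 + \<alpha> - \<gamma>) * t powr - (1 + \<alpha> - \<gamma>))"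
    using C al ga powr_decay[OF e, of "1 + \<alpha> - \<gamma>"] by (intro mult_left_mono) auto
  finally show ?thesis by simp
qed

lemma ab_bounded:
  assumes "r > 0" shows "\<bar>a r\<bar> \<le> C" "\<bar>b r\<bar> \<le> C" "\<bar>b1 r\<bar> \<le> C"
proof -
  have 1: "(1 + r) powr - q \<le> 1" if "q \<ge> 0" for q
    using powr_mono2'[of "- q" 1 "1 + r"] assms that by simp
  have *: "x \<le> C" if "x \<le> C * (1 + r) powr - q" "q \<ge> 0" for x q
  proof -
    have "C * (1 + r) powr - q \<le> C * 1" using C 1[OF that(2)] by (intro mult_left_mono) auto
    then show ?thesis using that(1) by linarith
  qed
  have "\<bar>a r\<bar> \<le> C * (1 + r) powr - (1 + \<alpha> - \<gamma>)" using a_bound assms by (auto simp: algebra_simps intro: less_imp_le)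
  then show "\<bar>a r\<bar> \<le> C" by (rule *) (use al ga in auto)
  show "\<bar>b r\<bar> \<le> C" by (rule *[OF b_decay(1)[OF assms]]) (use al in auto)
  show "\<bar>b1 r\<bar> \<le> C" using b_decay(2)[OF assms] al by (intro *[of _ "\<alpha> + 1"]) auto
qed

section \<open>The deviation phase and its growth\<close>

lemma antiderivative_b:
  assumes "d > 0"
  shows "\<exists>B. \<forall>y>d. (B has_real_derivative b y) (at y)"
proof -
  \<comment> \<open>Freezing the argument at \<open>d\<close> extends \<open>b\<close> continuously
    to the whole line without any information about its behaviour at 0.\<close>
  have "continuous_on UNIV (\<lambda>x. b (max x d))"
  proof (rule continuous_on_compose2[of "{0<..}" b])
    show "continuous_on {0<..} b"
      by (intro continuous_at_imp_continuous_on ballI DERIV_isCont[OF b_DERIV(1)]) simp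
  qed (use assms in \<open>auto intro!: continuous_intros\<close>)
  then obtain B where "\<And>t. (B has_vector_derivative b (max t d)) (at t)" using antiderivative_exists by blast
  then have "(B has_real_derivative b (max t d)) (at t)" for t by (simp add: has_real_derivative_iff_has_vector_derivative)
  then show ?thesis by (intro exI[of _ B]) (metis max.strict_order_iff max.commute)
qed

text \<open>Comparison with the antiderivative of \<open>C * y powr - \<alpha>\<close>; since
  \<alpha> < 1 it grows like a power, which is what makes a correction of the free evolution grow
  with time.\<close>

lemma antiderivative_b_bound:
  assumes d: "d > 0" "\<And>y. y > d \<Longrightarrow> (B has_real_derivative b y) (at y)" and s: "d < s" "s \<le> 1" and t: "t \<ge> 1"
  shows "\<bar>B (t * s) - B s\<bar> \<le> C / (1 - \<alpha>) * t powr (1 - \<alpha>)"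
proof -
  have s0: "s > 0" using d s by linarith
  have le: "s \<le> t * s" using s0 t by simp
  let ?phi = "\<lambda>y. C / (1 - \<alpha>) * y powr (1 - \<alpha>)"
  have dphi: "(?phi has_vector_derivative C * y powr - \<alpha>) (at y)" if "y > 0" for y
  proof -
    have "(?phi has_real_derivative C / (1 - \<alpha>) * ((1 - \<alpha>) * y powr (1 - \<alpha> - 1))) (at y)"
      using that by (intro DERIV_cmult has_real_derivative_powr)
    then show ?thesis using al by (simp add: has_real_derivative_iff_has_vector_derivative)
  qed
  have dB: "(B has_vector_derivative b y) (at y)" if "y > d" for y
    using d(2)[OF that] by (simp add: has_real_derivative_iff_has_vector_derivative)
  show ?thesis
  proof (cases "t = 1")
    case False
    then have "s < t * s" using le s0 by simp
    then have "norm (B (t * s) - B s) \<le> ?phi (t * s) - ?phi s"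
    proof (rule differentiable_bound_general)
      show "continuous_on {s..t * s} B"
        using s by (intro continuous_on_vderiv[OF dB]) auto
      show "continuous_on {s..t * s} ?phi"
        using s0 by (intro continuous_on_vderiv[OF dphi]) auto
      show "(B has_vector_derivative b y) (at y)" if "s < y" for y using dB s that by simp
      show "(?phi has_vector_derivative C * y powr - \<alpha>) (at y)" if "s < y" for y using dphi s0 that by simp
      show "norm (b y) \<le> C * y powr - \<alpha>" if "s < y" for y
      proof -
        have "y > 0" using that s0 by simp
        then have "(1 + y) powr - \<alpha> \<le> y powr - \<alpha>" using al by (intro powr_mono2') auto
        then have "C * (1 + y) powr - \<alpha> \<le> C * y powr - \<alpha>" using C by (intro mult_left_mono) auto
        then show ?thesis using b_decay(1)[OF \<open>y > 0\<close>] by simp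
      qed
    qed
    also have "\<dots> \<le> ?phi (t * s)" using C al by simp
    also have "\<dots> \<le> ?phi t"
      using C al s s0 t by (intro mult_left_mono powr_mono2) auto
    finally show ?thesis by simp
  qed (use C al in simp)
qed

text \<open>Exponent of the deviation factor for positive times; the sign of time is attached in
  \<open>theta\<close>.\<close>

definition phase :: "real \<Rightarrow> real \<Rightarrow> real" where
  "phase t p = (LBINT r=1..t. b \<bar>r * speed m p\<bar>)"

text \<open>Substituting \<open>y = r * s\<close> expresses the phase through an antiderivative of
  \<open>b\<close>, so derivatives in \<open>p\<close> come from the chain rule instead of
  differentiation under the integral.\<close>

lemma phase_eq:
  assumes d: "d > 0" "\<And>y. y > d \<Longrightarrow> (B has_real_derivative b y) (at y)" and s: "d < speed m p" "d < t * speed m p" and t: "t > 0"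
  shows "phase t p = (B (t * speed m p) - B (speed m p)) / speed m p"
proof -
  let ?s = "speed m p"
  have s0: "?s > 0" using d s by linarith
  have low: "d < r * ?s" if "min 1 t \<le> r" for r
  proof -
    have "min 1 t * ?s \<le> r * ?s" using that s0 by (intro mult_right_mono) auto
    then show ?thesis using s by (auto simp: min_def split: if_splits)
  qed
  have rp: "r > 0" if "min 1 t \<le> r" for r using that t by (auto simp: min_def split: if_splits)
  have "(LBINT r=1..t. b \<bar>r * ?s\<bar>) = B (t * ?s) / ?s - B (1 * ?s) / ?s"
    unfolding one_ereal_def
  proof (rule interval_integral_FTC_finite)
    have "((\<lambda>x. B (x * ?s) / ?s) has_real_derivative b (r * ?s)) (at r)" if "min 1 t \<le> r" for r
    proof -
      have "((\<lambda>x. B (x * ?s)) has_real_derivative b (r * ?s) * ?s) (at r)"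
        by (rule DERIV_chain2[where g = "\<lambda>x. x * ?s", OF d(2)[OF low[OF that]]]) (auto intro!: derivative_eq_intros)
      from DERIV_cdivide[OF this, of ?s] show ?thesis using s0 by simp
    qed
    then show "((\<lambda>x. B (x * ?s) / ?s) has_vector_derivative b \<bar>r * ?s\<bar>) (at r within {min 1 t..max 1 t})"
      if "min 1 t \<le> r" for r
      using rp[OF that] s0 that
      by (auto simp: has_real_derivative_iff_has_vector_derivative intro: has_vector_derivative_at_within)
    show "continuous_on {min 1 t..max 1 t} (\<lambda>r. b \<bar>r * ?s\<bar>)"
    proof (rule continuous_on_compose2[of "{0<..}" b])
      show "continuous_on {0<..} b"
        by (intro continuous_at_imp_continuous_on ballI DERIV_isCont[OF b_DERIV(1)]) simp
      show "(\<lambda>r. \<bar>r * ?s\<bar>) ` {min 1 t..max 1 t} \<subseteq> {0<..}"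
      proof (rule image_subsetI)
        fix r assume "r \<in> {min 1 t..max 1 t}"
        then have "min 1 t \<le> r" by (simp only: atLeastAtMost_iff)
        from rp[OF this] s0 show "\<bar>r * ?s\<bar> \<in> {0<..}" by simp
      qed
    qed (intro continuous_intros)
  qed
  then show ?thesis by (simp add: phase_def diff_divide_distrib)
qed

text \<open>\<Phi> is a smooth expression that agrees with the phase on \<open>S\<close>; its
  derivatives are two-sided also at the ends of \<open>S\<close>, where agreement on a neighbourhood
  is not claimed.\<close>

definition phase_data :: "real set \<Rightarrow> real \<Rightarrow> real \<Rightarrow> (real \<Rightarrow> real) \<Rightarrow> (real \<Rightarrow> real) \<Rightarrow> (real \<Rightarrow> real) \<Rightarrow> bool" where
  "phase_data S K t \<Phi> \<Phi>1 \<Phi>2 \<longleftrightarrow> (\<forall>p\<in>S. \<Phi> p = phase t p \<and> (\<Phi> has_real_derivative \<Phi>1 p) (at p) \<and>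
    (\<Phi>1 has_real_derivative \<Phi>2 p) (at p) \<and> \<bar>\<Phi>1 p\<bar> \<le> K * t powr (1 - \<alpha>) \<and> \<bar>\<Phi>2 p\<bar> \<le> K * t powr (1 - \<alpha>))"

lemma phase_dataD:
  assumes "phase_data S K t \<Phi> \<Phi>1 \<Phi>2" "p \<in> S"
  shows "\<Phi> p = phase t p" "(\<Phi> has_real_derivative \<Phi>1 p) (at p)" "(\<Phi>1 has_real_derivative \<Phi>2 p) (at p)"
    "\<bar>\<Phi>1 p\<bar> \<le> K * t powr (1 - \<alpha>)" "\<bar>\<Phi>2 p\<bar> \<le> K * t powr (1 - \<alpha>)"
  using assms by (auto simp: phase_data_def)

text \<open>A derivative in \<open>p\<close> brings a factor \<open>t\<close> through
  \<open>t * speed m p\<close>, and the faster decay of the next derivative of \<open>b\<close>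
  takes it back. So both derivatives grow only like \<open>t powr (1 - \<alpha>)\<close>. Dividing
  by this growth first allows products to be handled at scale 1.\<close>

lemma phase_c2:
  assumes p1: "0 < p1"
  shows "\<exists>K\<ge>0. \<forall>t\<ge>1. \<exists>\<Phi> \<Phi>1 \<Phi>2. phase_data {p1..p2} K t \<Phi> \<Phi>1 \<Phi>2"
proof -
  \<comment> \<open>Minimal speed on the momentum interval; everything below happens beyond the ray
    of this speed.\<close>
  define e where "e = speed m p1"
  have e: "e > 0" unfolding e_def speed_def using p1 energy_facts(1)[OF m] by simp
  \<comment> \<open>Half the minimal speed, so that all arguments of the antiderivative lie strictly
    beyond \<open>d\<close>.\<close>
  define d where "d = e / 2"
  have d: "d > 0" using e by (simp add: d_def)
  obtain B where B: "\<And>y. y > d \<Longrightarrow> (B has_real_derivative b y) (at y)" using antiderivative_b[OF d] by blast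
  define D where "D = 1 + 1 / m + 3 / m\<^sup>2"
  \<comment> \<open>Common bound for the three quotients by \<open>L\<close>: the first term serves
    the difference of antiderivatives, the others the values of \<open>b\<close> and
    \<open>b1\<close> at \<open>s\<close> and at \<open>t * s\<close>.\<close>
  define A where "A = C / (1 - \<alpha>) + C + C * e powr - \<alpha> + C * e powr - (\<alpha> + 1)"
  let ?S = "{p1..p2}" and ?s = "speed m"
  let ?s1 = "speed1 m" and ?s2 = "speed2 m"
  have sD: "\<bar>?s p\<bar> \<le> D" "\<bar>?s1 p\<bar> \<le> D" "\<bar>?s2 p\<bar> \<le> D" for p
  proof -
    have "0 \<le> 1 / m" "0 \<le> 3 / m\<^sup>2" using m by auto
    then show "\<bar>?s p\<bar> \<le> D" "\<bar>?s1 p\<bar> \<le> D" "\<bar>?s2 p\<bar> \<le> D" using speed_bounds[OF m, of p] unfolding D_def by linarith+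
  qed
  have D0: "D \<ge> 0" using sD(1)[of 0] by linarith
  have A0: "C / (1 - \<alpha>) \<le> A" "C \<le> A" "C + C * e powr - \<alpha> \<le> A" "C + C * e powr - (\<alpha> + 1) \<le> A" "0 \<le> A"
    using C al by (auto simp: A_def)
  have se: "e \<le> ?s p" if "p \<in> ?S" for p
    using speed_strict_mono[OF m, of p1 p] that unfolding e_def by (cases "p = p1") auto
  have cs: "c2_bound ?S 1 D (\<lambda>p. of_real (?s p))"
    by (rule c2_bound_of_real[OF speed_DERIV[OF m] speed_DERIV2[OF m]]) (rule sD)+
  \<comment> \<open>Bounds for the function, its first derivative and the two terms of its second
    derivative, added up.\<close>
  define M1 where "M1 = A + A * D + A * D\<^sup>2 + A * D"
  define N where "N = 1 / e + D / e\<^sup>2 + 2 * D\<^sup>2 / e ^ 3"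
  have cinv: "c2_bound ?S 1 N (\<lambda>p. 1 / complex_of_real (?s p))"
    unfolding N_def
  proof (rule c2_bound_inverse[OF cs e])
    show "cmod (of_real (?s p)) \<ge> e" if "p \<in> ?S" for p using se[OF that] e by simp
  qed
  define K where "K = \<bar>4 * M1 * N\<bar>"
  have "\<exists>\<Phi> \<Phi>1 \<Phi>2. phase_data ?S K t \<Phi> \<Phi>1 \<Phi>2" if t: "t \<ge> 1" for t
  proof -
    define L where "L = t powr (1 - \<alpha>)"
    have L: "L \<ge> 1" unfolding L_def using t al by (simp add: ge_one_powr_ge_zero)
    \<comment> \<open>The factors of \<open>t\<close> from the chain rule are compensated so that
      both orders of differentiation grow like the same power \<open>L\<close>.\<close>
    have tL: "t * t powr - \<alpha> = L" "t\<^sup>2 * t powr - (\<alpha> + 1) = L"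
      using t unfolding L_def by (simp_all add: powr_diff powr_minus powr_add field_simps power2_eq_square)
    have cB: "c2_bound ?S 1 M1 (\<lambda>p. of_real ((B (t * ?s p) - B (?s p)) / L))"
    proof (rule c2_bound_of_real)
      fix p assume p: "p \<in> ?S"
      have s: "?s p > d" "t * ?s p > d" "e * t \<le> t * ?s p" "?s p > 0" "t * ?s p > 0"
      proof -
        show 1: "?s p > d" using se[OF p] e by (simp add: d_def)
        then show 2: "?s p > 0" using d by simp
        then have "?s p \<le> t * ?s p" using t by simp
        then show "t * ?s p > d" "t * ?s p > 0" using 1 2 by linarith+
        show "e * t \<le> t * ?s p" using se[OF p] t by (simp add: mult.commute)
      qed
      show "((\<lambda>p. (B (t * ?s p) - B (?s p)) / L) has_real_derivative ((t * b (t * ?s p) - b (?s p)) / L) * ?s1 p) (at p)"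
      proof -
        have "((\<lambda>p. B (t * ?s p)) has_real_derivative b (t * ?s p) * (t * ?s1 p)) (at p)"
          by (rule DERIV_chain2[where g = "\<lambda>p. t * ?s p", OF B[OF s(2)] DERIV_cmult[OF speed_DERIV[OF m]]])
        from DERIV_cdivide[OF DERIV_diff[OF this DERIV_chain2[where g = ?s, OF B[OF s(1)] speed_DERIV[OF m]]], of L]
        show ?thesis by (rule DERIV_cong) (use L energy_facts(1)[OF m, of p] in \<open>simp add: field_simps\<close>)
      qed
      show "((\<lambda>p. ((t * b (t * ?s p) - b (?s p)) / L) * ?s1 p) has_real_derivative
          ((t\<^sup>2 * b1 (t * ?s p) - b1 (?s p)) / L) * (?s1 p * ?s1 p) + ((t * b (t * ?s p) - b (?s p)) / L) * ?s2 p) (at p)"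
      proof -
        have "((\<lambda>p. b (t * ?s p)) has_real_derivative b1 (t * ?s p) * (t * ?s1 p)) (at p)"
          by (rule DERIV_chain2[where g = "\<lambda>p. t * ?s p", OF b_DERIV(1)[OF s(5)] DERIV_cmult[OF speed_DERIV[OF m]]])
        from DERIV_cdivide[OF DERIV_diff[OF DERIV_cmult[OF this, of t] DERIV_chain2[where g = ?s, OF b_DERIV(1)[OF s(4)] speed_DERIV[OF m]]], of L]
        have "((\<lambda>p. (t * b (t * ?s p) - b (?s p)) / L) has_real_derivative ((t\<^sup>2 * b1 (t * ?s p) - b1 (?s p)) / L) * ?s1 p) (at p)"
          by (rule DERIV_cong) (use L energy_facts(1)[OF m, of p] in \<open>simp add: field_simps power2_eq_square\<close>)
        from DERIV_mult[OF this speed_DERIV2[OF m]] show ?thesis by (simp add: mult_ac add.commute)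
      qed
      have q: "\<bar>x / L\<bar> \<le> A" if "\<bar>x\<bar> \<le> A * L" for x using that L by (simp add: abs_divide divide_le_eq)
      have "C / (1 - \<alpha>) * L \<le> A * L" using A0 L by (intro mult_right_mono) auto
      then have q0: "\<bar>(B (t * ?s p) - B (?s p)) / L\<bar> \<le> A"
        using antiderivative_b_bound[OF d B s(1) _ t] speed_bounds(1)[OF m, of p] unfolding L_def[symmetric] by (intro q) linarith
      have q1: "\<bar>(t * b (t * ?s p) - b (?s p)) / L\<bar> \<le> A"
      proof (rule q)
        have "\<bar>t * b (t * ?s p)\<bar> \<le> t * (C * e powr - \<alpha> * t powr - \<alpha>)"
          using b_decay_far(1)[OF e _ s(3)] t by (simp add: abs_mult)
        also have "\<dots> = C * e powr - \<alpha> * L" unfolding tL(1)[symmetric] by simp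
        finally have "\<bar>t * b (t * ?s p)\<bar> \<le> C * e powr - \<alpha> * L" .
        moreover have "\<bar>b (?s p)\<bar> \<le> C * L" using ab_bounded(2)[OF s(4)] mult_left_mono[OF L less_imp_le[OF C]] unfolding mult_1_right by linarith
        moreover have "(C + C * e powr - \<alpha>) * L \<le> A * L" using A0 L by (intro mult_right_mono) auto
        ultimately show "\<bar>t * b (t * ?s p) - b (?s p)\<bar> \<le> A * L" unfolding distrib_right by linarith
      qed
      have q2: "\<bar>(t\<^sup>2 * b1 (t * ?s p) - b1 (?s p)) / L\<bar> \<le> A"
      proof (rule q)
        have "\<bar>t\<^sup>2 * b1 (t * ?s p)\<bar> \<le> t\<^sup>2 * (C * e powr - (\<alpha> + 1) * t powr - (\<alpha> + 1))"
          using b_decay_far(2)[OF e _ s(3)] t by (simp add: abs_mult)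
        also have "\<dots> = C * e powr - (\<alpha> + 1) * L" unfolding tL(2)[symmetric] by simp
        finally have "\<bar>t\<^sup>2 * b1 (t * ?s p)\<bar> \<le> C * e powr - (\<alpha> + 1) * L" .
        moreover have "\<bar>b1 (?s p)\<bar> \<le> C * L" using ab_bounded(3)[OF s(4)] mult_left_mono[OF L less_imp_le[OF C]] unfolding mult_1_right by linarith
        moreover have "(C + C * e powr - (\<alpha> + 1)) * L \<le> A * L" using A0 L by (intro mult_right_mono) auto
        ultimately show "\<bar>t\<^sup>2 * b1 (t * ?s p) - b1 (?s p)\<bar> \<le> A * L" unfolding distrib_right by linarith
      qed
      have nn: "0 \<le> A * D" "0 \<le> A * D\<^sup>2" using A0 D0 by auto
      show "\<bar>(B (t * ?s p) - B (?s p)) / L\<bar> \<le> M1" using q0 nn unfolding M1_def by linarith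
      have "\<bar>((t * b (t * ?s p) - b (?s p)) / L) * ?s1 p\<bar> \<le> A * D" unfolding abs_mult by (intro mult_mono q1 sD A0) auto
      then show "\<bar>((t * b (t * ?s p) - b (?s p)) / L) * ?s1 p\<bar> \<le> M1" using nn A0 unfolding M1_def by linarith
      have "\<bar>((t\<^sup>2 * b1 (t * ?s p) - b1 (?s p)) / L) * (?s1 p * ?s1 p)\<bar> \<le> A * (D * D)"
        unfolding abs_mult[of "_ / L"] abs_mult[of "?s1 p"] by (intro mult_mono q2 sD A0 D0) auto
      moreover have "\<bar>((t * b (t * ?s p) - b (?s p)) / L) * ?s2 p\<bar> \<le> A * D" unfolding abs_mult[of "_ / L"] by (intro mult_mono q1 sD A0) auto
      moreover have "0 \<le> A * D\<^sup>2" by fact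
      ultimately show "\<bar>((t\<^sup>2 * b1 (t * ?s p) - b1 (?s p)) / L) * (?s1 p * ?s1 p) + ((t * b (t * ?s p) - b (?s p)) / L) * ?s2 p\<bar> \<le> M1"
        using nn A0 unfolding M1_def power2_eq_square by linarith
    qed
    have "c2_bound ?S 1 (4 * M1 * N) (\<lambda>p. of_real ((B (t * ?s p) - B (?s p)) / L) * (1 / complex_of_real (?s p)))"
      by (rule c2_bound_mult[OF cB cinv]) simp
    then obtain f1 f2 where "c2_data ?S 1 (4 * M1 * N) (\<lambda>p. of_real ((B (t * ?s p) - B (?s p)) / L) * (1 / complex_of_real (?s p))) f1 f2"
      unfolding c2_bound_def by blast
    note f = c2_dataD[OF this, unfolded power_one mult_1_right]
    define \<Phi> where "\<Phi> p = (B (t * ?s p) - B (?s p)) / ?s p" for p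
    \<comment> \<open>The calculus of \<open>c2_bound\<close> returns complex derivative functions;
      real parts recover the real derivatives of the phase.\<close>
    have re: "((\<lambda>p. L * Re (f p)) has_real_derivative L * Re f') (at p)" if "(f has_vector_derivative f') (at p)" for f f' p
      using bounded_linear.has_vector_derivative[OF bounded_linear_Re that]
      by (intro DERIV_cmult) (simp add: has_real_derivative_iff_has_vector_derivative)
    have fin: "\<Phi> p = phase t p \<and> (\<Phi> has_real_derivative L * Re (f1 p)) (at p) \<and>
      ((\<lambda>p. L * Re (f1 p)) has_real_derivative L * Re (f2 p)) (at p) \<and> \<bar>L * Re (f1 p)\<bar> \<le> K * L \<and> \<bar>L * Re (f2 p)\<bar> \<le> K * L"
      if p: "p \<in> ?S" for p
    proof (intro conjI)
      have s: "?s p > d" using se[OF p] e by (simp add: d_def)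
      then have "?s p \<le> t * ?s p" using t d by simp
      then have "d < t * ?s p" using s by linarith
      then show "\<Phi> p = phase t p" unfolding \<Phi>_def using s t phase_eq[OF d B] by simp
      have "(\<lambda>p. L * Re (of_real ((B (t * ?s p) - B (?s p)) / L) * (1 / complex_of_real (?s p)))) = \<Phi>"
        using L by (auto simp: fun_eq_iff \<Phi>_def Re_divide_of_real)
      with re[OF f(1)[OF p]] show "(\<Phi> has_real_derivative L * Re (f1 p)) (at p)" by simp
      show "((\<lambda>p. L * Re (f1 p)) has_real_derivative L * Re (f2 p)) (at p)" by (rule re[OF f(2)[OF p]])
      have *: "\<bar>L * Re z\<bar> \<le> K * L" if "cmod z \<le> 4 * M1 * N" for z
      proof -
        have "\<bar>Re z\<bar> \<le> K" using abs_Re_le_cmod[of z] that by (simp add: K_def)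
        then show ?thesis using L by (simp add: abs_mult mult.commute)
      qed
      show "\<bar>L * Re (f1 p)\<bar> \<le> K * L" "\<bar>L * Re (f2 p)\<bar> \<le> K * L" using * f(4,5)[OF p] by auto
    qed
    show ?thesis
      unfolding phase_data_def L_def[symmetric]
      by (rule exI[of _ \<Phi>], rule exI[of _ "\<lambda>p. L * Re (f1 p)"], rule exI[of _ "\<lambda>p. L * Re (f2 p)"], rule ballI, rule fin)
  qed
  note main = this
  have "K \<ge> 0" by (simp add: K_def)
  then show ?thesis by (intro exI[of _ K] conjI allI impI main)
qed

section \<open>Oscillatory integrals with the Dirac phase\<close>

definition kap :: real where "kap = min (2 * \<alpha> - 1 / 2) (1 / 2 + \<alpha> - \<gamma>)"

lemma kap: "kap > 1" using al ga by (auto simp: kap_def)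

abbreviation dirac_wave :: "real \<Rightarrow> real \<Rightarrow> real \<Rightarrow> (real \<Rightarrow> real) \<Rightarrow> real \<Rightarrow> complex" where
  "dirac_wave r T \<eta> \<Phi> p \<equiv> exp (\<i> * of_real (p * r - energy m p * T - \<eta> * \<Phi> p))"

abbreviation b_diff_symbol :: "real \<Rightarrow> real \<Rightarrow> real \<Rightarrow> real" where
  "b_diff_symbol T r p \<equiv> b \<bar>r\<bar> - b (T * speed m p)"

text \<open>One envelope for all regions of \<open>r\<close>. The norm of
  \<open>1 / (T + \<bar>r\<bar>)\<^sup>2\<close> in \<open>r\<close> is of order
  \<open>T powr (- 3 / 2)\<close>, so the exponent is normalised to leave
  \<open>T powr (- kap)\<close>.\<close>

abbreviation decay :: "real \<Rightarrow> real \<Rightarrow> real \<Rightarrow> real" where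
  "decay K T r \<equiv> K * T powr (3 / 2 - kap) / (T + \<bar>r\<bar>)\<^sup>2"

text \<open>Normal form with positive momenta and the branch \<open>+ energy\<close>. Amplitudes
  live in \<open>{l<..<u}\<close>; the wider window makes boundary terms vanish, including those
  with derivatives, and keeps momenta away from 0.\<close>

definition osc :: "real \<Rightarrow> real \<Rightarrow> (real \<Rightarrow> complex) \<Rightarrow> (real \<Rightarrow> real) \<Rightarrow> real \<Rightarrow> real \<Rightarrow> real \<Rightarrow> complex" where
  "osc l u c q T r \<eta> = integral {l/2..2*u}
     (\<lambda>p. dirac_wave r T \<eta> (phase T) p * (of_real (q p) * c p))"

lemma speed_lower:
  assumes "0 < l" "p \<in> {l/2..2*u}"
  shows "0 < speed m (l/2)" "speed m (l/2) \<le> speed m p"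
proof -
  show "0 < speed m (l/2)" unfolding speed_def using assms energy_facts(1)[OF m] by simp
  show "speed m (l/2) \<le> speed m p"
    using speed_strict_mono[OF m, of "l/2" p] assms by (cases "p = l/2") auto
qed

lemma osc_exp_derivative:
  assumes "(\<Phi> has_real_derivative \<Phi>1) (at p)"
  shows "((\<lambda>p. dirac_wave r T \<eta> \<Phi> p) has_vector_derivative
     \<i> * of_real (r - T * speed m p - \<eta> * \<Phi>1) * dirac_wave r T \<eta> \<Phi> p) (at p)"
proof -
  have "((\<lambda>p. p * r - energy m p * T - \<eta> * \<Phi> p) has_real_derivative 1 * r - speed m p * T - \<eta> * \<Phi>1) (at p)"
    by (intro DERIV_diff DERIV_cmult DERIV_cmult_right DERIV_ident energy_DERIV[OF m] assms)
  then have "((\<lambda>p. \<i> * of_real (p * r - energy m p * T - \<eta> * \<Phi> p)) has_vector_derivative \<i> * of_real (1 * r - speed m p * T - \<eta> * \<Phi>1)) (at p)"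
    by (intro has_vector_derivative_mult_right has_vector_derivative_of_real) (simp add: has_real_derivative_iff_has_vector_derivative)
  from field_vector_diff_chain_at[OF this DERIV_exp] show ?thesis by (simp add: o_def mult.commute)
qed

text \<open>The diagonal value makes the divided difference continuous; the stationary point
  \<open>y = r\<close> is later treated as an exceptional point for its derivative.\<close>

definition ddiff :: "real \<Rightarrow> real \<Rightarrow> real" where
  "ddiff r y = (if y = r then b1 r else (b r - b y) / (r - y))"

lemma ddiff_mult: "(r - y) * ddiff r y = b r - b y"
  by (simp add: ddiff_def)

text \<open>One use of the mean value theorem bounds the divided difference by \<open>b1\<close>,
  two nested uses bound its derivative by \<open>b2\<close>. All intermediate points stay beyond
  \<open>k * T\<close>, so the bounds decay in \<open>T\<close> uniformly in the distance to the
  diagonal.\<close>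

lemma ddiff_facts:
  assumes k: "k > 0" "T > 0" "k * T \<le> r" "k * T \<le> y"
  shows "\<bar>ddiff r y\<bar> \<le> C * k powr - (\<alpha> + 1) * T powr - (\<alpha> + 1)" "isCont (ddiff r) y"
    "y \<noteq> r \<Longrightarrow> \<exists>h'. (ddiff r has_real_derivative h') (at y) \<and> \<bar>h'\<bar> \<le> C * k powr - (\<alpha> + 2) * T powr - (\<alpha> + 2)"
proof -
  have kT: "k * T > 0" using k by simp
  \<comment> \<open>Orientation-free mean value theorem, including the degenerate case of equal
    points.\<close>
  have mv: "\<exists>z. k * T \<le> z \<and> f x - f w = (x - w) * f' z \<and> \<bar>z - w\<bar> \<le> \<bar>x - w\<bar>"
    if f: "\<And>z. z > 0 \<Longrightarrow> (f has_real_derivative f' z) (at z)" and xw: "k * T \<le> x" "k * T \<le> w" for f f' :: "real \<Rightarrow> real" and x w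
  proof (cases x w rule: linorder_cases)
    case less
    then obtain z where "x < z" "z < w" "f w - f x = (w - x) * f' z"
      using MVT2[of x w f f'] f kT xw by (metis less_le_trans)
    then show ?thesis using xw less by (intro exI[of _ z]) (auto simp: algebra_simps)
  next
    case equal
    then show ?thesis using xw by (intro exI[of _ w]) auto
  next
    case greater
    then obtain z where "w < z" "z < x" "f x - f w = (x - w) * f' z"
      using MVT2[of w x f f'] f kT xw by (metis less_le_trans)
    then show ?thesis using xw greater by (intro exI[of _ z]) auto
  qed
  have pos: "r > 0" "y > 0" using k kT by linarith+
  show "\<bar>ddiff r y\<bar> \<le> C * k powr - (\<alpha> + 1) * T powr - (\<alpha> + 1)"
  proof (cases "y = r")
    case True
    then show ?thesis using b_decay_far(2)[OF k(1,2,3)] by (simp add: ddiff_def)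
  next
    case False
    obtain z where "k * T \<le> z" "b r - b y = (r - y) * b1 z" using mv[of b b1 r y] b_DERIV(1) k by blast
    then show ?thesis using False b_decay_far(2)[OF k(1,2), of z] by (simp add: ddiff_def)
  qed
  show "isCont (ddiff r) y"
  proof (cases "y = r")
    case True
    have "((\<lambda>y. (b y - b r) / (y - r)) \<longlongrightarrow> b1 r) (at r)"
      using b_DERIV(1)[OF pos(1)] by (simp add: has_field_derivative_iff)
    then have "(ddiff r \<longlongrightarrow> b1 r) (at r)"
      by (rule Lim_transform_eventually)
        (auto simp: eventually_at_filter ddiff_def intro!: always_eventually, metis minus_diff_eq minus_divide_divide)
    then show ?thesis using True by (simp add: isCont_def ddiff_def)
  next
    case False
    have "isCont (\<lambda>y. (b r - b y) / (r - y)) y"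
      using False by (intro continuous_intros DERIV_isCont[OF b_DERIV(1)[OF pos(2)]]) auto
    moreover have "\<forall>\<^sub>F z in nhds y. (b r - b z) / (r - z) = ddiff r z"
      by (rule eventually_mono[OF t1_space_nhds[OF False]]) (simp add: ddiff_def)
    ultimately show ?thesis by (simp add: isCont_cong)
  qed
  show "\<exists>h'. (ddiff r has_real_derivative h') (at y) \<and> \<bar>h'\<bar> \<le> C * k powr - (\<alpha> + 2) * T powr - (\<alpha> + 2)" if False: "y \<noteq> r"
  proof (intro exI conjI)
    let ?h = "(b r - b y - b1 y * (r - y)) / (r - y)\<^sup>2"
    have "((\<lambda>y. (b r - b y) / (r - y)) has_real_derivative ((0 - b1 y) * (r - y) - (b r - b y) * (0 - 1)) / ((r - y) * (r - y))) (at y)"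
      using False by (intro DERIV_divide DERIV_diff DERIV_const DERIV_ident b_DERIV pos) auto
    moreover have "((0 - b1 y) * (r - y) - (b r - b y) * (0 - 1)) / ((r - y) * (r - y)) = ?h"
      by (simp add: power2_eq_square algebra_simps)
    ultimately have "((\<lambda>y. (b r - b y) / (r - y)) has_real_derivative ?h) (at y)" by simp
    moreover have "\<forall>\<^sub>F z in nhds y. (b r - b z) / (r - z) = ddiff r z"
      by (rule eventually_mono[OF t1_space_nhds[OF False]]) (simp add: ddiff_def)
    ultimately show "(ddiff r has_real_derivative ?h) (at y)"
      using DERIV_cong_ev[of y y "\<lambda>z. (b r - b z) / (r - z)" "ddiff r" ?h ?h] by simp
    obtain z where z: "k * T \<le> z" "b r - b y = (r - y) * b1 z" "\<bar>z - y\<bar> \<le> \<bar>r - y\<bar>" using mv[of b b1 r y] b_DERIV(1) k by blast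
    obtain w where w: "k * T \<le> w" "b1 z - b1 y = (z - y) * b2 w" using mv[of b1 b2 z y] b_DERIV(2) k z(1) by blast
    \<comment> \<open>The first mean value turns the numerator into an increment of
      \<open>b1\<close>; since \<open>z\<close> is no farther from \<open>y\<close> than
      \<open>r\<close>, one factor of the denominator cancels.\<close>
    have "?h = (b1 z - b1 y) * (r - y) / (r - y)\<^sup>2" unfolding z(2) by (simp add: algebra_simps)
    also have "\<dots> = (z - y) * b2 w / (r - y)" using False unfolding w(2) by (simp add: power2_eq_square)
    finally have "\<bar>?h\<bar> = \<bar>z - y\<bar> / \<bar>r - y\<bar> * \<bar>b2 w\<bar>" by (simp add: abs_mult abs_divide)
    also have "\<dots> \<le> 1 * \<bar>b2 w\<bar>" using z(3) False by (intro mult_right_mono) auto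
    also have "\<dots> \<le> C * k powr - (\<alpha> + 2) * T powr - (\<alpha> + 2)" using b_decay_far(3)[OF k(1,2) w(1)] by simp
    finally show "\<bar>?h\<bar> \<le> C * k powr - (\<alpha> + 2) * T powr - (\<alpha> + 2)" .
  qed
qed

text \<open>With \<open>d = r - T * s\<close> the symbol is \<open>d\<close> times
  \<open>ddiff\<close>. After one integration by parts the derivative of \<open>ddiff\<close> costs
  \<open>T * T powr - (\<alpha> + 2)\<close>, while the deviation phase costs
  \<open>T powr (1 - \<alpha>) * T powr - (\<alpha> + 1)\<close>. The latter dominates because
  \<alpha> < 1.\<close>

lemma osc_stationary:
  assumes lu: "0 < l" "l < u" and c: "c2_bound {l/2..2*u} 1 Mc c" "\<And>p. p \<notin> {l<..<u} \<Longrightarrow> c p = 0"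
  shows "\<exists>K\<ge>0. \<forall>T\<ge>1. \<forall>r. \<forall>\<eta>\<in>{-1,1}. speed m (l/2) / 2 * T \<le> r \<longrightarrow>
    cmod (osc l u c (b_diff_symbol T r) T r \<eta>) \<le> K * T powr (- 2 * \<alpha>)"
proof -
  let ?S = "{l/2..2*u}" and ?s = "speed m"
  obtain c1 c2 where "c2_data ?S 1 Mc c c1 c2" using c(1) unfolding c2_bound_def by blast
  note c' = c2_dataD[OF this, unfolded power_one mult_1_right]
  have lS: "l/2 \<in> ?S" using lu by simp
  have Mc: "Mc \<ge> 0" using c'(3)[OF lS] norm_ge_zero order_trans by blast
  have "0 < l / 2" using lu by simp
  from phase_c2[OF this, of "2 * u"] obtain K1 where K1: "K1 \<ge> 0" and ph: "\<forall>t\<ge>1. \<exists>\<Phi> \<Phi>1 \<Phi>2. phase_data ?S K1 t \<Phi> \<Phi>1 \<Phi>2"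
    by (elim exE conjE) (erule (1) that)
  define k where "k = ?s (l/2) / 2"
  have k: "k > 0" using speed_lower(1)[OF lu(1) lS] by (simp add: k_def)
  define C2 where "C2 = C * k powr - (\<alpha> + 1)"
  define C3 where "C3 = C * k powr - (\<alpha> + 2)"
  have C23: "C2 \<ge> 0" "C3 \<ge> 0" using C by (auto simp: C2_def C3_def)
  \<comment> \<open>In order: derivative of the divided difference (with \<open>1 / m\<close> from
    the derivative of the speed), derivative of the amplitude, derivative of the deviation
    phase.\<close>
  define B where "B = C3 * (1 / m) * Mc + C2 * Mc + K1 * (C2 * Mc)"
  have B: "B \<ge> 0" unfolding B_def using C23 m Mc K1 by simp
  define K where "K = B * (2 * u - l / 2)"
  have "cmod (osc l u c (b_diff_symbol T r) T r \<eta>) \<le> K * T powr (- 2 * \<alpha>)"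
    if T: "T \<ge> 1" and eta: "\<eta> \<in> {-1,1}" and r: "k * T \<le> r" for T r \<eta>
  proof -
    from ph[THEN spec, THEN mp, OF T] obtain \<Phi> \<Phi>1 \<Phi>2 where
      F: "phase_data ?S K1 T \<Phi> \<Phi>1 \<Phi>2"
      by (elim exE) (erule that)
    note \<Phi> = phase_dataD[OF F]
    have T0: "T > 0" using T by simp
    have "0 < k * T" using k T by simp
    then have r0: "r > 0" using r by linarith
    have Ts: "k * T \<le> T * ?s p" if "p \<in> ?S" for p
    proof -
      have "k \<le> ?s p" using speed_lower[OF lu(1) that] unfolding k_def by linarith
      then show ?thesis using T by (simp add: mult.commute)
    qed
    let ?e = "\<lambda>p. dirac_wave r T \<eta> \<Phi> p"
    let ?K = "\<lambda>p. of_real (ddiff r (T * ?s p)) * c p"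
    let ?d = "\<lambda>p. r - T * ?s p"
    \<comment> \<open>Away from the diagonal some derivative with the right bound exists; this picks
      it as a function.\<close>
    define h' where "h' y = (SOME h'. (ddiff r has_real_derivative h') (at y) \<and> \<bar>h'\<bar> \<le> C3 * T powr - (\<alpha> + 2))" for y
    have h': "(ddiff r has_real_derivative h' y) (at y) \<and> \<bar>h' y\<bar> \<le> C3 * T powr - (\<alpha> + 2)" if "k * T \<le> y" "y \<noteq> r" for y
      unfolding h'_def C3_def using ddiff_facts(3)[OF k T0 r that] by (rule someI_ex)
    \<comment> \<open>The stationary point of the free phase. The speed is strictly increasing, so
      there is at most one.\<close>
    define Z where "Z = {p. T * ?s p = r}"
    have "finite Z"
    proof (cases "Z = {}")
      case False
      then obtain q where q: "T * ?s q = r" by (auto simp: Z_def)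
      have "Z \<subseteq> {q}"
      proof
        fix p assume "p \<in> Z"
        then have "?s p = ?s q" using q T0 by (auto simp: Z_def)
        then show "p \<in> {q}" using speed_strict_mono[OF m, of p q] speed_strict_mono[OF m, of q p] by (cases p q rule: linorder_cases) auto
      qed
      then show ?thesis by (rule finite_subset) simp
    qed simp
    have sc: "continuous_on ?S ?s"
      by (intro continuous_at_imp_continuous_on ballI DERIV_isCont[OF speed_DERIV[OF m]])
    have "osc l u c (b_diff_symbol T r) T r \<eta> = integral ?S (\<lambda>p. ?e p * (of_real (?d p) * ?K p))"
      unfolding osc_def
    proof (rule Henstock_Kurzweil_Integration.integral_cong)
      fix p assume p: "p \<in> ?S"
      have dk: "of_real (?d p) * ?K p = of_real (b r - b (T * ?s p)) * c p"
        by (simp only: mult.assoc[symmetric] of_real_mult[symmetric] ddiff_mult)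
      show "dirac_wave r T \<eta> (phase T) p * (of_real (b \<bar>r\<bar> - b (T * ?s p)) * c p)
         = ?e p * (of_real (?d p) * ?K p)" by (simp only: dk abs_of_pos[OF r0] \<Phi>(1)[OF p])
    qed
    also have "cmod \<dots> \<le> (B * T powr (- 2 * \<alpha>)) * (2 * u - l / 2)"
    proof (rule oscillatory_by_parts[OF _ \<open>finite Z\<close>, where f = "\<lambda>p. \<eta> * \<Phi>1 p"
        and K' = "\<lambda>p. of_real (ddiff r (T * ?s p)) * c1 p + of_real (h' (T * ?s p) * (T * (speed1 m p))) * c p"])
      show "l / 2 \<le> 2 * u" using lu by simp
      show "(?e has_vector_derivative \<i> * of_real (?d p - \<eta> * \<Phi>1 p) * ?e p) (at p)" if "p \<in> ?S" for p
        by (rule osc_exp_derivative[OF \<Phi>(2)[OF that]])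
      show "continuous_on ?S ?K"
      proof (intro continuous_intros)
        show "continuous_on ?S c"
          by (intro continuous_on_vderiv[OF c'(1)])
        show "continuous_on ?S (\<lambda>p. ddiff r (T * ?s p))"
        proof (rule continuous_on_compose2[of "{k * T..}" "ddiff r"])
          show "continuous_on {k * T..} (ddiff r)"
            using ddiff_facts(2)[OF k T0 r] by (intro continuous_at_imp_continuous_on) auto
        qed (use Ts in \<open>auto intro!: continuous_intros sc\<close>)
      qed
      show "(?K has_vector_derivative of_real (ddiff r (T * ?s p)) * c1 p + of_real (h' (T * ?s p) * (T * (speed1 m p))) * c p) (at p)"
        if p: "p \<in> ?S - Z" for p
      proof (rule has_vector_derivative_mult)
        have "(ddiff r has_real_derivative h' (T * ?s p)) (at (T * ?s p))" using h'[OF Ts] p by (auto simp: Z_def)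
        from DERIV_chain2[where g = "\<lambda>p. T * ?s p", OF this DERIV_cmult[OF speed_DERIV[OF m]]]
        show "((\<lambda>p. complex_of_real (ddiff r (T * ?s p))) has_vector_derivative of_real (h' (T * ?s p) * (T * (speed1 m p)))) (at p)"
          by (intro has_vector_derivative_of_real) (simp add: has_real_derivative_iff_has_vector_derivative)
        show "(c has_vector_derivative c1 p) (at p)" using c'(1) p by simp
      qed
      show "continuous_on ?S ?d" by (intro continuous_intros sc)
      show "?K (l / 2) = 0" "?K (2 * u) = 0" using c(2)[of "l/2"] c(2)[of "2*u"] lu by auto
      show "0 \<le> B * T powr (- 2 * \<alpha>)" using B by simp
      show "cmod (of_real (ddiff r (T * ?s p)) * c1 p + of_real (h' (T * ?s p) * (T * (speed1 m p))) * c p)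
          + \<bar>\<eta> * \<Phi>1 p\<bar> * cmod (?K p) \<le> B * T powr (- 2 * \<alpha>)" if p: "p \<in> ?S - Z" for p
      proof -
        have pS: "p \<in> ?S" using p by simp
        have dd: "\<bar>ddiff r (T * ?s p)\<bar> \<le> C2 * T powr - (\<alpha> + 1)" unfolding C2_def by (rule ddiff_facts(1)[OF k T0 r Ts[OF pS]])
        have hh: "\<bar>h' (T * ?s p)\<bar> \<le> C3 * T powr - (\<alpha> + 2)" using h'[OF Ts[OF pS]] p by (auto simp: Z_def)
        have TT: "T powr - (\<alpha> + 2) * T = T powr - (\<alpha> + 1)"
          using T0 powr_mult_base[of T "- (\<alpha> + 2)"] by (simp add: mult.commute algebra_simps)
        have le: "T powr - (\<alpha> + 1) \<le> T powr (- 2 * \<alpha>)" using T al by (intro powr_mono) auto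
        have TL: "T powr (1 - \<alpha>) * T powr - (\<alpha> + 1) = T powr (- 2 * \<alpha>)" by (simp add: powr_add[symmetric])
        have h0: "0 \<le> C2 * T powr - (\<alpha> + 1)" "0 \<le> C3 * T powr - (\<alpha> + 2)" using C23 by auto
        have "cmod (of_real (ddiff r (T * ?s p)) * c1 p) \<le> (C2 * T powr - (\<alpha> + 1)) * Mc"
          unfolding norm_mult norm_of_real using dd c'(4)[OF pS] h0 by (intro mult_mono) auto
        moreover have "cmod (of_real (h' (T * ?s p) * (T * (speed1 m p))) * c p) \<le> ((C3 * T powr - (\<alpha> + 2)) * (T * (1 / m))) * Mc"
          unfolding norm_mult norm_of_real abs_mult using hh c'(3)[OF pS] h0 speed_bounds(2)[OF m, of p] T0 m
          by (intro mult_mono) (auto simp: abs_mult)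
        moreover have "((C3 * T powr - (\<alpha> + 2)) * (T * (1 / m))) * Mc = (C3 * (1 / m) * Mc) * T powr - (\<alpha> + 1)"
          unfolding TT[symmetric] by (simp add: mult_ac)
        moreover have "\<bar>\<eta> * \<Phi>1 p\<bar> * cmod (?K p) \<le> (K1 * T powr (1 - \<alpha>)) * ((C2 * T powr - (\<alpha> + 1)) * Mc)"
          unfolding norm_mult norm_of_real using dd c'(3)[OF pS] h0 eta \<Phi>(4)[OF pS] K1
          by (intro mult_mono) auto
        moreover have "(K1 * T powr (1 - \<alpha>)) * ((C2 * T powr - (\<alpha> + 1)) * Mc) = K1 * (C2 * Mc) * T powr (- 2 * \<alpha>)"
          unfolding TL[symmetric] by (simp add: mult_ac)
        moreover have "(C3 * (1 / m) * Mc) * T powr - (\<alpha> + 1) \<le> (C3 * (1 / m) * Mc) * T powr (- 2 * \<alpha>)"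
          "(C2 * T powr - (\<alpha> + 1)) * Mc \<le> (C2 * Mc) * T powr (- 2 * \<alpha>)"
          using mult_left_mono[OF le, of "C3 * (1 / m) * Mc"] mult_left_mono[OF le, of "C2 * Mc"] C23 Mc m by (simp_all add: mult_ac)
        ultimately show ?thesis
          unfolding B_def distrib_right
          using norm_triangle_ineq[of "of_real (ddiff r (T * ?s p)) * c1 p" "of_real (h' (T * ?s p) * (T * (speed1 m p))) * c p"]
          by linarith
      qed
    qed auto
    finally show ?thesis by (simp add: K_def mult_ac)
  qed
  note main = this
  have "K \<ge> 0" unfolding K_def using B lu by simp
  then show ?thesis unfolding k_def[symmetric] by (intro exI[of _ K] conjI allI ballI impI main)
qed

text \<open>The free phase derivative is comparable to \<open>T + \<bar>r\<bar>\<close> here, so the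
  deviation phase can be counted as amplitude: its derivatives cost only
  \<open>L = T powr (1 - \<alpha>)\<close> each. Two integrations by parts gain the square of
  \<open>L / (T + \<bar>r\<bar>)\<close>.\<close>

lemma osc_nonstationary:
  assumes lu: "0 < l" "l < u" and c: "c2_bound {l/2..2*u} 1 Mc c" "\<And>p. p \<notin> {l<..<u} \<Longrightarrow> c p = 0"
  shows "\<exists>K\<ge>0. \<forall>T\<ge>1. \<forall>r. \<forall>\<eta>\<in>{-1,1}. \<not> (speed m (l/2) / 2 * T \<le> r \<and> r \<le> 2 * T) \<longrightarrow>
    cmod (osc l u c (b_diff_symbol T r) T r \<eta>) \<le> K * T powr (2 - 2 * \<alpha>) / (T + \<bar>r\<bar>)\<^sup>2 \<and>
    cmod (osc l u c (\<lambda>p. a \<bar>r\<bar>) T r \<eta>) \<le> K * T powr (2 - 2 * \<alpha>) / (T + \<bar>r\<bar>)\<^sup>2"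
proof -
  let ?S = "{l/2..2*u}" and ?s = "speed m"
  let ?s1 = "speed1 m" and ?s2 = "speed2 m"
  have lS: "l/2 \<in> ?S" using lu by simp
  note cb = c2_bound_cmod[OF c(1)]
  have Mc: "Mc \<ge> 0" using cb[OF lS] norm_ge_zero order_trans by blast
  have "0 < l / 2" using lu by simp
  from phase_c2[OF this, of "2 * u"] obtain K1 where K1: "K1 \<ge> 0" and ph: "\<forall>t\<ge>1. \<exists>\<Phi> \<Phi>1 \<Phi>2. phase_data ?S K1 t \<Phi> \<Phi>1 \<Phi>2"
    by (elim exE conjE) (erule (1) that)
  define e where "e = ?s (l/2)"
  have e: "0 < e" "e < 1" using speed_lower(1)[OF lu(1) lS] speed_bounds(1)[OF m, of "l/2"] by (auto simp: e_def)
  define D where "D = 1 + 1 / m + 3 / m\<^sup>2"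
  have sD: "\<bar>?s1 p\<bar> \<le> D" "\<bar>?s2 p\<bar> \<le> D" for p
  proof -
    have "0 \<le> 1 / m" "0 \<le> 3 / m\<^sup>2" using m by auto
    then show "\<bar>?s1 p\<bar> \<le> D" "\<bar>?s2 p\<bar> \<le> D" using speed_bounds[OF m, of p] unfolding D_def by linarith+
  qed
  have D1: "D \<ge> 1" using m by (simp add: D_def)
  define Q where "Q = C * e powr - (\<alpha> + 1) + C * e powr - (\<alpha> + 2)"
  have Q: "C * e powr - (\<alpha> + 1) \<le> Q" "C * e powr - (\<alpha> + 2) \<le> Q" "0 \<le> Q" using C by (auto simp: Q_def)
  \<comment> \<open>Common bound for both symbols and their derivatives; the arbitrary values
    \<open>a 0\<close> and \<open>b 0\<close> enter because \<open>r = 0\<close> is allowed.\<close>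
  define Mq where "Mq = 2 * C + \<bar>a 0\<bar> + \<bar>b 0\<bar> + Q * D + Q * D\<^sup>2"
  have QD: "0 \<le> Q * D" "0 \<le> Q * D\<^sup>2" using Q D1 by auto
  have Mq: "0 \<le> Mq" unfolding Mq_def using C QD by simp
  define Me where "Me = 1 + K1 + K1\<^sup>2"
  define N where "N = 1 / (e/4) + D / (e/4)\<^sup>2 + 2 * D\<^sup>2 / (e/4) ^ 3"
  have N: "N \<ge> 0" unfolding N_def using e D1 by simp
  define M where "M = 4 * Mq * (4 * Mc * Me)"
  have M: "M \<ge> 0" unfolding M_def Me_def using Mq Mc K1 by simp
  define K where "K = 8 * M * N\<^sup>2 * (2 * u - l / 2)"
  have main: "cmod (osc l u c q T r \<eta>) \<le> K * T powr (2 - 2 * \<alpha>) / (T + \<bar>r\<bar>)\<^sup>2"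
    if T: "T \<ge> 1" and eta: "\<eta> \<in> {-1,1}" and r: "\<not> (e / 2 * T \<le> r \<and> r \<le> 2 * T)"
      and q: "c2_bound ?S 1 Mq (\<lambda>p. of_real (q p))" for T r \<eta> q
  proof -
    from ph[THEN spec, THEN mp, OF T] obtain \<Phi> \<Phi>1 \<Phi>2 where
      F: "phase_data ?S K1 T \<Phi> \<Phi>1 \<Phi>2"
      by (elim exE) (erule that)
    note \<Phi> = phase_dataD[OF F]
    define L where "L = T powr (1 - \<alpha>)"
    have L: "L \<ge> 1" unfolding L_def using T al by (simp add: ge_one_powr_ge_zero)
    define R where "R = T + \<bar>r\<bar>"
    have R: "R > 0" using T by (simp add: R_def)
    let ?d = "\<lambda>p. r - T * ?s p"
    \<comment> \<open>Speeds on the window lie between \<open>e\<close> and 1. Behind the slowest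
      ray there is a gap of at least half of \<open>e * T\<close>, beyond \<open>2 * T\<close> a gap
      to the fastest possible ray.\<close>
    have far: "e / 4 * R \<le> \<bar>?d p\<bar>" if p: "p \<in> ?S" for p
    proof -
      have s: "e \<le> ?s p" "?s p < 1" using speed_lower(2)[OF lu(1) p] speed_bounds(1)[OF m, of p] by (auto simp: e_def)
      have Ts: "e * T \<le> T * ?s p" "T * ?s p \<le> T" using s T by (auto simp: mult.commute mult_left_le)
      have eT: "0 < e * T" "e * T \<le> T" using e T by (auto simp: mult_left_le_one_le)
      show ?thesis
      proof (cases "r \<le> 2 * T")
        case True
        then have r': "r < e / 2 * T" using r by simp
        show ?thesis
        proof (cases "r \<ge> 0")
          case True
          have "e / 4 * R \<le> e / 4 * (2 * T)" using r' True eT e by (intro mult_left_mono) (auto simp: R_def)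
          then have "e / 4 * R \<le> e * T / 2" by (simp add: mult_ac)
          moreover have "r < e * T / 2" using r' by simp
          ultimately have "e / 4 * R \<le> T * ?s p - r" using Ts by linarith
          also have "\<dots> \<le> \<bar>?d p\<bar>" by linarith
          finally show ?thesis .
        next
          case False
          have "e * \<bar>r\<bar> \<le> \<bar>r\<bar>" using e by (intro mult_left_le_one_le) auto
          moreover have "e / 4 * R = e * T / 4 + e * \<bar>r\<bar> / 4" by (simp add: R_def algebra_simps)
          moreover have "\<bar>r\<bar> = - r" using False by simp
          ultimately have "e / 4 * R \<le> T * ?s p - r" using Ts(1) eT by linarith
          also have "\<dots> \<le> \<bar>?d p\<bar>" by linarith
          finally show ?thesis .
        qed
      next
        case False
        then have "e / 4 * R \<le> 1 / 4 * R" using e R by (intro mult_right_mono) auto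
        moreover have "R = T + r" using False T by (simp add: R_def)
        moreover have "T + r \<le> 4 * (r - T)" using False T by simp
        ultimately have "e / 4 * R \<le> r - T" by simp
        also have "\<dots> \<le> r - T * ?s p" using Ts(2) by simp
        also have "\<dots> \<le> \<bar>?d p\<bar>" by linarith
        finally show ?thesis .
      qed
    qed
    have cd: "c2_bound ?S 1 D (\<lambda>p. of_real (?d p / R))"
    proof (rule c2_bound_of_real[where ?f1.0 = "\<lambda>p. - (T / R) * ?s1 p" and ?f2.0 = "\<lambda>p. - (T / R) * ?s2 p"])
      fix p assume "p \<in> ?S"
      have "((\<lambda>p. (r - T * ?s p) / R) has_real_derivative (0 - T * ?s1 p) / R) (at p)"
        by (intro DERIV_cdivide DERIV_diff DERIV_const DERIV_cmult speed_DERIV[OF m])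
      then show "((\<lambda>p. ?d p / R) has_real_derivative - (T / R) * ?s1 p) (at p)" by (rule DERIV_cong) simp
      show "((\<lambda>p. - (T / R) * ?s1 p) has_real_derivative - (T / R) * ?s2 p) (at p)"
        by (rule DERIV_cmult[OF speed_DERIV2[OF m]])
      have TR: "\<bar>- (T / R)\<bar> \<le> 1" using T R by (simp add: R_def)
      have "\<bar>T * ?s p\<bar> \<le> T" using T speed_bounds(1)[OF m, of p] by (simp add: abs_mult mult_left_le)
      then have "\<bar>?d p\<bar> \<le> R" unfolding R_def by linarith
      then have "\<bar>?d p / R\<bar> \<le> 1" using R by (simp add: abs_divide)
      then show "\<bar>?d p / R\<bar> \<le> D" using D1 by linarith
      have "\<bar>- (T / R)\<bar> * \<bar>?s1 p\<bar> \<le> 1 * D" by (intro mult_mono TR sD) auto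
      then show "\<bar>- (T / R) * ?s1 p\<bar> \<le> D" unfolding abs_mult by simp
      have "\<bar>- (T / R)\<bar> * \<bar>?s2 p\<bar> \<le> 1 * D" by (intro mult_mono TR sD) auto
      then show "\<bar>- (T / R) * ?s2 p\<bar> \<le> D" unfolding abs_mult by simp
    qed
    have "c2_bound ?S 1 N (\<lambda>p. 1 / complex_of_real (?d p / R))"
      unfolding N_def
    proof (rule c2_bound_inverse[OF cd])
      show "e / 4 \<le> cmod (of_real (?d p / R))" if "p \<in> ?S" for p
        using far[OF that] R by (simp only: norm_of_real abs_divide pos_le_divide_eq abs_of_pos)
    qed (use e in simp)
    from c2_bound_mono[OF c2_bound_cmult[OF this, of "of_real (1 / R)"] _ L order_refl]
    have cg: "c2_bound ?S L (N / R) (\<lambda>p. of_real (1 / R) * (1 / complex_of_real (?d p / R)))"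
      using R by (simp add: norm_divide)
    have ce: "c2_bound ?S L Me (\<lambda>p. exp (\<i> * of_real (- \<eta> * \<Phi> p)))"
      unfolding Me_def
    proof (rule c2_bound_exp[OF _ _ _ _ L K1])
      show "((\<lambda>p. - \<eta> * \<Phi> p) has_real_derivative - \<eta> * \<Phi>1 p) (at p)" if "p \<in> ?S" for p
        by (rule DERIV_cmult[OF \<Phi>(2)[OF that]])
      show "((\<lambda>p. - \<eta> * \<Phi>1 p) has_real_derivative - \<eta> * \<Phi>2 p) (at p)" if "p \<in> ?S" for p
        by (rule DERIV_cmult[OF \<Phi>(3)[OF that]])
      show "\<bar>- \<eta> * \<Phi>1 p\<bar> \<le> K1 * L" "\<bar>- \<eta> * \<Phi>2 p\<bar> \<le> K1 * L" if "p \<in> ?S" for p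
        using eta \<Phi>(4,5)[OF that] by (auto simp: L_def)
    qed
    let ?G = "\<lambda>p. of_real (q p) * (c p * exp (\<i> * of_real (- \<eta> * \<Phi> p)))"
    have cG: "c2_bound ?S L M ?G"
      unfolding M_def using L
      by (intro c2_bound_mult c2_bound_mono[OF q _ L order_refl] c2_bound_mono[OF c(1) _ L order_refl] ce) auto
    \<comment> \<open>The deviation phase is moved into the amplitude; the idle term
      \<open>\<eta> * 0\<close> keeps the form required by
      \<open>osc_exp_derivative\<close>.\<close>
    let ?e = "\<lambda>p. exp (\<i> * of_real (p * r - energy m p * T - \<eta> * 0))"
    have "osc l u c q T r \<eta> = integral ?S (\<lambda>p. ?e p * ?G p)"
      unfolding osc_def
    proof (rule Henstock_Kurzweil_Integration.integral_cong)
      fix p assume p: "p \<in> ?S"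
      have "dirac_wave r T \<eta> (phase T) p = ?e p * exp (\<i> * of_real (- \<eta> * \<Phi> p))"
        unfolding exp_add[symmetric] \<Phi>(1)[OF p] by (simp add: algebra_simps)
      then show "dirac_wave r T \<eta> (phase T) p * (of_real (q p) * c p) = ?e p * ?G p"
        by (simp only: mult_ac)
    qed
    also have "cmod \<dots> \<le> 8 * M * (N / R)\<^sup>2 * L\<^sup>2 * (2 * u - l / 2)"
    proof (rule oscillatory_nonstationary[OF _ lu(2) _ _ M _ _ _ cG _ cg])
      show "(?e has_vector_derivative \<i> * of_real (?d p) * ?e p) (at p)" if "p \<in> ?S" for p
        using osc_exp_derivative[of "\<lambda>_. 0" 0 p r T \<eta>] by simp
      show "?G p = 0" if "p \<notin> {l<..<u}" for p using c(2)[OF that] by simp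
      show "of_real (?d p) * (of_real (1 / R) * (1 / complex_of_real (?d p / R))) = 1" if "p \<in> ?S" for p
      proof -
        have "0 < e / 4 * R" using e R by simp
        then have "?d p \<noteq> 0" using far[OF that] by auto
        then show ?thesis using R by (simp del: of_real_diff)
      qed
      show "continuous_on ?S ?d"
        by (intro continuous_intros continuous_at_imp_continuous_on ballI DERIV_isCont[OF speed_DERIV[OF m]])
    qed (use lu L R N in auto)
    also have "L\<^sup>2 = T powr (2 - 2 * \<alpha>)" unfolding L_def power2_eq_square by (simp add: powr_add[symmetric])
    finally show ?thesis by (simp add: K_def R_def power_divide mult_ac)
  qed
  have b_sym: "c2_bound ?S 1 Mq (\<lambda>p. of_real (b \<bar>r\<bar> - b (T * ?s p)))" if T: "T \<ge> 1" for T r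
  proof (rule c2_bound_of_real)
    fix p assume p: "p \<in> ?S"
    have sp: "e \<le> ?s p" using speed_lower(2)[OF lu(1) p] by (simp add: e_def)
    have Ts: "e * T \<le> T * ?s p" "T * ?s p > 0" using sp e T by (auto simp: mult.commute)
    have T0: "T > 0" using T by simp
    show "((b_diff_symbol T r) has_real_derivative - (T * b1 (T * ?s p)) * ?s1 p) (at p)"
    proof -
      have "((\<lambda>p. b (T * ?s p)) has_real_derivative b1 (T * ?s p) * (T * ?s1 p)) (at p)"
        by (rule DERIV_chain2[where g = "\<lambda>p. T * ?s p", OF b_DERIV(1)[OF Ts(2)] DERIV_cmult[OF speed_DERIV[OF m]]])
      from DERIV_diff[OF DERIV_const[of "b \<bar>r\<bar>"] this] show ?thesis by (rule DERIV_cong) (simp add: mult_ac)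
    qed
    show "((\<lambda>p. - (T * b1 (T * ?s p)) * ?s1 p) has_real_derivative
       - (T\<^sup>2 * b2 (T * ?s p)) * (?s1 p * ?s1 p) + - (T * b1 (T * ?s p)) * ?s2 p) (at p)"
    proof -
      have "((\<lambda>p. b1 (T * ?s p)) has_real_derivative b2 (T * ?s p) * (T * ?s1 p)) (at p)"
        by (rule DERIV_chain2[where g = "\<lambda>p. T * ?s p", OF b_DERIV(2)[OF Ts(2)] DERIV_cmult[OF speed_DERIV[OF m]]])
      from DERIV_mult[OF DERIV_minus[OF DERIV_cmult[OF this, of T]] speed_DERIV2[OF m]]
      show ?thesis by (rule DERIV_cong) (simp add: power2_eq_square mult_ac add.commute)
    qed
    have br: "\<bar>b \<bar>r\<bar>\<bar> \<le> C + \<bar>b 0\<bar>" using ab_bounded(2)[of "\<bar>r\<bar>"] C by (cases "r = 0") auto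
    show "\<bar>b \<bar>r\<bar> - b (T * ?s p)\<bar> \<le> Mq"
      using br ab_bounded(2)[OF Ts(2)] QD unfolding Mq_def by linarith
    have le: "T powr - \<alpha> \<le> 1" using powr_mono[of "- \<alpha>" 0 T] T al by simp
    have q1: "\<bar>T * b1 (T * ?s p)\<bar> \<le> Q"
    proof -
      have "T * \<bar>b1 (T * ?s p)\<bar> \<le> T * (C * e powr - (\<alpha> + 1) * T powr - (\<alpha> + 1))"
        using b_decay_far(2)[OF e(1) T0 Ts(1)] T by (intro mult_left_mono) auto
      also have "\<dots> = (C * e powr - (\<alpha> + 1)) * T powr - \<alpha>"
        using T0 powr_mult_base[of T "- (\<alpha> + 1)"] by (simp add: mult_ac)
      also have "\<dots> \<le> (C * e powr - (\<alpha> + 1)) * 1" using le C by (intro mult_left_mono) auto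
      finally show ?thesis using Q T by (simp add: abs_mult)
    qed
    have q2: "\<bar>T\<^sup>2 * b2 (T * ?s p)\<bar> \<le> Q"
    proof -
      have TT: "T\<^sup>2 * T powr - (\<alpha> + 2) = T powr - \<alpha>"
        using T0 by (simp add: powr_add[symmetric] flip: powr_numeral)
      have "T\<^sup>2 * \<bar>b2 (T * ?s p)\<bar> \<le> T\<^sup>2 * (C * e powr - (\<alpha> + 2) * T powr - (\<alpha> + 2))"
        using b_decay_far(3)[OF e(1) T0 Ts(1)] T by (intro mult_left_mono) auto
      also have "\<dots> = (C * e powr - (\<alpha> + 2)) * T powr - \<alpha>" unfolding TT[symmetric] by (simp add: mult_ac)
      also have "\<dots> \<le> (C * e powr - (\<alpha> + 2)) * 1" using le C by (intro mult_left_mono) auto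
      finally show ?thesis using Q T by (simp add: abs_mult)
    qed
    have 1: "\<bar>- (T * b1 (T * ?s p)) * ?s1 p\<bar> \<le> Q * D" unfolding abs_mult[of "- _"] abs_minus_cancel using q1 sD Q by (intro mult_mono) auto
    then show "\<bar>- (T * b1 (T * ?s p)) * ?s1 p\<bar> \<le> Mq" using QD C unfolding Mq_def by linarith
    have 2: "\<bar>- (T * b1 (T * ?s p)) * ?s2 p\<bar> \<le> Q * D" unfolding abs_mult[of "- _"] abs_minus_cancel using q1 sD Q by (intro mult_mono) auto
    have "\<bar>- (T\<^sup>2 * b2 (T * ?s p)) * (?s1 p * ?s1 p)\<bar> \<le> Q * (D * D)"
      unfolding abs_mult[of "- _"] abs_mult[of "?s1 p"] abs_minus_cancel using q2 sD Q D1 by (intro mult_mono) auto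
    with 2 show "\<bar>- (T\<^sup>2 * b2 (T * ?s p)) * (?s1 p * ?s1 p) + - (T * b1 (T * ?s p)) * ?s2 p\<bar> \<le> Mq"
      using C unfolding Mq_def power2_eq_square by linarith
  qed
  have a_sym: "c2_bound ?S 1 Mq (\<lambda>p. of_real (a \<bar>r\<bar>))" for r
  proof (rule c2_bound_mono[OF c2_bound_const[of 1]])
    have "\<bar>a \<bar>r\<bar>\<bar> \<le> C + \<bar>a 0\<bar>" using ab_bounded(1)[of "\<bar>r\<bar>"] C by (cases "r = 0") auto
    then show "cmod (of_real (a \<bar>r\<bar>)) \<le> Mq" using C QD unfolding Mq_def by simp
  qed auto
  have "K \<ge> 0" unfolding K_def using M N lu by simp
  show ?thesis
    unfolding e_def[symmetric]
    by (rule exI[of _ K], intro conjI allI ballI impI \<open>K \<ge> 0\<close>; rule main; (assumption | rule b_sym a_sym, assumption?))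
qed

text \<open>Near the rays \<open>\<bar>r\<bar>\<close> is comparable to \<open>T\<close>, so pure
  powers of \<open>T\<close> fit under the common envelope. The integral with \<open>a\<close> has
  no vanishing symbol there and is bounded by its absolute size.\<close>

theorem osc_estimate:
  assumes lu: "0 < l" "l < u" and c: "c2_bound {l/2..2*u} 1 Mc c" "\<And>p. p \<notin> {l<..<u} \<Longrightarrow> c p = 0"
  shows "\<exists>K\<ge>0. \<forall>T\<ge>1. \<forall>r. \<forall>\<eta>\<in>{-1,1}.
    cmod (osc l u c (b_diff_symbol T r) T r \<eta>) \<le> decay K T r \<and>
    cmod (osc l u c (\<lambda>p. a \<bar>r\<bar>) T r \<eta>) \<le> decay K T r"
proof -
  let ?S = "{l/2..2*u}"
  obtain K1 where K1: "K1 \<ge> 0" "\<forall>T\<ge>1. \<forall>r. \<forall>\<eta>\<in>{-1,1}. speed m (l/2) / 2 * T \<le> r \<longrightarrow>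
    cmod (osc l u c (b_diff_symbol T r) T r \<eta>) \<le> K1 * T powr (- 2 * \<alpha>)"
    using osc_stationary[OF lu c] by blast
  obtain K2 where K2: "K2 \<ge> 0" "\<forall>T\<ge>1. \<forall>r. \<forall>\<eta>\<in>{-1,1}. \<not> (speed m (l/2) / 2 * T \<le> r \<and> r \<le> 2 * T) \<longrightarrow>
    cmod (osc l u c (b_diff_symbol T r) T r \<eta>) \<le> K2 * T powr (2 - 2 * \<alpha>) / (T + \<bar>r\<bar>)\<^sup>2 \<and>
    cmod (osc l u c (\<lambda>p. a \<bar>r\<bar>) T r \<eta>) \<le> K2 * T powr (2 - 2 * \<alpha>) / (T + \<bar>r\<bar>)\<^sup>2"
    using osc_nonstationary[OF lu c] by blast
  have lS: "l/2 \<in> ?S" using lu by simp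
  note cb = c2_bound_cmod[OF c(1)]
  have Mc: "Mc \<ge> 0" using cb[OF lS] norm_ge_zero order_trans by blast
  define k where "k = speed m (l/2) / 2"
  have k: "k > 0" using speed_lower(1)[OF lu(1) lS] by (simp add: k_def)
  define A where "A = C * k powr - (1 + \<alpha> - \<gamma>)"
  have A: "A \<ge> 0" using C by (simp add: A_def)
  \<comment> \<open>The factor 9 is the square of 3, from
    \<open>T + \<bar>r\<bar> \<le> 3 * T\<close> near the rays.\<close>
  define K where "K = 9 * K1 + K2 + 9 * (A * Mc * (2 * u - l / 2))"
  have nn: "0 \<le> A * Mc * (2 * u - l / 2)" using A Mc lu by simp
  have K: "K \<ge> 0" using K1(1) K2(1) nn by (simp add: K_def)
  have "cmod (osc l u c (b_diff_symbol T r) T r \<eta>) \<le> decay K T r \<and>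
    cmod (osc l u c (\<lambda>p. a \<bar>r\<bar>) T r \<eta>) \<le> decay K T r"
    if T: "T \<ge> 1" and eta: "\<eta> \<in> {-1,1}" for T r \<eta>
  proof (cases "k * T \<le> r \<and> r \<le> 2 * T")
    case False
    have "K2 * T powr (2 - 2 * \<alpha>) / (T + \<bar>r\<bar>)\<^sup>2 \<le> decay K T r"
      using K1(1) K2(1) nn T K by (intro divide_right_mono mult_mono powr_mono) (auto simp: K_def kap_def)
    then show ?thesis using K2(2)[rule_format, OF T eta, of r] False unfolding k_def by linarith
  next
    case True
    have "0 < k * T" using k T by simp
    then have r0: "r > 0" using True by linarith
    \<comment> \<open>Conversion of a power of \<open>T\<close> into the envelope; the condition on
      \<open>q\<close> is where the two entries of \<open>kap\<close> are used.\<close>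
    have *: "x \<le> decay K T r" if x: "x \<le> B * T powr (q - 2)" and B: "0 \<le> B" "9 * B \<le> K" and q: "q \<le> 3 / 2 - kap" for x B q
    proof -
      have T2: "T powr (q - 2) = T powr q / T\<^sup>2" using T by (simp add: powr_diff powr_numeral)
      have "(T + \<bar>r\<bar>)\<^sup>2 \<le> (3 * T)\<^sup>2" using True r0 T by (intro power_mono) auto
      then have "(T + \<bar>r\<bar>)\<^sup>2 \<le> 9 * T\<^sup>2" by (simp add: power_mult_distrib)
      then have "B * T powr q * (T + \<bar>r\<bar>)\<^sup>2 \<le> B * T powr q * (9 * T\<^sup>2)" using B by (intro mult_left_mono) auto
      then have "B * T powr q / T\<^sup>2 \<le> 9 * B * T powr q / (T + \<bar>r\<bar>)\<^sup>2" using T r0 by (simp add: divide_simps mult_ac)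
      also have "\<dots> \<le> decay K T r"
        using B q T K by (intro divide_right_mono mult_mono powr_mono) auto
      finally show ?thesis using x T2 by simp
    qed
    have 1: "cmod (osc l u c (b_diff_symbol T r) T r \<eta>) \<le> K1 * T powr ((2 - 2 * \<alpha>) - 2)"
      using K1(2)[rule_format, OF T eta, of r] True unfolding k_def by simp
    have "cmod (osc l u c (\<lambda>p. a \<bar>r\<bar>) T r \<eta>) \<le> (\<bar>a \<bar>r\<bar>\<bar> * Mc) * measure lborel (cbox (l/2) (2*u))"
    \<comment> \<open>A function that is not integrable has gauge integral 0, so the bound is
      trivial in that case.\<close>
    proof (cases "(\<lambda>p. dirac_wave r T \<eta> (phase T) p * (of_real (a \<bar>r\<bar>) * c p)) integrable_on ?S")
      case i: True
      then have "((\<lambda>p. dirac_wave r T \<eta> (phase T) p * (of_real (a \<bar>r\<bar>) * c p)) has_integral osc l u c (\<lambda>p. a \<bar>r\<bar>) T r \<eta>) (cbox (l/2) (2*u))"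
        unfolding osc_def by (simp add: integrable_integral)
      then show ?thesis
        by (rule has_integral_bound[rotated]) (use Mc cb in \<open>auto simp: norm_mult intro!: mult_left_mono\<close>)
    next
      case False
      then show ?thesis unfolding osc_def using Mc by (simp add: not_integrable_integral)
    qed
    also have "\<dots> = \<bar>a r\<bar> * (Mc * (2 * u - l / 2))" using lu r0 by simp
    also have "\<dots> \<le> (A * T powr - (1 + \<alpha> - \<gamma>)) * (Mc * (2 * u - l / 2))"
      unfolding A_def using a_decay_far[OF k _ conjunct1[OF True]] T Mc lu by (intro mult_right_mono) auto
    also have "\<dots> = (A * Mc * (2 * u - l / 2)) * T powr ((1 - \<alpha> + \<gamma>) - 2)" by (simp add: mult_ac add_ac algebra_simps)
    finally have 2: "cmod (osc l u c (\<lambda>p. a \<bar>r\<bar>) T r \<eta>) \<le> (A * Mc * (2 * u - l / 2)) * T powr ((1 - \<alpha> + \<gamma>) - 2)" .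
    show ?thesis
      by (intro conjI *[OF 1] *[OF 2]) (use K1(1) K2(1) nn in \<open>auto simp: K_def kap_def\<close>)
  qed
  note main = this
  from K show ?thesis by (intro exI[of _ K] conjI allI ballI impI) (assumption, (rule conjunct1[OF main] conjunct2[OF main]; assumption)+)
qed

end

section \<open>Absolute continuity of the free Dirac operator\<close>

text \<open>Off the origin \<open>p\<close> is one of the two smooth functions \<open>\<plusminus> sqrt (y\<^sup>2 - m\<^sup>2)\<close> of \<open>y = \<plusminus> energy m p\<close>.\<close>

lemma energy_preimage_null:
  assumes m: "m > 0" and s: "s \<in> {-1, 1}" and N: "N \<in> null_sets lborel"
  shows "{p. s * energy m p \<in> N} \<in> null_sets lborel"
proof -
  have Nb: "N \<in> sets borel" using N by auto
  have meas: "{p. s * energy m p \<in> N} \<in> sets lborel"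
  proof -
    have "(\<lambda>p. s * energy m p) -` N \<inter> space borel \<in> sets borel"
      by (rule measurable_sets[OF _ Nb]) measurable
    then show ?thesis by (simp add: vimage_def)
  qed
  have neg: "negligible N"
    unfolding negligible_iff_null_sets using N null_sets_completion_iff[of N lborel] by auto
  let ?f = "\<lambda>y. sqrt (y\<^sup>2 - m\<^sup>2)" and ?N = "N \<inter> {y. \<bar>y\<bar> > m}"
  have d: "(\<lambda>y. c * ?f y) differentiable_on ?N" for c :: real
  proof (intro differentiable_at_imp_differentiable_on)
    fix y assume "y \<in> ?N"
    then have "m\<^sup>2 < \<bar>y\<bar>\<^sup>2" using m by (intro power_strict_mono) auto
    then have "y\<^sup>2 - m\<^sup>2 > 0" by simp
    then have "((\<lambda>y. c * ?f y) has_real_derivative c * ((2 * y) * (inverse (sqrt (y\<^sup>2 - m\<^sup>2)) / 2))) (at y)"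
      by (auto intro!: derivative_eq_intros)
    then show "(\<lambda>y. c * ?f y) differentiable (at y)" by (auto simp: real_differentiable_def)
  qed
  have n: "negligible ((\<lambda>y. c * ?f y) ` ?N)" for c :: real
    by (rule negligible_differentiable_image_negligible[OF order_refl _ d]) (rule negligible_subset[OF neg], auto)
  \<comment> \<open>The point \<open>p = 0\<close> is split off since the inverse branches are not
    differentiable at the threshold energy \<open>m\<close>.\<close>
  have "{p. s * energy m p \<in> N} \<subseteq> {0} \<union> ((\<lambda>y. 1 * ?f y) ` ?N \<union> (\<lambda>y. (-1) * ?f y) ` ?N)"
  proof
    fix p assume p: "p \<in> {p. s * energy m p \<in> N}"
    show "p \<in> {0} \<union> ((\<lambda>y. 1 * ?f y) ` ?N \<union> (\<lambda>y. (-1) * ?f y) ` ?N)"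
    proof (cases "p = 0")
      case False
      have "m < energy m p" unfolding energy_def using m False by (intro real_less_rsqrt) auto
      then have y: "s * energy m p \<in> ?N" using p s by auto
      have "?f (s * energy m p) = \<bar>p\<bar>"
        using s energy_facts(3)[OF m, of p] by (auto simp: power_mult_distrib)
      then have "p = 1 * ?f (s * energy m p) \<or> p = (-1) * ?f (s * energy m p)" by (cases "p > 0") auto
      then show ?thesis using y by blast
    qed simp
  qed
  then have "negligible {p. s * energy m p \<in> N}"
    by (rule negligible_subset[rotated]) (intro negligible_Un n negligible_sing)
  then show ?thesis
    unfolding negligible_iff_null_sets using null_sets_completion_iff[OF meas] by simp
qed

text \<open>The sum is formed from Radon-Nikodym densities, which makes absolute continuity and the
  formula for integrals immediate. The index \<open>bool\<close> stands for the two signs of the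
  energy.\<close>

lemma ac_measure_add:
  fixes \<mu> :: "bool \<Rightarrow> real measure"
  assumes \<mu>: "\<And>i::bool. sets (\<mu> i) = sets borel" "\<And>i. finite_measure (\<mu> i)" "\<And>i. absolutely_continuous lborel (\<mu> i)"
  shows "\<exists>\<nu>. sets \<nu> = sets borel \<and> finite_measure \<nu> \<and> absolutely_continuous lborel \<nu> \<and>
    (\<forall>(f :: real \<Rightarrow> complex) K. f \<in> borel_measurable borel \<longrightarrow> (\<forall>x. cmod (f x) \<le> K) \<longrightarrow>
      (\<integral>x. f x \<partial>\<nu>) = (\<integral>x. f x \<partial>\<mu> True) + (\<integral>x. f x \<partial>\<mu> False))"
proof -
  have "\<exists>D::real \<Rightarrow> real. D \<in> borel_measurable borel \<and> (\<forall>x. 0 \<le> D x) \<and> \<mu> i = density lborel (\<lambda>x. ennreal (D x))" for i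
  proof -
    have sl: "sets (\<mu> i) = sets lborel" using \<mu>(1)[of i] by simp
    obtain D where D: "D \<in> borel_measurable lborel" "AE x in lborel. RN_deriv lborel (\<mu> i) x = ennreal (D x)" "\<And>x. 0 \<le> D x"
      by (rule sigma_finite_measure.real_RN_deriv[OF sigma_finite_lborel \<mu>(2)[of i] \<mu>(3)[of i] sl]) (rule that)
    have "\<mu> i = density lborel (RN_deriv lborel (\<mu> i))"
      using sigma_finite_measure.density_RN_deriv[OF sigma_finite_lborel \<mu>(3)[of i]] \<mu>(1)[of i] by simp
    also have "\<dots> = density lborel (\<lambda>x. ennreal (D x))"
      by (rule density_cong[OF borel_measurable_RN_deriv _ D(2)]) (use D(1) in measurable)
    finally show ?thesis using D by auto
  qed
  then obtain D :: "bool \<Rightarrow> real \<Rightarrow> real" where D: "\<And>i. D i \<in> borel_measurable borel" "\<And>i x. 0 \<le> D i x" "\<And>i. \<mu> i = density lborel (\<lambda>x. ennreal (D i x))" by metis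
  note [measurable] = D(1)
  have Di: "integrable lborel (D i)" for i
  proof -
    have "integrable (\<mu> i) (\<lambda>x. 1 :: real)" using finite_measure.integrable_const[OF \<mu>(2)] by blast
    then show ?thesis unfolding D(3) by (subst (asm) integrable_density) (auto simp: D(2))
  qed
  define \<nu> where "\<nu> = density lborel (\<lambda>x. ennreal (D True x + D False x))"
  have s: "sets \<nu> = sets borel" by (simp add: \<nu>_def)
  have "integrable \<nu> (\<lambda>x. 1 :: real)"
    unfolding \<nu>_def by (subst integrable_density) (auto simp: D(2) Di)
  then have fin: "finite_measure \<nu>"
    by (intro finite_measureI) (auto simp: integrable_iff_bounded top.not_eq_extremum)
  have ac: "absolutely_continuous lborel \<nu>" unfolding \<nu>_def by (rule absolutely_continuousI_density) measurable
  have "(\<integral>x. f x \<partial>\<nu>) = (\<integral>x. f x \<partial>\<mu> True) + (\<integral>x. f x \<partial>\<mu> False)"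
    if [measurable]: "f \<in> borel_measurable borel" and K: "\<And>x. cmod (f x) \<le> K" for f :: "real \<Rightarrow> complex" and K
  proof -
    have i: "integrable lborel (\<lambda>x. D i x *\<^sub>R f x)" for i
    proof (rule integrable_dominated)
      show "integrable lborel (\<lambda>x. K * D i x)" using Di by simp
      show "AE x in lborel. norm (D i x *\<^sub>R f x) \<le> norm (K * D i x)"
      proof (rule AE_I2)
        fix x
        have "D i x * cmod (f x) \<le> D i x * K" by (intro mult_left_mono K D)
        also have "\<dots> \<le> norm (K * D i x)" by (simp add: mult.commute)
        finally show "norm (D i x *\<^sub>R f x) \<le> norm (K * D i x)" by (simp add: D(2))
      qed
    qed measurable
    have e: "(\<integral>x. f x \<partial>\<mu> i) = (LBINT x. D i x *\<^sub>R f x)" for i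
      unfolding D(3) by (rule integral_density) (auto simp: D(2))
    have "(\<integral>x. f x \<partial>\<nu>) = (LBINT x. (D True x + D False x) *\<^sub>R f x)"
      unfolding \<nu>_def by (rule integral_density) (auto simp: D(2))
    also have "\<dots> = (LBINT x. D True x *\<^sub>R f x) + (LBINT x. D False x *\<^sub>R f x)"
      unfolding scaleR_add_left by (rule Bochner_Integration.integral_add[OF i i])
    finally show ?thesis by (simp add: e)
  qed
  with s fin ac show ?thesis by blast
qed

text \<open>The spectral measure at \<open>x\<close> is the sum of the images, under plus and minus
  the energy, of the momentum densities of the two spectral components of \<open>x\<close>. Each
  image is absolutely continuous because preimages of null sets are null.\<close>

theorem ac_subspace_op_L0:
  assumes m: "m > 0"
  shows "ac_subspace (op_L0 m) = UNIV"
proof -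
  have "\<exists>\<mu>. is_spectral_measure (op_L0 m) x \<mu> \<and> absolutely_continuous lborel \<mu>" for x
  proof -
    define v where "v = rep_L2 (fourier x)"
    have v: "square_integrable v" by (simp add: v_def square_integrable_rep)
    note [measurable] = square_integrable_measurable[OF v]
    have vi: "integrable lborel (\<lambda>p. (norm (v p))\<^sup>2)" using v by (simp add: square_integrable_def)
    define h where "h p = (dirac_symbol m p *v v p) \<bullet> v p / energy m p" for p
    \<comment> \<open>Squared length of the projection of \<open>v p\<close> onto the eigenspace of
      the symbol with eigenvalue plus or minus the energy.\<close>
    define w where "w i p = ((norm (v p))\<^sup>2 + (if i then 1 else -1) * h p) / 2" for i p
    have hm [measurable]: "h \<in> borel_measurable borel"
      unfolding h_def
      by (intro borel_measurable_divide borel_measurable_inner measurable_matrix_vector dirac_symbol_measurable energy_measurable)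
        measurable
    have E: "energy m p > 0" for p by (rule energy_facts(1)[OF m])
    have hb: "\<bar>h p\<bar> \<le> (norm (v p))\<^sup>2" for p
    proof -
      have "\<bar>(dirac_symbol m p *v v p) \<bullet> v p\<bar> \<le> energy m p * norm (v p) * norm (v p)"
        using Cauchy_Schwarz_ineq2[of "dirac_symbol m p *v v p" "v p"] by (simp add: norm_dirac_symbol[OF m])
      then show ?thesis using E[of p] by (simp add: h_def abs_divide divide_le_eq power2_eq_square mult_ac)
    qed
    have w0: "0 \<le> w i p" for i p using hb[of p] by (auto simp: w_def)
    have wm [measurable]: "w i \<in> borel_measurable borel" for i unfolding w_def by measurable
    have wi: "integrable lborel (w i)" for i
    proof (rule integrable_dominated[OF vi])
      have "\<bar>w i p\<bar> \<le> (norm (v p))\<^sup>2" for p using hb[of p] w0[of i p] by (auto simp: w_def)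
      then show "AE p in lborel. norm (w i p) \<le> norm ((norm (v p))\<^sup>2)" by simp
    qed measurable
    define sg where "sg i = (if i then 1 else -1 :: real)" for i
    have sg: "sg i \<in> {-1, 1}" for i by (simp add: sg_def)
    define \<mu> where "\<mu> i = distr (density lborel (w i)) borel (\<lambda>p. sg i * energy m p)" for i
    have \<mu>: "\<exists>\<nu>. sets \<nu> = sets borel \<and> finite_measure \<nu> \<and> absolutely_continuous lborel \<nu> \<and>
      (\<forall>(f :: real \<Rightarrow> complex) K. f \<in> borel_measurable borel \<longrightarrow> (\<forall>x. cmod (f x) \<le> K) \<longrightarrow>
      (\<integral>x. f x \<partial>\<nu>) = (\<integral>x. f x \<partial>\<mu> True) + (\<integral>x. f x \<partial>\<mu> False))"
    proof (rule ac_measure_add)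
      fix i
      show "sets (\<mu> i) = sets borel" by (simp add: \<mu>_def)
      have "integrable (density lborel (w i)) (\<lambda>x. 1 :: real)"
        by (subst integrable_density) (auto simp: w0 wi)
      then have "finite_measure (density lborel (w i))"
        by (intro finite_measureI) (auto simp: integrable_iff_bounded top.not_eq_extremum)
      then show "finite_measure (\<mu> i)" unfolding \<mu>_def by (rule finite_measure.finite_measure_distr) measurable
      show "absolutely_continuous lborel (\<mu> i)"
        unfolding absolutely_continuous_def
      proof
        fix N :: "real set" assume N: "N \<in> null_sets lborel"
        have Nb: "N \<in> sets borel" using N by auto
        let ?P = "{p. sg i * energy m p \<in> N}"
        have P: "?P \<in> null_sets lborel" by (rule energy_preimage_null[OF m sg N])
        have "?P \<in> null_sets (density lborel (w i))"
          using absolutely_continuousI_density[of "\<lambda>p. ennreal (w i p)" lborel] P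
          unfolding absolutely_continuous_def by auto
        then have "emeasure (density lborel (w i)) ?P = 0" by auto
        then have "emeasure (\<mu> i) N = 0"
          unfolding \<mu>_def by (subst emeasure_distr[OF _ Nb]) (auto simp: vimage_def)
        then show "N \<in> null_sets (\<mu> i)" using Nb by (simp add: null_sets_def \<mu>_def)
      qed
    qed
    then obtain \<nu> where \<nu>: "sets \<nu> = sets borel" "finite_measure \<nu>" "absolutely_continuous lborel \<nu>"
      and int: "\<And>(f :: real \<Rightarrow> complex) K. f \<in> borel_measurable borel \<Longrightarrow> (\<And>x. cmod (f x) \<le> K) \<Longrightarrow>
        (\<integral>x. f x \<partial>\<nu>) = (\<integral>x. f x \<partial>\<mu> True) + (\<integral>x. f x \<partial>\<mu> False)" by metis
    have "cinner (exp_i (op_L0 m) t x) x = (\<integral>l. exp (\<i> * of_real (l * t)) \<partial>\<nu>)" for t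
    proof -
      have bs: "bounded_symbol (dirac_group_symbol m t) 1"
        by (rule unitary_symbol_norm(2)[OF dirac_group_unitary_symbol[OF m]])
      let ?d = "\<lambda>p. vdot (dirac_group_symbol m t p *v v p) (v p)"
      let ?W = "\<lambda>i p. w i p *\<^sub>R exp (\<i> * complex_of_real (sg i * energy m p * t))"
      have fm: "(\<lambda>l. exp (\<i> * complex_of_real (l * t))) \<in> borel_measurable borel"
        by (intro borel_measurable_continuous_onI continuous_intros)
      have ii: "(\<integral>l. exp (\<i> * of_real (l * t)) \<partial>\<mu> i) = (LBINT p. ?W i p)" for i
      proof -
        have "(\<integral>l. exp (\<i> * of_real (l * t)) \<partial>\<mu> i) = (\<integral>p. exp (\<i> * of_real (sg i * energy m p * t)) \<partial>density lborel (w i))"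
          unfolding \<mu>_def by (rule integral_distr[OF _ fm]) measurable
        also have "\<dots> = (LBINT p. ?W i p)"
          by (rule integral_density) (auto simp: w0)
        finally show ?thesis .
      qed
      have i1: "integrable lborel (\<lambda>p. ?W i p)" for i
      proof (rule integrable_dominated[OF wi[of i]])
        show "AE p in lborel. norm (?W i p) \<le> norm (w i p)"
          using cmod_exp_i[of "sg i * energy m p * t" for p] by simp
      qed measurable
      have "cinner (exp_i (op_L0 m) t x) x = cinner (fourier (free_group m t x)) (fourier x)"
        by (simp add: exp_i_op_L0[OF m] fourier_facts(7))
      also have "\<dots> = cinner (mult_op (dirac_group_symbol m t) (fourier x)) (fourier x)"
        by (simp add: free_group_def fourier_fmult)
      also have "\<dots> = (LBINT p. vdot (rep_L2 (mult_op (dirac_group_symbol m t) (fourier x)) p) (v p))"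
        unfolding cinner_rep_L2 v_def ..
      also have "\<dots> = (LBINT p. ?d p)"
      proof (rule integral_cong_AE)
        show "AE p in lborel. vdot (rep_L2 (mult_op (dirac_group_symbol m t) (fourier x)) p) (v p)
           = ?d p"
          using rep_mult_op[OF bs, of "fourier x"] unfolding v_def by eventually_elim simp
        have "(\<lambda>p. dirac_group_symbol m t p *v v p) \<in> borel_measurable borel"
          by (intro measurable_matrix_vector dirac_group_symbol_measurable) measurable
        then show "(\<lambda>p. ?d p) \<in> borel_measurable lborel" by measurable
      qed (simp add: borel_measurable_vdot)
      also have "\<dots> = (LBINT p. ?W True p + ?W False p)"
      proof (rule Bochner_Integration.integral_cong[OF refl])
        fix p
        let ?H = "dirac_symbol m p *v v p"
        have "Im (vdot ?H (v p)) = 0"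
          by (simp add: vdot_expand mat2_expand dirac_symbol_def algebra_simps)
        then have H: "vdot ?H (v p) = of_real (h p * energy m p)"
          using Re_vdot[of ?H "v p"] E[of p] by (simp add: complex_eq_iff h_def)
        have "?d p = of_real (cos (t * energy m p)) * of_real ((norm (v p))\<^sup>2)
          + \<i> * of_real (sin (t * energy m p) / energy m p) * of_real (h p * energy m p)"
        proof -
          have add: "vdot (a + b) c = vdot a c + vdot b c" for a b c
            by (simp add: vdot_expand algebra_simps)
          show ?thesis unfolding dirac_group_symbol_expand add vdot_scale_left H norm_vdot ..
        qed
        also have "\<dots> = of_real (cos (t * energy m p)) * of_real ((norm (v p))\<^sup>2) + \<i> * of_real (sin (t * energy m p)) * of_real (h p)"
          using E[of p] by simp
        also have "\<dots> = ?W True p + ?W False p"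
          by (simp add: complex_eq_iff w_def sg_def Re_exp Im_exp field_simps)
        finally show "?d p
          = ?W True p + ?W False p" .
      qed
      also have "\<dots> = (\<integral>l. exp (\<i> * of_real (l * t)) \<partial>\<mu> True) + (\<integral>l. exp (\<i> * of_real (l * t)) \<partial>\<mu> False)"
        unfolding ii by (rule Bochner_Integration.integral_add[OF i1 i1])
      also have "\<dots> = (\<integral>l. exp (\<i> * of_real (l * t)) \<partial>\<nu>)"
        by (rule int[where K = 1, OF fm, symmetric]) simp
      finally show ?thesis .
    qed
    then have "is_spectral_measure (op_L0 m) x \<nu>" using \<nu> by (simp add: is_spectral_measure_def)
    with \<nu>(3) show ?thesis by blast
  qed
  then show ?thesis by (auto simp: ac_subspace_def)
qed

lemma orth_projector_UNIV: "orth_projector UNIV x = x"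
  unfolding orth_projector_def
proof (rule the_equality)
  fix y assume "y \<in> UNIV \<and> (\<forall>z\<in>UNIV. cinner (x - y) z = 0)"
  then have "cinner (x - y) (x - y) = 0" by blast
  then show "y = x" by (simp add: cinner_self)
qed (simp add: cinner.zero_left)

section \<open>Scalar multipliers in the momentum representation\<close>

definition phase_symbol :: "(real \<Rightarrow> real) \<Rightarrow> real \<Rightarrow> complex^2^2" where
  "phase_symbol \<theta> p = mat (exp (\<i> * of_real (\<theta> p)))"

lemma mat_vector: "mat c *v (v :: complex^2) = c *s v"
  by (simp add: vec_eq_iff forall_2 matrix_vector_mult_def mat_def sum_2)

lemma mat_mat: "mat c ** mat d = (mat (c * d) :: complex^2^2)"
  by (simp add: vec_eq_iff forall_2 matrix_matrix_mult_def mat_def sum_2)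

lemma mat_commute: "mat c ** A = (A :: complex^2^2) ** mat c"
  unfolding vec_eq_iff forall_2 matrix_matrix_mult_def mat_def by (simp add: sum_2 mult.commute)

lemma matrix_vscale: "A *v (c *s v) = c *s ((A :: complex^2^2) *v v)"
  by (simp add: vec_eq_iff forall_2 matrix_vector_mult_def sum_2 algebra_simps)

lemma bounded_symbol_mat:
  assumes "c \<in> borel_measurable borel" "\<And>p. cmod (c p) \<le> K"
  shows "bounded_symbol (\<lambda>p. mat (c p)) K"
proof -
  have "(\<lambda>p. (mat (c p) :: complex^2^2) $ i $ j) \<in> borel_measurable borel" for i j
    using assms(1) by (cases "i = j") (simp_all add: mat_def)
  then show ?thesis unfolding bounded_symbol_def mat_vector norm_vscale using assms(2) by (auto intro: mult_right_mono)
qed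

lemma measurable_exp_i [measurable]:
  assumes [measurable]: "\<theta> \<in> borel_measurable borel"
  shows "(\<lambda>p. exp (\<i> * complex_of_real (\<theta> p))) \<in> borel_measurable borel"
  by measurable

lemma phase_symbol_unitary:
  assumes th: "\<theta> \<in> borel_measurable borel"
  shows "unitary_symbol (phase_symbol \<theta>) (phase_symbol (\<lambda>p. - \<theta> p))"
proof -
  have m: "(\<lambda>p. phase_symbol \<theta> p $ i $ j) \<in> borel_measurable borel" if "\<theta> \<in> borel_measurable borel" for \<theta> i j
    using bounded_symbol_mat[OF measurable_exp_i[OF that], of 1] by (simp add: bounded_symbol_def phase_symbol_def)
  have c: "cnj (exp (\<i> * complex_of_real (- \<theta> p))) = exp (\<i> * complex_of_real (\<theta> p))" for p
    by (simp add: exp_cnj)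
  have e: "exp (\<i> * complex_of_real (\<theta> p)) * exp (\<i> * complex_of_real (- \<theta> p)) = 1" for p
    by (simp add: exp_add[symmetric])
  show ?thesis
    unfolding unitary_symbol_def
  proof (intro conjI allI)
    show "vdot (phase_symbol \<theta> p *v u) v = vdot u (phase_symbol (\<lambda>p. - \<theta> p) p *v v)" for p u v
      unfolding phase_symbol_def mat_vector vdot_scale_left vdot_scale_right c ..
    show "phase_symbol \<theta> p ** phase_symbol (\<lambda>p. - \<theta> p) p = mat 1" "phase_symbol (\<lambda>p. - \<theta> p) p ** phase_symbol \<theta> p = mat 1" for p
      unfolding phase_symbol_def mat_mat using e[of p] by (simp_all add: mult.commute)
  qed (use m th in auto)
qed

lemma fmult_phase_mult:
  assumes "\<theta> \<in> borel_measurable borel" "\<theta>' \<in> borel_measurable borel"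
  shows "fmult (phase_symbol \<theta>) (fmult (phase_symbol \<theta>') x) = fmult (phase_symbol (\<lambda>p. \<theta> p + \<theta>' p)) x"
proof -
  have "(\<lambda>p. phase_symbol \<theta> p ** phase_symbol \<theta>' p) = phase_symbol (\<lambda>p. \<theta> p + \<theta>' p)"
    by (simp add: fun_eq_iff phase_symbol_def mat_mat exp_add[symmetric] distrib_left)
  then show ?thesis
    using fmult_fmult[OF unitary_symbol_norm(2)[OF phase_symbol_unitary[OF assms(1)]] unitary_symbol_norm(2)[OF phase_symbol_unitary[OF assms(2)]]]
    by simp
qed

text \<open>Unimodular factors are dominated by the transform itself, so pointwise convergence off
  one point suffices.\<close>

lemma fmult_phase_tendsto:
  fixes \<theta> :: "real \<Rightarrow> real \<Rightarrow> real"
  assumes \<theta>: "\<And>t. \<theta> t \<in> borel_measurable borel" and lim: "\<And>p. p \<noteq> 0 \<Longrightarrow> ((\<lambda>t. \<theta> t p) \<longlongrightarrow> 0) at_top"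
  shows "((\<lambda>t. fmult (phase_symbol (\<theta> t)) x) \<longlongrightarrow> x) at_top"
proof -
  let ?v = "rep_L2 (fourier x)"
  have bs: "bounded_symbol (phase_symbol (\<theta> t)) 1" for t by (rule unitary_symbol_norm(2)[OF phase_symbol_unitary[OF \<theta>]])
  have "((\<lambda>t. abs_L2 (\<lambda>p. phase_symbol (\<theta> t) p *v ?v p)) \<longlongrightarrow> abs_L2 ?v) at_top"
  proof (rule L2_tendsto_dominated_at_top[where w = "\<lambda>p. norm (?v p)"])
    show "square_integrable (\<lambda>p. phase_symbol (\<theta> t) p *v ?v p)" for t
      by (rule square_integrable_mult[OF bs square_integrable_rep])
    show "integrable lborel (\<lambda>x. (norm (?v x))\<^sup>2)" using square_integrable_rep by (simp add: square_integrable_def)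
    show "AE p in lborel. norm (phase_symbol (\<theta> t) p *v ?v p) \<le> norm (?v p)" for t
      using bs[of t] by (simp add: bounded_symbol_def)
    have "((\<lambda>t. phase_symbol (\<theta> t) p *v ?v p) \<longlongrightarrow> ?v p) at_top" if "p \<noteq> 0" for p
    proof -
      have "((\<lambda>t. exp (\<i> * complex_of_real (\<theta> t p))) \<longlongrightarrow> exp (\<i> * complex_of_real 0)) at_top"
        by (intro tendsto_intros lim that)
      then have "((\<lambda>t. exp (\<i> * complex_of_real (\<theta> t p)) *s ?v p) \<longlongrightarrow> 1 *s ?v p) at_top"
        unfolding vector_scalar_mult_def by (intro tendsto_intros) auto
      then show ?thesis by (simp add: phase_symbol_def mat_vector)
    qed
    then show "AE p in lborel. ((\<lambda>t. phase_symbol (\<theta> t) p *v ?v p) \<longlongrightarrow> ?v p) at_top"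
      using AE_lborel_singleton[of 0] by (auto elim!: eventually_mono)
  qed (rule square_integrable_rep)
  then have "((\<lambda>t. fourier (fmult (phase_symbol (\<theta> t)) x)) \<longlongrightarrow> fourier x) at_top"
    by (simp add: fourier_fmult mult_op_def)
  then show ?thesis by (simp add: fourier_tendsto_iff)
qed

lemma op_L0_fmult_mat:
  assumes m: "m > 0" and c: "c \<in> borel_measurable borel" "\<And>p. cmod (c p) \<le> K" and f: "op_L0 m f = Some g"
  shows "op_L0 m (fmult (\<lambda>p. mat (c p)) f) = Some (fmult (\<lambda>p. mat (c p)) g)"
proof -
  have bs: "bounded_symbol (\<lambda>p. mat (c p)) K" by (rule bounded_symbol_mat[OF c])
  have "AE p in lborel. rep_L2 (fourier g) p = dirac_symbol m p *v rep_L2 (fourier f) p"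
    using f by (simp add: op_L0_fourier[OF m])
  with rep_mult_op[OF bs, of "fourier f"] rep_mult_op[OF bs, of "fourier g"] show ?thesis
    unfolding op_L0_fourier[OF m] fourier_fmult
    by eventually_elim (simp add: mat_vector matrix_vscale)
qed

text \<open>Equality of domains: if the phase could move \<open>x\<close> into the domain, the
  inverse phase would move it back within the domain.\<close>

lemma op_L0_phase_commute:
  assumes m: "m > 0" and th: "\<theta> \<in> borel_measurable borel"
  shows "map_option (fmult (phase_symbol \<theta>)) (op_L0 m x) = op_L0 m (fmult (phase_symbol \<theta>) x)"
proof -
  have *: "op_L0 m (fmult (phase_symbol \<theta>) f) = Some (fmult (phase_symbol \<theta>) g)"
    if "\<theta> \<in> borel_measurable borel" "op_L0 m f = Some g" for \<theta> f g
    using op_L0_fmult_mat[OF m measurable_exp_i[OF that(1)], of 1 f g] that(2) by (simp add: phase_symbol_def[abs_def])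
  show ?thesis
  proof (cases "op_L0 m x")
    case None
    have "op_L0 m (fmult (phase_symbol \<theta>) x) = None"
    proof (rule ccontr)
      assume "op_L0 m (fmult (phase_symbol \<theta>) x) \<noteq> None"
      then obtain g where "op_L0 m (fmult (phase_symbol \<theta>) x) = Some g" by blast
      from *[OF _ this, of "\<lambda>p. - \<theta> p"] th fmult_unitary(2)[OF phase_symbol_unitary[OF th]] None show False by simp
    qed
    then show ?thesis using None by simp
  qed (simp add: *[OF th])
qed

section \<open>Properties of the deviation factor\<close>

context dirac_coefficients
begin

lemma phase_measurable [measurable]: "phase t \<in> borel_measurable borel"
proof -
  have [measurable]: "(\<lambda>r. b \<bar>r\<bar>) \<in> borel_measurable borel" by (rule even_extension_measurable) (use b_diff in auto)
  have [measurable]: "speed m \<in> borel_measurable borel" unfolding speed_def[abs_def] by measurable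
  have "(\<lambda>p. phase t p) \<in> borel_measurable borel"
    unfolding phase_def interval_lebesgue_integral_def set_lebesgue_integral_def
    by measurable
  then show ?thesis by simp
qed

lemma speed_minus: "speed m (- p) = - speed m p"
  by (simp add: speed_def energy_def)

lemma phase_minus: "phase t (- p) = phase t p"
  by (simp add: phase_def speed_minus)

lemma phase_abs: "phase t \<bar>p\<bar> = phase t p"
  using phase_minus[of t p] by (cases "p \<ge> 0") auto

text \<open>The time derivative is \<open>b\<close> on the classical ray, which is precisely the
  term that Cook's method will subtract from the potential.\<close>

lemma phase_DERIV:
  assumes p: "p > 0" and t: "t > 0"
  shows "((\<lambda>t. phase t p) has_real_derivative b (t * speed m p)) (at t)"
proof -
  let ?s = "speed m p"
  have s: "?s > 0" using p energy_facts(1)[OF m] by (simp add: speed_def)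
  \<comment> \<open>Lies below \<open>s\<close> and below \<open>u * s\<close> for all
    \<open>u > t / 2\<close>, so one antiderivative serves a whole neighbourhood of
    \<open>t\<close>.\<close>
  define d where "d = ?s * min 1 t / 2"
  have d: "d > 0" using s t by (simp add: d_def)
  obtain B where B: "\<And>y. y > d \<Longrightarrow> (B has_real_derivative b y) (at y)" using antiderivative_b[OF d] by blast
  have ds: "d < ?s"
  proof -
    have "?s * min 1 t \<le> ?s * 1" using s by (intro mult_left_mono) auto
    then show ?thesis using s by (simp add: d_def)
  qed
  have dt: "d < u * ?s" if "t / 2 < u" for u
  proof -
    have "?s * min 1 t \<le> ?s * t" using s by (intro mult_left_mono) auto
    moreover have "t / 2 * ?s < u * ?s" using s that by simp
    ultimately show ?thesis by (simp add: d_def mult.commute)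
  qed
  have "((\<lambda>t. B (t * ?s)) has_real_derivative b (t * ?s) * ?s) (at t)"
    by (rule DERIV_chain2[where g = "\<lambda>t. t * ?s", OF B[OF dt]]) (use t in \<open>auto intro!: derivative_eq_intros\<close>)
  from DERIV_cdivide[OF DERIV_diff[OF this DERIV_const[of "B (?s)"]], of "?s"]
  have "((\<lambda>t. (B (t * ?s) - B (?s)) / ?s) has_real_derivative b (t * ?s)) (at t)" using s by simp
  moreover have "\<forall>\<^sub>F u in nhds t. (B (u * ?s) - B (?s)) / ?s = phase u p"
  proof -
    have "\<forall>\<^sub>F u in nhds t. u \<in> {t / 2<..}" using t by (intro eventually_nhds_in_open) auto
    then show ?thesis
    proof eventually_elim
      case (elim u)
      then show ?case using phase_eq[OF d B ds dt, of u] t by simp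
    qed
  qed
  ultimately show ?thesis by (simp add: DERIV_cong_ev)
qed

text \<open>The first bound decays in \<open>t\<close> and gives the limit of ratios of deviation
  factors; the second is uniform in \<open>p\<close> and serves as a dominating function.\<close>

lemma phase_lipschitz:
  assumes p: "p > 0" and t: "0 < t" "t \<le> u"
  shows "\<bar>phase u p - phase t p\<bar> \<le> (u - t) * (C * speed m p powr - \<alpha> * t powr - \<alpha>)" "\<bar>phase u p - phase t p\<bar> \<le> (u - t) * C"
proof -
  let ?s = "speed m p"
  have s: "?s > 0" using p energy_facts(1)[OF m] by (simp add: speed_def)
  have "\<exists>z. t \<le> z \<and> phase u p - phase t p = (u - t) * b (z * ?s)"
  proof (cases "t = u")
    case False
    then have "t < u" using t by simp
    then have "\<exists>z>t. z < u \<and> phase u p - phase t p = (u - t) * b (z * ?s)"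
      by (rule MVT2) (use t in \<open>auto intro: phase_DERIV[OF p]\<close>)
    then show ?thesis by (auto intro: less_imp_le)
  qed auto
  then obtain z where z: "t \<le> z" "phase u p - phase t p = (u - t) * b (z * ?s)" by blast
  have e: "\<bar>phase u p - phase t p\<bar> = (u - t) * \<bar>b (z * ?s)\<bar>" using z t by (simp add: abs_mult)
  have "?s * t \<le> z * ?s" using z s by (simp add: mult.commute)
  from b_decay_far(1)[OF s t(1) this]
  show "\<bar>phase u p - phase t p\<bar> \<le> (u - t) * (C * ?s powr - \<alpha> * t powr - \<alpha>)"
    unfolding e using t by (intro mult_left_mono) auto
  have "z * ?s > 0" using z t s by (intro mult_pos_pos) auto
  from ab_bounded(2)[OF this] show "\<bar>phase u p - phase t p\<bar> \<le> (u - t) * C"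
    unfolding e using t by (intro mult_left_mono) auto
qed

text \<open>For either sign of \<tau> the smaller of the two times is at least
  \<open>t - \<bar>\<tau>\<bar>\<close>, where the Lipschitz constant tends to 0.\<close>

lemma phase_increment_tendsto:
  assumes p: "p \<noteq> 0"
  shows "((\<lambda>t. phase (t + \<tau>) p - phase t p) \<longlongrightarrow> 0) at_top"
proof -
  let ?C = "C * speed m \<bar>p\<bar> powr - \<alpha>"
  have "((\<lambda>t. \<bar>\<tau>\<bar> * (?C * (t - \<bar>\<tau>\<bar>) powr - \<alpha>)) \<longlongrightarrow> \<bar>\<tau>\<bar> * (?C * 0)) at_top"
  proof (intro tendsto_mult_left)
    have "filterlim (\<lambda>t. t - \<bar>\<tau>\<bar>) at_top at_top"
      using filterlim_tendsto_add_at_top[OF tendsto_const[of "- \<bar>\<tau>\<bar>"] filterlim_ident] by simp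
    then show "((\<lambda>t. (t - \<bar>\<tau>\<bar>) powr - \<alpha>) \<longlongrightarrow> 0) at_top"
      using al by (intro tendsto_neg_powr) auto
  qed
  then have lim: "((\<lambda>t. \<bar>\<tau>\<bar> * (?C * (t - \<bar>\<tau>\<bar>) powr - \<alpha>)) \<longlongrightarrow> 0) at_top" by simp
  have "\<forall>\<^sub>F t in at_top. norm (phase (t + \<tau>) p - phase t p) \<le> \<bar>\<tau>\<bar> * (?C * (t - \<bar>\<tau>\<bar>) powr - \<alpha>)"
  proof (rule eventually_mono[OF eventually_gt_at_top[of "\<bar>\<tau>\<bar>"]])
    fix t assume t: "\<bar>\<tau>\<bar> < t"
    have p': "\<bar>p\<bar> > 0" using p by simp
    have mono: "\<bar>\<tau>\<bar> * (?C * x powr - \<alpha>) \<le> \<bar>\<tau>\<bar> * (?C * (t - \<bar>\<tau>\<bar>) powr - \<alpha>)" if "t - \<bar>\<tau>\<bar> \<le> x" for x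
      using t that al C by (intro mult_left_mono powr_mono2') auto
    show "norm (phase (t + \<tau>) p - phase t p) \<le> \<bar>\<tau>\<bar> * (?C * (t - \<bar>\<tau>\<bar>) powr - \<alpha>)"
    proof (cases "\<tau> \<ge> 0")
      case True
      have "norm (phase (t + \<tau>) p - phase t p) \<le> \<bar>\<tau>\<bar> * (?C * t powr - \<alpha>)"
        using phase_lipschitz(1)[OF p', of t "t + \<tau>"] True t by (simp add: phase_abs)
      then show ?thesis using mono[of t] by simp
    next
      case False
      have "norm (phase (t + \<tau>) p - phase t p) \<le> \<bar>\<tau>\<bar> * (?C * (t + \<tau>) powr - \<alpha>)"
        using phase_lipschitz(1)[OF p', of "t + \<tau>" t] False t by (simp add: phase_abs abs_minus_commute)
      then show ?thesis using mono[of "t + \<tau>"] False by simp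
    qed
  qed
  then show ?thesis by (rule Lim_null_comparison[OF _ lim])
qed

definition theta :: "real \<Rightarrow> real \<Rightarrow> real" where
  "theta t p = sgn t * phase \<bar>t\<bar> p"

lemma theta_measurable [measurable]: "theta t \<in> borel_measurable borel"
  unfolding theta_def[abs_def] by measurable

abbreviation W0 :: "real \<Rightarrow> L2 \<Rightarrow> L2" where
  "W0 \<equiv> deviation_factor m b"

lemma W0_tilde_eq: "W0_tilde m b t = phase_symbol (theta t)"
  by (simp add: fun_eq_iff W0_tilde_def Let_def phase_symbol_def theta_def phase_def speed_def energy_def)

lemma deviation_factor_eq: "W0 t = fmult (phase_symbol (theta t))"
  by (simp add: fun_eq_iff deviation_factor_def fmult_def W0_tilde_eq)

lemma deviation_factor_inverse:
  "inv (W0 t) = fmult (phase_symbol (\<lambda>p. - theta t p))"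
  unfolding deviation_factor_eq
  using fmult_unitary(2,3)[OF phase_symbol_unitary[OF theta_measurable[of t]]]
  by (intro inv_unique_comp) (auto simp: fun_eq_iff)

lemma deviation_factor_ratio_tendsto:
  shows "((\<lambda>t. W0 (t + \<tau>) (inv (W0 t) x)) \<longlongrightarrow> x) at_top" (is ?a)
    and "((\<lambda>t. W0 (t + \<tau>) (inv (W0 t) x)) \<longlongrightarrow> x) at_bot" (is ?b)
proof -
  have eq: "W0 (t + \<tau>) (inv (W0 t) x)
      = fmult (phase_symbol (\<lambda>p. theta (t + \<tau>) p - theta t p)) x" for t
    unfolding deviation_factor_inverse unfolding deviation_factor_eq by (subst fmult_phase_mult) auto
  show ?a
    unfolding eq
  proof (rule fmult_phase_tendsto)
    fix p :: real assume p: "p \<noteq> 0"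
    have "\<forall>\<^sub>F t in at_top. phase (t + \<tau>) p - phase t p = theta (t + \<tau>) p - theta t p"
      by (rule eventually_mono[OF eventually_gt_at_top[of "\<bar>\<tau>\<bar>"]]) (simp add: theta_def)
    from Lim_transform_eventually[OF phase_increment_tendsto[OF p] this]
    show "((\<lambda>t. theta (t + \<tau>) p - theta t p) \<longlongrightarrow> 0) at_top" .
  qed measurable
  \<comment> \<open>\<open>theta\<close> is odd in time, so the limit at minus infinity is the one
    at plus infinity for the shift \<open>- \<tau>\<close> with the opposite sign.\<close>
  show ?b
    unfolding eq filterlim_at_bot_mirror
  proof (rule fmult_phase_tendsto)
    fix p :: real assume p: "p \<noteq> 0"
    have "\<forall>\<^sub>F t in at_top. - (phase (t + - \<tau>) p - phase t p) = theta (- t + \<tau>) p - theta (- t) p"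
      by (rule eventually_mono[OF eventually_gt_at_top[of "\<bar>\<tau>\<bar>"]]) (simp add: theta_def)
    from Lim_transform_eventually[OF tendsto_minus[OF phase_increment_tendsto[OF p]] this]
    show "((\<lambda>t. theta (- t + \<tau>) p - theta (- t) p) \<longlongrightarrow> 0) at_top" by simp
  qed measurable
qed

end

section \<open>The amplitude of the Cook integrand\<close>

text \<open>For \<open>\<eta> = 1\<close> and \<open>\<eta> = - 1\<close> these are the entries of
  the two spectral projections of the symbol.\<close>

definition branch :: "real \<Rightarrow> real \<Rightarrow> 2 \<Rightarrow> 2 \<Rightarrow> real \<Rightarrow> complex" where
  "branch m \<eta> k j p = (if k = j then 1 / 2 else 0) + of_real (\<eta> / (2 * energy m p)) * dirac_symbol m p $ k $ j"

lemma dirac_group_symbol_branch: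
  assumes m: "m > 0"
  shows "dirac_group_symbol m t p $ k $ j =
    exp (\<i> * of_real (t * energy m p)) * branch m 1 k j p + exp (\<i> * of_real (- (t * energy m p))) * branch m (-1) k j p"
proof -
  have E: "energy m p \<noteq> 0" by (rule energy_facts(2)[OF m])
  have e: "exp (\<i> * of_real x) = Complex (cos x) (sin x)" for x
    by (simp add: complex_eq_iff Re_exp Im_exp)
  have h: "branch m (- 1) k j p = (if k = j then 1 else 0) - branch m 1 k j p" for k j
    by (simp add: branch_def)
  have k: "k = 1 \<or> k = 2" and j: "j = 1 \<or> j = 2" using exhaust_2 by auto
  have br: "branch m 1 1 1 p = Complex (1 / 2 + m / (2 * energy m p)) 0" "branch m 1 2 2 p = Complex (1 / 2 - m / (2 * energy m p)) 0"
    "branch m 1 1 2 p = Complex 0 (- p / (2 * energy m p))" "branch m 1 2 1 p = Complex 0 (p / (2 * energy m p))"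
    by (simp_all add: branch_def dirac_symbol_def complex_eq_iff)
  show ?thesis
    unfolding e h dirac_group_symbol_def dirac_group_matrix_def using k j
    by (elim disjE) (use E in \<open>simp_all add: br complex_eq_iff field_simps\<close>)
qed

text \<open>Reduces the smoothness of every matrix entry to that of the two scalar functions
  \<open>1 / energy\<close> and \<open>speed\<close>, uniformly in the sign of the momentum.\<close>

lemma branch_affine:
  assumes m: "m > 0" and sg: "sg \<in> {-1, 1}"
  shows "\<exists>A B D. \<forall>p. branch m \<eta> k j (sg * p) = A + (B * (1 / complex_of_real (energy m p)) + D * of_real (speed m p))"
proof -
  have E: "energy m (sg * p) = energy m p" for p using sg by (auto simp: energy_def)
  have E0: "energy m p \<noteq> 0" for p by (rule energy_facts(2)[OF m])
  have "branch m \<eta> k j (sg * p) = (if k = j then 1 / 2 else 0)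
     + ((if k = j then (if k = 1 then of_real (\<eta> * m / 2) else - of_real (\<eta> * m / 2)) else 0) * (1 / complex_of_real (energy m p))
     + (if k = j then 0 else (if k = 1 then - (\<i> * of_real (\<eta> * sg / 2)) else \<i> * of_real (\<eta> * sg / 2))) * of_real (speed m p))" for p
  proof -
    have k: "k = 1 \<or> k = 2" and j: "j = 1 \<or> j = 2" using exhaust_2 by auto
    then show ?thesis
      by (elim disjE) (simp_all add: branch_def dirac_symbol_def E speed_def)
  qed
  then show ?thesis by blast
qed

lemma energy_le: "m > 0 \<Longrightarrow> energy m p \<le> \<bar>p\<bar> + m"
  using sqrt_sum_squares_le_sum_abs[of p m] by (simp add: energy_def)

lemma branch_c2:
  assumes m: "m > 0" and sg: "sg \<in> {-1, 1}"
  shows "\<exists>M. c2_bound {p1..p2} 1 M (\<lambda>p. branch m \<eta> k j (sg * p))"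
proof -
  let ?S = "{p1..p2}"
  define D where "D = \<bar>p1\<bar> + \<bar>p2\<bar> + m + 1 + 1 / m + 3 / m\<^sup>2"
  have pos: "0 \<le> 1 / m" "0 \<le> 3 / m\<^sup>2" using m by auto
  have sb: "\<bar>speed m p\<bar> \<le> D" "\<bar>speed1 m p\<bar> \<le> D" "\<bar>speed2 m p\<bar> \<le> D" for p
    using speed_bounds[OF m, of p] pos m unfolding D_def by linarith+
  have cs: "c2_bound ?S 1 D (\<lambda>p. of_real (speed m p))"
    by (rule c2_bound_of_real[OF speed_DERIV[OF m] speed_DERIV2[OF m]]) (rule sb)+
  have ce: "c2_bound ?S 1 D (\<lambda>p. of_real (energy m p))"
  proof (rule c2_bound_of_real[OF energy_DERIV[OF m] speed_DERIV[OF m]])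
    show "\<bar>energy m p\<bar> \<le> D" if "p \<in> ?S" for p
    proof -
      have "\<bar>p\<bar> \<le> \<bar>p1\<bar> + \<bar>p2\<bar>" using that by auto
      then show ?thesis using energy_le[OF m, of p] energy_facts(1)[OF m, of p] pos unfolding D_def by linarith
    qed
  qed (rule sb)+
  have ci: "c2_bound ?S 1 (1 / m + D / m\<^sup>2 + 2 * D\<^sup>2 / m ^ 3) (\<lambda>p. 1 / complex_of_real (energy m p))"
    by (rule c2_bound_inverse[OF ce m]) (use energy_ge[OF m] energy_facts(1)[OF m] in \<open>simp add: abs_of_pos\<close>)
  obtain A B F where e: "\<And>p. branch m \<eta> k j (sg * p) = A + (B * (1 / complex_of_real (energy m p)) + F * of_real (speed m p))"
    using branch_affine[OF m sg] by blast
  have "c2_bound ?S 1 (cmod A + (cmod B * (1 / m + D / m\<^sup>2 + 2 * D\<^sup>2 / m ^ 3) + cmod F * D)) (\<lambda>p. branch m \<eta> k j (sg * p))"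
    unfolding e by (intro c2_bound_add c2_bound_cmult c2_bound_const ci cs) simp
  then show ?thesis ..
qed

lemma bump_c2:
  assumes ab: "a < b" "c > 0" and sg: "sg \<in> {-1, 1}"
  shows "\<exists>M. c2_bound S 1 M (\<lambda>p. of_real (bump c 0 0 a b (sg * p)))"
proof -
  let ?f = "bump c 0 0 a b"
  have f: "?f \<in> bump_span" using ab by (auto intro: bump_span.intros)
  obtain g where g: "g \<in> bump_span" "\<And>x. (?f has_real_derivative g x) (at x)" using bump_span_DERIV[OF f] by blast
  obtain h where h: "h \<in> bump_span" "\<And>x. (g has_real_derivative h x) (at x)" using bump_span_DERIV[OF g(1)] by blast
  have bd: "\<exists>B\<ge>0. \<forall>x. \<bar>u x\<bar> \<le> B" if u: "u \<in> bump_span" for u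
  proof -
    obtain B R where B: "B \<ge> 0" "\<And>x. \<bar>u x\<bar> \<le> B * indicator {-R..R} x"
      using compactly_supported_bounded[OF test_function_facts(2)[OF bump_span_test_function[OF u]]] by blast
    have "B * indicator {-R..R} x \<le> B" for x using B(1) by (simp add: indicator_def)
    then show ?thesis using B by (intro exI[of _ B]) (meson order_trans)
  qed
  obtain B1 B2 B3 where B: "B1 \<ge> 0" "\<And>x. \<bar>?f x\<bar> \<le> B1" "B2 \<ge> 0" "\<And>x. \<bar>g x\<bar> \<le> B2" "B3 \<ge> 0" "\<And>x. \<bar>h x\<bar> \<le> B3"
    using bd[OF f] bd[OF g(1)] bd[OF h(1)] by blast
  have ss: "sg * sg = 1" "\<bar>sg\<bar> = 1" using sg by auto
  have ch: "((\<lambda>p. u (sg * p)) has_real_derivative sg * u' (sg * p)) (at p)"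
    if "\<And>x. (u has_real_derivative u' x) (at x)" for u u' p
  proof -
    have "((\<lambda>p. sg * p) has_real_derivative sg) (at p)" by (auto intro!: derivative_eq_intros)
    from DERIV_chain2[where g = "\<lambda>p. sg * p", OF that this] show ?thesis by (simp add: mult.commute)
  qed
  have "c2_bound S 1 (B1 + B2 + B3) (\<lambda>p. of_real (?f (sg * p)))"
  proof (rule c2_bound_of_real[OF ch[OF g(2)], where ?f2.0 = "\<lambda>p. h (sg * p)"])
    fix p
    show "((\<lambda>p. sg * g (sg * p)) has_real_derivative h (sg * p)) (at p)"
      using DERIV_cmult[OF ch[OF h(2)], of sg p] by (rule DERIV_cong) (simp add: ss(1) flip: mult.assoc)
    show "\<bar>?f (sg * p)\<bar> \<le> B1 + B2 + B3" "\<bar>sg * g (sg * p)\<bar> \<le> B1 + B2 + B3" "\<bar>h (sg * p)\<bar> \<le> B1 + B2 + B3"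
      using B(1,3,5) B(2,4,6)[of "sg * p"] by (auto simp: abs_mult ss(2))
  qed
  then show ?thesis ..
qed

text \<open>An inequality rather than an equality: if \<open>f\<close> is not integrable its
  Lebesgue integral is 0, so no integrability has to be established by the user of the
  bound.\<close>

lemma cmod_integral_le_of_support:
  fixes f :: "real \<Rightarrow> complex"
  assumes lu: "0 < l" "l < u" and f: "\<And>p. p \<notin> {l<..<u} \<Longrightarrow> f p = 0"
  shows "cmod (LBINT p. f p) \<le> cmod (integral {l/2..2*u} f)"
proof (cases "integrable lborel f")
  case True
  have "(LBINT p. f p) = integral UNIV f" using integral_lborel[OF True] by simp
  also have "\<dots> = integral UNIV (\<lambda>p. if p \<in> {l/2..2*u} then f p else 0)"
    by (rule Henstock_Kurzweil_Integration.integral_cong) (use f lu in auto)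
  also have "\<dots> = integral {l/2..2*u} f" by (rule integral_restrict_UNIV)
  finally show ?thesis by simp
qed (simp add: not_integrable_integral_eq)

lemma integrable_inverse_sum_squares:
  assumes T: "T > 0"
  shows "integrable lborel (\<lambda>r::real. 1 / (T\<^sup>2 + r\<^sup>2))"
    "(LBINT r. 1 / (T\<^sup>2 + r\<^sup>2)) = (LBINT r. 1 / (1 + (r::real)\<^sup>2)) / T"
proof -
  have 1: "integrable lborel (\<lambda>x::real. 1 / (1 + x\<^sup>2))"
    using integrable_inverse_1_plus_square by (simp add: set_integrable_def inverse_eq_divide)
  have e: "1 / (T\<^sup>2 + (0 + T * x)\<^sup>2) = (1 / T\<^sup>2) * (1 / (1 + x\<^sup>2))" for x
  proof -
    have "T\<^sup>2 + (0 + T * x)\<^sup>2 = T\<^sup>2 * (1 + x\<^sup>2)" by (simp add: power_mult_distrib algebra_simps)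
    then show ?thesis by simp
  qed
  have "integrable lborel (\<lambda>x. 1 / (T\<^sup>2 + (0 + T * x)\<^sup>2))" unfolding e by (intro integrable_mult_right 1)
  then show "integrable lborel (\<lambda>r::real. 1 / (T\<^sup>2 + r\<^sup>2))"
    using lborel_integrable_real_affine_iff[of T "\<lambda>r. 1 / (T\<^sup>2 + r\<^sup>2)" 0] T by simp
  have "(LBINT r. 1 / (T\<^sup>2 + r\<^sup>2)) = \<bar>T\<bar> *\<^sub>R (LBINT x. 1 / (T\<^sup>2 + (0 + T * x)\<^sup>2))"
    using T by (intro lborel_integral_real_affine) simp
  also have "\<dots> = \<bar>T\<bar> *\<^sub>R ((1 / T\<^sup>2) * (LBINT r. 1 / (1 + (r::real)\<^sup>2)))"
    by (simp only: e integral_mult_right_zero)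
  also have "\<dots> = (LBINT r. 1 / (1 + (r::real)\<^sup>2)) / T"
    using T by (simp add: power2_eq_square)
  finally show "(LBINT r. 1 / (T\<^sup>2 + r\<^sup>2)) = (LBINT r. 1 / (1 + (r::real)\<^sup>2)) / T" .
qed

text \<open>The fourth power of \<open>T + \<bar>r\<bar>\<close> is at least
  \<open>T\<^sup>2 * (T\<^sup>2 + r\<^sup>2)\<close>, and scaling by \<open>T\<close> reduces the
  remaining integral to a fixed constant over \<open>T\<close>.\<close>

lemma L2_norm_decay:
  assumes f: "square_integrable f" and bd: "\<And>r. norm (f r) \<le> K / (T + \<bar>r\<bar>)\<^sup>2" and T: "T > 0" and K: "K \<ge> 0"
  shows "norm (abs_L2 f) \<le> sqrt (LBINT r. 1 / (1 + (r::real)\<^sup>2)) * (K * T powr (- 3 / 2))"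
proof (rule power2_le_imp_le)
  let ?c = "\<integral>r. 1 / (1 + (r::real)\<^sup>2) \<partial>lborel"
  have c: "?c \<ge> 0" by (rule Bochner_Integration.integral_nonneg) simp
  have "(norm (abs_L2 f))\<^sup>2 = (LBINT r. (norm (f r))\<^sup>2)" by (rule norm_abs_L2[OF f])
  also have "\<dots> \<le> (LBINT r. K\<^sup>2 / T\<^sup>2 * (1 / (T\<^sup>2 + r\<^sup>2)))"
  proof (rule integral_mono)
    show "integrable lborel (\<lambda>r. (norm (f r))\<^sup>2)" using f by (simp add: square_integrable_def)
    show "integrable lborel (\<lambda>r. K\<^sup>2 / T\<^sup>2 * (1 / (T\<^sup>2 + r\<^sup>2)))"
      by (intro integrable_mult_right integrable_inverse_sum_squares T)
    fix r :: real
    have p: "0 < T\<^sup>2" "0 < T\<^sup>2 + r\<^sup>2" using T by (auto intro: add_pos_nonneg)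
    have "T\<^sup>2 * (T\<^sup>2 + r\<^sup>2) \<le> (T + \<bar>r\<bar>)\<^sup>2 * (T + \<bar>r\<bar>)\<^sup>2"
    proof (rule mult_mono)
      show "T\<^sup>2 \<le> (T + \<bar>r\<bar>)\<^sup>2" using T by (intro power_mono) auto
      show "T\<^sup>2 + r\<^sup>2 \<le> (T + \<bar>r\<bar>)\<^sup>2" using T by (simp add: power2_sum)
    qed (use p in auto)
    then have "K\<^sup>2 / ((T + \<bar>r\<bar>)\<^sup>2 * (T + \<bar>r\<bar>)\<^sup>2) \<le> K\<^sup>2 / (T\<^sup>2 * (T\<^sup>2 + r\<^sup>2))"
      using p T by (intro divide_left_mono) auto
    moreover have "(norm (f r))\<^sup>2 \<le> (K / (T + \<bar>r\<bar>)\<^sup>2)\<^sup>2" by (intro power_mono bd) auto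
    ultimately show "(norm (f r))\<^sup>2 \<le> K\<^sup>2 / T\<^sup>2 * (1 / (T\<^sup>2 + r\<^sup>2))"
      by (simp add: power_divide power2_eq_square[of "(T + \<bar>r\<bar>)\<^sup>2"])
  qed
  also have "\<dots> = K\<^sup>2 / T\<^sup>2 * (?c / T)"
    by (simp only: integral_mult_right_zero integrable_inverse_sum_squares(2)[OF T])
  also have "\<dots> = (sqrt ?c * (K * T powr (- 3 / 2)))\<^sup>2"
  proof -
    have "(T powr (- 3 / 2))\<^sup>2 = T powr (- 3)" using T by (simp add: power2_eq_square powr_add[symmetric])
    also have "\<dots> = 1 / T ^ 3" using T by (simp add: powr_minus inverse_eq_divide flip: powr_numeral)
    finally have "(T powr (- 3 / 2))\<^sup>2 = 1 / T ^ 3" .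
    then show ?thesis
      unfolding power_mult_distrib real_sqrt_pow2[OF c] by (simp add: power2_eq_square power3_eq_cube)
  qed
  finally show "(norm (abs_L2 f))\<^sup>2 \<le> (sqrt ?c * (K * T powr (- 3 / 2)))\<^sup>2" .
  show "0 \<le> sqrt ?c * (K * T powr (- 3 / 2))" using c K by simp
qed

section \<open>Reduction to positive momenta and positive energy\<close>

context dirac_coefficients
begin

text \<open>\<epsilon> is the sign in front of the energy and \<sigma> the sign in front of the
  deviation phase, that is, the direction of time.\<close>

abbreviation osc_kernel :: "real \<Rightarrow> real \<Rightarrow> real \<Rightarrow> real \<Rightarrow> real \<Rightarrow> complex" where
  "osc_kernel T r \<epsilon> \<sigma> p \<equiv> exp (\<i> * of_real (p * r - \<epsilon> * (energy m p * T) - \<sigma> * phase T p))"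

abbreviation kernel_integral :: "(real \<Rightarrow> real) \<Rightarrow> (real \<Rightarrow> complex) \<Rightarrow> real \<Rightarrow> real \<Rightarrow> real \<Rightarrow> real \<Rightarrow> complex" where
  "kernel_integral q A T r \<epsilon> \<sigma> \<equiv> (LBINT p. osc_kernel T r \<epsilon> \<sigma> p * (of_real (q p) * A p))"

text \<open>Negative momenta and the branch \<open>\<epsilon> = -1\<close> reduce to \<^const>\<open>osc\<close> by reflection and by complex conjugation.\<close>

lemma branch_integral_estimate:
  assumes lu: "0 < l" "l < u" and sg: "sg \<in> {-1, 1}"
    and A: "c2_bound {l/2..2*u} 1 M (\<lambda>p. A (sg * p))" "\<And>p. p \<notin> {l<..<u} \<Longrightarrow> A (sg * p) = 0"
  shows "\<exists>K\<ge>0. \<forall>T\<ge>1. \<forall>r. \<forall>\<epsilon>\<in>{-1,1}. \<forall>\<sigma>\<in>{-1,1}.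
    cmod (kernel_integral (\<lambda>p. b \<bar>r\<bar> - b \<bar>T * speed m p\<bar>) A T r \<epsilon> \<sigma>) \<le> decay K T r \<and>
    cmod (kernel_integral (\<lambda>p. a \<bar>r\<bar>) A T r \<epsilon> \<sigma>) \<le> decay K T r"
proof -
  let ?c = "\<lambda>p. A (sg * p)"
  have ss: "\<bar>sg\<bar> = 1" using sg by auto
  have Em: "energy m (sg * p) = energy m p" for p using sg by (auto simp: energy_def)
  have Pm: "phase T (sg * p) = phase T p" for T p using sg by (auto simp: phase_minus)
  have Sm: "\<bar>speed m (sg * p)\<bar> = \<bar>speed m p\<bar>" for p using sg by (auto simp: speed_minus)
  have sp: "\<bar>T * speed m (sg * p)\<bar> = T * speed m p" if "T \<ge> 1" "p \<in> {l/2..2*u}" for T p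
    using speed_lower[OF lu(1) that(2)] that(1) by (simp add: abs_mult Sm)
  \<comment> \<open>Complex conjugation will exchange the two signs of the energy, so the conjugated
    amplitude needs its own estimate.\<close>
  have ccnj: "c2_bound {l/2..2*u} 1 M (\<lambda>p. cnj (?c p))"
  proof -
    obtain f1 f2 where "c2_data {l/2..2*u} 1 M ?c f1 f2"
      using A(1) unfolding c2_bound_def by blast
    note F = c2_dataD[OF this]
    show ?thesis
      by (rule c2_boundI[where ?f1.0 = "\<lambda>p. cnj (f1 p)" and ?f2.0 = "\<lambda>p. cnj (f2 p)"])
        (use F in \<open>auto intro!: bounded_linear.has_vector_derivative[OF bounded_linear_cnj]\<close>)
  qed
  obtain K1 where K1: "K1 \<ge> 0" "\<And>T r \<eta>. T \<ge> 1 \<Longrightarrow> \<eta> \<in> {-1,1} \<Longrightarrow>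
    cmod (osc l u ?c (b_diff_symbol T r) T r \<eta>) \<le> decay K1 T r \<and>
    cmod (osc l u ?c (\<lambda>p. a \<bar>r\<bar>) T r \<eta>) \<le> decay K1 T r"
    using osc_estimate[OF lu A] by blast
  obtain K2 where K2: "K2 \<ge> 0" "\<And>T r \<eta>. T \<ge> 1 \<Longrightarrow> \<eta> \<in> {-1,1} \<Longrightarrow>
    cmod (osc l u (\<lambda>p. cnj (?c p)) (b_diff_symbol T r) T r \<eta>) \<le> decay K2 T r \<and>
    cmod (osc l u (\<lambda>p. cnj (?c p)) (\<lambda>p. a \<bar>r\<bar>) T r \<eta>) \<le> decay K2 T r"
    using osc_estimate[OF lu ccnj] A(2) by fastforce
  have sub: "(LBINT p. f p) = (LBINT p. f (sg * p))" for f :: "real \<Rightarrow> complex"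
    using lborel_integral_real_affine[of sg f 0] ss by auto
  \<comment> \<open>Energy and phase are even in the momentum, so reflecting the momentum only
    replaces \<open>r\<close> by \<open>sg * r\<close>.\<close>
  have plus: "cmod (LBINT p. osc_kernel T r 1 \<sigma> p * (of_real (q p) * B p)) \<le> cmod (osc l u (\<lambda>p. B (sg * p)) q' T (sg * r) \<sigma>)"
    if B: "\<And>p. p \<notin> {l<..<u} \<Longrightarrow> B (sg * p) = 0" and q: "\<And>p. p \<in> {l/2..2*u} \<Longrightarrow> q (sg * p) = q' p" for T r \<sigma> q q' B
  proof -
    have rr: "sg * p * r = p * (sg * r)" for p by simp
    have "cmod (LBINT p. osc_kernel T r 1 \<sigma> p * (of_real (q p) * B p))
      \<le> cmod (integral {l/2..2*u} (\<lambda>p. osc_kernel T r 1 \<sigma> (sg * p) * (of_real (q (sg * p)) * B (sg * p))))"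
      unfolding sub[of "\<lambda>p. osc_kernel T r 1 \<sigma> p * (of_real (q p) * B p)"]
      by (rule cmod_integral_le_of_support[OF lu]) (simp add: B)
    also have "integral {l/2..2*u} (\<lambda>p. osc_kernel T r 1 \<sigma> (sg * p) * (of_real (q (sg * p)) * B (sg * p))) = osc l u (\<lambda>p. B (sg * p)) q' T (sg * r) \<sigma>"
      unfolding osc_def by (rule Henstock_Kurzweil_Integration.integral_cong) (simp only: q Em Pm rr mult_1)
    finally show ?thesis .
  qed
  \<comment> \<open>Conjugation flips the energy term; the flipped signs of \<open>r\<close> and
    \<sigma> are harmless because the estimates depend on \<open>\<bar>r\<bar>\<close> only and
    allow both signs.\<close>
  have minus: "cmod (LBINT p. osc_kernel T r (-1) \<sigma> p * (of_real (q p) * A p))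
     = cmod (LBINT p. osc_kernel T (- r) 1 (- \<sigma>) p * (of_real (q p) * cnj (A p)))" for T r \<sigma> q
  proof -
    have "cnj (osc_kernel T r (-1) \<sigma> p * (of_real (q p) * A p)) = osc_kernel T (- r) 1 (- \<sigma>) p * (of_real (q p) * cnj (A p))" for p
      by (simp add: exp_cnj algebra_simps)
    then have "(LBINT p. osc_kernel T (- r) 1 (- \<sigma>) p * (of_real (q p) * cnj (A p))) = cnj (LBINT p. osc_kernel T r (-1) \<sigma> p * (of_real (q p) * A p))"
      by (simp only: Bochner_Integration.integral_cnj[symmetric])
    then show ?thesis by (simp only: complex_mod_cnj)
  qed
  have "cmod (kernel_integral (\<lambda>p. b \<bar>r\<bar> - b \<bar>T * speed m p\<bar>) A T r \<epsilon> \<sigma>) \<le> decay (K1 + K2) T r \<and>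
    cmod (kernel_integral (\<lambda>p. a \<bar>r\<bar>) A T r \<epsilon> \<sigma>) \<le> decay (K1 + K2) T r"
    if T: "T \<ge> 1" and e: "\<epsilon> \<in> {-1,1}" and s: "\<sigma> \<in> {-1,1}" for T r \<epsilon> \<sigma>
  proof -
    have le: "x \<le> decay (K1 + K2) T r"
      if "x \<le> y" "y \<le> decay L T r" "L \<le> K1 + K2" for x y L
    proof -
      have "decay L T r \<le> decay (K1 + K2) T r"
        using that by (intro divide_right_mono mult_right_mono) auto
      then show ?thesis using that by linarith
    qed
    have L: "K1 \<le> K1 + K2" "K2 \<le> K1 + K2" using K1(1) K2(1) by auto
    have r1: "\<bar>sg * r\<bar> = \<bar>r\<bar>" "\<bar>sg * - r\<bar> = \<bar>r\<bar>" by (simp_all add: abs_mult ss)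
    have s': "- \<sigma> \<in> {-1, 1}" using s by auto
    have cA: "\<And>p. p \<notin> {l<..<u} \<Longrightarrow> cnj (A (sg * p)) = 0" using A(2) by simp
    have q1: "\<And>p. p \<in> {l/2..2*u} \<Longrightarrow> b \<bar>r\<bar> - b \<bar>T * speed m (sg * p)\<bar> = b \<bar>r\<bar> - b (T * speed m p)"
      by (simp add: sp[OF T])
    from e consider "\<epsilon> = 1" | "\<epsilon> = -1" by auto
    then show ?thesis
    proof cases
      case 1
      note K = K1(2)[OF T s, of "sg * r", unfolded r1]
      note P = plus[where B = A and T = T and r = r and \<sigma> = \<sigma>, OF A(2)]
      show ?thesis
        unfolding 1
        by (intro conjI le[OF P[where q = "\<lambda>p. b \<bar>r\<bar> - b \<bar>T * speed m p\<bar>", OF _ q1] conjunct1[OF K] L(1)]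
            le[OF P[where q = "\<lambda>p. a \<bar>r\<bar>", OF _ refl] conjunct2[OF K] L(1)])
    next
      case 2
      note K = K2(2)[OF T s', of "sg * - r", unfolded r1]
      note P = plus[where B = "\<lambda>p. cnj (A p)" and T = T and r = "- r" and \<sigma> = "- \<sigma>", OF cA]
      show ?thesis
        unfolding 2 minus
        by (intro conjI le[OF P[where q = "\<lambda>p. b \<bar>r\<bar> - b \<bar>T * speed m p\<bar>", OF _ q1] conjunct1[OF K] L(2)]
            le[OF P[where q = "\<lambda>p. a \<bar>r\<bar>", OF _ refl] conjunct2[OF K] L(2)])
    qed
  qed
  then show ?thesis using K1(1) K2(1) by (intro exI[of _ "K1 + K2"] conjI allI ballI impI) (auto simp del: of_real_diff)
qed

end

section \<open>Existence of the wave operators by Cook's method\<close>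

text \<open>The sign \<sigma> lets the limit at minus infinity be treated as a limit at plus
  infinity with reversed time.\<close>

lemma generates_signed:
  assumes U: "generates U A" and s: "\<sigma> \<in> {-1, 1 :: real}"
  shows "unitary_group (\<lambda>t. U (\<sigma> * t))"
    "A x = Some y \<Longrightarrow> ((\<lambda>h. (1 / h) *\<^sub>R (U (\<sigma> * h) x - x)) \<longlongrightarrow> (\<i> * of_real \<sigma>) *\<^sub>C y) (at 0)"
proof -
  have ug: "unitary_group U" using U by (simp add: generates_def)
  show "unitary_group (\<lambda>t. U (\<sigma> * t))" using s ug ug_uminus[OF ug] by auto
  assume "A x = Some y"
  then have g: "(generator_quotient U x \<longlongrightarrow> \<i> *\<^sub>C y) (at 0)" using U by (simp add: generates_def)
  from s g ug_reverse_quotient[OF ug g]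
  show "((\<lambda>h. (1 / h) *\<^sub>R (U (\<sigma> * h) x - x)) \<longlongrightarrow> (\<i> * of_real \<sigma>) *\<^sub>C y) (at 0)"
    by (auto simp: scaleC_uminus_left)
qed

lemma generates_orbit:
  assumes U: "generates U A" and x: "A x = Some y"
  shows "A (U t x) = Some (U t y)"
proof -
  have ug: "unitary_group U" using U by (simp add: generates_def)
  have "(generator_quotient U x \<longlongrightarrow> \<i> *\<^sub>C y) (at 0)" using U x by (simp add: generates_def)
  from ug_orbit_quotient[OF ug this, of t]
  have "((\<lambda>h. (1 / h) *\<^sub>R (U h (U t x) - U t x)) \<longlongrightarrow> \<i> *\<^sub>C U t y) (at 0)"
    by (simp add: unitary_operator_bounded_linear(3)[OF ug_unitary[OF ug]])
  then show ?thesis using U by (simp add: generates_def)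
qed

text \<open>The contributions of the unbounded operator \<open>A0\<close> cancel; what remains is
  the perturbation and the derivative of the corrected initial vector.\<close>

lemma cook_derivative:
  fixes A0 :: "'a::complex_hilbert_space \<rightharpoonup> 'a"
  assumes U0: "generates U0 A0" and U: "generates U (\<lambda>x. map_option (\<lambda>y. y + V x) (A0 x))"
    and s: "\<sigma> \<in> {-1, 1}" and w: "A0 (z t) = Some w" and z: "(z has_vector_derivative z') (at t)"
  shows "((\<lambda>t. U (\<sigma> * t) (U0 (- (\<sigma> * t)) (z t))) has_vector_derivative
    U (\<sigma> * t) ((\<i> * of_real \<sigma>) *\<^sub>C V (U0 (- (\<sigma> * t)) (z t)) + U0 (- (\<sigma> * t)) z')) (at t)"
proof -
  have s': "- \<sigma> \<in> {-1, 1}" using s by auto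
  have ug0: "unitary_group U0" using U0 by (simp add: generates_def)
  note bl = unitary_operator_bounded_linear[OF ug_unitary[OF ug0]]
  let ?y = "\<lambda>t. U0 (- (\<sigma> * t)) (z t)" and ?u = "U0 (- (\<sigma> * t))"
  have y: "(?y has_vector_derivative ?u ((\<i> * of_real (- \<sigma>)) *\<^sub>C w + z')) (at t)"
    using ug_has_vector_derivative_path[OF generates_signed(1)[OF U0 s'] generates_signed(2)[where A = A0, OF U0 s' w] z] by simp
  have "(\<lambda>x. map_option (\<lambda>y. y + V x) (A0 x)) (?y t) = Some (?u w + V (?y t))"
    using generates_orbit[OF U0 w] by simp
  from ug_has_vector_derivative_path[OF generates_signed(1)[OF U s] generates_signed(2)[OF U s this] y]
  have "((\<lambda>t. U (\<sigma> * t) (?y t)) has_vector_derivative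
    U (\<sigma> * t) ((\<i> * of_real \<sigma>) *\<^sub>C (?u w + V (?y t)) + ?u ((\<i> * of_real (- \<sigma>)) *\<^sub>C w + z'))) (at t)" .
  moreover have "(\<i> * of_real \<sigma>) *\<^sub>C (?u w + V (?y t)) + ?u ((\<i> * of_real (- \<sigma>)) *\<^sub>C w + z')
      = (\<i> * of_real \<sigma>) *\<^sub>C V (?y t) + ?u z'"
    by (simp add: linear_add[OF bounded_linear.linear[OF bl(1)]] linear_diff[OF bounded_linear.linear[OF bl(1)]] bl(3)
        scaleC_add_right scaleC_uminus_left)
  ultimately show ?thesis by simp
qed

lemma integrable_bounded_symbol:
  assumes M: "bounded_symbol M K" and f: "integrable lborel f"
  shows "integrable lborel (\<lambda>x. M x *v f x)"
proof (rule integrable_dominated)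
  show "integrable lborel (\<lambda>x. K * norm (f x))" using f by simp
  have "f \<in> borel_measurable borel" using f by auto
  then show "(\<lambda>x. M x *v f x) \<in> borel_measurable lborel"
    using M measurable_matrix_vector[of M f] by (simp add: bounded_symbol_def)
  show "AE x in lborel. norm (M x *v f x) \<le> norm (K * norm (f x))"
  proof (rule AE_I2)
    fix x
    have "norm (M x *v f x) \<le> K * norm (f x)" using M by (simp add: bounded_symbol_def)
    then show "norm (M x *v f x) \<le> norm (K * norm (f x))" by simp
  qed
qed

lemma inv_fourier_abs:
  assumes f: "integrable lborel f" "square_integrable f"
  shows "inv fourier (abs_L2 f) = abs_L2 (\<lambda>r. FT f (- r))" "square_integrable (\<lambda>r. FT f (- r))"
  using fourier_abs[OF f] FT_plancherel(1)[OF f] square_integrable_reflect by (simp_all add: inv_fourier reflect_abs)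

lemma cmod_branch_le:
  assumes m: "m > 0" and e: "\<eta> \<in> {-1, 1}"
  shows "cmod (branch m \<eta> k j p) \<le> 1"
proof -
  have E: "energy m p > 0" by (rule energy_facts(1)[OF m])
  have "\<bar>p\<bar> \<le> energy m p" "m \<le> energy m p" unfolding energy_def using m by (auto intro: real_le_rsqrt)
  moreover have "k = 1 \<or> k = 2" "j = 1 \<or> j = 2" using exhaust_2 by auto
  ultimately have H: "cmod (dirac_symbol m p $ k $ j) \<le> energy m p"
    using m by (elim disjE) (simp_all add: dirac_symbol_def norm_mult)
  have "cmod (branch m \<eta> k j p) \<le> cmod (if k = j then 1 / 2 else 0) + cmod (of_real (\<eta> / (2 * energy m p)) * dirac_symbol m p $ k $ j)"
    unfolding branch_def by (rule norm_triangle_ineq)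
  also have "\<dots> \<le> 1 / 2 + 1 / 2"
  proof (rule add_mono)
    have "\<bar>\<eta>\<bar> = 1" using e by auto
    then show "cmod (of_real (\<eta> / (2 * energy m p)) * dirac_symbol m p $ k $ j) \<le> 1 / 2"
      using H E by (simp add: norm_mult norm_divide field_simps)
  qed (simp add: norm_divide)
  finally show ?thesis by simp
qed

lemma exp_i_difference: "cmod (exp (\<i> * of_real x) - exp (\<i> * of_real y)) \<le> \<bar>x - y\<bar>"
proof -
  have "exp (\<i> * of_real x) - exp (\<i> * of_real y) = exp (\<i> * of_real x) * (1 - exp (- (\<i> * of_real (x - y))))"
    by (simp add: algebra_simps exp_add[symmetric])
  then show ?thesis using cmod_one_minus_exp_le[of "x - y"] by (simp only: norm_mult cmod_exp_i mult_1)
qed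

section \<open>The Cook integrand in position space\<close>

context dirac_coefficients
begin

text \<open>Value of \<open>b\<close> on the classical ray, as a scalar multiplier in momentum; up
  to \<i> and the sign of time it generates the deviation factor.\<close>

definition beta :: "real \<Rightarrow> real \<Rightarrow> complex^2^2" where
  "beta T p = mat (of_real (b \<bar>T * speed m p\<bar>))"

lemma speed_measurable [measurable]: "speed m \<in> borel_measurable borel"
  unfolding speed_def[abs_def] by measurable

lemma b_even_bound: "\<bar>b \<bar>r\<bar>\<bar> \<le> C + \<bar>b 0\<bar>"
  using ab_bounded(2)[of "\<bar>r\<bar>"] C by (cases "r = 0") auto

lemma b_even_measurable [measurable]: "(\<lambda>r. b \<bar>r\<bar>) \<in> borel_measurable borel"
  by (rule even_extension_measurable) (use b_diff in auto)

lemma b_speed_measurable: "(\<lambda>p. complex_of_real (b \<bar>T * speed m p\<bar>)) \<in> borel_measurable borel"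
  using measurable_compose[OF _ b_even_measurable, of "\<lambda>p. T * speed m p"] by simp

lemma beta_bounded: "bounded_symbol (beta T) (C + \<bar>b 0\<bar>)"
  unfolding beta_def[abs_def] by (rule bounded_symbol_mat[OF b_speed_measurable]) (simp add: b_even_bound)

lemma potential_bounded: "\<exists>K. bounded_symbol (potential a b) K"
  by (rule potential_bounded_symbol[of a b C]) (use a_diff b_diff ab_bounded in auto)

text \<open>For \<open>T > 0\<close> this is the inverse of the deviation factor at time
  \<open>\<sigma> * T\<close>, written without \<open>sgn\<close> so that it can be differentiated
  in \<open>T\<close>.\<close>

definition incoming :: "real \<Rightarrow> real \<Rightarrow> L2 \<Rightarrow> L2" where
  "incoming \<sigma> T x = fmult (phase_symbol (\<lambda>p. - (\<sigma> * phase T p))) x"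

text \<open>Integrand of the inverse transform of the corrected free evolution, split into energy
  branches. The evolution runs backwards by \<open>\<sigma> * T\<close>, so the projection with sign
  1 carries the kernel sign \<sigma>.\<close>

lemma osc_kernel_sum:
  "exp (\<i> * of_real (p * r)) * ((dirac_group_symbol m (- (\<sigma> * T)) p *v (phase_symbol (\<lambda>p. - (\<sigma> * phase T p)) p *v (x *\<^sub>R axis j 1))) $ k)
   = osc_kernel T r \<sigma> \<sigma> p * (of_real x * branch m 1 k j p) + osc_kernel T r (- \<sigma>) \<sigma> p * (of_real x * branch m (-1) k j p)"
proof -
  have j: "j = 1 \<or> j = 2" using exhaust_2 by auto
  have ax: "(x *\<^sub>R axis j (1::complex)) $ i = (if i = j then of_real x else 0)" for i j :: 2
    by (simp only: vector_scaleR_component) (simp add: axis_def scaleR_conv_of_real)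
  have "(dirac_group_symbol m (- (\<sigma> * T)) p *v (phase_symbol (\<lambda>p. - (\<sigma> * phase T p)) p *v (x *\<^sub>R axis j 1))) $ k
      = dirac_group_symbol m (- (\<sigma> * T)) p $ k $ j * (exp (\<i> * of_real (- (\<sigma> * phase T p))) * of_real x)"
    unfolding phase_symbol_def mat_vector using j
    by (elim disjE; simp only: matrix_vector_mult_def sum_2 vec_lambda_beta vector_smult_component ax; simp)
  also have "exp (\<i> * of_real (p * r)) * \<dots> =
     (exp (\<i> * of_real (p * r)) * exp (\<i> * of_real (- (\<sigma> * T) * energy m p)) * exp (\<i> * of_real (- (\<sigma> * phase T p)))) * (of_real x * branch m 1 k j p)
     + (exp (\<i> * of_real (p * r)) * exp (\<i> * of_real (- (- (\<sigma> * T) * energy m p))) * exp (\<i> * of_real (- (\<sigma> * phase T p)))) * (of_real x * branch m (-1) k j p)"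
    unfolding dirac_group_symbol_branch[OF m] by (simp only: algebra_simps)
  also have "exp (\<i> * of_real (p * r)) * exp (\<i> * of_real (- (\<sigma> * T) * energy m p)) * exp (\<i> * of_real (- (\<sigma> * phase T p))) = osc_kernel T r \<sigma> \<sigma> p"
    unfolding exp_add[symmetric] by (simp add: algebra_simps)
  also have "exp (\<i> * of_real (p * r)) * exp (\<i> * of_real (- (- (\<sigma> * T) * energy m p))) * exp (\<i> * of_real (- (\<sigma> * phase T p))) = osc_kernel T r (- \<sigma>) \<sigma> p"
    unfolding exp_add[symmetric] by (simp add: algebra_simps)
  finally show ?thesis .
qed

abbreviation packet :: "real \<Rightarrow> real \<Rightarrow> real \<Rightarrow> 2 \<Rightarrow> L2" where
  "packet c a' b' j \<equiv> inv fourier (vtest (bump c 0 0 a' b') j)"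

text \<open>The potential multiplies in position and \<open>beta\<close> in momentum, but after
  inverse transformation both appear under one momentum integral, with the difference
  \<open>b \<bar>r\<bar> - b \<bar>T * speed m p\<bar>\<close> as symbol. The pointwise bounds in
  \<open>r\<close> are then squared and integrated.\<close>

lemma cook_integrand_decay:
  assumes ab: "a' < b'" "0 < a' \<or> b' < 0" "c > 0"
  shows "\<exists>K\<ge>0. \<forall>T\<ge>1. \<forall>\<sigma>\<in>{-1,1}.
    norm (mult_op (potential a b) (free_group m (- (\<sigma> * T)) (incoming \<sigma> T (packet c a' b' j)))
      - fmult (beta T) (free_group m (- (\<sigma> * T)) (incoming \<sigma> T (packet c a' b' j)))) \<le> K * T powr (- kap)"
proof -
  define \<phi> where "\<phi> = bump c 0 0 a' b'"
  have csup: "compactly_supported \<phi>" unfolding \<phi>_def by (rule compactly_supported_bump[OF ab(1,3)])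
  have phi: "integrable lborel \<phi>" by (rule compactly_supported_integrable(1)[OF csup])
  let ?v = "\<lambda>p. \<phi> p *\<^sub>R axis j (1::complex)"
  have v: "square_integrable ?v" by (rule square_integrable_vtest[OF csup])
  have vi: "integrable lborel ?v" using phi by (rule integrable_scaleR_left)
  \<comment> \<open>A packet has momenta of one sign; \<open>sg\<close> reflects its support into
    the positive half-line.\<close>
  obtain sg l u where sg: "sg \<in> {-1, 1}" and lu: "0 < l" "l < u" and supp: "\<And>p. p \<notin> {l<..<u} \<Longrightarrow> \<phi> (sg * p) = 0"
  proof (cases "0 < a'")
    case True
    show ?thesis by (rule that[of 1 a' b']) (use True ab in \<open>auto simp: \<phi>_def bump_def\<close>)
  next
    case False
    show ?thesis by (rule that[of "-1" "- b'" "- a'"]) (use False ab in \<open>auto simp: \<phi>_def bump_def\<close>)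
  qed
  let ?A = "\<lambda>k \<eta> p. of_real (\<phi> p) * branch m \<eta> k j p"
  \<comment> \<open>Packages the estimate so that a constant depending only on the component and the
    energy branch can be chosen for all times and positions at once.\<close>
  define good where "good K k \<eta> \<longleftrightarrow> K \<ge> 0 \<and> (\<forall>T\<ge>1. \<forall>r. \<forall>\<epsilon>\<in>{-1,1}. \<forall>\<sigma>\<in>{-1,1}.
    cmod (kernel_integral (\<lambda>p. b \<bar>r\<bar> - b \<bar>T * speed m p\<bar>) (?A k \<eta>) T r \<epsilon> \<sigma>) \<le> decay K T r \<and>
    cmod (kernel_integral (\<lambda>p. a \<bar>r\<bar>) (?A k \<eta>) T r \<epsilon> \<sigma>) \<le> decay K T r)" for K k \<eta>
  have "\<exists>K. good K k \<eta>" for k \<eta>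
  proof -
    obtain M1 where M1: "c2_bound {l/2..2*u} 1 M1 (\<lambda>p. of_real (\<phi> (sg * p)))" unfolding \<phi>_def using bump_c2[OF ab(1,3) sg] by blast
    obtain M2 where M2: "c2_bound {l/2..2*u} 1 M2 (\<lambda>p. branch m \<eta> k j (sg * p))" using branch_c2[OF m sg] by blast
    show ?thesis
      unfolding good_def
      by (rule branch_integral_estimate[OF lu sg c2_bound_mult[OF M1 M2]]) (simp_all add: supp)
  qed
  then obtain Kf where good: "\<And>k \<eta>. good (Kf k \<eta>) k \<eta>" by metis
  have Kf0: "Kf k \<eta> \<ge> 0" for k \<eta> using good[of k \<eta>] by (simp only: good_def)
  have Kf: "cmod (kernel_integral (\<lambda>p. b \<bar>r\<bar> - b \<bar>T * speed m p\<bar>) (?A k \<eta>) T r \<epsilon> \<sigma>) \<le> decay (Kf k \<eta>) T r \<and>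
    cmod (kernel_integral (\<lambda>p. a \<bar>r\<bar>) (?A k \<eta>) T r \<epsilon> \<sigma>) \<le> decay (Kf k \<eta>) T r" if "T \<ge> 1" "\<epsilon> \<in> {-1,1}" "\<sigma> \<in> {-1,1}" for k \<eta> T r \<epsilon> \<sigma>
    using good[of k \<eta>] that unfolding good_def by blast
  define K0 where "K0 = Kf 1 1 + Kf 2 1 + (Kf 1 (-1) + Kf 2 (-1))"
  have K0: "Kf k 1 \<le> K0" "Kf k (-1) \<le> K0" "0 \<le> K0" for k
  proof -
    have "k = 1 \<or> k = 2" using exhaust_2 by auto
    then show "Kf k 1 \<le> K0" "Kf k (-1) \<le> K0" using Kf0[of 1 1] Kf0[of 2 1] Kf0[of 1 "-1"] Kf0[of 2 "-1"] by (auto simp: K0_def)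
    show "0 \<le> K0" using Kf0[of 1 1] Kf0[of 2 1] Kf0[of 1 "-1"] Kf0[of 2 "-1"] by (simp add: K0_def)
  qed
  obtain KV where KV: "bounded_symbol (potential a b) KV" using potential_bounded by blast
  let ?I = "sqrt (LBINT r. 1 / (1 + (r::real)\<^sup>2))"
  have I0: "?I \<ge> 0" by (intro real_sqrt_ge_zero Bochner_Integration.integral_nonneg) simp
  have main: "norm (mult_op (potential a b) (free_group m (- (\<sigma> * T)) (incoming \<sigma> T (inv fourier (vtest \<phi> j))))
      - fmult (beta T) (free_group m (- (\<sigma> * T)) (incoming \<sigma> T (inv fourier (vtest \<phi> j))))) \<le> (?I * (8 * K0)) * T powr (- kap)"
    if T: "T \<ge> 1" and s: "\<sigma> \<in> {-1,1}" for T \<sigma>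
  proof -
    let ?G = "dirac_group_symbol m (- (\<sigma> * T))" and ?P = "phase_symbol (\<lambda>p. - (\<sigma> * phase T p))"
    have s': "- \<sigma> \<in> {-1, 1}" using s by auto
    have G: "bounded_symbol ?G 1" by (rule unitary_symbol_norm(2)[OF dirac_group_unitary_symbol[OF m]])
    have P: "bounded_symbol ?P 1" by (rule unitary_symbol_norm(2)[OF phase_symbol_unitary]) measurable
    define Y where "Y p = ?G p *v (?P p *v ?v p)" for p
    define Z where "Z p = beta T p *v Y p" for p
    have Y: "integrable lborel Y" "square_integrable Y"
      unfolding Y_def by (intro integrable_bounded_symbol[OF G] integrable_bounded_symbol[OF P] vi,
          intro square_integrable_mult[OF G] square_integrable_mult[OF P] v)
    have Z: "integrable lborel Z" "square_integrable Z"
      unfolding Z_def by (intro integrable_bounded_symbol[OF beta_bounded] Y, intro square_integrable_mult[OF beta_bounded] Y)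
    let ?y = "free_group m (- (\<sigma> * T)) (incoming \<sigma> T (inv fourier (vtest \<phi> j)))"
    have fy: "fourier ?y = abs_L2 Y"
      unfolding free_group_def incoming_def fourier_fmult fourier_facts(1) vtest_def Y_def
      by (simp only: mult_op_abs[OF P v] mult_op_abs[OF G square_integrable_mult[OF P v]])
    then have y: "?y = abs_L2 (\<lambda>r. FT Y (- r))"
      using inv_fourier_abs(1)[OF Y] fourier_facts(2)[of ?y] by simp
    have by': "fmult (beta T) ?y = abs_L2 (\<lambda>r. FT Z (- r))"
      unfolding fmult_def fy mult_op_abs[OF beta_bounded Y(2)] using inv_fourier_abs(1)[OF Z] by (simp add: Z_def[abs_def])
    \<comment> \<open>Pointwise representative of the Cook integrand, which is what the decay
      estimate in \<open>r\<close> applies to.\<close>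
    define D where "D r = potential a b r *v FT Y (- r) - FT Z (- r)" for r
    have SIV: "square_integrable (\<lambda>r. potential a b r *v FT Y (- r))"
      by (rule square_integrable_mult[OF KV inv_fourier_abs(2)[OF Y]])
    have D: "square_integrable D" unfolding D_def by (rule square_integrable_diff[OF SIV inv_fourier_abs(2)[OF Z]])
    have eqD: "mult_op (potential a b) ?y - fmult (beta T) ?y = abs_L2 D"
      unfolding by' unfolding y mult_op_abs[OF KV inv_fourier_abs(2)[OF Y]] abs_L2_minus[OF SIV inv_fourier_abs(2)[OF Z]] D_def ..
    let ?k0 = "complex_of_real (1 / sqrt (2 * pi))"
    have k0: "cmod ?k0 \<le> 1" using pi_gt3 by (simp add: norm_divide)
    let ?e = "\<lambda>r p. exp (\<i> * complex_of_real (p * r))"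
    have FTn: "FT W (- r) $ k = ?k0 * (LBINT p. ?e r p * W p $ k)" if "integrable lborel W" for W r k
      unfolding FT_nth[OF that] ft_def by (simp add: mult.commute)
    have ei: "integrable lborel (\<lambda>p. ?e r p * W p $ k)" if "integrable lborel W" for W :: "real \<Rightarrow> complex^2" and r k
    proof (rule integrable_unimodular_mult[where K = 1])
      show "integrable lborel (\<lambda>p. W p $ k)" using that integrable_vec_iff by blast
      show "(\<lambda>p. ?e r p) \<in> borel_measurable borel" by (intro measurable_exp_i) measurable
      show "cmod (?e r p) \<le> 1" for p by (simp only: cmod_exp_i order_refl)
    qed
    have pm: "integrable lborel (\<lambda>p. osc_kernel T r \<epsilon> \<sigma> p * (of_real (q p) * ?A k \<eta> p))"
      if q: "(\<lambda>p. complex_of_real (q p)) \<in> borel_measurable borel" "\<And>p. \<bar>q p\<bar> \<le> Q" and e: "\<eta> \<in> {-1, 1}" for q Q r k \<eta> \<epsilon>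
    proof -
      have Q: "Q \<ge> 0" using q(2)[of 0] by linarith
      have bm: "branch m \<eta> k j \<in> borel_measurable borel"
        unfolding branch_def[abs_def]
        by (intro borel_measurable_add borel_measurable_times dirac_symbol_measurable borel_measurable_of_real borel_measurable_divide)
          measurable
      have "integrable lborel (\<lambda>p. (osc_kernel T r \<epsilon> \<sigma> p * (of_real (q p) * branch m \<eta> k j p)) * of_real (\<phi> p))"
      proof (rule integrable_unimodular_mult[where K = "1 * (Q * 1)"])
        show "integrable lborel (\<lambda>p. complex_of_real (\<phi> p))" using phi by (rule integrable_of_real)
        show "(\<lambda>p. osc_kernel T r \<epsilon> \<sigma> p * (of_real (q p) * branch m \<eta> k j p)) \<in> borel_measurable borel"
          by (intro borel_measurable_times q(1) bm measurable_exp_i) measurable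
        show "cmod (osc_kernel T r \<epsilon> \<sigma> p * (of_real (q p) * branch m \<eta> k j p)) \<le> 1 * (Q * 1)" for p
          unfolding norm_mult[of "exp _"] norm_mult[of "of_real _"] cmod_exp_i norm_of_real
          by (intro mult_mono q(2) cmod_branch_le[OF m e] order_refl) (use Q in auto)
      qed
      then show ?thesis by (simp only: mult_ac)
    qed
    have split: "(LBINT p. of_real (q p) * (?e r p * Y p $ k)) =
        (LBINT p. osc_kernel T r \<sigma> \<sigma> p * (of_real (q p) * ?A k 1 p)) + (LBINT p. osc_kernel T r (- \<sigma>) \<sigma> p * (of_real (q p) * ?A k (-1) p))"
      if q: "(\<lambda>p. complex_of_real (q p)) \<in> borel_measurable borel" "\<And>p. \<bar>q p\<bar> \<le> Q" for q Q r k
    proof -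
      have "(LBINT p. of_real (q p) * (?e r p * Y p $ k)) =
        (LBINT p. osc_kernel T r \<sigma> \<sigma> p * (of_real (q p) * ?A k 1 p) + osc_kernel T r (- \<sigma>) \<sigma> p * (of_real (q p) * ?A k (-1) p))"
        unfolding Y_def osc_kernel_sum by (simp only: distrib_left mult.left_commute)
      also have "\<dots> = (LBINT p. osc_kernel T r \<sigma> \<sigma> p * (of_real (q p) * ?A k 1 p)) + (LBINT p. osc_kernel T r (- \<sigma>) \<sigma> p * (of_real (q p) * ?A k (-1) p))"
        by (intro Bochner_Integration.integral_add pm[OF q]) auto
      finally show ?thesis .
    qed
    let ?X = "\<lambda>r. decay K0 T r"
    have KX: "x \<le> ?X r" if "x \<le> decay L T r" "L \<le> K0" for x L r
    proof -
      have "decay L T r \<le> ?X r" using that(2) by (intro divide_right_mono mult_right_mono) auto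
      then show ?thesis using that(1) by linarith
    qed
    have Db: "cmod (D r $ k) \<le> 4 * ?X r" for r k
    proof -
      \<comment> \<open>The other component: the entry \<open>a\<close> of the potential couples the
        two components, while \<open>b\<close> is diagonal.\<close>
      define k' :: 2 where "k' = (if k = 1 then 2 else 1)"
      have k12: "k = 1 \<or> k = 2" using exhaust_2 by auto
      have Vk: "(potential a b r *v w) $ k = of_real (b \<bar>r\<bar>) * w $ k + of_real (a \<bar>r\<bar>) * w $ k'" for w
        using k12 by (elim disjE) (simp_all add: potential_def mat2_expand k'_def add.commute)
      have Zk: "Z p $ k = of_real (b \<bar>T * speed m p\<bar>) * Y p $ k" for p
        unfolding Z_def beta_def mat_vector by simp
      let ?qb = "\<lambda>p. b \<bar>r\<bar> - b \<bar>T * speed m p\<bar>" and ?qa = "\<lambda>p. a \<bar>r\<bar>"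
      have qb: "(\<lambda>p. complex_of_real (?qb p)) \<in> borel_measurable borel" "\<And>p. \<bar>?qb p\<bar> \<le> (C + \<bar>b 0\<bar>) + (C + \<bar>b 0\<bar>)"
      proof -
        show "(\<lambda>p. complex_of_real (?qb p)) \<in> borel_measurable borel"
          unfolding of_real_diff by (intro borel_measurable_diff b_speed_measurable) measurable
        show "\<bar>?qb p\<bar> \<le> (C + \<bar>b 0\<bar>) + (C + \<bar>b 0\<bar>)" for p
          by (rule order_trans[OF abs_triangle_ineq4 add_mono[OF b_even_bound b_even_bound]])
      qed
      have qa: "(\<lambda>p. complex_of_real (?qa p)) \<in> borel_measurable borel" "\<And>p. \<bar>?qa p\<bar> \<le> \<bar>a \<bar>r\<bar>\<bar>" by auto
      have eZ: "(LBINT p. ?e r p * Z p $ k) = (LBINT p. of_real (b \<bar>T * speed m p\<bar>) * (?e r p * Y p $ k))"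
        unfolding Zk by (simp only: mult.left_commute)
      have iZ: "integrable lborel (\<lambda>p. of_real (b \<bar>T * speed m p\<bar>) * (?e r p * Y p $ k))"
        using ei[OF Z(1), of r k] unfolding Zk by (simp only: mult.left_commute)
      have "D r $ k = of_real (b \<bar>r\<bar>) * (?k0 * (LBINT p. ?e r p * Y p $ k)) + of_real (a \<bar>r\<bar>) * (?k0 * (LBINT p. ?e r p * Y p $ k'))
         - ?k0 * (LBINT p. ?e r p * Z p $ k)"
        unfolding D_def vector_minus_component Vk FTn[OF Y(1)] FTn[OF Z(1)] ..
      also have "\<dots> = ?k0 * (((LBINT p. of_real (b \<bar>r\<bar>) * (?e r p * Y p $ k)) - (LBINT p. of_real (b \<bar>T * speed m p\<bar>) * (?e r p * Y p $ k)))
         + (LBINT p. of_real (a \<bar>r\<bar>) * (?e r p * Y p $ k')))"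
        unfolding eZ integral_mult_right_zero by (simp only: algebra_simps)
      also have "(LBINT p. of_real (b \<bar>r\<bar>) * (?e r p * Y p $ k)) - (LBINT p. of_real (b \<bar>T * speed m p\<bar>) * (?e r p * Y p $ k))
         = (LBINT p. of_real (?qb p) * (?e r p * Y p $ k))"
        unfolding of_real_diff left_diff_distrib
        by (rule Bochner_Integration.integral_diff[symmetric, OF integrable_mult_right[OF ei[OF Y(1)]] iZ])
      finally have Dk: "D r $ k = ?k0 * ((LBINT p. of_real (?qb p) * (?e r p * Y p $ k)) + (LBINT p. of_real (?qa p) * (?e r p * Y p $ k')))" .
      have "cmod (D r $ k) \<le> 1 * ((?X r + ?X r) + (?X r + ?X r))"
        unfolding Dk norm_mult split[OF qb] split[OF qa]
        by (intro mult_mono k0 order_trans[OF norm_triangle_ineq add_mono] KX[OF conjunct1[OF Kf[OF T s s]] K0(1)]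
            KX[OF conjunct1[OF Kf[OF T s' s]] K0(2)] KX[OF conjunct2[OF Kf[OF T s s]] K0(1)]
            KX[OF conjunct2[OF Kf[OF T s' s]] K0(2)]) auto
      then show ?thesis by simp
    qed
    have "norm (D r) \<le> (8 * K0 * T powr (3 / 2 - kap)) / (T + \<bar>r\<bar>)\<^sup>2" for r
    proof -
      have "norm (D r) \<le> (\<Sum>i\<in>UNIV. cmod (D r $ i))" unfolding norm_vec_def by (rule L2_set_le_sum) simp
      also have "\<dots> \<le> 4 * ?X r + 4 * ?X r" unfolding sum_2 by (intro add_mono Db)
      finally show ?thesis by simp
    qed
    \<comment> \<open>The 8 counts two symbols, two energy branches and two components; the
      exponents add up to \<open>- kap\<close>.\<close>
    from L2_norm_decay[OF D this _ _] have "norm (abs_L2 D) \<le> ?I * ((8 * K0 * T powr (3 / 2 - kap)) * T powr (- 3 / 2))"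
      using T K0(3) by simp
    also have "\<dots> = (?I * (8 * K0)) * T powr (- kap)"
      by (simp add: powr_add[symmetric] mult.assoc)
    finally show ?thesis unfolding eqD .
  qed
  have "?I * (8 * K0) \<ge> 0" using I0 K0(3) by simp
  then show ?thesis unfolding \<phi>_def[symmetric] by (intro exI[of _ "?I * (8 * K0)"] conjI allI ballI impI main)
qed

end

section \<open>Differentiation of the corrected evolution and the wave limits\<close>

context dirac_coefficients
begin

lemma incoming_vtest:
  assumes csup: "compactly_supported \<phi>"
  shows "fourier (incoming \<sigma> T (inv fourier (vtest \<phi> j))) = abs_L2 (\<lambda>p. exp (\<i> * of_real (- (\<sigma> * phase T p))) *s (\<phi> p *\<^sub>R axis j 1))" (is "?A = ?B")
    "square_integrable (\<lambda>p. exp (\<i> * of_real (- (\<sigma> * phase T p))) *s (\<phi> p *\<^sub>R axis j (1::complex)))" (is ?S)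
proof -
  have P: "bounded_symbol (phase_symbol (\<lambda>p. - (\<sigma> * phase T p))) 1"
    by (rule unitary_symbol_norm(2)[OF phase_symbol_unitary]) measurable
  note v = square_integrable_vtest[OF csup, of j]
  show "?A = ?B"
    unfolding incoming_def fourier_fmult fourier_facts(1) vtest_def mult_op_abs[OF P v] by (simp only: phase_symbol_def mat_vector)
  show ?S
    using square_integrable_mult[OF P v] by (simp only: phase_symbol_def mat_vector)
qed

text \<open>On the compact momentum support the energy is bounded, so the symbol keeps the packet in
  L2; the phase then commutes with the free operator.\<close>

lemma incoming_in_domain:
  assumes csup: "compactly_supported \<phi>"
  shows "\<exists>w. op_L0 m (incoming \<sigma> T (inv fourier (vtest \<phi> j))) = Some w"
proof -
  let ?v = "\<lambda>p. \<phi> p *\<^sub>R axis j (1::complex)"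
  note v = square_integrable_vtest[OF csup, of j]
  obtain B R where R: "R \<ge> 0" and B: "\<And>x. \<bar>\<phi> x\<bar> \<le> B * indicator {-R..R} x" using compactly_supported_bounded[OF csup] by blast
  have Hv: "square_integrable (\<lambda>p. dirac_symbol m p *v ?v p)"
  proof (rule square_integrable_bound[OF v, where K = "R + m"])
    show "(\<lambda>p. dirac_symbol m p *v ?v p) \<in> borel_measurable borel"
      by (rule measurable_matrix_vector[OF dirac_symbol_measurable square_integrable_measurable[OF v]])
    have "norm (dirac_symbol m p *v ?v p) \<le> (R + m) * norm (?v p)" for p
    proof (cases "p \<in> {-R..R}")
      case True
      then have "energy m p \<le> R + m" using energy_le[OF m, of p] by auto
      then show ?thesis unfolding norm_dirac_symbol[OF m] by (intro mult_right_mono) auto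
    next
      case False
      then have "\<phi> p = 0" using B[of p] by simp
      then show ?thesis by (simp add: mat2_expand vec_eq_iff forall_2 norm_vec_def L2_set_def sum_2)
    qed
    then show "AE p in lborel. norm (dirac_symbol m p *v ?v p) \<le> (R + m) * norm (?v p)" by simp
  qed
  have Lx: "op_L0 m (inv fourier (vtest \<phi> j)) = Some (inv fourier (abs_L2 (\<lambda>p. dirac_symbol m p *v ?v p)))"
    unfolding op_L0_fourier[OF m] fourier_facts(1) vtest_def
    using rep_abs_L2[OF v] rep_abs_L2[OF Hv] by eventually_elim simp
  have "(\<lambda>p. - (\<sigma> * phase T p)) \<in> borel_measurable borel" by measurable
  from op_L0_phase_commute[OF m this, symmetric] show ?thesis by (simp add: incoming_def Lx)
qed

lemma phase_deriv_abs:
  assumes "p \<noteq> 0" "T > 0"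
  shows "((\<lambda>t. phase t p) has_real_derivative b \<bar>T * speed m p\<bar>) (at T)"
proof -
  have "\<bar>T * speed m p\<bar> = T * speed m \<bar>p\<bar>"
    using assms(2) energy_facts(1)[OF m, of p] by (simp add: abs_mult speed_def energy_def)
  then show ?thesis using phase_DERIV[of "\<bar>p\<bar>" T] assms by (simp add: phase_abs)
qed

text \<open>Pointwise the derivative is that of the phase. The Lipschitz bound with constant
  \<open>C\<close>, uniform in momentum, dominates the difference quotients.\<close>

lemma incoming_derivative:
  fixes j :: 2
  assumes csup: "compactly_supported \<phi>" and T: "T \<ge> 1" and s: "\<sigma> \<in> {-1, 1}"
  defines "x \<equiv> inv fourier (vtest \<phi> j)"
  shows "((\<lambda>T. incoming \<sigma> T x) has_vector_derivative - ((\<i> * of_real \<sigma>) *\<^sub>C fmult (beta T) (incoming \<sigma> T x))) (at T)"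
proof -
  let ?v = "\<lambda>p. \<phi> p *\<^sub>R axis j (1::complex)"
  let ?E = "\<lambda>T p. exp (\<i> * of_real (- (\<sigma> * phase T p)))"
  note v = square_integrable_vtest[OF csup, of j]
  note inc = incoming_vtest[OF csup, where \<sigma> = \<sigma> and j = j]
  let ?g = "\<lambda>h p. ((1 / complex_of_real h) * (?E (T + h) p - ?E T p)) *s ?v p"
  let ?lim = "\<lambda>p. (- ((\<i> * of_real \<sigma>) * of_real (b \<bar>T * speed m p\<bar>)) * ?E T p) *s ?v p"
  have sub: "square_integrable (\<lambda>p. ?E (T + h) p *s ?v p - ?E T p *s ?v p)" for h by (rule square_integrable_diff[OF inc(2) inc(2)])
  have geq: "?g h = (\<lambda>p. (1 / complex_of_real h) *s (?E (T + h) p *s ?v p - ?E T p *s ?v p))" for h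
    by (simp only: vector_smult_assoc[symmetric] vector_sub_rdistrib) 
  have g: "square_integrable (?g h)" for h unfolding geq by (rule square_integrable_vscale[OF sub])
  have bE: "square_integrable (\<lambda>p. beta T p *v (?E T p *s ?v p))" by (rule square_integrable_mult[OF beta_bounded inc(2)])
  have g0eq: "?lim = (\<lambda>p. (- (\<i> * of_real \<sigma>)) *s (beta T p *v (?E T p *s ?v p)))"
    by (simp add: beta_def mat_vector vector_smult_assoc mult.assoc)
  have g0: "square_integrable ?lim" unfolding g0eq by (rule square_integrable_vscale[OF bE])
  have "((\<lambda>h. abs_L2 (?g h)) \<longlongrightarrow> abs_L2 ?lim) (at 0)"
  \<comment> \<open>Radius 1/2 keeps \<open>T + h\<close> positive, as required by the Lipschitz
    bound.\<close>
  proof (rule L2_tendsto_dominated_at[OF g g0, where w = "\<lambda>p. C * norm (?v p)" and d = "1 / 2"])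
    have "((\<lambda>h. ?g h p) \<longlongrightarrow> ?lim p) (at 0)" if p: "p \<noteq> 0" for p
    proof -
      have "((\<lambda>t. \<i> * of_real (- (\<sigma> * phase t p))) has_vector_derivative \<i> * of_real (- (\<sigma> * b \<bar>T * speed m p\<bar>))) (at T)"
        using phase_deriv_abs[OF p, of T] T
        by (intro has_vector_derivative_mult_right has_vector_derivative_of_real)
          (auto simp: has_real_derivative_iff_has_vector_derivative[symmetric] intro!: DERIV_minus DERIV_cmult)
      from field_vector_diff_chain_at[OF this DERIV_exp]
      have "((\<lambda>t. ?E t p) has_vector_derivative (\<i> * of_real (- (\<sigma> * b \<bar>T * speed m p\<bar>))) * ?E T p) (at T)" by (simp add: o_def)
      then have "((\<lambda>h. (1 / h) *\<^sub>R (?E (T + h) p - ?E T p)) \<longlongrightarrow> (\<i> * of_real (- (\<sigma> * b \<bar>T * speed m p\<bar>))) * ?E T p) (at 0)"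
        by (simp only: has_vector_derivative_iff_quotient)
      then have "((\<lambda>h. (1 / complex_of_real h) * (?E (T + h) p - ?E T p)) \<longlongrightarrow> - ((\<i> * of_real \<sigma>) * of_real (b \<bar>T * speed m p\<bar>)) * ?E T p) (at 0)"
        by (simp add: scaleR_conv_of_real mult.assoc)
      then show ?thesis unfolding vector_scalar_mult_def by (intro tendsto_vec_lambda tendsto_mult_right)
    qed
    then show "AE p in lborel. ((\<lambda>h. ?g h p) \<longlongrightarrow> ?lim p) (at 0)"
      using AE_lborel_singleton[of 0] by (auto elim!: eventually_mono)
    have "integrable lborel (\<lambda>p. C\<^sup>2 * (norm (?v p))\<^sup>2)" using v by (intro integrable_mult_right) (simp add: square_integrable_def)
    then show "integrable lborel (\<lambda>p. (C * norm (?v p))\<^sup>2)" by (simp only: power_mult_distrib)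
    fix h :: real assume h: "h \<noteq> 0" "\<bar>h - 0\<bar> < 1 / 2"
    have "norm (?g h p) \<le> C * norm (?v p)" if p: "p \<noteq> 0" for p
    proof -
      have "cmod (?E (T + h) p - ?E T p) \<le> \<bar>- (\<sigma> * phase (T + h) p) - - (\<sigma> * phase T p)\<bar>" by (rule exp_i_difference)
      also have "\<dots> = \<bar>phase (T + h) \<bar>p\<bar> - phase T \<bar>p\<bar>\<bar>" using s by (auto simp: phase_abs)
      also have "\<dots> \<le> C * \<bar>h\<bar>"
      proof (cases "h > 0")
        case True
        then show ?thesis using phase_lipschitz(2)[of "\<bar>p\<bar>" T "T + h"] p T by (simp add: mult.commute)
      next
        case False
        then show ?thesis using phase_lipschitz(2)[of "\<bar>p\<bar>" "T + h" T] p T h by (simp add: mult.commute abs_minus_commute)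
      qed
      finally have "cmod ((1 / complex_of_real h) * (?E (T + h) p - ?E T p)) \<le> C"
        using h by (simp add: norm_divide norm_mult divide_le_eq)
      then show ?thesis unfolding norm_vscale by (intro mult_right_mono) auto
    qed
    then show "AE p in lborel. norm (?g h p) \<le> C * norm (?v p)"
      using AE_lborel_singleton[of 0] by (auto elim!: eventually_mono)
  qed simp
  moreover have "abs_L2 (?g h) = fourier ((1 / h) *\<^sub>R (incoming \<sigma> (T + h) x - incoming \<sigma> T x))" for h
  proof -
    have "fourier ((1 / h) *\<^sub>R (incoming \<sigma> (T + h) x - incoming \<sigma> T x))
       = complex_of_real (1 / h) *\<^sub>C (fourier (incoming \<sigma> (T + h) x) - fourier (incoming \<sigma> T x))"
      using linear_diff[OF bounded_linear.linear[OF fourier_bounded_linear]]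
      by (simp only: scaleC_of_real[symmetric] fourier_scaleC)
    also have "\<dots> = abs_L2 (?g h)"
      unfolding x_def inc(1) abs_L2_minus[OF inc(2) inc(2)] abs_L2_scaleC[OF sub] geq by simp
    finally show ?thesis ..
  qed
  moreover have "abs_L2 ?lim = fourier (- ((\<i> * of_real \<sigma>) *\<^sub>C fmult (beta T) (incoming \<sigma> T x)))"
    unfolding scaleC_uminus_left[symmetric] fourier_scaleC fourier_fmult x_def inc(1) mult_op_abs[OF beta_bounded inc(2)]
      abs_L2_scaleC[OF bE] g0eq ..
  ultimately show ?thesis unfolding has_vector_derivative_iff_quotient by (simp only: fourier_tendsto_iff)
qed

lemma beta_free_commute: "fmult (beta T) (free_group m t x) = free_group m t (fmult (beta T) x)"
proof -
  have G: "bounded_symbol (dirac_group_symbol m t) 1" by (rule unitary_symbol_norm(2)[OF dirac_group_unitary_symbol[OF m]])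
  show ?thesis
    unfolding free_group_def fmult_fmult[OF beta_bounded G] fmult_fmult[OF G beta_bounded] unfolding beta_def mat_commute ..
qed

abbreviation scattering :: "(real \<Rightarrow> L2 \<Rightarrow> L2) \<Rightarrow> real \<Rightarrow> real \<Rightarrow> L2 \<Rightarrow> L2" where
  "scattering U \<sigma> t x \<equiv> U (\<sigma> * t) (free_group m (- (\<sigma> * t)) x)"

text \<open>\<open>beta\<close> is scalar and commutes with the free group, so the derivative of the
  corrected evolution contains the potential only through its difference with \<open>beta\<close>,
  whose decay rate \<open>kap\<close> exceeds 1.\<close>

theorem cook_convergence:
  assumes U: "generates U (op_L m a b)" and s: "\<sigma> \<in> {-1, 1}"
    and ab: "a' < b'" "0 < a' \<or> b' < 0" "c > 0"
  shows "\<exists>l. ((\<lambda>T. scattering U \<sigma> T (incoming \<sigma> T (packet c a' b' j))) \<longlongrightarrow> l) at_top"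
proof -
  define x where "x = packet c a' b' j"
  have csup: "compactly_supported (bump c 0 0 a' b')" by (rule compactly_supported_bump[OF ab(1,3)])
  obtain KV where KV: "bounded_symbol (potential a b) KV" using potential_bounded by blast
  let ?V = "mult_op (potential a b)" and ?y = "\<lambda>T. free_group m (- (\<sigma> * T)) (incoming \<sigma> T x)"
  have U': "generates U (\<lambda>f. map_option (\<lambda>y. y + ?V f) (op_L0 m f))" using U by (simp only: op_L_eq[OF KV])
  have ugU: "unitary_group U" and ug0: "unitary_group (free_group m)"
    using U free_group_generates[OF m] by (auto simp: generates_def)
  obtain K where K: "K \<ge> 0" "\<And>T. T \<ge> 1 \<Longrightarrow> norm (?V (?y T) - fmult (beta T) (?y T)) \<le> K * T powr (- kap)"
    using cook_integrand_decay[OF ab, of j] s unfolding x_def by blast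
  let ?i = "\<i> * complex_of_real \<sigma>"
  have d: "((\<lambda>T. U (\<sigma> * T) (?y T)) has_vector_derivative U (\<sigma> * T) (?i *\<^sub>C (?V (?y T) - fmult (beta T) (?y T)))) (at T)"
    if T: "T \<ge> 1" for T
  proof -
    obtain w where w: "op_L0 m (incoming \<sigma> T x) = Some w" using incoming_in_domain[OF csup] unfolding x_def by blast
    have "((\<lambda>T. U (\<sigma> * T) (?y T)) has_vector_derivative
      U (\<sigma> * T) (?i *\<^sub>C ?V (?y T) + free_group m (- (\<sigma> * T)) (- (?i *\<^sub>C fmult (beta T) (incoming \<sigma> T x))))) (at T)"
      using cook_derivative[where ?A0.0 = "op_L0 m" and V = ?V, OF free_group_generates[OF m] U' s w incoming_derivative[OF csup T s, of j, folded x_def]] .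
    moreover have "free_group m (- (\<sigma> * T)) (- (?i *\<^sub>C fmult (beta T) (incoming \<sigma> T x))) = - (?i *\<^sub>C fmult (beta T) (?y T))"
      unfolding beta_free_commute scaleC_uminus_left[symmetric] unitary_operator_bounded_linear(3)[OF ug_unitary[OF ug0]] ..
    ultimately show ?thesis by (simp add: scaleC_diff_right)
  qed
  have "norm (U (\<sigma> * T) (?i *\<^sub>C (?V (?y T) - fmult (beta T) (?y T)))) \<le> K * T powr (- kap)" if "T \<ge> 1" for T
  proof -
    have "cmod ?i = 1" using s by (auto simp: norm_mult)
    then show ?thesis using K(2)[OF that] by (simp only: unitary_operator_bounded_linear(2)[OF ug_unitary[OF ugU]] norm_scaleC mult_1)
  qed
  from convergent_at_top_if_derivative_bound[OF d this kap] show ?thesis unfolding x_def .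
qed

lemma deviation_factor_inverse_signed:
  assumes "\<sigma> \<in> {-1, 1}" "T > 0"
  shows "inv (W0 (\<sigma> * T)) x = incoming \<sigma> T x"
proof -
  have "theta (\<sigma> * T) p = \<sigma> * phase T p" for p using assms by (auto simp: theta_def sgn_mult)
  then show ?thesis by (simp only: deviation_factor_inverse incoming_def)
qed

abbreviation packets :: "L2 set" where
  "packets \<equiv> {packet c a' b' j |a' b' c j. a' < b' \<and> (0 < a' \<or> b' < 0) \<and> c > 0}"

text \<open>All three factors are unitary, so convergence on the wave packets extends to every
  vector once these are total.\<close>

lemma wave_limit:
  assumes U: "generates U (op_L m a b)" and s: "\<sigma> \<in> {-1, 1}"
  shows "\<exists>l. ((\<lambda>t. scattering U \<sigma> t (inv (W0 (\<sigma> * t)) x)) \<longlongrightarrow> l) at_top"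
proof (rule convergence_on_total_set[where D = "packets"])
  have ugU: "unitary_group U" and ug0: "unitary_group (free_group m)"
    using U free_group_generates[OF m] by (auto simp: generates_def)
  note u1 = unitary_operator_bounded_linear[OF ug_unitary[OF ugU]]
  note u2 = unitary_operator_bounded_linear[OF ug_unitary[OF ug0]]
  have u3: "unitary_operator (inv (W0 t))" for t
    unfolding deviation_factor_inverse by (rule fmult_unitary(1)[OF phase_symbol_unitary]) measurable
  note u3 = unitary_operator_bounded_linear[OF u3]
  show "bounded_linear (\<lambda>x. scattering U \<sigma> t (inv (W0 (\<sigma> * t)) x))" for t
    by (intro bounded_linear_compose[OF u1(1)] bounded_linear_compose[OF u2(1)] u3(1))
  show "scattering U \<sigma> t (inv (W0 (\<sigma> * t)) (c *\<^sub>C x))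
    = c *\<^sub>C scattering U \<sigma> t (inv (W0 (\<sigma> * t)) x)" for t c x
    by (simp only: u1(3) u2(3) u3(3))
  show "norm (scattering U \<sigma> t (inv (W0 (\<sigma> * t)) x)) = norm x" for t x
    by (simp only: u1(2) u2(2) u3(2))
  show "\<exists>l. ((\<lambda>t. scattering U \<sigma> t (inv (W0 (\<sigma> * t)) y)) \<longlongrightarrow> l) at_top"
    if y: "y \<in> packets" for y
  proof -
    from y obtain a' b' c j where y': "y = packet c a' b' j" "a' < b'" "0 < a' \<or> b' < 0" "c > 0" by blast
    obtain l where l: "((\<lambda>T. scattering U \<sigma> T (incoming \<sigma> T y)) \<longlongrightarrow> l) at_top"
      using cook_convergence[OF U s y'(2-4), of j] unfolding y'(1) by blast
    have "\<forall>\<^sub>F T in at_top. scattering U \<sigma> T (incoming \<sigma> T y)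
        = scattering U \<sigma> T (inv (W0 (\<sigma> * T)) y)"
      by (rule eventually_mono[OF eventually_gt_at_top[of 0]]) (simp add: deviation_factor_inverse_signed[OF s])
    from Lim_transform_eventually[OF l this] show ?thesis by blast
  qed
  show "x = 0" if z: "\<And>y. y \<in> packets \<Longrightarrow> cinner x y = 0" for x
  proof -
    \<comment> \<open>Totality of the packets is totality of the bumps in momentum space, carried
      over by unitarity of the transform.\<close>
    have "fourier x = 0"
    proof (rule L2_total)
      fix a' b' c :: real and j assume "a' < b'" "0 < a' \<or> b' < 0" "c > 0"
      then have "cinner x (packet c a' b' j) = 0" by (intro z) blast
      then show "cinner (fourier x) (vtest (bump c 0 0 a' b') j) = 0"
        using fourier_facts(7)[of x "packet c a' b' j"] by (simp add: fourier_facts(1))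
    qed
    then have "norm x = 0" using fourier_norm[of x] by simp
    then show ?thesis by simp
  qed
qed simp

lemma wave_limits:
  assumes U: "generates U (op_L m a b)"
  shows "\<exists>l. ((\<lambda>t. U t (free_group m (- t) (inv (W0 t) x))) \<longlongrightarrow> l) at_top"
    "\<exists>l. ((\<lambda>t. U t (free_group m (- t) (inv (W0 t) x))) \<longlongrightarrow> l) at_bot"
  using wave_limit[OF U, of 1 x] wave_limit[OF U, of "-1" x] by (simp_all add: filterlim_at_bot_mirror)

lemma deviation_factor_bounded:
  "bij (W0 t)" "bounded_operator_in UNIV (W0 t)"
  "bounded_operator_in UNIV (inv (W0 t))"
proof -
  have *: "unitary_operator T \<Longrightarrow> bounded_operator_in UNIV T" for T :: "L2 \<Rightarrow> L2"
    unfolding bounded_operator_in_def using unitary_operator_bounded_linear(2)[of T]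
    by (auto simp: unitary_operator_def intro!: exI[of _ 1])
  have u: "unitary_operator (W0 t)" "unitary_operator (inv (W0 t))"
    unfolding deviation_factor_inverse unfolding deviation_factor_eq by (intro fmult_unitary(1)[OF phase_symbol_unitary]; measurable)+
  show "bij (W0 t)" by (rule unitary_operator_bounded_linear(4)[OF u(1)])
  show "bounded_operator_in UNIV (W0 t)" "bounded_operator_in UNIV (inv (W0 t))"
    by (intro * u)+
qed

theorem wave_operators_exist:
  "\<exists>Wplus Wminus. generalized_wave_operators (op_L m a b) (op_L0 m) W0 Wplus Wminus"
proof -
  obtain KV where KV: "bounded_symbol (potential a b) KV" using potential_bounded by blast
  obtain U where U: "generates U (op_L m a b)" using op_L_generates(1)[OF m KV] by blast
  have eU: "exp_i (op_L m a b) = U" by (rule exp_i_eq[OF U op_L_generates(2)[OF m KV]])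
  obtain Wp where Wp: "\<And>x. ((\<lambda>t. U t (free_group m (- t) (inv (W0 t) x))) \<longlongrightarrow> Wp x) at_top"
    using wave_limits(1)[OF U] by metis
  obtain Wm where Wm: "\<And>x. ((\<lambda>t. U t (free_group m (- t) (inv (W0 t) x))) \<longlongrightarrow> Wm x) at_bot"
    using wave_limits(2)[OF U] by metis
  have comm: "W0 t (W0 u x) = W0 u (W0 t x)" for t u x
    unfolding deviation_factor_eq by (simp add: fmult_phase_mult add.commute)
  have "generalized_wave_operators (op_L m a b) (op_L0 m) W0 Wp Wm"
    unfolding generalized_wave_operators_def ac_subspace_op_L0[OF m] orth_projector_UNIV Let_def eU exp_i_op_L0[OF m]
  \<comment> \<open>\<open>R = 0\<close> works: the deviation factor is unitary at every time and
    commutes there with the free operator.\<close>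
  proof (rule exI[of _ 0], intro conjI allI impI)
    show "(\<lambda>x. map_option (W0 t) (op_L0 m x)) = (\<lambda>x. op_L0 m (W0 t x))" for t
      using op_L0_phase_commute[OF m theta_measurable[of t]] by (simp add: fun_eq_iff deviation_factor_eq)
  qed (use deviation_factor_bounded deviation_factor_ratio_tendsto comm Wp Wm in auto)
  then show ?thesis by blast
qed

end

theorem theorem6p1:
  fixes m C \<alpha> \<gamma> :: real and a b :: "real \<Rightarrow> real"
  assumes "m > 0"
    and "C > 0" and "3 / 4 < \<alpha>" and "\<alpha> < 1" and "1 - \<alpha> < \<gamma>" and "\<gamma> < \<alpha> - 1 / 2"
    and "\<forall>r>0. a differentiable (at r) \<and> deriv a differentiable (at r)"
    and "\<forall>r>0. b differentiable (at r) \<and> deriv b differentiable (at r)"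
    and "\<forall>\<nu>\<in>{0, 1, 2::nat}. \<forall>r>0.
           \<bar>(deriv ^^ \<nu>) a r\<bar> + \<bar>(deriv ^^ \<nu>) b r\<bar> \<le> C * (1 + r) powr (- \<alpha> - real \<nu>)"
    and "\<forall>r>0. \<bar>a r\<bar> < C * (1 + r) powr (- 1 - \<alpha> + \<gamma>)"
  shows "self_adjoint (op_L m a b) \<and> self_adjoint (op_L0 m) \<and> ac_subspace (op_L0 m) = UNIV \<and>
    (\<exists>Wplus Wminus.
       generalized_wave_operators (op_L m a b) (op_L0 m) (deviation_factor m b) Wplus Wminus)"
proof -
  interpret dirac_coefficients m C \<alpha> \<gamma> a b using assms by unfold_locales
  obtain KV where KV: "bounded_symbol (potential a b) KV" using potential_bounded by blast
  have "self_adjoint (op_L m a b)"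
    using op_L_generates[OF m KV] generates_self_adjoint by blast
  moreover have "self_adjoint (op_L0 m)"
    by (rule generates_self_adjoint[OF free_group_generates[OF m] op_L0_dense[OF m]])
  ultimately show ?thesis using ac_subspace_op_L0[OF m] wave_operators_exist by blast
qed

end
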